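(* Let $(f_{s,t})_{s\le t}$ be a $\mathcal P$-REF. Then there exist a continuous function $I\ni t\mapsto\gamma_t\in\mathbb R$ with $\gamma_0=0$ and a Borel measure $\mathcal H$ on $\mathbb R\times I$ with $\mathcal H(\mathbb R\times[0,t])<\infty$ and $\mathcal H(\mathbb R\times\{t\})=0$ for all $t\in I$, such that $$f_{s,t}(z)=z+\gamma_s-\gamma_t+\int_{\mathbb R\times[s,t]}\frac{1+x f_{r,t}(z)}{x-f_{r,t}(z)}\,\mathcal H(dx\,dr),\qquad s,t\in I,\ 0\le s\le t,\ z\in\mathbb C^+.$$ The pair $((\gamma_t)_{t\in I},\mathcal H)$ is unique. Conversely, given such a pair $((\gamma_t)_{t\in I},\mathcal H)$, there is a unique $\mathcal P$-REF $(f_{s,t})_{s\le t}$ such that $$f_{s,t}(z)=z+\gamma_s-\gamma_t+\int_{\mathbb R\times[s,t]}\frac{1+x f_{r,t}(z)}{x-f_{r,t}(z)}\,\mathcal H(dx\,dr)$$ holds for all $s,t\in I$ with $0\le s\le t$ and all $z\in\mathbb C^+$.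
   Context: $I$ is a fixed interval of the form $[0,T_0)$ with $0<T_0\le+\infty$ or $[0,T_0]$ with $0<T_0<+\infty$; indices $s\le t$ range over $I$. $\mathbb C^+$ is the open upper half-plane. For a Borel probability measure $\mu$ on $\mathbb R$ put $G_\mu(z)=\int_{\mathbb R}\frac1{z-x}\,\mu(dx)$ and $F_\mu=1/G_\mu$ on $\mathbb C^+$, and let $\mathcal P=\{F_\mu:\mu \text{ a Borel probability measure on }\mathbb R\}$. A $\mathcal P$-REF (reverse evolution family in $\mathcal P$) is a family $(f_{s,t})_{s,t\in I,\,s\le t}$ of holomorphic self-mappings of $\mathbb C^+$, all belonging to $\mathcal P$, such that $f_{s,s}=\mathrm{id}$ for each $s$, $f_{s,t}\circ f_{t,u}=f_{s,u}$ whenever $s\le t\le u$, and $(s,t)\mapsto f_{s,t}$ is continuous for the topology of locally uniform convergence on $\mathbb C^+$. *)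

theory Defs
  imports "HOL-Probability.Probability" "HOL-Complex_Analysis.Complex_Analysis"
begin

definition upper_half_plane :: "complex set" where
  "upper_half_plane = {z. Im z > 0}"

definition cauchy_transform :: "real measure \<Rightarrow> complex \<Rightarrow> complex" where
  "cauchy_transform \<mu> z = (LINT x|\<mu>. 1 / (z - complex_of_real x))"

definition reciprocal_cauchy_transform :: "real measure \<Rightarrow> complex \<Rightarrow> complex" where
  "reciprocal_cauchy_transform \<mu> z = 1 / cauchy_transform \<mu> z"

text \<open>Functions on the upper half-plane are represented by total functions on the complex plane;
  only their values on the upper half-plane are meaningful.\<close>

definition class_P :: "(complex \<Rightarrow> complex) set" where
  "class_P = {f. \<exists>\<mu>. real_distribution \<mu> \<and>
     (\<forall>z\<in>upper_half_plane. f z = reciprocal_cauchy_transform \<mu> z)}"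

definition time_interval :: "real set \<Rightarrow> bool" where
  "time_interval I \<longleftrightarrow>
     (\<exists>T0::ereal. 0 < T0 \<and> I = {t. 0 \<le> t \<and> ereal t < T0}) \<or>
     (\<exists>T0::real. 0 < T0 \<and> I = {0..T0})"

definition ordered_pairs :: "real set \<Rightarrow> (real \<times> real) set" where
  "ordered_pairs I = {(s, t). s \<in> I \<and> t \<in> I \<and> s \<le> t}"

text \<open>Reverse evolution families in the class. Locally uniform convergence on the
  upper half-plane is uniform convergence on each of its compact subsets.\<close>

definition P_REF :: "real set \<Rightarrow> (real \<Rightarrow> real \<Rightarrow> complex \<Rightarrow> complex) \<Rightarrow> bool" where
  "P_REF I f \<longleftrightarrow>
     (\<forall>(s, t)\<in>ordered_pairs I.
        f s t holomorphic_on upper_half_plane \<and>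
        f s t ` upper_half_plane \<subseteq> upper_half_plane \<and>
        f s t \<in> class_P) \<and>
     (\<forall>s\<in>I. \<forall>z\<in>upper_half_plane. f s s z = z) \<and>
     (\<forall>s\<in>I. \<forall>t\<in>I. \<forall>u\<in>I. s \<le> t \<longrightarrow> t \<le> u \<longrightarrow>
        (\<forall>z\<in>upper_half_plane. f s t (f t u z) = f s u z)) \<and>
     (\<forall>(s, t)\<in>ordered_pairs I. \<forall>K. compact K \<longrightarrow> K \<subseteq> upper_half_plane \<longrightarrow>
        uniform_limit K (\<lambda>(s', t'). f s' t') (f s t) (at (s, t) within ordered_pairs I))"

text \<open>The measure lives on the Borel subsets of the strip \<open>UNIV \<times> I\<close>, so that equality of two
  such measures is equality on this strip.\<close>

definition generating_pair :: "real set \<Rightarrow> (real \<Rightarrow> real) \<Rightarrow> (real \<times> real) measure \<Rightarrow> bool" where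
  "generating_pair I \<gamma> H \<longleftrightarrow>
     continuous_on I \<gamma> \<and> \<gamma> 0 = 0 \<and>
     sets H = sets (restrict_space borel (UNIV \<times> I)) \<and>
     (\<forall>t\<in>I. emeasure H (UNIV \<times> {0..t}) < \<infinity> \<and> emeasure H (UNIV \<times> {t}) = 0)"

text \<open>Integrability is required explicitly because the Bochner integral of a non-integrable
  function is 0 by convention.\<close>

definition satisfies_integral_equation ::
  "real set \<Rightarrow> (real \<Rightarrow> real \<Rightarrow> complex \<Rightarrow> complex) \<Rightarrow> (real \<Rightarrow> real) \<Rightarrow> (real \<times> real) measure \<Rightarrow> bool"
where
  "satisfies_integral_equation I f \<gamma> H \<longleftrightarrow>
     (\<forall>s\<in>I. \<forall>t\<in>I. s \<le> t \<longrightarrow> (\<forall>z\<in>upper_half_plane.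
        set_integrable H (UNIV \<times> {s..t})
          (\<lambda>(x, r). (1 + complex_of_real x * f r t z) / (complex_of_real x - f r t z)) \<and>
        f s t z = z + complex_of_real (\<gamma> s) - complex_of_real (\<gamma> t) +
          set_lebesgue_integral H (UNIV \<times> {s..t})
            (\<lambda>(x, r). (1 + complex_of_real x * f r t z) / (complex_of_real x - f r t z))))"

end

theory Submission
  imports Defs "HOL-Real_Asymp.Real_Asymp"
begin

text \<open>Both directions rest on one observation. A member F of the class \<P> of reciprocal Cauchy
  transforms satisfies Im F(z) \<ge> Im z (lemma class_P_Im_ge), so F - id maps the upper half-plane
  into its closure, and Nevanlinna's theorem (Nevanlinna_circle) writes it as a real constant plus an
  integral of the kernel (1 + xz)/(x - z) against a finite measure on the extended real line. A
  reverse evolution family is thus a composition of many small perturbations of the identity, each of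
  which carries a constant and a measure; the pair (\<gamma>, H) records these data together with the
  times at which they act.

  From the family to the pair. On [0,T], cut time at the dyadic points t_j and represent every
  f_{t_j,t_{j+1}} as above, with measure \<nu>_j. Evaluated at f_{t_{j+1},t}(z), these representations
  telescope: f_{s,t}(z) - z is a sum of constants plus the integral of the kernel at f_{r,t}(z)
  against the sum of the measures \<nu>_j \<otimes> \<delta>_{t_{j+1}} (grid_equation). The imaginary
  part of the kernel is bounded below on compact sets, so the mass of \<nu>_j is controlled by the
  decrease of the continuous monotone function r \<mapsto> Im f_{r,T}(i) over the step
  (step_measure_mass). Hence the masses are bounded, a subsequence converges weakly, the limit charges
  no single time, and the equation survives, first at dyadic times (limit_measure), then at all times
  by continuity (limit_equation). For compactness the variable x has to range over the circle of real
  numbers and infinity. A mass of the limit at infinity would contribute linear growth to f_{0,T}(iy),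
  which the asymptotics F(iy)/(iy) \<longlongrightarrow> 1 exclude (class_P_asymp,
  exists_generating_pair).

  Uniqueness of the pair. The sums of f - id over finer and finer partitions of [0,t] converge to
  -\<gamma>_t plus the integral of the kernel at z itself over [0,t] (generator_from_REF). This is
  again a Nevanlinna representation, and Stieltjes inversion (Nevanlinna_unique) recovers \<gamma>_t
  and the measure of all sets A \<times> [0,t]. Uniqueness on compact intervals also allows the pairs
  on an exhausting sequence of intervals [0,T_k] to be glued (generating_pair_exists).

  From the pair to the family. For a fixed final time t the integral equation is an ordinary
  differential equation that runs backwards from t, driven by H. It is solved by Euler polygons. All
  estimates are expressed by hsize w = (1 + |w|^2)/Im w, which is 2 cosh of the hyperbolic distance
  from i to w: the kernel at w is at most hsize w, and it is Lipschitz with constant hsize w * hsize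
  w'. One Euler step is the identity plus a map into the closed half-plane, so a Schwarz-Pick estimate
  (hsize_image_le) bounds the growth of hsize; once \<gamma> has been subtracted, the growth factor of
  a step is the exponential of a multiple of its mass, and the product over all steps is bounded
  independently of the mesh (euler_hsize). On sublevel sets of hsize the kernel is Lipschitz, and
  Gronwall's inequality for a measure without atoms in time (gronwall) yields stability
  (kernel_stability). Stability makes the polygons a Cauchy sequence, makes their limit, the flow, the
  only solution, and makes it Lipschitz in z. The composition rule is uniqueness, holomorphy passes to
  the locally uniform limit, and the flow belongs to \<P> because it is asymptotic to iy at z = iy,
  which characterises \<P> among holomorphic self-maps (class_P_criterion).\<close>

section \<open>The Pick kernel in circle coordinates\<close>

definition pick_kernel :: "complex \<Rightarrow> real \<Rightarrow> complex" where
  "pick_kernel w x = (1 + complex_of_real x * w) / (complex_of_real x - w)"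

text \<open>The Pick kernel at x = - cot (\<pi> u). As u runs through [0,1], the point x runs through the
  extended real line; u = 0 and u = 1 both stand for infinity, where the kernel degenerates to w. The
  compact range of the parameter is what makes bounded sets of representing measures weakly compact.\<close>
definition circle_kernel :: "complex \<Rightarrow> real \<Rightarrow> complex" where
  "circle_kernel w u = (w * of_real (cos (pi * u)) - of_real (sin (pi * u)))
                     / (w * of_real (sin (pi * u)) + of_real (cos (pi * u)))"

definition kernel_den :: "complex \<Rightarrow> real \<Rightarrow> complex" where
  "kernel_den w u = w * of_real (sin (pi * u)) + of_real (cos (pi * u))"

text \<open>Twice the hyperbolic cosine of the hyperbolic distance from \<i> to w. Its sublevel sets are
  compact, and it bounds at once the kernel, the Lipschitz constant of the kernel, and the reciprocal
  of the imaginary part of the kernel.\<close>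
definition hsize :: "complex \<Rightarrow> real" where
  "hsize w = (1 + (cmod w)\<^sup>2) / Im w"

lemma uhp_iff [simp]: "z \<in> upper_half_plane \<longleftrightarrow> Im z > 0"
  by (simp add: upper_half_plane_def)

lemma open_uhp: "open upper_half_plane"
  unfolding upper_half_plane_def by (rule open_halfspace_Im_gt)

lemma kernel_den_nz: assumes "Im w > 0" shows "kernel_den w u \<noteq> 0"
proof
  assume *: "kernel_den w u = 0"
  have "Im (kernel_den w u) = Im w * sin (pi * u)" by (simp add: kernel_den_def)
  with * assms have s: "sin (pi * u) = 0" by simp
  with * have "cos (pi * u) = 0" by (simp add: kernel_den_def)
  with s sin_cos_squared_add[of "pi * u"] show False by simp
qed

lemma kernel_den_norm_sq:
  "(cmod (kernel_den w u))\<^sup>2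
     = (Re w * sin (pi * u) + cos (pi * u))\<^sup>2 + (Im w * sin (pi * u))\<^sup>2"
  by (simp add: cmod_power2 kernel_den_def)

text \<open>Numerator and denominator of the kernel are the image of (w, 1) under a rotation by \<pi> u, which
  preserves the norm of pairs.\<close>
lemma kernel_num_norm_sq:
  "(cmod (w * of_real (cos (pi * u)) - of_real (sin (pi * u))))\<^sup>2 + (cmod (kernel_den w u))\<^sup>2
     = 1 + (cmod w)\<^sup>2"
proof -
  define s c where "s = sin (pi * u)" "c = cos (pi * u)"
  have sc: "s\<^sup>2 + c\<^sup>2 = 1" by (simp add: s_c_def)
  have "(cmod (w * of_real c - of_real s))\<^sup>2 + ((Re w * s + c)\<^sup>2 + (Im w * s)\<^sup>2)
      = (s\<^sup>2 + c\<^sup>2) * (1 + ((Re w)\<^sup>2 + (Im w)\<^sup>2))"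
    unfolding cmod_power2 by (simp add: power2_eq_square algebra_simps)
  thus ?thesis unfolding kernel_den_norm_sq s_c_def[symmetric] sc by (simp add: cmod_power2)
qed

lemma kernel_den_le: "(cmod (kernel_den w u))\<^sup>2 \<le> 1 + (cmod w)\<^sup>2"
  using kernel_num_norm_sq[of w u] by (smt (verit) zero_le_power2)

text \<open>The difference of the two sides is a sum of two squares.\<close>
lemma kernel_den_ge: 
  assumes "Im w > 0"
  shows "(Im w)\<^sup>2 \<le> (cmod (kernel_den w u))\<^sup>2 * (1 + (cmod w)\<^sup>2)"
proof -
  define s c a v where "s = sin (pi * u)" "c = cos (pi * u)" "a = Re w" "v = Im w"
  have sc: "s\<^sup>2 + c\<^sup>2 = 1" by (simp add: s_c_a_v_def)
  have 1: "((a * s + c)\<^sup>2 + (v * s)\<^sup>2) * (1 + (a\<^sup>2 + v\<^sup>2)) - v\<^sup>2 * (s\<^sup>2 + c\<^sup>2)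
     = (a * s + c)\<^sup>2 + (a * (a * s + c) + v\<^sup>2 * s)\<^sup>2"
    by (simp add: power2_eq_square algebra_simps)
  have "0 \<le> (a * s + c)\<^sup>2 + (a * (a * s + c) + v\<^sup>2 * s)\<^sup>2" by simp
  with 1[unfolded sc mult_1_right] have "v\<^sup>2 \<le> ((a * s + c)\<^sup>2 + (v * s)\<^sup>2) * (1 + (a\<^sup>2 + v\<^sup>2))" by linarith
  thus ?thesis unfolding kernel_den_norm_sq s_c_a_v_def by (simp add: cmod_power2)
qed

lemma hsize_pos: "Im w > 0 \<Longrightarrow> hsize w > 0"
  by (simp add: hsize_def add_pos_nonneg)

lemma hsize_bounds:
  assumes "Im w > 0"
  shows "1 / hsize w \<le> Im w" "1 / Im w \<le> hsize w" "cmod w \<le> hsize w" "hsize w \<ge> 1"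
proof -
  have "Im w \<le> cmod w" by (rule order_trans[OF _ abs_Im_le_cmod]) simp
  have a: "(1 + (cmod w)\<^sup>2) \<ge> 1" by simp
  show 2: "1 / Im w \<le> hsize w" unfolding hsize_def using assms by (simp add: divide_right_mono)
  show "1 / hsize w \<le> Im w" using 2 assms hsize_pos[OF assms]
    by (simp add: field_simps)
  have "cmod w * Im w \<le> cmod w * cmod w" 
    by (intro mult_left_mono) (auto simp: \<open>Im w \<le> cmod w\<close>)
  also have "\<dots> \<le> 1 + (cmod w)\<^sup>2" by (simp add: power2_eq_square)
  finally show "cmod w \<le> hsize w" using assms by (simp add: hsize_def field_simps)
  have "2 * cmod w \<le> 1 + (cmod w)\<^sup>2" using zero_le_power2[of "cmod w - 1"]
    by (simp add: power2_eq_square algebra_simps)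
  hence "Im w \<le> 1 + (cmod w)\<^sup>2" using \<open>Im w \<le> cmod w\<close> assms by linarith
  thus "hsize w \<ge> 1" using assms by (simp add: hsize_def field_simps)
qed

lemma inverse_kernel_den_le:
  assumes "Im w > 0"
  shows "1 / (cmod (kernel_den w u))\<^sup>2 \<le> hsize w / Im w" "1 / cmod (kernel_den w u) \<le> hsize w"
proof -
  have p: "(cmod (kernel_den w u))\<^sup>2 > 0" using kernel_den_nz[OF assms] by simp
  show 1: "1 / (cmod (kernel_den w u))\<^sup>2 \<le> hsize w / Im w"
    using kernel_den_ge[OF assms, of u] p assms
    by (simp add: hsize_def divide_simps power2_eq_square) (simp add: algebra_simps)
  have "hsize w * (1 / Im w) \<le> hsize w * hsize w"
    by (rule mult_left_mono[OF hsize_bounds(2)[OF assms]]) (use hsize_pos[OF assms] in simp)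
  hence "hsize w / Im w \<le> (hsize w)\<^sup>2" by (simp add: power2_eq_square)
  with 1 have "(1 / cmod (kernel_den w u))\<^sup>2 \<le> (hsize w)\<^sup>2" by (simp add: power_divide)
  thus "1 / cmod (kernel_den w u) \<le> hsize w"
    by (rule power2_le_imp_le) (use hsize_pos[OF assms] in simp)
qed

text \<open>The kernel is a Moebius transformation of w given by a rotation matrix, and a real matrix of
  determinant one divides the imaginary part by the square of the modulus of the denominator.\<close>
lemma Im_circle_kernel:
  assumes "Im w > 0" shows "Im (circle_kernel w u) = Im w / (cmod (kernel_den w u))\<^sup>2"
proof -
  have "Im (circle_kernel w u) = (Im w * (sin (pi*u) * sin (pi*u)) + Im w * (cos (pi*u) * cos (pi*u))) / (cmod (kernel_den w u))\<^sup>2"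
    unfolding circle_kernel_def kernel_den_def[symmetric] Im_divide cmod_power2[symmetric]
    by (rule arg_cong[where f = "\<lambda>x. x / _"]) (simp add: kernel_den_def algebra_simps)
  also have "Im w * (sin (pi*u) * sin (pi*u)) + Im w * (cos (pi*u) * cos (pi*u)) = Im w * ((sin (pi*u))\<^sup>2 + (cos (pi*u))\<^sup>2)"
    by (simp only: distrib_left power2_eq_square)
  finally show ?thesis by simp
qed

lemma norm_circle_kernel_sq:
  assumes "Im w > 0" 
  shows "(cmod (circle_kernel w u))\<^sup>2 = (1 + (cmod w)\<^sup>2) / (cmod (kernel_den w u))\<^sup>2 - 1"
proof -
  have p: "(cmod (kernel_den w u))\<^sup>2 \<noteq> 0" using kernel_den_nz[OF assms] by simp
  have "(cmod (circle_kernel w u))\<^sup>2 = (1 + (cmod w)\<^sup>2 - (cmod (kernel_den w u))\<^sup>2) / (cmod (kernel_den w u))\<^sup>2"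
    using kernel_num_norm_sq[of w u]
    by (simp add: circle_kernel_def norm_divide power_divide flip: kernel_den_def)
  thus ?thesis using p by (simp add: diff_divide_distrib)
qed

lemma norm_circle_kernel_le:
  assumes "Im w > 0" shows "cmod (circle_kernel w u) \<le> hsize w"
proof -
  have "(cmod (circle_kernel w u))\<^sup>2 \<le> (1 + (cmod w)\<^sup>2) * (1 / (cmod (kernel_den w u))\<^sup>2)"
    by (simp add: norm_circle_kernel_sq assms)
  also have "\<dots> \<le> (1 + (cmod w)\<^sup>2) * (hsize w / Im w)"
    by (intro mult_left_mono inverse_kernel_den_le assms) (simp add: add_nonneg_nonneg)
  also have "\<dots> = (hsize w)\<^sup>2" by (simp add: hsize_def power2_eq_square)
  finally show ?thesis by (rule power2_le_imp_le) (use hsize_pos[OF assms] in simp)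
qed

text \<open>The other effect of the determinant being one: a difference of two values is the difference of the
  arguments divided by both denominators.\<close>
lemma circle_kernel_diff:
  assumes "Im w > 0" "Im w' > 0" 
  shows "circle_kernel w u - circle_kernel w' u = (w - w') / (kernel_den w u * kernel_den w' u)"
proof -
  have "circle_kernel w u - circle_kernel w' u 
     = ((w - w') * ((of_real (sin (pi*u)))\<^sup>2 + (of_real (cos (pi*u)))\<^sup>2)) / (kernel_den w u * kernel_den w' u)"
    using kernel_den_nz[OF assms(1), of u] kernel_den_nz[OF assms(2), of u]
    unfolding circle_kernel_def 
    by (simp add: diff_frac_eq power2_eq_square flip: kernel_den_def) (simp add: kernel_den_def algebra_simps)
  also have "(of_real (sin (pi*u)))\<^sup>2 + (of_real (cos (pi*u)))\<^sup>2 = complex_of_real ((sin (pi*u))\<^sup>2 + (cos (pi*u))\<^sup>2)"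
    by (simp only: of_real_add of_real_power)
  finally show ?thesis by simp
qed

lemma circle_kernel_lipschitz:
  assumes "Im w > 0" "Im w' > 0" 
  shows "cmod (circle_kernel w u - circle_kernel w' u) \<le> hsize w * hsize w' * cmod (w - w')"
proof -
  have "cmod (circle_kernel w u - circle_kernel w' u) 
     = (1 / cmod (kernel_den w u)) * (1 / cmod (kernel_den w' u)) * cmod (w - w')"
    by (simp add: circle_kernel_diff[OF assms] norm_divide norm_mult)
  also have "\<dots> \<le> hsize w * hsize w' * cmod (w - w')"
    by (intro mult_right_mono mult_mono inverse_kernel_den_le assms) 
       (auto simp: hsize_pos assms less_imp_le)
  finally show ?thesis .
qed

lemma Im_circle_kernel_ge:
  assumes "Im w > 0" shows "1 / hsize w \<le> Im (circle_kernel w u)"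
proof -
  have p: "(cmod (kernel_den w u))\<^sup>2 > 0" using kernel_den_nz[OF assms] by simp
  have "Im w / (1 + (cmod w)\<^sup>2) \<le> Im w / (cmod (kernel_den w u))\<^sup>2"
    by (intro divide_left_mono kernel_den_le) (use assms p in \<open>auto simp: add_pos_nonneg\<close>)
  thus ?thesis by (simp add: Im_circle_kernel assms hsize_def)
qed

lemma Im_circle_kernel_pos: "Im w > 0 \<Longrightarrow> 0 < Im (circle_kernel w u)"
  using Im_circle_kernel_ge[of w u] hsize_pos[of w] by (smt (verit) divide_pos_pos)

lemma circle_kernel_i [simp]: "circle_kernel \<i> u = \<i>"
proof -
  have "kernel_den \<i> u \<noteq> 0" by (rule kernel_den_nz) simp
  thus ?thesis by (simp add: circle_kernel_def kernel_den_def divide_simps) (simp add: algebra_simps)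
qed

lemma circle_kernel_01: "circle_kernel w 0 = w" "circle_kernel w 1 = w"
  by (simp_all add: circle_kernel_def)

lemma continuous_on_circle_kernel:
  assumes "continuous_on S f" "continuous_on S g" "\<And>x. x \<in> S \<Longrightarrow> Im (f x) > 0"
  shows "continuous_on S (\<lambda>x. circle_kernel (f x) (g x))"
proof -
  have "f x * of_real (sin (pi * g x)) + of_real (cos (pi * g x)) \<noteq> 0" if "x \<in> S" for x
    using kernel_den_nz[OF assms(3)[OF that]] by (simp add: kernel_den_def)
  moreover have "continuous_on S (\<lambda>x. sin (pi * g x))" "continuous_on S (\<lambda>x. cos (pi * g x))"
    by (rule continuous_on_compose2[of UNIV sin] continuous_on_compose2[of UNIV cos];
        intro continuous_intros assms subset_UNIV)+
  ultimately show ?thesis unfolding circle_kernel_def by (intro continuous_intros assms) auto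
qed

lemma circle_kernel_eq_pick:
  assumes "0 < u" "u < 1"
  shows "pick_kernel w (- cot (pi * u)) = circle_kernel w u"
proof -
  have s: "sin (pi * u) > 0" using assms by (intro sin_gt_zero) auto
  define S C where "S = complex_of_real (sin (pi*u))" "C = complex_of_real (cos (pi*u))"
  have "S \<noteq> 0" using s by (simp add: S_C_def)
  have c: "complex_of_real (cot (pi*u)) = C / S" by (simp add: S_C_def cot_def)
  have "pick_kernel w (- cot (pi * u)) = (1 - C / S * w) / (- (C / S) - w)"
    by (simp add: pick_kernel_def c)
  also have "\<dots> = (S * (1 - C / S * w)) / (S * (- (C / S) - w))" 
    using \<open>S \<noteq> 0\<close> by simp
  also have "\<dots> = (S - C * w) / (- (C + w * S))" 
    using \<open>S \<noteq> 0\<close> by (simp add: right_diff_distrib mult.commute)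
  also have "\<dots> = (w * C - S) / (w * S + C)" by (simp only: divide_minus_right minus_divide_left) (simp add: algebra_simps)
  finally show ?thesis by (simp add: circle_kernel_def S_C_def)
qed

text \<open>Every real x has a circle coordinate, so that the estimates for the circle kernel carry over to the
  Pick kernel.\<close>
lemma pick_kernel_eq_circle: "\<exists>u. 0 < u \<and> u < 1 \<and> x = - cot (pi * u) \<and> (\<forall>w. pick_kernel w x = circle_kernel w u)"
proof -
  define u where "u = (arctan x + pi/2) / pi"
  have "0 < u" "u < 1" using arctan_bounded[of x] by (auto simp: u_def field_simps)
  have "pi * u = arctan x + pi/2" by (simp add: u_def)
  hence "- cot (pi * u) = - (cos (arctan x + pi/2) / sin (arctan x + pi/2))" by (simp add: cot_def)
  also have "\<dots> = tan (arctan x)" by (simp add: cos_add sin_add tan_def)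
  finally have "x = - cot (pi * u)" by (simp add: tan_arctan)
  thus ?thesis using circle_kernel_eq_pick[OF \<open>0 < u\<close> \<open>u < 1\<close>] \<open>0 < u\<close> \<open>u < 1\<close> by blast
qed

lemma pick_kernel_le: "Im w > 0 \<Longrightarrow> cmod (pick_kernel w x) \<le> hsize w"
  using pick_kernel_eq_circle[of x] norm_circle_kernel_le by metis

lemma pick_kernel_lipschitz:
  "Im w > 0 \<Longrightarrow> Im w' > 0 \<Longrightarrow> cmod (pick_kernel w x - pick_kernel w' x) \<le> hsize w * hsize w' * cmod (w - w')"
  using pick_kernel_eq_circle[of x] circle_kernel_lipschitz by metis

lemma pick_kernel_i [simp]: "pick_kernel \<i> x = \<i>"
  using pick_kernel_eq_circle[of x] circle_kernel_i by metis

lemma Im_pick_kernel_pos: "Im w > 0 \<Longrightarrow> 0 < Im (pick_kernel w x)"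
  using pick_kernel_eq_circle[of x] Im_circle_kernel_pos by metis

lemma continuous_on_pick_kernel:
  assumes "continuous_on S f" "continuous_on S g" "\<And>x. x \<in> S \<Longrightarrow> Im (f x) > 0"
  shows "continuous_on S (\<lambda>x. pick_kernel (f x) (g x))"
proof -
  have "complex_of_real (g x) - f x \<noteq> 0" if "x \<in> S" for x
    using assms(3)[OF that] by (metis Im_complex_of_real eq_iff_diff_eq_0 less_irrefl)
  thus ?thesis unfolding pick_kernel_def by (intro continuous_intros assms) auto
qed

lemma hsize_continuous: "continuous_on upper_half_plane hsize"
  unfolding hsize_def by (intro continuous_intros) auto

lemma hsize_bounded_on_compact:
  assumes "compact K" "K \<subseteq> upper_half_plane"
  obtains C where "C \<ge> 1" "\<And>w. w \<in> K \<Longrightarrow> hsize w \<le> C"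
proof -
  have "compact (hsize ` K)" 
    by (intro compact_continuous_image assms continuous_on_subset[OF hsize_continuous])
  then obtain C where "\<And>y. y \<in> hsize ` K \<Longrightarrow> norm y \<le> C" 
    using compact_imp_bounded bounded_iff by metis
  thus ?thesis by (intro that[of "max 1 C"]) (auto, fastforce)
qed

text \<open>The cross term in |w + q|^2 when q is an integral of the kernel at w. Multiplied by the square of
  the denominator, the two sides differ by nonnegative terms only.\<close>
lemma Re_circle_kernel_bound:
  assumes "Im w > 0"
  shows "2 * Re (cnj w * circle_kernel w u) 
    \<le> (1 + (cmod w)\<^sup>2) * (1 / (cmod (kernel_den w u))\<^sup>2) + (1 + (cmod w)\<^sup>2)"
proof -
  define s c a v where "s = sin (pi * u)" "c = cos (pi * u)" "a = Re w" "v = Im w"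
  define D where "D = (cmod (kernel_den w u))\<^sup>2"
  have sc1: "s\<^sup>2 + c\<^sup>2 = 1" by (simp add: s_c_a_v_def)
  hence sc: "c\<^sup>2 = 1 - s\<^sup>2" by linarith
  have D: "D > 0" using kernel_den_nz[OF assms] by (simp add: D_def)
  have D2: "D = (a * s + c)\<^sup>2 + (v * s)\<^sup>2" by (simp add: D_def kernel_den_norm_sq s_c_a_v_def)
  define N where "N = a\<^sup>2 + v\<^sup>2"
  have R: "Re (cnj w * circle_kernel w u) = ((a * (a * c - s) + v * (v * c)) * (a * s + c) 
            + (a * (v * c) - v * (a * c - s)) * (v * s)) / D"
  proof -
    have "cnj w * circle_kernel w u = cnj w * (w * of_real c - of_real s) * cnj (kernel_den w u) / of_real D"
      unfolding circle_kernel_def kernel_den_def[symmetric] D_def s_c_a_v_def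
      by (subst complex_div_cnj) (simp add: mult.assoc)
    hence "Re (cnj w * circle_kernel w u) = Re (cnj w * (w * of_real c - of_real s) * cnj (kernel_den w u)) / D"
      by (simp add: Re_divide_of_real)
    also have "Re (cnj w * (w * of_real c - of_real s) * cnj (kernel_den w u)) = 
       (a * (a * c - s) + v * (v * c)) * (a * s + c) + (a * (v * c) - v * (a * c - s)) * (v * s)"
      unfolding kernel_den_def s_c_a_v_def by simp
    finally show ?thesis by simp
  qed
  have "2 * ((a * (a * c - s) + v * (v * c)) * (a * s + c) + (a * (v * c) - v * (a * c - s)) * (v * s))
     = (1 + N * (s\<^sup>2 + c\<^sup>2)) + (N - 1) * D - ((1 - c\<^sup>2) + (N\<^sup>2 + 2 * a\<^sup>2 - 2 * v\<^sup>2) * s\<^sup>2)"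
    unfolding D2 N_def by (simp add: power2_eq_square algebra_simps)
  also note sc1
  also have "(1 - c\<^sup>2) + (N\<^sup>2 + 2 * a\<^sup>2 - 2 * v\<^sup>2) * s\<^sup>2 = s\<^sup>2 * ((1 - N)\<^sup>2 + 4 * a\<^sup>2)"
    unfolding sc N_def by (simp add: power2_eq_square algebra_simps)
  also have "(1 + N * 1) + (N - 1) * D - s\<^sup>2 * ((1 - N)\<^sup>2 + 4 * a\<^sup>2) \<le> (1 + N) + (N - 1) * D" by simp
  also have "\<dots> \<le> (1 + N) + (1 + N) * D" using D by (simp add: mult_right_mono)
  finally have "2 * Re (cnj w * circle_kernel w u) \<le> ((1 + N) + (1 + N) * D) / D"
    unfolding R using D by (simp add: divide_right_mono)
  also have "\<dots> = (1 + N) * (1 / D) + (1 + N)" using D by (simp add: add_divide_distrib)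
  finally show ?thesis by (simp add: N_def D_def s_c_a_v_def cmod_power2)
qed

section \<open>The Nevanlinna representation\<close>

text \<open>Helly's selection theorem for measures of bounded total mass. First the masses are made to converge
  along a subsequence. If their limit is zero, all integrals of bounded functions tend to zero; if it
  is positive, the measures are normalised, and the normalised measures are tight.\<close>
lemma finite_measures_unit_interval_subsequence:
  fixes N :: "nat \<Rightarrow> real measure"
  assumes sets [measurable_cong]: "\<And>n. sets (N n) = sets borel"
    and fin: "\<And>n. finite_measure (N n)"
    and supp: "\<And>n. emeasure (N n) (- {0..1}) = 0"
    and bnd: "\<And>n. measure (N n) UNIV \<le> B"
  obtains r M where "strict_mono (r :: nat \<Rightarrow> nat)" "sets M = sets borel" "finite_measure M"
    "emeasure M (- {0..1}) = 0"
    "\<And>g :: real \<Rightarrow> complex. \<And>C. g \<in> borel_measurable borel \<Longrightarrow> (\<And>x. cmod (g x) \<le> C) \<Longrightarrow>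
       emeasure M {x. \<not> isCont g x} = 0 \<Longrightarrow> (\<lambda>n. integral\<^sup>L (N (r n)) g) \<longlonglongrightarrow> integral\<^sup>L M g"
proof -
  interpret N: finite_measure "N n" for n by (rule fin)
  have sp: "space (N n) = UNIV" for n using sets_eq_imp_space_eq[OF sets] by simp
  define m where "m n = measure (N n) UNIV" for n
  have "\<forall>n. m n \<in> {0..B}" using bnd by (simp add: m_def)
  then obtain m0 r1 where r1: "strict_mono (r1 :: nat \<Rightarrow> nat)" "m0 \<in> {0..B}" and m0: "(m \<circ> r1) \<longlonglongrightarrow> m0"
    using compact_Icc[of 0 B] unfolding compact_def by metis
  show thesis
  proof (cases "m0 = 0")
    case True
    show thesis
    proof (rule that[of r1 "null_measure borel"])
      fix g :: "real \<Rightarrow> complex" and C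
      assume g: "g \<in> borel_measurable borel" "\<And>x. cmod (g x) \<le> C"
      have gN: "g \<in> borel_measurable (N n)" for n using g(1) by (simp add: measurable_cong_sets[OF sets refl])
      have "cmod (integral\<^sup>L (N (r1 n)) g) \<le> C * (m \<circ> r1) n" for n
      proof -
        have "cmod (integral\<^sup>L (N (r1 n)) g) \<le> integral\<^sup>L (N (r1 n)) (\<lambda>_. C)"
          by (rule Bochner_Integration.integral_norm_bound_integral) (use g in \<open>auto intro!: N.integrable_const_bound[where B=C] gN\<close>)
        also have "\<dots> = C * (m \<circ> r1) n" by (simp add: m_def sp)
        finally show ?thesis .
      qed
      moreover have "(\<lambda>n. C * (m \<circ> r1) n) \<longlonglongrightarrow> C * 0" using m0 True by (intro tendsto_intros) (auto simp: comp_def)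
      ultimately show "(\<lambda>n. integral\<^sup>L (N (r1 n)) g) \<longlonglongrightarrow> integral\<^sup>L (null_measure borel) g"
        using Lim_null_comparison[of "\<lambda>n. integral\<^sup>L (N (r1 n)) g" "\<lambda>n. C * (m \<circ> r1) n" sequentially]
        by (simp add: integral_null_measure)
    qed (use r1 in \<open>auto intro!: finite_measureI\<close>)
  next
    case False
    hence m0_pos: "m0 > 0" using r1 by simp
    \<comment> \<open>a Dirac measure replaces measures of mass zero, which can occur only finitely often\<close>
    define P where "P n = (if m (r1 n) > 0 then density (N (r1 n)) (\<lambda>_. ennreal (1 / m (r1 n))) else return borel 0)" for n
    have Psets [measurable_cong]: "sets (P n) = sets borel" for n by (simp add: P_def sets)
    have Pspace: "space (P n) = UNIV" for n using sets_eq_imp_space_eq[OF Psets] by simp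
    have Pem: "emeasure (P n) A = ennreal (1 / m (r1 n)) * emeasure (N (r1 n)) A" if "m (r1 n) > 0" "A \<in> sets borel" for n A
      using that by (simp add: P_def emeasure_density_const sets)
    have Pprob: "prob_space (P n)" for n
    proof (cases "m (r1 n) > 0")
      case True
      show ?thesis
      proof
        have "emeasure (P n) UNIV = ennreal (1 / m (r1 n)) * ennreal (m (r1 n))"
          using True by (simp add: Pem m_def N.emeasure_eq_measure)
        thus "emeasure (P n) (space (P n)) = 1" using True 
          by (simp add: Pspace flip: ennreal_mult')
      qed
    qed (simp add: P_def prob_space_return)
    have Pdist: "real_distribution (P n)" for n
      by (intro real_distribution.intro Pprob real_distribution_axioms.intro Psets)
    interpret P: real_distribution "P n" for n by (rule Pdist)
    have Psupp: "emeasure (P n) (- {0..1}) = 0" for n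
    proof (cases "m (r1 n) > 0")
      case True
      show ?thesis using Pem[OF True, of "- {0..1}"] supp[of "r1 n"] by (simp del: emeasure_eq_0)
    qed (simp add: P_def emeasure_return)
    have "P.prob n {-1<..1} = 1" for n
    proof -
      have "emeasure (P n) (- {-1<..1}) \<le> emeasure (P n) (- {0..1})"
        by (rule emeasure_mono) auto
      hence "P.prob n (- {-1<..1}) = 0" using Psupp[of n] by (simp add: measure_def)
      thus ?thesis using P.prob_compl[of "{-1<..1}" n] by (simp add: Compl_eq_Diff_UNIV)
    qed
    hence "tight P" unfolding tight_def
      by (intro conjI allI impI Pdist exI[of _ "-1"] exI[of _ 1]) auto
    then obtain r2 Q where r2: "strict_mono (r2 :: nat \<Rightarrow> nat)" "real_distribution Q" "weak_conv_m (P \<circ> id \<circ> r2) Q"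
      using tight_imp_convergent_subsubsequence[of P id] strict_mono_id by auto
    interpret Q: real_distribution Q by (rule r2)
    have Qconv: "(\<lambda>n. integral\<^sup>L (P (r2 n)) g) \<longlonglongrightarrow> integral\<^sup>L Q g"
      if "g \<in> borel_measurable borel" "\<And>x. cmod (g x) \<le> C" "emeasure Q {x. \<not> isCont g x} = 0" for g :: "real \<Rightarrow> complex" and C
      using weak_conv_imp_bdd_ae_continuous_conv[of "\<lambda>n. P (r2 n)" Q g C] r2 Pdist that
      by (auto simp: comp_def)
    \<comment> \<open>the truncated distance from the unit interval: a continuous test function that detects
         mass of the limit outside of it\<close>
    define d where "d x = complex_of_real (min 1 (max 0 (max (- x) (x - 1))))" for x :: real
    have dcont: "isCont d x" for x unfolding d_def by (intro continuous_intros)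
    have dmeas: "d \<in> borel_measurable borel" using dcont 
      by (intro borel_measurable_continuous_onI continuous_at_imp_continuous_on) auto
    have dbnd: "cmod (d x) \<le> 1" for x unfolding d_def by (auto simp: norm_of_real)
    have "integral\<^sup>L (P n) d = 0" for n
    proof -
      have "AE x in P n. x \<in> {0..1}" using Psupp[of n]
        by (intro AE_I[of _ _ "- {0..1}"]) (auto simp: Psets)
      hence "AE x in P n. d x = 0" by eventually_elim (auto simp: d_def max_def)
      thus ?thesis by (rule integral_eq_zero_AE)
    qed
    hence "(\<lambda>n. 0) \<longlonglongrightarrow> integral\<^sup>L Q d" using Qconv[of d 1] dmeas dbnd dcont by simp
    hence "integral\<^sup>L Q d = 0" by (simp add: LIMSEQ_const_iff)
    moreover have dint: "integrable Q d"
      by (intro Q.integrable_const_bound[where B=1] AE_I2 dbnd) 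
         (simp add: dmeas measurable_cong_sets[OF Q.events_eq_borel refl])
    ultimately have "integral\<^sup>L Q (\<lambda>x. Re (d x)) = 0" by simp
    moreover have "integrable Q (\<lambda>x. Re (d x))" using dint by (rule integrable_Re)
    ultimately have "AE x in Q. Re (d x) = 0"
      by (subst (asm) integral_nonneg_eq_0_iff_AE) (auto simp: d_def)
    hence "AE x in Q. x \<in> {0..1}" by eventually_elim (auto simp: d_def min_def max_def split: if_splits)
    hence Qsupp: "emeasure Q (- {0..1}) = 0" 
      by (subst (asm) AE_iff_measurable[where N="- {0..1}"]) auto
    define M where "M = density Q (\<lambda>_. ennreal m0)"
    have Mem: "emeasure M A = ennreal m0 * emeasure Q A" if "A \<in> sets borel" for A
      using that by (simp add: M_def emeasure_density_const)
    have Msets: "sets M = sets borel" by (simp add: M_def)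
    show thesis
    proof (rule that[of "r1 \<circ> r2" M])
      show "strict_mono (r1 \<circ> r2)" using r1 r2 by (intro strict_mono_o)
      show "finite_measure M" 
        by (intro finite_measureI) (use sets_eq_imp_space_eq[OF Msets] in \<open>simp add: Mem Q.emeasure_eq_measure ennreal_mult_eq_top_iff\<close>)
      show "emeasure M (- {0..1}) = 0" by (subst Mem) (auto simp: Qsupp simp del: emeasure_eq_0)
      fix g :: "real \<Rightarrow> complex" and C
      assume g: "g \<in> borel_measurable borel" "\<And>x. cmod (g x) \<le> C" and g0: "emeasure M {x. \<not> isCont g x} = 0"
      have "emeasure Q {x. \<not> isCont g x} = 0"
      proof (cases "{x. \<not> isCont g x} \<in> sets borel")
        case True thus ?thesis using g0 Mem[OF True] m0_pos by simp
      next
        case False thus ?thesis by (intro emeasure_notin_sets) simp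
      qed
      hence 1: "(\<lambda>n. integral\<^sup>L (P (r2 n)) g) \<longlonglongrightarrow> integral\<^sup>L Q g" using Qconv g by blast
      have mr: "(\<lambda>n. (m \<circ> r1) (r2 n)) \<longlonglongrightarrow> m0" 
        using LIMSEQ_subseq_LIMSEQ[OF m0 r2(1)] by (simp add: comp_def)
      have 2: "(\<lambda>n. (m \<circ> r1) (r2 n) *\<^sub>R integral\<^sup>L (P (r2 n)) g) \<longlonglongrightarrow> m0 *\<^sub>R integral\<^sup>L Q g"
        by (intro tendsto_intros 1 mr)
      have eq: "m0 *\<^sub>R integral\<^sup>L Q g = integral\<^sup>L M g"
        unfolding M_def by (subst integral_density) (use m0_pos g in auto)
      have ev: "\<forall>\<^sub>F n in sequentially. (m \<circ> r1) (r2 n) *\<^sub>R integral\<^sup>L (P (r2 n)) g = integral\<^sup>L (N ((r1 \<circ> r2) n)) g"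
      proof -
        have "\<forall>\<^sub>F n in sequentially. (m \<circ> r1) (r2 n) > 0" using order_tendstoD(1)[OF mr m0_pos] .
        thus ?thesis
        proof eventually_elim
          case (elim n)
          have "integral\<^sup>L (P (r2 n)) g = (1 / m (r1 (r2 n))) *\<^sub>R integral\<^sup>L (N (r1 (r2 n))) g"
            using elim g by (simp add: P_def) (subst integral_density, auto simp: sets measurable_cong_sets[OF sets refl])
          thus ?case using elim by simp
        qed
      qed
      show "(\<lambda>n. integral\<^sup>L (N ((r1 \<circ> r2) n)) g) \<longlonglongrightarrow> integral\<^sup>L M g"
        by (rule Lim_transform_eventually[OF 2[unfolded eq] ev])
    qed (simp add: Msets)
  qed
qed

lemma Cauchy_circle_mean:
  assumes "h holomorphic_on cball 0 1" "cmod \<zeta> < 1"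
  shows "((\<lambda>u. h (exp (2 * of_real pi * \<i> * of_real u)) * exp (2 * of_real pi * \<i> * of_real u)
            / (exp (2 * of_real pi * \<i> * of_real u) - \<zeta>)) has_integral h \<zeta>) {0..1}"
proof -
  let ?e = "\<lambda>u::real. exp (2 * of_real pi * \<i> * of_real u)"
  have "((\<lambda>w. h w / (w - \<zeta>)) has_contour_integral (2 * of_real pi * \<i> * h \<zeta>)) (circlepath 0 1)"
    by (rule Cauchy_integral_circlepath_simple) (use assms in auto)
  hence "((\<lambda>u. h (circlepath 0 1 u) / (circlepath 0 1 u - \<zeta>) * vector_derivative (circlepath 0 1) (at u within {0..1}))
           has_integral (2 * of_real pi * \<i> * h \<zeta>)) {0..1}"
    by (simp add: has_contour_integral_def)
  hence "((\<lambda>u. (1 / (2 * of_real pi * \<i>)) * (h (circlepath 0 1 u) / (circlepath 0 1 u - \<zeta>) * vector_derivative (circlepath 0 1) (at u within {0..1})))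
           has_integral ((1 / (2 * of_real pi * \<i>)) * (2 * of_real pi * \<i> * h \<zeta>))) {0..1}"
    by (rule has_integral_mult_right)
  hence hi: "((\<lambda>u. (1 / (2 * of_real pi * \<i>)) * (h (circlepath 0 1 u) / (circlepath 0 1 u - \<zeta>) * vector_derivative (circlepath 0 1) (at u within {0..1})))
           has_integral h \<zeta>) {0..1}" by simp
  have ii: "\<i> * (a * (\<i> * b)) = - (a * b)" for a b :: complex
  proof -
    have "\<i> * (a * (\<i> * b)) = (\<i> * \<i>) * (a * b)" by (simp only: mult_ac)
    thus ?thesis by simp
  qed
  show ?thesis
    by (rule has_integral_eq[OF _ hi]) (auto simp: vector_derivative_circlepath01, auto simp: circlepath ii)
qed

text \<open>On the circle, the imaginary part of g determines g up to a real constant. Cauchy's formula at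
  \<zeta> represents g \<zeta>. Applied at 0 to g(w)/(1 - cnj \<zeta> w) and conjugated, it gives the
  same integral with cnj g in place of g, because cnj w = 1/w on the circle. The difference contains
  only Im g.\<close>
lemma Schwarz_formula:
  assumes g: "g holomorphic_on cball 0 1" and \<zeta>: "cmod \<zeta> < 1"
  defines "e \<equiv> \<lambda>u::real. exp (2 * of_real pi * \<i> * of_real u)"
  shows "((\<lambda>u. of_real (Im (g (e u))) * (\<i> * (e u + \<zeta>) / (e u - \<zeta>))) has_integral g \<zeta> - of_real (Re (g 0))) {0..1}"
proof -
  have e1: "cmod (e u) = 1" for u unfolding e_def by simp
  have ee: "e u * cnj (e u) = 1" for u by (simp add: complex_norm_square[symmetric] e1)
  have e0: "e u \<noteq> 0" "e u - \<zeta> \<noteq> 0" for u using e1[of u] \<zeta> by auto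
  have den: "1 - cnj \<zeta> * w \<noteq> 0" if "w \<in> cball 0 1" for w
  proof
    assume "1 - cnj \<zeta> * w = 0"
    hence "cmod (cnj \<zeta> * w) = 1" by (metis eq_iff_diff_eq_0 norm_one)
    moreover have "cmod (cnj \<zeta> * w) \<le> cmod \<zeta> * 1" 
      unfolding norm_mult using that by (intro mult_mono) auto
    ultimately show False using \<zeta> by simp
  qed
  have 1: "((\<lambda>u. g (e u) * e u / (e u - \<zeta>)) has_integral g \<zeta>) {0..1}"
    unfolding e_def by (rule Cauchy_circle_mean[OF g \<zeta>])
  have "(\<lambda>w. g w / (1 - cnj \<zeta> * w)) holomorphic_on cball 0 1"
    by (intro holomorphic_intros g den)
  from Cauchy_circle_mean[OF this, of 0] 
  have "((\<lambda>u. g (e u) / (1 - cnj \<zeta> * e u)) has_integral g 0) {0..1}"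
    unfolding e_def by simp
  from has_integral_linear[OF this bounded_linear_cnj]
  have "((\<lambda>u. cnj (g (e u) / (1 - cnj \<zeta> * e u))) has_integral cnj (g 0)) {0..1}" by (simp add: comp_def)
  moreover have "cnj (g (e u) / (1 - cnj \<zeta> * e u)) = cnj (g (e u)) * e u / (e u - \<zeta>)" for u
  proof -
    have "1 - \<zeta> * cnj (e u) = (e u - \<zeta>) / e u" using ee[of u] e0[of u] by (simp add: field_simps)
    thus ?thesis by simp
  qed
  ultimately have 2: "((\<lambda>u. cnj (g (e u)) * e u / (e u - \<zeta>)) has_integral cnj (g 0)) {0..1}" by simp
  have "((\<lambda>u. g (e u)) has_integral g 0) {0..1}"
    using Cauchy_circle_mean[OF g, of 0] unfolding e_def by simp
  from has_integral_linear[OF this bounded_linear_Im] 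
  have "((\<lambda>u. Im (g (e u))) has_integral Im (g 0)) {0..1}" by (simp add: comp_def)
  from has_integral_mult_right[OF has_integral_of_real[OF this, where 'b=complex], of \<i>]
  have 3: "((\<lambda>u. \<i> * of_real (Im (g (e u)))) has_integral \<i> * of_real (Im (g 0))) {0..1}" .
  have "((\<lambda>u. g (e u) * e u / (e u - \<zeta>) - cnj (g (e u)) * e u / (e u - \<zeta>) - \<i> * of_real (Im (g (e u))))
    has_integral g \<zeta> - cnj (g 0) - \<i> * of_real (Im (g 0))) {0..1}"
    by (intro has_integral_diff 1 2 3)
  moreover have "g (e u) * e u / (e u - \<zeta>) - cnj (g (e u)) * e u / (e u - \<zeta>) - \<i> * of_real (Im (g (e u)))
     = of_real (Im (g (e u))) * (\<i> * (e u + \<zeta>) / (e u - \<zeta>))" for u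
  proof -
    have "g (e u) * e u / (e u - \<zeta>) - cnj (g (e u)) * e u / (e u - \<zeta>) = (g (e u) - cnj (g (e u))) * e u / (e u - \<zeta>)"
      by (simp add: diff_divide_distrib left_diff_distrib)
    also have "g (e u) - cnj (g (e u)) = 2 * \<i> * of_real (Im (g (e u)))" by (simp add: complex_diff_cnj mult_ac)
    finally show ?thesis using e0[of u] by (simp add: divide_simps) (simp add: algebra_simps)
  qed
  moreover have "g \<zeta> - cnj (g 0) - \<i> * of_real (Im (g 0)) = g \<zeta> - of_real (Re (g 0))"
    by (simp add: complex_eq_iff)
  ultimately show ?thesis by simp
qed

text \<open>Under the Cayley transform the Herglotz kernel of the disc becomes the circle kernel.\<close>
lemma circle_kernel_disc:
  assumes "Im z > 0"
  defines "e \<equiv> \<lambda>u::real. exp (2 * of_real pi * \<i> * of_real u)"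
  defines "\<zeta> \<equiv> (z - \<i>) / (z + \<i>)"
  shows "\<i> * (e u + \<zeta>) / (e u - \<zeta>) = circle_kernel z u" "cmod \<zeta> < 1" "\<i> * (1 + \<zeta>) / (1 - \<zeta>) = z"
proof -
  define E where "E = cis (pi * u)"
  have eE: "e u = E * E" unfolding e_def E_def cis_mult by (simp add: cis_conv_exp algebra_simps)
  have zi: "z + \<i> \<noteq> 0" using assms by (auto simp: complex_eq_iff)
  have EE: "E * cnj E = 1" "E \<noteq> 0" by (auto simp: E_def cis_cnj cis_mult)
  have s: "of_real (sin (pi * u)) = (E - cnj E) / (2 * \<i>)" "of_real (cos (pi * u)) = (E + cnj E) / 2"
    by (auto simp: E_def complex_eq_iff)
  have "e u + \<zeta> = (E * E * (z + \<i>) + (z - \<i>)) / (z + \<i>)" "e u - \<zeta> = (E * E * (z + \<i>) - (z - \<i>)) / (z + \<i>)"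
    unfolding eE \<zeta>_def using zi by (auto simp: add_divide_distrib diff_divide_distrib)
  hence "\<i> * (e u + \<zeta>) / (e u - \<zeta>) = (\<i> * ((E * E * (z + \<i>) + (z - \<i>)) / (z + \<i>))) / ((E * E * (z + \<i>) - (z - \<i>)) / (z + \<i>))"
    by (simp only:)
  also have "\<dots> = \<i> * (E * E * (z + \<i>) + (z - \<i>)) / (E * E * (z + \<i>) - (z - \<i>))" using zi by simp
  also have "E * E * (z + \<i>) + (z - \<i>) = E * (E * (z + \<i>) + cnj E * (z - \<i>))"
    using EE by (simp add: algebra_simps)
  also have "E * E * (z + \<i>) - (z - \<i>) = E * (E * (z + \<i>) - cnj E * (z - \<i>))"
    using EE by (simp add: algebra_simps)
  also have "E * (z + \<i>) + cnj E * (z - \<i>) = 2 * (z * of_real (cos (pi * u)) - of_real (sin (pi * u)))"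
    unfolding s by (simp add: field_simps)
  also have "E * (z + \<i>) - cnj E * (z - \<i>) = 2 * \<i> * (z * of_real (sin (pi * u)) + of_real (cos (pi * u)))"
    unfolding s by (simp add: field_simps)
  finally have "\<i> * (e u + \<zeta>) / (e u - \<zeta>) = 
     ((2 * \<i> * E) * (z * of_real (cos (pi * u)) - of_real (sin (pi * u)))) / ((2 * \<i> * E) * (z * of_real (sin (pi * u)) + of_real (cos (pi * u))))"
    by (simp only: mult_ac)
  thus "\<i> * (e u + \<zeta>) / (e u - \<zeta>) = circle_kernel z u"
    unfolding circle_kernel_def by (subst (asm) mult_divide_mult_cancel_left) (use EE in auto)
  have "(cmod (z - \<i>))\<^sup>2 < (cmod (z + \<i>))\<^sup>2"
    using assms by (simp add: cmod_power2) (simp add: power2_eq_square algebra_simps)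
  hence "cmod (z - \<i>) < cmod (z + \<i>)" by (rule power2_less_imp_less) simp
  thus "cmod \<zeta> < 1" using zi by (simp add: \<zeta>_def norm_divide divide_simps)
  have "1 + \<zeta> = 2 * z / (z + \<i>)" "1 - \<zeta> = 2 * \<i> / (z + \<i>)" 
    unfolding \<zeta>_def using zi by (auto simp: field_simps)
  thus "\<i> * (1 + \<zeta>) / (1 - \<zeta>) = z" using zi by simp
qed

lemma circle_kernel_borel [measurable]: 
  "Im z > 0 \<Longrightarrow> circle_kernel z \<in> borel_measurable borel"
  by (intro borel_measurable_continuous_onI continuous_on_circle_kernel continuous_intros)

lemma isCont_circle_kernel: "Im z > 0 \<Longrightarrow> isCont (circle_kernel z) u"
  using continuous_on_circle_kernel[of UNIV "\<lambda>_. z" "\<lambda>x. x"]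
  by (simp add: continuous_on_eq_continuous_at)

lemma holomorphic_disc_transform:
  assumes "\<phi> holomorphic_on upper_half_plane"
  shows "(\<lambda>\<zeta>. \<phi> (\<i> * (1 + \<zeta>) / (1 - \<zeta>))) holomorphic_on ball 0 1"
    and "\<zeta> \<in> ball 0 1 \<Longrightarrow> \<i> * (1 + \<zeta>) / (1 - \<zeta>) \<in> upper_half_plane"
proof -
  have im: "Im (\<i> * (1 + \<zeta>) / (1 - \<zeta>)) > 0" if "cmod \<zeta> < 1" for \<zeta>
  proof -
    have n: "1 - \<zeta> \<noteq> 0" using that by auto
    have "(cmod \<zeta>)\<^sup>2 < 1" using that by (simp add: power_less_one_iff)
    hence "Re \<zeta> * Re \<zeta> + Im \<zeta> * Im \<zeta> < 1" unfolding cmod_power2 by (simp add: power2_eq_square)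
    moreover have "Im (\<i> * (1 + \<zeta>) / (1 - \<zeta>)) = (1 - (Re \<zeta> * Re \<zeta> + Im \<zeta> * Im \<zeta>)) / (cmod (1 - \<zeta>))\<^sup>2"
      unfolding Im_divide cmod_power2[symmetric] by (rule arg_cong[where f = "\<lambda>x. x / _"]) (simp add: algebra_simps)
    ultimately show ?thesis using n by simp
  qed
  show "\<zeta> \<in> ball 0 1 \<Longrightarrow> \<i> * (1 + \<zeta>) / (1 - \<zeta>) \<in> upper_half_plane" using im by simp
  have "(\<phi> \<circ> (\<lambda>\<zeta>. \<i> * (1 + \<zeta>) / (1 - \<zeta>))) holomorphic_on ball 0 1"
  proof (rule holomorphic_on_compose_gen[OF _ assms])
    show "(\<lambda>\<zeta>. \<i> * (1 + \<zeta>) / (1 - \<zeta>)) holomorphic_on ball 0 1"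
      by (intro holomorphic_intros) auto
  qed (use im in auto)
  thus "(\<lambda>\<zeta>. \<phi> (\<i> * (1 + \<zeta>) / (1 - \<zeta>))) holomorphic_on ball 0 1" by (simp add: comp_def)
qed

text \<open>On the disc, the dilations g(R \<zeta>) with R < 1 are represented by the densities Im g(R e(u)),
  which are nonnegative and have mass Im g(0) by the mean value property. A weak limit of these
  measures as R tends to one represents g.\<close>
theorem Nevanlinna_circle:
  assumes hol: "\<phi> holomorphic_on upper_half_plane" and nonneg: "\<And>z. Im z > 0 \<Longrightarrow> Im (\<phi> z) \<ge> 0"
  obtains \<nu> where "sets \<nu> = sets borel" "finite_measure \<nu>" "emeasure \<nu> (- {0..1}) = 0"
    "measure \<nu> UNIV = Im (\<phi> \<i>)"
    "\<And>z. Im z > 0 \<Longrightarrow> \<phi> z = of_real (Re (\<phi> \<i>)) + (LINT u|\<nu>. circle_kernel z u)"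
proof -
  define g where "g \<zeta> = \<phi> (\<i> * (1 + \<zeta>) / (1 - \<zeta>))" for \<zeta>
  have ghol: "g holomorphic_on ball 0 1" unfolding g_def by (rule holomorphic_disc_transform[OF hol])
  have gIm: "Im (g \<zeta>) \<ge> 0" if "cmod \<zeta> < 1" for \<zeta>
    unfolding g_def using holomorphic_disc_transform(2)[OF hol, of \<zeta>] that by (intro nonneg) auto
  have g0: "g 0 = \<phi> \<i>" by (simp add: g_def)
  define R where "R n = real (Suc n) / real (Suc (Suc n))" for n
  have R: "0 < R n" "R n < 1" for n by (auto simp: R_def)
  have R1: "R \<longlonglongrightarrow> 1" unfolding R_def
  proof -
    have "(\<lambda>n. real n / real (Suc n)) \<longlonglongrightarrow> 1" by (rule LIMSEQ_n_over_Suc_n)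
    from LIMSEQ_Suc[OF this] show "(\<lambda>n. real (Suc n) / real (Suc (Suc n))) \<longlonglongrightarrow> 1" .
  qed
  define gn where "gn n \<zeta> = g (of_real (R n) * \<zeta>)" for n \<zeta>
  have in_ball: "cmod (of_real (R n) * \<zeta>) < 1" if "cmod \<zeta> \<le> 1" for n \<zeta>
  proof -
    have "cmod (of_real (R n) * \<zeta>) \<le> R n * 1" using that R[of n] by (simp add: norm_mult mult_left_le)
    thus ?thesis using R[of n] by simp
  qed
  have gnhol: "gn n holomorphic_on cball 0 1" for n
  proof -
    have "(g \<circ> (\<lambda>\<zeta>. of_real (R n) * \<zeta>)) holomorphic_on cball 0 1"
      by (rule holomorphic_on_compose_gen[OF _ ghol]) (use in_ball in \<open>auto intro!: holomorphic_intros\<close>)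
    thus ?thesis unfolding gn_def by (simp add: comp_def)
  qed
  have gnIm: "Im (gn n \<zeta>) \<ge> 0" if "cmod \<zeta> \<le> 1" for n \<zeta> unfolding gn_def by (rule gIm[OF in_ball[OF that]])
  define e where "e = (\<lambda>u::real. exp (2 * of_real pi * \<i> * of_real u))"
  have e1: "cmod (e u) = 1" for u unfolding e_def by simp
  define d where "d n u = indicator {0..1} u * Im (gn n (e u))" for n u
  have dcont: "continuous_on {0..1} (\<lambda>u. Im (gn n (e u)))" for n
  proof (intro continuous_intros continuous_on_compose2[OF holomorphic_on_imp_continuous_on[OF gnhol]])
    show "continuous_on {0..1} e" unfolding e_def by (intro continuous_intros)
  qed (auto simp: e1)
  have dmeas [measurable]: "d n \<in> borel_measurable borel" for n
    using borel_measurable_continuous_on_indicator[OF _ dcont, of n] by (simp add: d_def[abs_def])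
  have dnn: "d n u \<ge> 0" for n u unfolding d_def using gnIm e1 by simp
  define N where "N n = density lborel (\<lambda>u. ennreal (d n u))" for n
  have Nsets [measurable_cong]: "sets (N n) = sets borel" for n by (simp add: N_def)
  have Nint: "integral\<^sup>L (N n) h = integral {0..1} (\<lambda>u. of_real (Im (gn n (e u))) * h u)"
    if h: "continuous_on UNIV h" for h :: "real \<Rightarrow> complex" and n
  proof -
    have hm: "h \<in> borel_measurable borel" using h by (rule borel_measurable_continuous_onI)
    have "integral\<^sup>L (N n) h = (LINT u|lborel. d n u *\<^sub>R h u)"
      unfolding N_def by (rule integral_density) (use hm dnn in auto)
    also have "\<dots> = (LINT u:{0..1}|lborel. of_real (Im (gn n (e u))) * h u)"
      unfolding set_lebesgue_integral_def d_def 
      by (intro Bochner_Integration.integral_cong refl) (auto simp: indicator_def scaleR_conv_of_real)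
    also have "\<dots> = integral {0..1} (\<lambda>u. of_real (Im (gn n (e u))) * h u)"
      by (intro set_borel_integral_eq_integral(2) borel_integrable_compact[unfolded set_integrable_def[symmetric]] continuous_intros dcont
            continuous_on_subset[OF h]) auto
    finally show ?thesis .
  qed
  have Nem: "emeasure (N n) A = (\<integral>\<^sup>+u. ennreal (d n u) * indicator A u \<partial>lborel)" if "A \<in> sets borel" for n A
    unfolding N_def by (rule emeasure_density) (use that in auto)
  have Nfin: "finite_measure (N n)" for n
  proof
    obtain K where K: "\<And>u. u \<in> {0..1} \<Longrightarrow> Im (gn n (e u)) \<le> K"
      using compact_continuous_image[OF dcont compact_Icc, of n] compact_imp_bounded bounded_imp_bdd_above
      unfolding bdd_above_def by (metis imageI)
    have "emeasure (N n) (space (N n)) \<le> (\<integral>\<^sup>+u. ennreal K * indicator {0..1::real} u \<partial>lborel)"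
      by (subst Nem) (auto simp: d_def N_def intro!: nn_integral_mono ennreal_leI K split: split_indicator)
    also have "\<dots> = ennreal K" by (subst nn_integral_cmult_indicator) auto
    finally show "emeasure (N n) (space (N n)) \<noteq> \<infinity>" by (auto simp: top_unique)
  qed
  have Nsp: "space (N n) = UNIV" for n by (simp add: N_def)
  have Nmass: "measure (N n) UNIV = Im (\<phi> \<i>)" for n
  proof -
    have "((\<lambda>u. gn n (e u)) has_integral gn n 0) {0..1}"
      using Cauchy_circle_mean[OF gnhol, of 0] unfolding e_def by simp
    from has_integral_linear[OF this bounded_linear_Im] 
    have "((\<lambda>u. Im (gn n (e u))) has_integral Im (gn n 0)) {0..1}" by (simp add: comp_def)
    from has_integral_of_real[OF this, where 'b=complex] 
    have "integral {0..1} (\<lambda>u. of_real (Im (gn n (e u)))) = complex_of_real (Im (gn n 0))" by (rule integral_unique)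
    moreover have "integral\<^sup>L (N n) (\<lambda>u. 1 :: complex) = of_real (measure (N n) UNIV)"
      using finite_measure.integrable_const[OF Nfin, of n "1::complex"] by (simp add: Nsp scaleR_conv_of_real)
    ultimately show ?thesis using Nint[of "\<lambda>_. 1" n] by (simp add: gn_def g0 continuous_on_const)
  qed
  have Nsupp: "emeasure (N n) (- {0..1}) = 0" for n
    by (subst Nem) (auto simp: d_def intro!: nn_integral_zero' AE_I2 split: split_indicator)
  have Nrep: "g (of_real (R n) * ((z - \<i>) / (z + \<i>))) = of_real (Re (\<phi> \<i>)) + (LINT u|N n. circle_kernel z u)" if z: "Im z > 0" for n z
  proof -
    define \<zeta> where "\<zeta> = (z - \<i>) / (z + \<i>)"
    note ck = circle_kernel_disc[OF z, folded \<zeta>_def e_def]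
    have "((\<lambda>u. of_real (Im (gn n (e u))) * (\<i> * (e u + \<zeta>) / (e u - \<zeta>))) has_integral gn n \<zeta> - of_real (Re (gn n 0))) {0..1}"
      unfolding e_def by (rule Schwarz_formula[OF gnhol ck(2)])
    hence "((\<lambda>u. of_real (Im (gn n (e u))) * circle_kernel z u) has_integral gn n \<zeta> - of_real (Re (gn n 0))) {0..1}"
      unfolding e_def ck(1)[unfolded e_def] .
    hence "integral {0..1} (\<lambda>u. of_real (Im (gn n (e u))) * circle_kernel z u) = gn n \<zeta> - of_real (Re (gn n 0))"
      by (rule integral_unique)
    hence "(LINT u|N n. circle_kernel z u) = gn n \<zeta> - of_real (Re (gn n 0))"
      by (subst Nint) (use z in \<open>auto intro!: continuous_on_circle_kernel continuous_intros\<close>)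
    thus ?thesis by (simp add: gn_def g0 \<zeta>_def)
  qed
  obtain r \<nu> where r: "strict_mono (r :: nat \<Rightarrow> nat)" and \<nu>: "sets \<nu> = sets borel" "finite_measure \<nu>" "emeasure \<nu> (- {0..1}) = 0"
    and conv: "\<And>g :: real \<Rightarrow> complex. \<And>C. g \<in> borel_measurable borel \<Longrightarrow> (\<And>x. cmod (g x) \<le> C) \<Longrightarrow>
       emeasure \<nu> {x. \<not> isCont g x} = 0 \<Longrightarrow> (\<lambda>n. integral\<^sup>L (N (r n)) g) \<longlonglongrightarrow> integral\<^sup>L \<nu> g"
    using finite_measures_unit_interval_subsequence[of N "Im (\<phi> \<i>)"] Nsets Nfin Nsupp Nmass by (metis order_refl)
  have \<nu>sp: "space \<nu> = UNIV" using sets_eq_imp_space_eq[OF \<nu>(1)] by simp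
  have one: "integral\<^sup>L M (\<lambda>u. 1 :: complex) = of_real (measure M UNIV)" if "finite_measure M" "space M = UNIV" for M :: "real measure"
    using finite_measure.integrable_const[OF that(1), of "1::complex"] that by (simp add: scaleR_conv_of_real)
  show thesis
  proof (rule that[OF \<nu>])
    have "(\<lambda>n. integral\<^sup>L (N (r n)) (\<lambda>_. 1 :: complex)) \<longlonglongrightarrow> integral\<^sup>L \<nu> (\<lambda>_. 1 :: complex)"
      by (rule conv[of _ 1]) auto
    hence "(\<lambda>n::nat. complex_of_real (Im (\<phi> \<i>))) \<longlonglongrightarrow> of_real (measure \<nu> UNIV)"
      using one[OF Nfin Nsp] one[OF \<nu>(2) \<nu>sp] Nmass by simp
    hence "complex_of_real (measure \<nu> UNIV) = of_real (Im (\<phi> \<i>))" by (simp add: LIMSEQ_const_iff)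
    thus "measure \<nu> UNIV = Im (\<phi> \<i>)" by (simp only: of_real_eq_iff)
    fix z assume z: "Im z > 0"
    define \<zeta> where "\<zeta> = (z - \<i>) / (z + \<i>)"
    note ck = circle_kernel_disc[OF z, folded \<zeta>_def]
    have "(\<lambda>n. of_real (Re (\<phi> \<i>)) + (LINT u|N (r n). circle_kernel z u)) \<longlonglongrightarrow> of_real (Re (\<phi> \<i>)) + (LINT u|\<nu>. circle_kernel z u)"
      by (intro tendsto_intros conv[of _ "hsize z"] norm_circle_kernel_le z circle_kernel_borel)
         (simp add: isCont_circle_kernel z)
    hence 1: "(\<lambda>n. g (of_real (R (r n)) * \<zeta>)) \<longlonglongrightarrow> of_real (Re (\<phi> \<i>)) + (LINT u|\<nu>. circle_kernel z u)"
      unfolding \<zeta>_def Nrep[OF z] .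
    have "isCont g \<zeta>" using ghol ck(2) 
      by (metis continuous_on_interior holomorphic_on_imp_continuous_on interior_open mem_ball_0 open_ball)
    moreover have "(\<lambda>n. of_real (R (r n)) * \<zeta>) \<longlonglongrightarrow> of_real 1 * \<zeta>"
      by (intro tendsto_intros LIMSEQ_subseq_LIMSEQ[OF R1 r, unfolded comp_def])
    ultimately have "(\<lambda>n. g (of_real (R (r n)) * \<zeta>)) \<longlonglongrightarrow> g \<zeta>"
      by (intro isCont_tendsto_compose[of _ g]) auto
    with 1 have "g \<zeta> = of_real (Re (\<phi> \<i>)) + (LINT u|\<nu>. circle_kernel z u)" by (metis LIMSEQ_unique)
    moreover have "g \<zeta> = \<phi> z" by (simp add: g_def ck(3))
    ultimately show "\<phi> z = of_real (Re (\<phi> \<i>)) + (LINT u|\<nu>. circle_kernel z u)" by simp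
  qed
qed

section \<open>Reciprocal Cauchy transforms\<close>

lemma uhp_minus_real_nz: "Im z > 0 \<Longrightarrow> z - complex_of_real x \<noteq> 0"
  by (metis Im_complex_of_real eq_iff_diff_eq_0 less_irrefl)

lemma norm_uhp_minus_real_ge: "Im z > 0 \<Longrightarrow> Im z \<le> cmod (z - complex_of_real x)"
  using abs_Im_le_cmod[of "z - complex_of_real x"] by simp

lemma cauchy_integrand_integrable:
  assumes "finite_measure \<mu>" "sets \<mu> = sets borel" "Im z > 0"
  shows "integrable \<mu> (\<lambda>x. 1 / (z - complex_of_real x))"
proof (rule finite_measure.integrable_const_bound[OF assms(1), where B = "1 / Im z"])
  show "AE x in \<mu>. cmod (1 / (z - complex_of_real x)) \<le> 1 / Im z"
    using norm_uhp_minus_real_ge[OF assms(3)] assms(3)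
    by (intro AE_I2) (auto simp: norm_divide intro!: divide_left_mono mult_pos_pos uhp_minus_real_nz)
  show "(\<lambda>x. 1 / (z - complex_of_real x)) \<in> borel_measurable \<mu>"
    using assms(2) by (simp cong: measurable_cong_sets)
qed

text \<open>With X = 1/(z - x), the imaginary part of the Cauchy transform G is - Im z * E |X|^2, while |G|^2
  \<le> E |X|^2 by Cauchy-Schwarz; hence Im (1/G) = - Im G / |G|^2 is at least Im z.\<close>
lemma class_P_Im_ge:
  assumes f: "f \<in> class_P" and z: "Im z > 0" and fz: "Im (f z) > 0"
  shows "Im z \<le> Im (f z)"
proof -
  from f obtain \<mu> where \<mu>: "real_distribution \<mu>" and fG: "\<And>z. Im z > 0 \<Longrightarrow> f z = 1 / cauchy_transform \<mu> z"
    by (auto simp: class_P_def reciprocal_cauchy_transform_def)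
  interpret real_distribution \<mu> by (rule \<mu>)
  define G where "G = cauchy_transform \<mu> z"
  have G0: "G \<noteq> 0" using fG[OF z] fz by (auto simp: G_def)
  define X where "X x = 1 / (z - complex_of_real x)" for x
  have Xint: "integrable \<mu> X" unfolding X_def using cauchy_integrand_integrable[OF _ _ z, of \<mu>] by simp
  have Xb: "cmod (X x) \<le> 1 / Im z" for x
    using norm_uhp_minus_real_ge[OF z] z unfolding X_def
    by (auto simp: norm_divide intro!: divide_left_mono mult_pos_pos uhp_minus_real_nz)
  have X2int: "integrable \<mu> (\<lambda>x. (cmod (X x))\<^sup>2)"
    by (rule integrable_const_bound[where B = "(1 / Im z)\<^sup>2"])
       (use Xb Xint in \<open>auto intro!: AE_I2 power_mono\<close>)
  have nint: "integrable \<mu> (\<lambda>x. cmod (X x))" using Xint by (rule integrable_norm)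
  have ImX: "Im (X x) = - (Im z * (cmod (X x))\<^sup>2)" for x
    by (simp add: X_def Im_divide norm_divide power_divide cmod_power2)
  have ImG: "Im G = - (Im z * expectation (\<lambda>x. (cmod (X x))\<^sup>2))"
  proof -
    have "Im G = expectation (\<lambda>x. Im (X x))"
      unfolding G_def cauchy_transform_def X_def[symmetric] by (rule integral_Im[OF Xint, symmetric])
    thus ?thesis by (simp add: ImX)
  qed
  have "0 \<le> variance (\<lambda>x. cmod (X x))" by (rule variance_positive)
  hence 1: "(expectation (\<lambda>x. cmod (X x)))\<^sup>2 \<le> expectation (\<lambda>x. (cmod (X x))\<^sup>2)"
    by (subst (asm) variance_eq[OF nint X2int]) simp
  have "cmod G \<le> expectation (\<lambda>x. cmod (X x))"
    unfolding G_def cauchy_transform_def X_def[symmetric] by (rule integral_norm_bound)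
  hence "(cmod G)\<^sup>2 \<le> (expectation (\<lambda>x. cmod (X x)))\<^sup>2" by (intro power_mono) auto
  hence 2: "(cmod G)\<^sup>2 \<le> expectation (\<lambda>x. (cmod (X x))\<^sup>2)" using 1 by (rule order_trans)
  have "Im (f z) = - Im G / (cmod G)\<^sup>2"
    unfolding fG[OF z] G_def[symmetric] by (simp add: Im_divide cmod_power2)
  also have "\<dots> = Im z * expectation (\<lambda>x. (cmod (X x))\<^sup>2) / (cmod G)\<^sup>2" by (simp add: ImG)
  also have "\<dots> \<ge> Im z * (cmod G)\<^sup>2 / (cmod G)\<^sup>2"
    by (intro divide_right_mono mult_left_mono 2) (use z in auto)
  finally show ?thesis using G0 by simp
qed

lemma cauchy_transform_asymp:
  assumes "real_distribution \<mu>"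
  shows "(\<lambda>n. (\<i> * of_nat (Suc n)) * cauchy_transform \<mu> (\<i> * of_nat (Suc n))) \<longlonglongrightarrow> 1"
proof -
  interpret real_distribution \<mu> by (rule assms)
  define s where "s n x = (\<i> * of_nat (Suc n)) / (\<i> * of_nat (Suc n) - complex_of_real x)" for n x
  have Imn: "Im (\<i> * of_nat (Suc n)) = real (Suc n)" for n by simp
  have "(\<lambda>n. expectation (s n)) \<longlonglongrightarrow> expectation (\<lambda>_. 1)"
  proof (rule integral_dominated_convergence[where w = "\<lambda>_. 1"])
    show "AE x in \<mu>. (\<lambda>n. s n x) \<longlonglongrightarrow> 1"
    proof (rule AE_I2)
      fix x
      have "(\<lambda>n. 1 / (1 - (complex_of_real x / \<i>) * complex_of_real (inverse (real (Suc n))))) \<longlonglongrightarrow> 1 / (1 - (complex_of_real x / \<i>) * complex_of_real 0)"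
        by (intro tendsto_intros LIMSEQ_inverse_real_of_nat) auto
      moreover have "1 / (1 - (complex_of_real x / \<i>) * complex_of_real (inverse (real (Suc n)))) = s n x" for n
      proof -
        have nz: "\<i> * of_nat (Suc n) - complex_of_real x \<noteq> 0" by (rule uhp_minus_real_nz) simp
        have n0: "(of_nat (Suc n) :: complex) \<noteq> 0" using of_nat_neq_0 by blast
        have "1 - (complex_of_real x / \<i>) * complex_of_real (inverse (real (Suc n))) = (\<i> * of_nat (Suc n) - complex_of_real x) / (\<i> * of_nat (Suc n))"
          using n0 by (simp add: divide_simps del: of_nat_Suc) (simp add: algebra_simps del: of_nat_Suc)
        thus ?thesis using nz n0 by (simp add: s_def del: of_nat_Suc)
      qed
      ultimately show "(\<lambda>n. s n x) \<longlonglongrightarrow> 1" by simp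
    qed
    show "AE x in \<mu>. cmod (s n x) \<le> 1" for n
      using norm_uhp_minus_real_ge[of "\<i> * of_nat (Suc n)"] unfolding s_def
      by (intro AE_I2) (auto simp: norm_divide norm_mult divide_le_eq_1 simp del: of_nat_Suc)
  qed (auto simp: s_def[abs_def])
  moreover have "expectation (s n) = (\<i> * of_nat (Suc n)) * cauchy_transform \<mu> (\<i> * of_nat (Suc n))" for n
  proof -
    have "expectation (\<lambda>x. (\<i> * of_nat (Suc n)) * (1 / (\<i> * of_nat (Suc n) - complex_of_real x))) 
        = (\<i> * of_nat (Suc n)) * cauchy_transform \<mu> (\<i> * of_nat (Suc n))"
      unfolding cauchy_transform_def by (rule Bochner_Integration.integral_mult_right) (rule cauchy_integrand_integrable, auto)
    thus ?thesis by (simp add: s_def[abs_def])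
  qed
  moreover have "expectation (\<lambda>_. 1 :: complex) = 1" using prob_space by simp
  ultimately show ?thesis by (simp del: of_nat_Suc)
qed

lemma class_P_asymp:
  assumes f: "f \<in> class_P"
  shows "(\<lambda>n. f (\<i> * of_nat (Suc n)) / (\<i> * of_nat (Suc n))) \<longlonglongrightarrow> 1"
proof -
  from f obtain \<mu> where \<mu>: "real_distribution \<mu>" and fG: "\<And>z. Im z > 0 \<Longrightarrow> f z = 1 / cauchy_transform \<mu> z"
    by (auto simp: class_P_def reciprocal_cauchy_transform_def)
  have "(\<lambda>n. 1 / ((\<i> * of_nat (Suc n)) * cauchy_transform \<mu> (\<i> * of_nat (Suc n)))) \<longlonglongrightarrow> 1 / 1"
    by (intro tendsto_intros cauchy_transform_asymp \<mu>) auto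
  moreover have "1 / ((\<i> * of_nat (Suc n)) * cauchy_transform \<mu> (\<i> * of_nat (Suc n))) = f (\<i> * of_nat (Suc n)) / (\<i> * of_nat (Suc n))" for n
    by (subst fG) (auto simp: mult_ac simp del: of_nat_Suc)
  ultimately show ?thesis by simp
qed

text \<open>Cauchy-Schwarz against the constant function one, in the form of a nonnegative quadratic expression
  in |h|.\<close>
lemma finite_measure_norm_integral_sq_le:
  assumes "finite_measure M" "integrable M h" "\<And>x. cmod (h x) \<le> B" 
  shows "(cmod (integral\<^sup>L M h))\<^sup>2 \<le> measure M (space M) * (LINT x|M. (cmod (h x))\<^sup>2)"
proof -
  interpret finite_measure M by (rule assms(1))
  define m where "m = measure M (space M)"
  define A where "A = (LINT x|M. cmod (h x))"
  define Q where "Q = (LINT x|M. (cmod (h x))\<^sup>2)"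
  have i1: "integrable M (\<lambda>x. cmod (h x))" using assms(2) by (rule integrable_norm)
  have i2: "integrable M (\<lambda>x. (cmod (h x))\<^sup>2)"
    by (rule integrable_const_bound[where B = "B\<^sup>2"]) (use assms in \<open>auto intro!: AE_I2 power_mono\<close>)
  have "cmod (integral\<^sup>L M h) \<le> A" unfolding A_def by (rule integral_norm_bound)
  hence 1: "(cmod (integral\<^sup>L M h))\<^sup>2 \<le> A\<^sup>2" by (intro power_mono) auto
  have m0: "m \<ge> 0" by (simp add: m_def)
  have "0 \<le> (LINT x|M. (m * cmod (h x) - A)\<^sup>2)" by simp
  also have "\<dots> = (LINT x|M. m\<^sup>2 * (cmod (h x))\<^sup>2 - 2 * m * A * cmod (h x) + A\<^sup>2)"
    by (rule Bochner_Integration.integral_cong) (auto simp: power2_eq_square algebra_simps)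
  also have "\<dots> = m\<^sup>2 * Q - 2 * m * A * A + A\<^sup>2 * m"
    using i1 i2 by (simp add: A_def Q_def m_def)
  also have "\<dots> = m * (m * Q - A\<^sup>2)" by (simp add: power2_eq_square algebra_simps)
  finally have 2: "0 \<le> m * (m * Q - A\<^sup>2)" .
  have "A\<^sup>2 \<le> m * Q"
  proof (cases "m = 0")
    case True
    hence "emeasure M (space M) = 0" by (simp add: m_def emeasure_eq_measure)
    hence "AE x in M. cmod (h x) = 0" by (intro AE_I[of _ _ "space M"]) auto
    hence "A = 0" unfolding A_def by (rule integral_eq_zero_AE)
    thus ?thesis using True by simp
  next
    case False
    with m0 have "m > 0" by simp
    with 2 show ?thesis by (simp add: zero_le_mult_iff)
  qed
  with 1 show ?thesis by (simp add: m_def Q_def)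
qed

lemma circle_kernel_integrable:
  assumes "finite_measure \<nu>" "sets \<nu> = sets borel" "Im z > 0"
  shows "integrable \<nu> (circle_kernel z)"
  by (rule finite_measure.integrable_const_bound[OF assms(1), where B = "hsize z"])
     (use assms in \<open>auto intro!: AE_I2 norm_circle_kernel_le circle_kernel_borel simp: measurable_cong_sets[OF assms(2) refl]\<close>)

lemma kernel_den_borel [measurable]: "kernel_den z \<in> borel_measurable borel"
  unfolding kernel_den_def[abs_def] by measurable

lemma inverse_kernel_den_integrable:
  assumes "finite_measure \<nu>" "sets \<nu> = sets borel" "Im z > 0"
  shows "integrable \<nu> (\<lambda>u. 1 / (cmod (kernel_den z u))\<^sup>2)"
  by (rule finite_measure.integrable_const_bound[OF assms(1), where B = "hsize z / Im z"])
     (use assms in \<open>auto intro!: AE_I2 inverse_kernel_den_le(1)[unfolded power2_eq_square] simp: measurable_cong_sets[OF assms(2) refl] power2_eq_square\<close>)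

lemma Im_circle_integral:
  assumes "finite_measure \<nu>" "sets \<nu> = sets borel" "Im z > 0"
  shows "Im (LINT u|\<nu>. circle_kernel z u) = Im z * (LINT u|\<nu>. 1 / (cmod (kernel_den z u))\<^sup>2)"
proof -
  have "Im (LINT u|\<nu>. circle_kernel z u) = (LINT u|\<nu>. Im (circle_kernel z u))"
    by (rule integral_Im[symmetric, OF circle_kernel_integrable[OF assms]])
  also have "\<dots> = (LINT u|\<nu>. Im z * (1 / (cmod (kernel_den z u))\<^sup>2))"
    by (simp add: Im_circle_kernel[OF assms(3)])
  also have "\<dots> = Im z * (LINT u|\<nu>. 1 / (cmod (kernel_den z u))\<^sup>2)"
    by (rule Bochner_Integration.integral_mult_right) (rule inverse_kernel_den_integrable[OF assms])
  finally show ?thesis .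
qed

text \<open>A Schwarz-Pick estimate: the hyperbolic distance of F w from \<i> exceeds that of w by no more than
  an amount controlled by F \<i>. The factor tends to one as F \<i> tends to \<i>, which matters
  because the estimate is iterated over arbitrarily many small steps. Let q be the kernel integral of
  F - id at w, J the integral of 1 / |kernel_den w u|^2, and m the mass. Then Im (w + q) = Im w * (1 +
  J) and 1 + |w + q|^2 \<le> (1 + |w|^2) * (1 + J) * (1 + m), and the factor 1 + J cancels in hsize.\<close>
lemma hsize_image_le:
  assumes hol: "F holomorphic_on upper_half_plane" and ge: "\<And>z. Im z > 0 \<Longrightarrow> Im z \<le> Im (F z)"
    and w: "Im w > 0"
  shows "hsize (F w) \<le> (1 + \<bar>Re (F \<i>)\<bar>)\<^sup>2 * Im (F \<i>) * hsize w"
proof -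
  have h1: "(\<lambda>z. F z - z) holomorphic_on upper_half_plane" by (intro holomorphic_intros hol)
  have h2: "Im (F z - z) \<ge> 0" if "Im z > 0" for z using ge[OF that] by simp
  obtain \<nu> where \<nu>': "sets \<nu> = sets borel" "finite_measure \<nu>" "emeasure \<nu> (- {0..1}) = 0"
    and mass: "measure \<nu> UNIV = Im (F \<i> - \<i>)"
    and rep: "\<And>z. Im z > 0 \<Longrightarrow> F z - z = of_real (Re (F \<i> - \<i>)) + (LINT u|\<nu>. circle_kernel z u)"
    using Nevanlinna_circle[OF h1 h2] by blast
  note \<nu> = \<nu>'(2,1)
  define a where "a = Re (F \<i>)"
  define m where "m = measure \<nu> UNIV"
  have sp: "space \<nu> = UNIV" using sets_eq_imp_space_eq[OF \<nu>(2)] by simp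
  interpret \<nu>: finite_measure \<nu> by (rule \<nu>)
  define q where "q = (LINT u|\<nu>. circle_kernel w u)"
  define jj where "jj u = 1 / (cmod (kernel_den w u))\<^sup>2" for u
  define J where "J = integral\<^sup>L \<nu> jj"
  define N where "N = (cmod w)\<^sup>2"
  have qint: "integrable \<nu> (circle_kernel w)" by (rule circle_kernel_integrable[OF \<nu> w])
  have Jint: "integrable \<nu> jj" unfolding jj_def[abs_def] by (rule inverse_kernel_den_integrable[OF \<nu> w])
  have m0: "m \<ge> 0" by (simp add: m_def)
  have J0: "J \<ge> 0" unfolding J_def jj_def by (intro integral_nonneg_AE) auto
  have N0: "N \<ge> 0" by (simp add: N_def)
  have Imq: "Im q = Im w * J" unfolding q_def J_def jj_def by (rule Im_circle_integral[OF \<nu> w])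
  have "(LINT u|\<nu>. (cmod (circle_kernel w u))\<^sup>2) = (LINT u|\<nu>. (1 + N) * jj u - 1)"
    by (simp add: norm_circle_kernel_sq[OF w] N_def jj_def)
  also have "\<dots> = (1 + N) * J - m" using Jint by (simp add: J_def m_def sp)
  finally have q2: "(cmod q)\<^sup>2 \<le> m * ((1 + N) * J - m)"
    using finite_measure_norm_integral_sq_le[OF \<nu>(1) qint norm_circle_kernel_le[OF w]] by (simp add: q_def m_def sp)
  have "2 * Re (cnj w * q) = (LINT u|\<nu>. 2 * Re (cnj w * circle_kernel w u))"
  proof -
    have "cnj w * q = (LINT u|\<nu>. cnj w * circle_kernel w u)" unfolding q_def using qint by simp
    moreover have "Re (LINT u|\<nu>. cnj w * circle_kernel w u) = (LINT u|\<nu>. Re (cnj w * circle_kernel w u))"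
      by (rule integral_Re[symmetric]) (use qint in simp)
    ultimately show ?thesis by (simp only: integral_mult_right_zero)
  qed
  also have "\<dots> \<le> (LINT u|\<nu>. (1 + N) * jj u + (1 + N))"
    by (rule integral_mono) (use Jint qint Re_circle_kernel_bound[OF w, folded jj_def] in \<open>auto simp: N_def\<close>)
  also have "\<dots> = (1 + N) * J + (1 + N) * m" using Jint by (simp add: J_def m_def sp)
  finally have cross: "2 * Re (cnj w * q) \<le> (1 + N) * J + (1 + N) * m" .
  have "(cmod (w + q))\<^sup>2 = N + 2 * Re (cnj w * q) + (cmod q)\<^sup>2"
    unfolding N_def cmod_power2 by (simp add: power2_eq_square algebra_simps)
  hence "1 + (cmod (w + q))\<^sup>2 \<le> 1 + N + ((1 + N) * J + (1 + N) * m) + m * ((1 + N) * J - m)"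
    using cross q2 by linarith
  also have "\<dots> = (1 + N) * (1 + J) * (1 + m) - m * m" by (simp add: algebra_simps)
  also have "\<dots> \<le> (1 + N) * (1 + J) * (1 + m)" by simp
  finally have n1: "1 + (cmod (w + q))\<^sup>2 \<le> (1 + N) * (1 + J) * (1 + m)" .
  have Fw: "F w = w + q + of_real a" using rep[OF w] by (simp add: q_def a_def algebra_simps)
  have ImF: "Im (F w) = Im w * (1 + J)" by (simp add: Fw Imq algebra_simps)
  define r where "r = cmod (w + q)"
  have "cmod (F w) \<le> r + \<bar>a\<bar>" unfolding Fw r_def by (rule order_trans[OF norm_triangle_ineq]) simp
  hence "(cmod (F w))\<^sup>2 \<le> (r + \<bar>a\<bar>)\<^sup>2" by (intro power_mono) auto
  also have "\<dots> = r\<^sup>2 + 2 * r * \<bar>a\<bar> + \<bar>a\<bar>\<^sup>2" by (simp add: power2_eq_square algebra_simps)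
  also have "\<dots> \<le> r\<^sup>2 + (1 + r\<^sup>2) * \<bar>a\<bar> * 2 + \<bar>a\<bar>\<^sup>2 + \<bar>a\<bar>\<^sup>2 * r\<^sup>2"
  proof -
    have "2 * r \<le> 1 + r\<^sup>2" using zero_le_power2[of "r - 1"] by (simp add: power2_eq_square algebra_simps)
    hence "r \<le> 1 + r\<^sup>2" by (smt (verit) zero_le_power2)
    hence "r * \<bar>a\<bar> \<le> (1 + r\<^sup>2) * \<bar>a\<bar>" by (rule mult_right_mono) simp
    moreover have "0 \<le> \<bar>a\<bar>\<^sup>2 * r\<^sup>2" by simp
    ultimately show ?thesis by linarith
  qed
  finally have "1 + (cmod (F w))\<^sup>2 \<le> (1 + \<bar>a\<bar>)\<^sup>2 * (1 + r\<^sup>2)" by (simp add: power2_eq_square algebra_simps)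
  also have "\<dots> \<le> (1 + \<bar>a\<bar>)\<^sup>2 * ((1 + N) * (1 + J) * (1 + m))" using n1 by (intro mult_left_mono) (auto simp: r_def)
  finally have "hsize (F w) \<le> ((1 + \<bar>a\<bar>)\<^sup>2 * ((1 + N) * (1 + J) * (1 + m))) / (Im w * (1 + J))"
    unfolding hsize_def ImF by (rule divide_right_mono) (use w J0 in simp)
  also have "\<dots> = (1 + \<bar>a\<bar>)\<^sup>2 * (1 + m) * ((1 + N) / Im w)"
  proof -
    have "1 + J \<noteq> 0" using J0 by simp
    moreover have "(A * (B * K * C)) / (v * K) = A * C * (B / v)" if "K \<noteq> 0" for A B C K v :: real
      using that by simp
    ultimately show ?thesis by blast
  qed
  finally show ?thesis by (simp add: hsize_def N_def a_def m_def mass)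
qed

text \<open>The function -1/F has a Nevanlinna representation. Its imaginary part on the imaginary axis shows
  that the integrals of an increasing sequence of functions with limit 1/sin^2(\<pi> u) = 1 + x^2
  converge to one. So the representing measure \<nu> has no mass at infinity, and (1 + x^2) \<nu> is a
  probability measure on the line. As (1 + xz)/(x - z) = -x - (1 + x^2)/(z - x), its Cauchy transform
  differs from 1/F by a real constant, which vanishes because both functions decay along the imaginary
  axis.\<close>
theorem class_P_criterion:
  assumes hol: "F holomorphic_on upper_half_plane" and self: "\<And>z. Im z > 0 \<Longrightarrow> Im (F z) > 0"
    and asymp: "(\<lambda>n. F (\<i> * of_nat (Suc n)) / (\<i> * of_nat (Suc n))) \<longlonglongrightarrow> 1"
  shows "F \<in> class_P"
proof -
  have F0: "F z \<noteq> 0" if "Im z > 0" for z using self[OF that] by auto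
  have h1: "(\<lambda>z. - (1 / F z)) holomorphic_on upper_half_plane" by (intro holomorphic_intros hol) (use F0 in auto)
  have h2: "Im (- (1 / F z)) \<ge> 0" if "Im z > 0" for z
    using self[OF that] by (simp add: Im_divide)
  obtain \<nu> where \<nu>': "sets \<nu> = sets borel" "finite_measure \<nu>" and supp: "emeasure \<nu> (- {0..1}) = 0"
    and "measure \<nu> UNIV = Im (- (1 / F \<i>))"
    and rep0: "\<And>z. Im z > 0 \<Longrightarrow> - (1 / F z) = of_real (Re (- (1 / F \<i>))) + (LINT u|\<nu>. circle_kernel z u)"
    using Nevanlinna_circle[OF h1 h2] by blast
  note \<nu> = \<nu>'(2,1)
  define a where "a = Re (- (1 / F \<i>))"
  note rep = rep0[folded a_def]
  have sp: "space \<nu> = UNIV" using sets_eq_imp_space_eq[OF \<nu>(2)] by simp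
  interpret \<nu>: finite_measure \<nu> by (rule \<nu>)
  note \<nu>(2)[measurable_cong]
  define zn where "zn n = \<i> * complex_of_real (real (Suc n))" for n
  have Imzn: "Im (zn n) = real (Suc n)" for n by (simp add: zn_def)
  have Imzn0: "Im (zn n) > 0" for n unfolding Imzn by simp
  \<comment> \<open>in terms of x = - cot (pi u) this is 1 / (1 + x^2); its zeros are the points that stand
       for infinity\<close>
  define S where "S u = (sin (pi * u))\<^sup>2" for u :: real
  define k where "k n u = (real (Suc n))\<^sup>2 * (1 / (cmod (kernel_den (zn n) u))\<^sup>2)" for n u
  have kden: "(cmod (kernel_den (zn n) u))\<^sup>2 = 1 - S u + (real (Suc n))\<^sup>2 * S u" for n u
    unfolding kernel_den_norm_sq Imzn by (simp add: zn_def S_def power_mult_distrib cos_squared_eq)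
  have kden_pos: "1 - S u + (real (Suc n))\<^sup>2 * S u > 0" for n u
    using kernel_den_nz[OF Imzn0, of n u] unfolding kden[symmetric] by simp
  have S01: "0 \<le> S u" "S u \<le> 1" for u unfolding S_def by (auto simp: abs_square_le_1)
  have kint: "integrable \<nu> (k n)" for n
    unfolding k_def by (rule integrable_mult_right) (rule inverse_kernel_den_integrable[OF \<nu> Imzn0])
  have kmono: "k n u \<le> k (Suc n) u" for n u
  proof -
    define x y where "x = (real (Suc n))\<^sup>2" "y = (real (Suc (Suc n)))\<^sup>2"
    have xy: "x \<le> y" unfolding x_y_def by (intro power_mono) auto
    have "x * (1 - S u + y * S u) \<le> y * (1 - S u + x * S u)"
      using mult_right_mono[OF xy, of "1 - S u"] S01[of u] by (simp add: algebra_simps)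
    thus ?thesis unfolding k_def kden using kden_pos[of u n] kden_pos[of u "Suc n"]
      unfolding x_y_def[symmetric] by (simp add: divide_simps mult.commute)
  qed
  have kInt: "(\<lambda>n. integral\<^sup>L \<nu> (k n)) \<longlonglongrightarrow> 1"
  proof -
    have "integral\<^sup>L \<nu> (k n) = Re (1 / (F (\<i> * of_nat (Suc n)) / (\<i> * of_nat (Suc n))))" for n
    proof -
      have "integral\<^sup>L \<nu> (k n) = real (Suc n) * (Im (zn n) * (LINT u|\<nu>. 1 / (cmod (kernel_den (zn n) u))\<^sup>2))"
        unfolding k_def Imzn 
        by (subst Bochner_Integration.integral_mult_right[OF inverse_kernel_den_integrable[OF \<nu> Imzn0]]) 
           (simp add: power2_eq_square mult.assoc del: of_nat_Suc)
      also have "\<dots> = real (Suc n) * Im (- (1 / F (zn n)))"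
        unfolding rep[OF Imzn0] Im_circle_integral[OF \<nu> Imzn0, symmetric] by simp
      also have "\<dots> = Re (zn n * (1 / F (zn n)))" unfolding zn_def by (simp del: of_nat_Suc times_divide_eq_right times_divide_eq_left)
      finally show ?thesis by (simp add: zn_def)
    qed
    moreover have "(\<lambda>n. Re (1 / (F (\<i> * of_nat (Suc n)) / (\<i> * of_nat (Suc n))))) \<longlonglongrightarrow> Re (1 / 1)"
      by (intro tendsto_intros asymp) auto
    ultimately show ?thesis by simp
  qed
  have k0: "k n u \<ge> 0" for n u by (simp add: k_def)
  \<comment> \<open>at the points at infinity k n is the square of n + 1, so that any mass there would make
       the integrals unbounded\<close>
  have zero: "emeasure \<nu> {u. S u = 0} = 0"
  proof -
    have mS [measurable]: "{u. S u = 0} \<in> sets \<nu>" unfolding S_def by measurable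
    have bd: "(real (Suc n))\<^sup>2 * measure \<nu> {u. S u = 0} \<le> 2" if n: "integral\<^sup>L \<nu> (k n) < 2" for n
    proof -
      have "(real (Suc n))\<^sup>2 * measure \<nu> {u. S u = 0} = (LINT u|\<nu>. (real (Suc n))\<^sup>2 * indicator {u. S u = 0} u)"
        by (simp add: \<nu>.emeasure_eq_measure)
      also have "\<dots> \<le> integral\<^sup>L \<nu> (k n)"
      proof (rule integral_mono[OF _ kint])
        fix u show "(real (Suc n))\<^sup>2 * indicator {u. S u = 0} u \<le> k n u"
          using k0[of n u] unfolding k_def kden by (auto simp: indicator_def)
      qed (simp add: \<nu>.emeasure_eq_measure)
      finally show ?thesis using n by simp
    qed
    have "\<forall>\<^sub>F n in sequentially. integral\<^sup>L \<nu> (k n) < 2" using order_tendstoD(2)[OF kInt] by simp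
    hence "\<forall>\<^sub>F n in sequentially. measure \<nu> {u. S u = 0} \<le> 2 * (inverse (real (Suc n)))\<^sup>2"
    proof (eventually_elim)
      case (elim n)
      note bd[OF elim]
      thus ?case by (simp add: field_simps)
    qed
    moreover have "(\<lambda>n. 2 * (inverse (real (Suc n)))\<^sup>2) \<longlonglongrightarrow> 2 * 0\<^sup>2" by (intro tendsto_intros LIMSEQ_inverse_real_of_nat)
    ultimately have "measure \<nu> {u. S u = 0} \<le> 2 * 0\<^sup>2" by (intro tendsto_lowerbound[of _ _ sequentially]) auto
    thus ?thesis by (simp add: \<nu>.emeasure_eq_measure measure_le_0_iff)
  qed
  have AES: "AE u in \<nu>. S u \<noteq> 0 \<and> 0 < u \<and> u < 1"
  proof -
    have "AE u in \<nu>. u \<in> {0..1}" using supp by (intro AE_I[of _ _ "- {0..1}"]) (auto simp: \<nu>)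
    moreover have "AE u in \<nu>. S u \<noteq> 0" using zero by (intro AE_I[of _ _ "{u. S u = 0}"]) (auto simp: S_def)
    ultimately show ?thesis
    proof eventually_elim
      case (elim u)
      hence "u \<noteq> 0" "u \<noteq> 1" by (auto simp: S_def)
      with elim show ?case by (auto simp: order_less_le)
    qed
  qed
  have hb: "has_bochner_integral \<nu> (\<lambda>u. 1 / S u) 1"
  proof (rule has_bochner_integral_monotone_convergence[where f = k])
    show "AE u in \<nu>. (\<lambda>n. k n u) \<longlonglongrightarrow> 1 / S u"
      using AES
    proof eventually_elim
      case (elim u)
      have "(\<lambda>n. 1 / ((1 - S u) * (inverse (real (Suc n)))\<^sup>2 + S u)) \<longlonglongrightarrow> 1 / ((1 - S u) * 0\<^sup>2 + S u)"
        by (intro tendsto_intros LIMSEQ_inverse_real_of_nat) (use elim in auto)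
      moreover have "k n u = 1 / ((1 - S u) * (inverse (real (Suc n)))\<^sup>2 + S u)" for n
      proof -
        define x where "x = (real (Suc n))\<^sup>2"
        have "x > 0" by (simp add: x_def)
        have i: "(inverse (real (Suc n)))\<^sup>2 = 1 / x" by (simp add: x_def inverse_eq_divide power_one_over)
        have "(1 - S u) * (1 / x) + S u = (1 - S u + x * S u) / x" using \<open>x > 0\<close> by (simp add: field_simps)
        thus ?thesis unfolding k_def kden i x_def[symmetric] using \<open>x > 0\<close> by simp
      qed
      ultimately show ?case by simp
    qed
    show "AE u in \<nu>. incseq (\<lambda>n. k n u)" by (intro AE_I2 incseq_SucI kmono)
    show "(\<lambda>u. 1 / S u) \<in> borel_measurable \<nu>" unfolding S_def by measurable
  qed (use kint kInt k0 in auto)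
  define \<mu> where "\<mu> = distr (density \<nu> (\<lambda>u. ennreal (1 / S u))) borel (\<lambda>u. - cot (pi * u))"
  have cotm [measurable]: "(\<lambda>u. - cot (pi * u)) \<in> borel_measurable borel" unfolding cot_def by measurable
  have cot2 [measurable]: "(\<lambda>u::real. cot (pi * u)) \<in> borel_measurable borel" unfolding cot_def by measurable
  have Sm [measurable]: "S \<in> borel_measurable borel" unfolding S_def[abs_def] by measurable
  have cm: "(\<lambda>u. - cot (pi * u)) \<in> borel_measurable (density \<nu> (\<lambda>u. ennreal (1 / S u)))"
    using cotm measurable_cong_sets[of "density \<nu> (\<lambda>u. ennreal (1 / S u))" borel borel borel] \<nu>(2) by simp
  have \<mu>prob: "prob_space \<mu>"
  proof
    have "emeasure \<mu> (space \<mu>) = (\<integral>\<^sup>+u. ennreal (1 / S u) \<partial>\<nu>)"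
      unfolding \<mu>_def using emeasure_distr[OF cm, of UNIV] by (simp add: sp) (simp add: emeasure_density sp)
    also have "\<dots> = ennreal 1"
      using nn_integral_eq_integral[of \<nu> "\<lambda>u. 1 / S u"] hb S01 by (auto simp: has_bochner_integral_iff)
    finally show "emeasure \<mu> (space \<mu>) = 1" by simp
  qed
  hence \<mu>: "real_distribution \<mu>" by (intro real_distribution.intro real_distribution_axioms.intro) (auto simp: \<mu>_def)
  have cauchy: "cauchy_transform \<mu> z = (LINT u|\<nu>. (1 / S u) *\<^sub>R (1 / (z - of_real (- cot (pi * u)))))" for z
  proof -
    have gm: "(\<lambda>u. 1 / (z - complex_of_real (- cot (pi * u)))) \<in> borel_measurable \<nu>" by measurable
    show ?thesis unfolding cauchy_transform_def \<mu>_def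
      by (subst integral_distr[OF cm], measurable) (subst integral_density[OF gm], auto simp: S01)
  qed
  have Sint: "integrable \<nu> (\<lambda>u. 1 / S u)" using hb by (simp add: has_bochner_integral_iff)
  have cotint: "integrable \<nu> (\<lambda>u. cot (pi * u))"
  proof (rule Bochner_Integration.integrable_bound[OF Sint])
    show "AE u in \<nu>. norm (cot (pi * u)) \<le> norm (1 / S u)"
    proof (rule AE_I2)
      fix u
      show "norm (cot (pi * u)) \<le> norm (1 / S u)"
      proof (cases "S u = 0")
        case True thus ?thesis by (simp add: S_def cot_def)
      next
        case False
        hence s: "sin (pi * u) \<noteq> 0" by (simp add: S_def)
        have "\<bar>cos (pi * u) * sin (pi * u)\<bar> \<le> 1" unfolding abs_mult by (intro mult_le_one) auto
        hence "\<bar>cos (pi * u) * sin (pi * u)\<bar> / S u \<le> 1 / S u" by (rule divide_right_mono) (rule S01)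
        moreover have "cot (pi * u) = (cos (pi * u) * sin (pi * u)) / S u"
          using s by (simp add: cot_def S_def power2_eq_square)
        ultimately show ?thesis using S01[of u] by simp
      qed
    qed
  qed (use cotm in simp)
  define a' where "a' = a + (LINT u|\<nu>. cot (pi * u))"
  have key: "- (1 / F z) = of_real a' - cauchy_transform \<mu> z" if z: "Im z > 0" for z
  proof -
    note circle_kernel_borel[OF z, measurable]
    have "AE u in \<nu>. circle_kernel z u = of_real (cot (pi * u)) - (1 / S u) *\<^sub>R (1 / (z - of_real (- cot (pi * u))))"
      using AES
    proof eventually_elim
      case (elim u)
      define x where "x = - cot (pi * u)"
      have s: "sin (pi * u) \<noteq> 0" using elim by (auto simp: S_def)
      have "1 + x\<^sup>2 = ((sin (pi * u))\<^sup>2 + (cos (pi * u))\<^sup>2) / (sin (pi * u))\<^sup>2"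
        using s unfolding x_def cot_def by (simp add: field_simps)
      hence S: "1 / S u = 1 + x\<^sup>2" by (simp add: S_def)
      have nz: "z - of_real x \<noteq> 0" by (rule uhp_minus_real_nz[OF z])
      hence nz': "of_real x - z \<noteq> 0" by auto
      have "circle_kernel z u = pick_kernel z x" using elim by (simp add: x_def circle_kernel_eq_pick)
      also have "\<dots> = - of_real x - of_real (1 + x\<^sup>2) * (1 / (z - of_real x))"
        unfolding pick_kernel_def using nz nz' by (simp add: field_simps power2_eq_square)
      finally show ?case unfolding S x_def[symmetric] by (simp add: x_def scaleR_conv_of_real)
    qed
    hence "(LINT u|\<nu>. circle_kernel z u) = (LINT u|\<nu>. of_real (cot (pi * u)) - (1 / S u) *\<^sub>R (1 / (z - of_real (- cot (pi * u)))))"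
      by (intro integral_cong_AE; measurable)
    also have "\<dots> = (LINT u|\<nu>. complex_of_real (cot (pi * u))) - cauchy_transform \<mu> z"
      unfolding cauchy
    proof (rule Bochner_Integration.integral_diff)
      show "integrable \<nu> (\<lambda>u. (1 / S u) *\<^sub>R (1 / (z - of_real (- cot (pi * u)))))"
      proof (rule Bochner_Integration.integrable_bound[where f = "\<lambda>u. (1 / Im z) * (1 / S u)"])
        show "AE u in \<nu>. norm ((1 / S u) *\<^sub>R (1 / (z - of_real (- cot (pi * u))))) \<le> norm ((1 / Im z) * (1 / S u))"
        proof (rule AE_I2)
          fix u
          have "cmod (1 / (z - of_real (- cot (pi * u)))) \<le> 1 / Im z"
            using norm_uhp_minus_real_ge[OF z, of "- cot (pi * u)"] z
            by (simp only: norm_divide norm_one) (intro divide_left_mono mult_pos_pos, auto intro: order_less_le_trans)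
          from mult_left_mono[OF this, of "1 / S u"] 
          show "norm ((1 / S u) *\<^sub>R (1 / (z - of_real (- cot (pi * u))))) \<le> norm ((1 / Im z) * (1 / S u))"
            using S01[of u] z by (simp add: mult.commute)
        qed
        show "integrable \<nu> (\<lambda>u. (1 / Im z) * (1 / S u))" by (rule integrable_mult_right[OF Sint])
      qed measurable
    qed (use cotint in simp)
    finally show ?thesis using rep[OF z] cotint by (simp add: a'_def)
  qed
  have "a' = 0"
  proof -
    have "(\<lambda>n. - ((1 / (F (\<i> * of_nat (Suc n)) / (\<i> * of_nat (Suc n)))) * (1 / \<i>) * complex_of_real (inverse (real (Suc n))))
          + ((\<i> * of_nat (Suc n)) * cauchy_transform \<mu> (\<i> * of_nat (Suc n))) * (1 / \<i>) * complex_of_real (inverse (real (Suc n))))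
       \<longlonglongrightarrow> - ((1 / 1) * (1 / \<i>) * complex_of_real 0) + 1 * (1 / \<i>) * complex_of_real 0"
      by (intro tendsto_intros asymp cauchy_transform_asymp \<mu> LIMSEQ_inverse_real_of_nat) auto
    moreover have "- ((1 / (F (\<i> * of_nat (Suc n)) / (\<i> * of_nat (Suc n)))) * (1 / \<i>) * complex_of_real (inverse (real (Suc n))))
          + ((\<i> * of_nat (Suc n)) * cauchy_transform \<mu> (\<i> * of_nat (Suc n))) * (1 / \<i>) * complex_of_real (inverse (real (Suc n))) = of_real a'" for n
    proof -
      have n0: "(of_nat (Suc n) :: complex) \<noteq> 0" using of_nat_neq_0 by blast
      have c: "complex_of_real (inverse (real (Suc n))) = inverse (of_nat (Suc n))" by simp
      have z: "Im (\<i> * of_nat (Suc n)) > 0" by simp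
      have "- ((1 / (F (\<i> * of_nat (Suc n)) / (\<i> * of_nat (Suc n)))) * (1 / \<i>) * inverse (of_nat (Suc n)))
          + ((\<i> * of_nat (Suc n)) * cauchy_transform \<mu> (\<i> * of_nat (Suc n))) * (1 / \<i>) * inverse (of_nat (Suc n))
          = - (1 / F (\<i> * of_nat (Suc n))) + cauchy_transform \<mu> (\<i> * of_nat (Suc n))"
      proof -
        have c: "(\<i> * N) * C * (1 / \<i>) * inverse N = C" if "N \<noteq> 0" for N C :: complex
        proof -
          have "(\<i> * N) * C * (1 / \<i>) * inverse N = (\<i> * (1 / \<i>)) * (N * inverse N) * C" by (simp only: mult_ac)
          thus ?thesis using that by simp
        qed
        have "1 / (f / (\<i> * N)) = (\<i> * N) * (1 / f)" for f N :: complex by simp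
        thus ?thesis by (simp only: c[OF n0])
      qed
      also have "\<dots> = of_real a'" unfolding key[OF z] by simp
      finally show ?thesis unfolding c .
    qed
    ultimately have "(\<lambda>n::nat. complex_of_real a') \<longlonglongrightarrow> 0" by simp
    thus "a' = 0" by (simp add: LIMSEQ_const_iff)
  qed
  hence "F z = 1 / cauchy_transform \<mu> z" if "Im z > 0" for z
  proof -
    have "F z * cauchy_transform \<mu> z = 1" using key[OF that] F0[OF that] \<open>a' = 0\<close> by (simp add: field_simps)
    thus ?thesis by (metis nonzero_eq_divide_eq mult_zero_right zero_neq_one)
  qed
  thus ?thesis using \<mu> by (auto simp: class_P_def reciprocal_cauchy_transform_def)
qed

section \<open>Weak compactness of measures on a rectangle\<close>

definition sum_measure :: "'i set \<Rightarrow> ('i \<Rightarrow> (real \<times> real) measure) \<Rightarrow> (real \<times> real) measure" where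
  "sum_measure J N = measure_of UNIV (sets borel) (\<lambda>A. \<Sum>j\<in>J. emeasure (N j) A)"

lemma sets_sum_measure [simp, measurable_cong]: "sets (sum_measure J N) = sets borel"
  unfolding sum_measure_def by (metis sets.sets_measure_of_eq space_borel)

lemma space_sum_measure [simp]: "space (sum_measure J N) = UNIV"
  using sets_eq_imp_space_eq[OF sets_sum_measure] by simp

lemma emeasure_sum_measure:
  assumes "finite J" "\<And>j. j \<in> J \<Longrightarrow> sets (N j) = sets borel" "A \<in> sets borel"
  shows "emeasure (sum_measure J N) A = (\<Sum>j\<in>J. emeasure (N j) A)"
proof (rule emeasure_measure_of[OF sum_measure_def])
  show "countably_additive (sets (sum_measure J N)) (\<lambda>A. \<Sum>j\<in>J. emeasure (N j) A)"
    unfolding countably_additive_def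
  proof (intro allI impI)
    fix A :: "nat \<Rightarrow> (real \<times> real) set"
    assume A: "range A \<subseteq> sets (sum_measure J N)" "disjoint_family A"
    have "(\<Sum>i. \<Sum>j\<in>J. emeasure (N j) (A i)) = (\<Sum>j\<in>J. \<Sum>i. emeasure (N j) (A i))"
      by (rule suminf_sum) simp
    also have "\<dots> = (\<Sum>j\<in>J. emeasure (N j) (\<Union>i. A i))"
      by (intro sum.cong refl suminf_emeasure) (use A assms(2) in auto)
    finally show "(\<Sum>i. \<Sum>j\<in>J. emeasure (N j) (A i)) = (\<Sum>j\<in>J. emeasure (N j) (\<Union>i. A i))" .
  qed
qed (use assms in \<open>auto simp: positive_def\<close>)

lemma nn_integral_sum_measure:
  assumes J: "finite J" and N: "\<And>j. j \<in> J \<Longrightarrow> sets (N j) = sets borel" and f: "f \<in> borel_measurable borel"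
  shows "(\<integral>\<^sup>+x. f x \<partial>sum_measure J N) = (\<Sum>j\<in>J. \<integral>\<^sup>+x. f x \<partial>N j)"
  using f
proof (induction rule: borel_measurable_induct)
  case (cong f g)
  have "f = g" using cong by auto
  thus ?case using cong by simp
next
  case (set A)
  thus ?case using N by (simp add: nn_integral_indicator emeasure_sum_measure[OF J N])
next
  case (mult u c)
  thus ?case using N by (simp add: nn_integral_cmult sum_distrib_left measurable_cong_sets[OF N refl] measurable_cong_sets[OF sets_sum_measure refl] cong: sum.cong)
next
  case (add u v)
  thus ?case using N by (simp add: nn_integral_add sum.distrib measurable_cong_sets[OF N refl] measurable_cong_sets[OF sets_sum_measure refl] cong: sum.cong)
next
  case (seq U)
  have "(\<integral>\<^sup>+x. (SUP i. U i) x \<partial>sum_measure J N) = (SUP i. \<integral>\<^sup>+x. U i x \<partial>sum_measure J N)"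
    unfolding SUP_apply by (rule nn_integral_monotone_convergence_SUP) (use seq in \<open>auto simp: measurable_cong_sets[OF sets_sum_measure refl]\<close>)
  also have "\<dots> = (SUP i. \<Sum>j\<in>J. \<integral>\<^sup>+x. U i x \<partial>N j)" using seq by simp
  also have "\<dots> = (\<Sum>j\<in>J. SUP i. \<integral>\<^sup>+x. U i x \<partial>N j)"
    by (rule ennreal_SUP_sum) (use seq in \<open>auto simp: incseq_def le_fun_def intro!: nn_integral_mono\<close>)
  also have "\<dots> = (\<Sum>j\<in>J. \<integral>\<^sup>+x. (SUP i. U i) x \<partial>N j)"
    unfolding SUP_apply 
    by (intro sum.cong refl nn_integral_monotone_convergence_SUP[symmetric]) (use seq N in \<open>auto simp: measurable_cong_sets[OF N refl]\<close>)
  finally show ?case .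
qed

lemma finite_measure_sum_measure:
  assumes J: "finite J" and N: "\<And>j. j \<in> J \<Longrightarrow> sets (N j) = sets borel" and fin: "\<And>j. j \<in> J \<Longrightarrow> finite_measure (N j)"
  shows "finite_measure (sum_measure J N)"
proof
  have "emeasure (N j) UNIV \<noteq> \<infinity>" if "j \<in> J" for j
    using finite_measure.emeasure_finite[OF fin[OF that]] by simp
  thus "emeasure (sum_measure J N) (space (sum_measure J N)) \<noteq> \<infinity>"
    using emeasure_sum_measure[OF J N, where A = UNIV] J by simp
qed

lemma integral_sum_measure:
  fixes g :: "real \<times> real \<Rightarrow> complex"
  assumes J: "finite J" and N: "\<And>j. j \<in> J \<Longrightarrow> sets (N j) = sets borel" and fin: "\<And>j. j \<in> J \<Longrightarrow> finite_measure (N j)"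
    and g: "g \<in> borel_measurable borel" and b: "\<And>x. cmod (g x) \<le> B"
  shows "integral\<^sup>L (sum_measure J N) g = (\<Sum>j\<in>J. integral\<^sup>L (N j) g)"
proof -
  let ?M = "sum_measure J N"
  have finM: "finite_measure ?M" by (rule finite_measure_sum_measure[OF J N fin])
  have mJ: "h \<in> borel_measurable (N j)" if "h \<in> borel_measurable borel" "j \<in> J" for h :: "real \<times> real \<Rightarrow> real" and j
    using that by (simp add: measurable_cong_sets[OF N refl])
  have mM: "h \<in> borel_measurable ?M" if "h \<in> borel_measurable borel" for h :: "real \<times> real \<Rightarrow> real"
    using that by (simp add: measurable_cong_sets[OF sets_sum_measure refl])
  have nonneg: "integral\<^sup>L ?M h = (\<Sum>j\<in>J. integral\<^sup>L (N j) h)"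
    if h: "h \<in> borel_measurable borel" "\<And>x. 0 \<le> h x" "\<And>x. h x \<le> K" for h :: "real \<times> real \<Rightarrow> real" and K
  proof -
    have hi: "integrable ?M h" 
      by (rule finite_measure.integrable_const_bound[OF finM AE_I2 mM[OF h(1)], where B = K]) (simp add: h(2,3))
    have hj: "integrable (N j) h" if "j \<in> J" for j
      by (rule finite_measure.integrable_const_bound[OF fin[OF that] AE_I2 mJ[OF h(1) that], where B = K]) (simp add: h(2,3))
    have "ennreal (integral\<^sup>L ?M h) = (\<integral>\<^sup>+x. ennreal (h x) \<partial>?M)"
      by (rule nn_integral_eq_integral[symmetric, OF hi AE_I2[OF h(2)]])
    also have "\<dots> = (\<Sum>j\<in>J. \<integral>\<^sup>+x. ennreal (h x) \<partial>N j)"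
      by (rule nn_integral_sum_measure[OF J N]) (use h in auto)
    also have "\<dots> = (\<Sum>j\<in>J. ennreal (integral\<^sup>L (N j) h))"
      by (intro sum.cong refl nn_integral_eq_integral hj AE_I2 h(2))
    also have "\<dots> = ennreal (\<Sum>j\<in>J. integral\<^sup>L (N j) h)" 
      by (intro sum_ennreal integral_nonneg_AE AE_I2 h(2))
    finally show ?thesis
      by (subst (asm) ennreal_inj; (intro integral_nonneg_AE sum_nonneg AE_I2 h(2))?)
  qed
  have real: "integral\<^sup>L ?M h = (\<Sum>j\<in>J. integral\<^sup>L (N j) h)"
    if h: "h \<in> borel_measurable borel" "\<And>x. \<bar>h x\<bar> \<le> K" for h :: "real \<times> real \<Rightarrow> real" and K
  proof -
    define p q where "p x = max (h x) 0" "q x = max (- h x) 0" for x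
    have pq: "p \<in> borel_measurable borel" "q \<in> borel_measurable borel" unfolding p_q_def[abs_def] using h by auto
    have b: "0 \<le> p x" "0 \<le> q x" "p x \<le> K" "q x \<le> K" for x using h(2)[of x] by (auto simp: p_q_def)
    have hpq: "h = (\<lambda>x. p x - q x)" by (auto simp: p_q_def)
    have i: "integrable R p" "integrable R q" if "finite_measure R" "sets R = sets borel" for R
      by (rule finite_measure.integrable_const_bound[OF that(1) AE_I2, where B = K];
          simp add: b pq measurable_cong_sets[OF that(2) refl])+
    have "integral\<^sup>L ?M h = integral\<^sup>L ?M p - integral\<^sup>L ?M q" 
      unfolding hpq by (rule Bochner_Integration.integral_diff[OF i[OF finM sets_sum_measure]])
    also have "\<dots> = (\<Sum>j\<in>J. integral\<^sup>L (N j) p) - (\<Sum>j\<in>J. integral\<^sup>L (N j) q)"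
      using nonneg[of p K] nonneg[of q K] pq b by simp
    also have "\<dots> = (\<Sum>j\<in>J. integral\<^sup>L (N j) p - integral\<^sup>L (N j) q)" by (simp add: sum_subtractf)
    also have "\<dots> = (\<Sum>j\<in>J. integral\<^sup>L (N j) h)"
      unfolding hpq by (intro sum.cong refl Bochner_Integration.integral_diff[symmetric] i fin N)
    finally show ?thesis .
  qed
  have gi: "integrable R g" if "finite_measure R" "sets R = sets borel" for R
    by (rule finite_measure.integrable_const_bound[OF that(1) AE_I2[OF b]])
       (simp add: g measurable_cong_sets[OF that(2) refl])
  have gM: "integrable ?M g" by (rule gi[OF finM sets_sum_measure])
  have Re: "Re (integral\<^sup>L ?M g) = (\<Sum>j\<in>J. Re (integral\<^sup>L (N j) g))"
  proof -
    have "Re (integral\<^sup>L ?M g) = integral\<^sup>L ?M (\<lambda>x. Re (g x))" by (rule integral_Re[OF gM, symmetric])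
    also have "\<dots> = (\<Sum>j\<in>J. integral\<^sup>L (N j) (\<lambda>x. Re (g x)))"
      by (rule real[of _ B]) (use g in simp, rule order_trans[OF abs_Re_le_cmod b])
    also have "\<dots> = (\<Sum>j\<in>J. Re (integral\<^sup>L (N j) g))" by (intro sum.cong refl integral_Re gi fin N)
    finally show ?thesis .
  qed
  have Im: "Im (integral\<^sup>L ?M g) = (\<Sum>j\<in>J. Im (integral\<^sup>L (N j) g))"
  proof -
    have "Im (integral\<^sup>L ?M g) = integral\<^sup>L ?M (\<lambda>x. Im (g x))" by (rule integral_Im[OF gM, symmetric])
    also have "\<dots> = (\<Sum>j\<in>J. integral\<^sup>L (N j) (\<lambda>x. Im (g x)))"
      by (rule real[of _ B]) (use g in simp, rule order_trans[OF abs_Im_le_cmod b])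
    also have "\<dots> = (\<Sum>j\<in>J. Im (integral\<^sup>L (N j) g))" by (intro sum.cong refl integral_Im gi fin N)
    finally show ?thesis .
  qed
  show ?thesis by (rule complex_eqI) (simp_all add: Re Im)
qed

text \<open>A continuous function of period one that vanishes on [0,1/6] and equals one on [1/2,2/3]. If all
  base-4 digits of c are 0 or 2, then the fractional part of 4^j c lies in one of these two intervals,
  according to digit number j, so that plateau (4^j c) is half of that digit.\<close>
definition plateau :: "real \<Rightarrow> real" where
  "plateau u = max 0 (min 1 (1/2 - cos (2 * pi * u)))"

text \<open>The two components, for k = 0 and k = 1, of Schoenberg's space-filling curve. If c has only the
  base-4 digits 0 and 2, the binary digits of the components are half the digits of c in even,
  respectively odd, positions. Being continuous, the curve transports weak convergence from the line
  to the plane.\<close>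
definition schoenberg :: "nat \<Rightarrow> real \<Rightarrow> real" where
  "schoenberg k c = (\<Sum>n. plateau (4 ^ (2 * n + k) * c) / 2 ^ Suc n)"

text \<open>The number 1 needs a separate clause: its expansion within the unit interval has all digits equal to
  one.\<close>
definition binary_digit :: "nat \<Rightarrow> real \<Rightarrow> real" where
  "binary_digit n x = (if x \<ge> 1 then 1 else of_int (\<lfloor>2 ^ Suc n * x\<rfloor> - 2 * \<lfloor>2 ^ n * x\<rfloor>))"

definition cantor_digit :: "real \<Rightarrow> real \<Rightarrow> nat \<Rightarrow> real" where
  "cantor_digit x y j = (if even j then binary_digit (j div 2) x else binary_digit (j div 2) y)"

text \<open>A Borel measurable right inverse of the curve: the binary digits of the coordinates are interleaved
  as base-4 digits 0 and 2.\<close>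
definition cantor_code :: "real \<Rightarrow> real \<Rightarrow> real" where
  "cantor_code x y = (\<Sum>j. 2 * cantor_digit x y j / 4 ^ Suc j)"

lemma plateau_bounds: "0 \<le> plateau u" "plateau u \<le> 1"
  by (auto simp: plateau_def)

lemma half_power_sums: "(\<lambda>n. (1::real) / 2 ^ Suc n) sums 1"
  using power_half_series by (simp add: power_one_over)

lemma schoenberg_summable: "summable (\<lambda>n. plateau (4 ^ (2 * n + k) * c) / 2 ^ Suc n)"
  by (rule summable_comparison_test[OF _ sums_summable[OF half_power_sums]])
     (auto intro!: exI[of _ 0] divide_right_mono simp: plateau_bounds abs_of_nonneg simp del: power_Suc)

lemma schoenberg_bounds: "0 \<le> schoenberg k c" "schoenberg k c \<le> 1"
proof -
  show "0 \<le> schoenberg k c" unfolding schoenberg_def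
    by (intro suminf_nonneg schoenberg_summable divide_nonneg_nonneg plateau_bounds) simp
  have "schoenberg k c \<le> (\<Sum>n. 1 / 2 ^ Suc n)" unfolding schoenberg_def
    by (intro suminf_le divide_right_mono plateau_bounds schoenberg_summable sums_summable[OF half_power_sums]) simp
  thus "schoenberg k c \<le> 1" using sums_unique[OF half_power_sums] by simp
qed

lemma continuous_schoenberg: "continuous_on UNIV (schoenberg k)"
proof -
  have u: "uniform_limit UNIV (\<lambda>n c. \<Sum>i<n. plateau (4 ^ (2 * i + k) * c) / 2 ^ Suc i) (\<lambda>c. \<Sum>i. plateau (4 ^ (2 * i + k) * c) / 2 ^ Suc i) sequentially"
    by (rule Weierstrass_m_test[OF _ sums_summable[OF half_power_sums]])
       (auto intro!: divide_right_mono simp: plateau_bounds abs_of_nonneg simp del: power_Suc)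
  have "continuous_on UNIV (\<lambda>c. \<Sum>i. plateau (4 ^ (2 * i + k) * c) / 2 ^ Suc i)"
    by (rule uniform_limit_theorem[OF _ u])
       (auto intro!: always_eventually continuous_intros simp: plateau_def)
  thus ?thesis by (simp add: schoenberg_def[abs_def])
qed

lemma binary_digit_01: 
  assumes "0 \<le> x" shows "binary_digit n x \<in> {0, 1}"
proof -
  have "\<lfloor>2 ^ Suc n * x\<rfloor> - 2 * \<lfloor>2 ^ n * x\<rfloor> \<in> {0, 1}"
  proof -
    define y where "y = 2 ^ n * x"
    have y2: "2 ^ Suc n * x = 2 * y" by (simp add: y_def)
    have "\<lfloor>2 * y\<rfloor> - 2 * \<lfloor>y\<rfloor> \<in> {0, 1}" 
      by (simp, linarith)
    thus ?thesis unfolding y2 y_def[symmetric] .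
  qed
  thus ?thesis by (auto simp: binary_digit_def)
qed

lemma binary_digit_sums:
  assumes "0 \<le> x" "x \<le> 1"
  shows "(\<lambda>n. binary_digit n x / 2 ^ Suc n) sums x"
proof (cases "x = 1")
  case True
  thus ?thesis using half_power_sums by (simp add: binary_digit_def)
next
  case False
  with assms have x1: "x < 1" by simp
  have part: "(\<Sum>i<n. binary_digit i x / 2 ^ Suc i) = of_int \<lfloor>2 ^ n * x\<rfloor> / 2 ^ n" for n
  proof (induction n)
    case 0
    have "\<lfloor>x\<rfloor> = 0" using assms x1 by linarith
    thus ?case by simp
  next
    case (Suc n)
    thus ?case using x1 by (simp add: binary_digit_def field_simps)
  qed
  have "(\<lambda>n. of_int \<lfloor>2 ^ n * x\<rfloor> / 2 ^ n) \<longlonglongrightarrow> x"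
  proof (rule tendsto_sandwich[of "\<lambda>n. x - 1 / 2 ^ n" _ _ "\<lambda>n. x"])
    have "x - 1 / 2 ^ n \<le> of_int \<lfloor>2 ^ n * x\<rfloor> / 2 ^ n \<and> of_int \<lfloor>2 ^ n * x\<rfloor> / 2 ^ n \<le> x" for n
    proof -
      have "2 ^ n * x - 1 \<le> of_int \<lfloor>2 ^ n * x\<rfloor>" "of_int \<lfloor>2 ^ n * x\<rfloor> \<le> 2 ^ n * x" by linarith+
      from this[THEN divide_right_mono, of "2 ^ n"] show ?thesis by (simp add: diff_divide_distrib)
    qed
    thus "\<forall>\<^sub>F n in sequentially. x - 1 / 2 ^ n \<le> of_int \<lfloor>2 ^ n * x\<rfloor> / 2 ^ n"
      "\<forall>\<^sub>F n in sequentially. of_int \<lfloor>2 ^ n * x\<rfloor> / 2 ^ n \<le> x" by auto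
    have "(\<lambda>n. x - (1 / 2) ^ n) \<longlonglongrightarrow> x - 0" by (intro tendsto_intros) simp
    thus "(\<lambda>n. x - 1 / 2 ^ n) \<longlonglongrightarrow> x" by (simp add: power_one_over)
  qed auto
  thus ?thesis unfolding sums_def part .
qed

lemma quarter_sums: "(\<lambda>n. (2::real) / 4 ^ Suc n) sums (2/3)"
proof -
  have "(\<lambda>n. (1/2) * (1/4::real) ^ n) sums ((1/2) * (1 / (1 - 1/4)))" by (intro sums_mult geometric_sums) simp
  moreover have "(1/2) * (1/4::real) ^ n = 2 / 4 ^ Suc n" for n by (simp add: power_one_over)
  moreover have "(1/2) * (1 / (1 - 1/4)) = (2/3 :: real)" by simp
  ultimately show ?thesis by (simp only:)
qed

text \<open>Multiplication by 4^k shifts the expansion, and a periodic function ignores the integer part.\<close>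
lemma plateau_cantor:
  fixes d :: "nat \<Rightarrow> real"
  assumes d: "\<And>j. d j \<in> {0, 1}"
  shows "plateau (4 ^ k * (\<Sum>j. 2 * d j / 4 ^ Suc j)) = d k"
proof -
  note geo = quarter_sums
  have db: "0 \<le> d j" "d j \<le> 1" for j using d[of j] by auto
  have sumd: "summable (\<lambda>j. 2 * d (j + m) / 4 ^ Suc j)" for m
    by (rule summable_comparison_test[OF _ sums_summable[OF geo]])
       (auto intro!: exI[of _ 0] divide_right_mono simp: db simp del: power_Suc)
  define tail where "tail m = (\<Sum>j. 2 * d (j + m) / 4 ^ Suc j)" for m
  have tail_b: "0 \<le> tail m" "tail m \<le> 2/3" for m
  proof -
    show "0 \<le> tail m" unfolding tail_def by (intro suminf_nonneg sumd divide_nonneg_nonneg) (auto simp: db)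
    have "tail m \<le> (\<Sum>j. 2 / 4 ^ Suc j)" unfolding tail_def
      by (intro suminf_le divide_right_mono sumd sums_summable[OF geo]) (auto simp: db)
    thus "tail m \<le> 2/3" using sums_unique[OF geo] by simp
  qed
  have step: "4 * tail m = tail (Suc m) + 2 * d m" for m
  proof -
    have "tail m = (\<Sum>j. 2 * d (Suc j + m) / 4 ^ Suc (Suc j)) + 2 * d m / 4"
      unfolding tail_def using suminf_split_initial_segment[OF sumd[of m], of 1] by simp
    also have "(\<Sum>j. 2 * d (Suc j + m) / 4 ^ Suc (Suc j)) = (\<Sum>j. (1/4) * (2 * d (j + Suc m) / 4 ^ Suc j))"
      by (intro suminf_cong) simp
    also have "\<dots> = (1/4) * tail (Suc m)" unfolding tail_def by (rule suminf_mult[OF sumd])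
    finally show ?thesis by simp
  qed
  have "\<exists>i::int. 4 ^ k * tail 0 = tail k + of_int i"
  proof (induction k)
    case 0 show ?case by (rule exI[of _ 0]) simp
  next
    case (Suc k)
    then obtain i :: int where i: "4 ^ k * tail 0 = tail k + of_int i" by blast
    obtain e :: int where e: "d k = of_int e" using d[of k] by (metis insertE of_int_0 of_int_1 singletonD)
    have "4 ^ Suc k * tail 0 = 4 * (tail k + of_int i)" using i by simp
    also have "\<dots> = tail (Suc k) + of_int (2 * e + 4 * i)" using step[of k] e by simp
    finally show ?case by blast
  qed
  then obtain i :: int where "4 ^ k * tail 0 = tail k + of_int i" by blast
  hence "cos (2 * pi * (4 ^ k * tail 0)) = cos (2 * pi * tail k + 2 * pi * of_int i)"
    by (simp add: algebra_simps)
  also have "\<dots> = cos (2 * pi * tail k)" 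
    by (simp add: cos_add sin_times_pi_eq_0 cos_int_2pin sin_int_2pin)
  finally have c: "plateau (4 ^ k * tail 0) = plateau (tail k)" by (simp add: plateau_def)
  define \<rho> where "\<rho> = tail (Suc k) / 4"
  have \<rho>: "0 \<le> \<rho>" "\<rho> \<le> 1/6" using tail_b[of "Suc k"] by (auto simp: \<rho>_def)
  have tk: "tail k = \<rho> + d k / 2" using step[of k] by (simp add: \<rho>_def)
  have cos: "cos (2 * pi * \<rho>) \<ge> 1/2"
  proof -
    have "2 * pi * \<rho> \<le> 2 * pi * (1/6)" by (intro mult_left_mono \<rho>) simp
    hence "cos (2 * pi * \<rho>) \<ge> cos (pi / 3)" using \<rho> by (intro cos_monotone_0_pi_le) auto
    thus ?thesis by (simp add: cos_60)
  qed
  have "plateau (tail k) = d k"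
  proof (cases "d k = 0")
    case True
    thus ?thesis using cos by (simp add: plateau_def tk)
  next
    case False
    hence "d k = 1" using d[of k] by auto
    moreover have "cos (2 * pi * (\<rho> + 1 / 2)) = - cos (2 * pi * \<rho>)" by (simp add: distrib_left)
    ultimately show ?thesis using cos by (simp add: plateau_def tk)
  qed
  with c show ?thesis by (simp add: tail_def)
qed

lemma schoenberg_cantor_code:
  assumes "x \<in> {0..1}" "y \<in> {0..1}"
  shows "schoenberg 0 (cantor_code x y) = x" "schoenberg 1 (cantor_code x y) = y"
proof -
  have d: "cantor_digit x y j \<in> {0, 1}" for j
    using binary_digit_01[of x] binary_digit_01[of y] assms by (simp add: cantor_digit_def)
  have "schoenberg k (cantor_code x y) = (\<Sum>n. cantor_digit x y (2 * n + k) / 2 ^ Suc n)" for k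
    unfolding schoenberg_def cantor_code_def plateau_cantor[of "cantor_digit x y", OF d] ..
  thus "schoenberg 0 (cantor_code x y) = x" "schoenberg 1 (cantor_code x y) = y"
    using sums_unique[OF binary_digit_sums[of x]] sums_unique[OF binary_digit_sums[of y]] assms
    by (simp_all add: cantor_digit_def)
qed

lemma cantor_code_bounds:
  assumes "x \<in> {0..1}" "y \<in> {0..1}"
  shows "cantor_code x y \<in> {0..1}"
proof -
  note geo = quarter_sums
  have "cantor_digit x y j \<in> {0, 1}" for j
    using binary_digit_01[of x] binary_digit_01[of y] assms by (simp add: cantor_digit_def)
  hence db: "0 \<le> cantor_digit x y j" "cantor_digit x y j \<le> 1" for j by (auto, metis insertE order_refl singletonD zero_le_one)+
  have sumd: "summable (\<lambda>j. 2 * cantor_digit x y j / 4 ^ Suc j)"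
    by (rule summable_comparison_test[OF _ sums_summable[OF geo]])
       (auto intro!: exI[of _ 0] divide_right_mono simp: db simp del: power_Suc)
  have "0 \<le> cantor_code x y" unfolding cantor_code_def by (intro suminf_nonneg sumd divide_nonneg_nonneg) (auto simp: db)
  moreover have "cantor_code x y \<le> (\<Sum>j. 2 / 4 ^ Suc j)" unfolding cantor_code_def
    by (intro suminf_le divide_right_mono sumd sums_summable[OF geo]) (auto simp: db)
  ultimately show ?thesis using sums_unique[OF geo] by simp
qed

lemma fst_snd_borel [measurable]: 
  "(fst :: real \<times> real \<Rightarrow> real) \<in> borel_measurable borel" "(snd :: real \<times> real \<Rightarrow> real) \<in> borel_measurable borel"
  by (intro borel_measurable_continuous_onI continuous_intros)+

lemma cantor_code_borel: "(\<lambda>p :: real \<times> real. cantor_code (fst p) (snd p / T)) \<in> borel_measurable borel"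
proof -
  have [measurable]: "binary_digit n \<in> borel_measurable borel" for n
    unfolding binary_digit_def[abs_def] by measurable
  have "(\<lambda>p :: real \<times> real. 2 * cantor_digit (fst p) (snd p / T) j / 4 ^ Suc j) \<in> borel_measurable borel" for j
    unfolding cantor_digit_def by (cases "even j") simp_all
  thus ?thesis unfolding cantor_code_def by (rule borel_measurable_suminf)
qed

text \<open>The code moves the measures to the unit interval, where Helly's theorem applies, and the curve
  \<psi> moves the limit back. Since \<psi> is continuous, g \<circ> \<psi> is continuous wherever
  \<psi> avoids the discontinuities of g, and since \<psi> inverts the code, integrals of g \<circ>
  \<psi> are integrals of g against the original measures.\<close>
theorem finite_measures_rectangle_subsequence:
  fixes M :: "nat \<Rightarrow> (real \<times> real) measure"
  assumes T: "T > 0" and sets [measurable_cong]: "\<And>n. sets (M n) = sets borel"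
    and fin: "\<And>n. finite_measure (M n)"
    and supp: "\<And>n. emeasure (M n) (- ({0..1} \<times> {0..T})) = 0"
    and bnd: "\<And>n. measure (M n) UNIV \<le> B"
  obtains r N where "strict_mono (r :: nat \<Rightarrow> nat)" "sets N = sets borel" "finite_measure N"
    "emeasure N (- ({0..1} \<times> {0..T})) = 0"
    "\<And>g :: real \<times> real \<Rightarrow> complex. \<And>C D. g \<in> borel_measurable borel \<Longrightarrow> (\<And>x. cmod (g x) \<le> C) \<Longrightarrow>
       D \<in> sets borel \<Longrightarrow> emeasure N D = 0 \<Longrightarrow> (\<And>x. x \<notin> D \<Longrightarrow> isCont g x) \<Longrightarrow> 
       (\<lambda>n. integral\<^sup>L (M (r n)) g) \<longlonglongrightarrow> integral\<^sup>L N g"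
proof -
  interpret M: finite_measure "M n" for n by (rule fin)
  define \<sigma> where "\<sigma> p = cantor_code (fst p) (snd p / T)" for p :: "real \<times> real"
  define \<psi> where "\<psi> c = (schoenberg 0 c, T * schoenberg 1 c)" for c
  have \<sigma>m: "\<sigma> \<in> borel_measurable borel" unfolding \<sigma>_def[abs_def] by (rule cantor_code_borel)
  have \<sigma>M: "\<sigma> \<in> borel_measurable (M n)" for n using \<sigma>m by (simp add: measurable_cong_sets[OF sets refl])
  have \<psi>c: "continuous_on UNIV \<psi>" unfolding \<psi>_def by (intro continuous_intros continuous_schoenberg)
  have \<psi>m: "\<psi> \<in> borel_measurable borel" using \<psi>c by (rule borel_measurable_continuous_onI)
  have \<psi>\<sigma>: "\<psi> (\<sigma> p) = p" if "p \<in> {0..1} \<times> {0..T}" for p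
    using schoenberg_cantor_code[of "fst p" "snd p / T"] that T by (auto simp: \<psi>_def \<sigma>_def)
  have \<sigma>b: "\<sigma> p \<in> {0..1}" if "p \<in> {0..1} \<times> {0..T}" for p
    unfolding \<sigma>_def by (rule cantor_code_bounds) (use that T in auto)
  have box [measurable]: "- ({0..1::real} \<times> {0..T}) \<in> sets borel"
    by (intro borel_open open_Compl closed_Times closed_atLeastAtMost)
  have AEbox: "AE p in M n. p \<in> {0..1} \<times> {0..T}" for n
    by (rule AE_I[of _ _ "- ({0..1} \<times> {0..T})"]) (use supp box sets in auto)
  define P where "P n = distr (M n) borel \<sigma>" for n
  have Pfin: "finite_measure (P n)" for n unfolding P_def by (rule M.finite_measure_distr[OF \<sigma>M])
  have Psupp: "emeasure (P n) (- {0..1}) = 0" for n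
  proof -
    have "emeasure (P n) (- {0..1}) = emeasure (M n) (\<sigma> -` (- {0..1}) \<inter> space (M n))"
      unfolding P_def by (rule emeasure_distr[OF \<sigma>M]) auto
    also have "\<dots> \<le> emeasure (M n) (- ({0..1} \<times> {0..T}))"
      by (rule emeasure_mono) (use \<sigma>b sets box in auto)
    finally show ?thesis using supp by simp
  qed
  have sp: "space (M n) = UNIV" for n using sets_eq_imp_space_eq[OF sets] by simp
  have Pmass: "measure (P n) UNIV \<le> B" for n 
    unfolding P_def using measure_distr[OF \<sigma>M, of UNIV] bnd by (simp add: sp)
  obtain r \<nu> where r: "strict_mono (r :: nat \<Rightarrow> nat)" and \<nu>: "sets \<nu> = sets borel" "finite_measure \<nu>" "emeasure \<nu> (- {0..1}) = 0"
    and conv: "\<And>g :: real \<Rightarrow> complex. \<And>C. g \<in> borel_measurable borel \<Longrightarrow> (\<And>x. cmod (g x) \<le> C) \<Longrightarrow>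
       emeasure \<nu> {x. \<not> isCont g x} = 0 \<Longrightarrow> (\<lambda>n. integral\<^sup>L (P (r n)) g) \<longlonglongrightarrow> integral\<^sup>L \<nu> g"
    using finite_measures_unit_interval_subsequence[of P B, OF _ Pfin Psupp Pmass] by (auto simp: P_def)
  have \<psi>\<nu>: "\<psi> \<in> borel_measurable \<nu>" using \<psi>m by (simp add: measurable_cong_sets[OF \<nu>(1) refl])
  have \<nu>sp: "space \<nu> = UNIV" using sets_eq_imp_space_eq[OF \<nu>(1)] by simp
  show thesis
  proof (rule that[of r "distr \<nu> borel \<psi>"])
    show "finite_measure (distr \<nu> borel \<psi>)" by (rule finite_measure.finite_measure_distr[OF \<nu>(2) \<psi>\<nu>])
    have "\<psi> -` (- ({0..1} \<times> {0..T})) = {}"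
      using schoenberg_bounds T by (auto simp: \<psi>_def mult_left_le)
    thus "emeasure (distr \<nu> borel \<psi>) (- ({0..1} \<times> {0..T})) = 0"
      using emeasure_distr[OF \<psi>\<nu> box] by simp
    fix g :: "real \<times> real \<Rightarrow> complex" and C D
    assume g: "g \<in> borel_measurable borel" "\<And>x. cmod (g x) \<le> C" 
      and D: "D \<in> sets borel" "emeasure (distr \<nu> borel \<psi>) D = 0" "\<And>x. x \<notin> D \<Longrightarrow> isCont g x"
    have gc: "isCont (\<lambda>c. g (\<psi> c)) c" if "\<psi> c \<notin> D" for c
      using D(3)[OF that] \<psi>c by (intro continuous_at_compose[of c \<psi> g, unfolded comp_def]) (auto simp: continuous_on_eq_continuous_at)
    have z1: "emeasure \<nu> (\<psi> -` D) = 0" using emeasure_distr[OF \<psi>\<nu> D(1)] D(2) \<nu>sp by simp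
    have z2: "\<psi> -` D \<in> sets \<nu>" using measurable_sets[OF \<psi>\<nu> D(1)] \<nu>sp by simp
    have "emeasure \<nu> {c. \<not> isCont (\<lambda>c. g (\<psi> c)) c} = 0"
      by (rule emeasure_eq_0[OF z2 z1]) (use gc in auto)
    moreover have "(\<lambda>c. g (\<psi> c)) \<in> borel_measurable borel" using measurable_compose[OF \<psi>m g(1)] .
    ultimately have "(\<lambda>n. integral\<^sup>L (P (r n)) (\<lambda>c. g (\<psi> c))) \<longlonglongrightarrow> integral\<^sup>L \<nu> (\<lambda>c. g (\<psi> c))"
      using conv[of "\<lambda>c. g (\<psi> c)" C] g(2) by blast
    moreover have "integral\<^sup>L (P n) (\<lambda>c. g (\<psi> c)) = integral\<^sup>L (M n) g" for n
    proof -
      have gm: "(\<lambda>c. g (\<psi> c)) \<in> borel_measurable borel" using measurable_compose[OF \<psi>m g(1)] .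
      have "integral\<^sup>L (P n) (\<lambda>c. g (\<psi> c)) = integral\<^sup>L (M n) (\<lambda>p. g (\<psi> (\<sigma> p)))"
        unfolding P_def by (rule integral_distr[OF \<sigma>M gm])
      also have "\<dots> = integral\<^sup>L (M n) g"
      proof (rule integral_cong_AE)
        show "AE p in M n. g (\<psi> (\<sigma> p)) = g p" using AEbox by eventually_elim (simp add: \<psi>\<sigma>)
        show "(\<lambda>p. g (\<psi> (\<sigma> p))) \<in> borel_measurable (M n)" using measurable_compose[OF \<sigma>M gm] .
        show "g \<in> borel_measurable (M n)" using g(1) by (simp add: measurable_cong_sets[OF sets refl])
      qed
      finally show ?thesis .
    qed
    moreover have "integral\<^sup>L \<nu> (\<lambda>c. g (\<psi> c)) = integral\<^sup>L (distr \<nu> borel \<psi>) g"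
      by (rule integral_distr[OF \<psi>\<nu> g(1), symmetric])
    ultimately show "(\<lambda>n. integral\<^sup>L (M (r n)) g) \<longlonglongrightarrow> integral\<^sup>L (distr \<nu> borel \<psi>) g" by simp
  qed (use r in auto)
qed

section \<open>Elementary properties of reverse evolution families\<close>

lemma P_REF_iff:
  "P_REF I f \<longleftrightarrow>
     (\<forall>s\<in>I. \<forall>t\<in>I. s \<le> t \<longrightarrow> f s t holomorphic_on upper_half_plane \<and>
        (\<forall>z. Im z > 0 \<longrightarrow> Im (f s t z) > 0) \<and> f s t \<in> class_P) \<and>
     (\<forall>s\<in>I. \<forall>z. Im z > 0 \<longrightarrow> f s s z = z) \<and>
     (\<forall>s\<in>I. \<forall>t\<in>I. \<forall>u\<in>I. s \<le> t \<longrightarrow> t \<le> u \<longrightarrow>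
        (\<forall>z. Im z > 0 \<longrightarrow> f s t (f t u z) = f s u z)) \<and>
     (\<forall>s\<in>I. \<forall>t\<in>I. s \<le> t \<longrightarrow> (\<forall>K. compact K \<longrightarrow> K \<subseteq> upper_half_plane \<longrightarrow>
        uniform_limit K (\<lambda>(s', t'). f s' t') (f s t) (at (s, t) within ordered_pairs I)))"
proof -
  have 1: "(\<forall>(s, t)\<in>ordered_pairs I. P s t) \<longleftrightarrow> (\<forall>s\<in>I. \<forall>t\<in>I. s \<le> t \<longrightarrow> P s t)" for P
    by (auto simp: ordered_pairs_def)
  have 2: "f s t ` upper_half_plane \<subseteq> upper_half_plane \<longleftrightarrow> (\<forall>z. Im z > 0 \<longrightarrow> Im (f s t z) > 0)" for s t
    by (auto simp: upper_half_plane_def)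
  have 3: "(\<forall>z\<in>upper_half_plane. P z) \<longleftrightarrow> (\<forall>z. Im z > 0 \<longrightarrow> P z)" for P
    by (auto simp: upper_half_plane_def)
  show ?thesis unfolding P_REF_def 1 2 3 ..
qed

lemma P_REF_props:
  assumes "P_REF I f" "s \<in> I" "t \<in> I" "s \<le> t"
  shows "f s t holomorphic_on upper_half_plane" "Im z > 0 \<Longrightarrow> Im (f s t z) > 0"
    "f s t \<in> class_P" "Im z > 0 \<Longrightarrow> f s s z = z"
  using assms unfolding P_REF_iff by simp_all

lemma P_REF_comp:
  assumes "P_REF I f" "s \<in> I" "t \<in> I" "u \<in> I" "s \<le> t" "t \<le> u" "Im z > 0"
  shows "f s t (f t u z) = f s u z"
  using assms unfolding P_REF_iff by simp

lemma P_REF_uniform_limit: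
  assumes "P_REF I f" "s \<in> I" "t \<in> I" "s \<le> t" "compact K" "K \<subseteq> upper_half_plane"
  shows "uniform_limit K (\<lambda>(s', t'). f s' t') (f s t) (at (s, t) within ordered_pairs I)"
  by (rule assms(1)[unfolded P_REF_iff, THEN conjunct2, THEN conjunct2, THEN conjunct2, rule_format]) (fact assms)+

lemma P_REF_Im_ge:
  assumes "P_REF I f" "s \<in> I" "t \<in> I" "s \<le> t" "Im z > 0"
  shows "Im z \<le> Im (f s t z)"
  using class_P_Im_ge[of "f s t" z] P_REF_props[OF assms(1-4)] assms(5) by auto

lemma P_REF_continuous:
  assumes "P_REF I f" "Im z > 0"
  shows "continuous_on (ordered_pairs I) (\<lambda>p. f (fst p) (snd p) z)"
  unfolding continuous_on_def
proof
  fix p assume p: "p \<in> ordered_pairs I"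
  obtain s t where st: "p = (s, t)" by (cases p)
  have "uniform_limit {z} (\<lambda>(s', t'). f s' t') (f s t) (at (s, t) within ordered_pairs I)"
    by (rule P_REF_uniform_limit[OF assms(1)]) (use assms p in \<open>auto simp: st ordered_pairs_def\<close>)
  hence "((\<lambda>p. (case p of (s', t') \<Rightarrow> f s' t') z) \<longlongrightarrow> f s t z) (at (s, t) within ordered_pairs I)"
    by (rule tendsto_uniform_limitI) simp
  thus "((\<lambda>p. f (fst p) (snd p) z) \<longlongrightarrow> f (fst p) (snd p) z) (at p within ordered_pairs I)"
    by (simp add: st case_prod_unfold)
qed

lemma compact_ordered_pairs: "compact (ordered_pairs {0..T})"
proof -
  have "ordered_pairs {0..T} = ({0..T} \<times> {0..T}) \<inter> {p. fst p \<le> snd p}" by (auto simp: ordered_pairs_def)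
  moreover have "closed {p :: real \<times> real. fst p \<le> snd p}" by (intro closed_Collect_le continuous_intros)
  ultimately show ?thesis by (simp add: compact_Int_closed compact_Times)
qed

lemma P_REF_restrict:
  assumes "P_REF I f" "J \<subseteq> I"
  shows "P_REF J f"
proof -
  have sub: "ordered_pairs J \<subseteq> ordered_pairs I" using assms(2) by (auto simp: ordered_pairs_def)
  have "uniform_limit K (\<lambda>(s', t'). f s' t') (f s t) (at (s, t) within ordered_pairs J)"
    if "(s, t) \<in> ordered_pairs J" "compact K" "K \<subseteq> upper_half_plane" for s t K
  proof (rule filterlim_mono[OF _ order_refl at_le[OF sub]])
    show "uniform_limit K (\<lambda>(s', t'). f s' t') (f s t) (at (s, t) within ordered_pairs I)"
      by (rule P_REF_uniform_limit[OF assms(1)]) (use that sub in \<open>auto simp: ordered_pairs_def\<close>)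
  qed
  hence *: "\<forall>s\<in>J. \<forall>t\<in>J. s \<le> t \<longrightarrow> (\<forall>K. compact K \<longrightarrow> K \<subseteq> upper_half_plane \<longrightarrow>
        uniform_limit K (\<lambda>(s', t'). f s' t') (f s t) (at (s, t) within ordered_pairs J))"
    by (simp add: ordered_pairs_def)
  have mem: "s \<in> I" if "s \<in> J" for s using that assms(2) by auto
  show ?thesis unfolding P_REF_iff
    by (intro conjI ballI impI allI * P_REF_props[OF assms(1)] P_REF_comp[OF assms(1)] P_REF_props(4)[OF assms(1), of _ _]; (rule mem)?; assumption?)
       (auto intro: P_REF_props(4)[OF assms(1) mem mem order_refl])
qed

text \<open>The pairs of times form a compact set, on which the values at z depend continuously.\<close>
lemma P_REF_hsize_bound:
  assumes "P_REF I f" "{0..T} \<subseteq> I" "Im z > 0"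
  obtains C where "C \<ge> 1" "\<And>r t. 0 \<le> r \<Longrightarrow> r \<le> t \<Longrightarrow> t \<le> T \<Longrightarrow> hsize (f r t z) \<le> C"
proof -
  have sub: "ordered_pairs {0..T} \<subseteq> ordered_pairs I" using assms(2) by (auto simp: ordered_pairs_def)
  have "compact ((\<lambda>p. f (fst p) (snd p) z) ` ordered_pairs {0..T})"
    by (intro compact_continuous_image compact_ordered_pairs continuous_on_subset[OF P_REF_continuous[OF assms(1,3)] sub])
  moreover have "(\<lambda>p. f (fst p) (snd p) z) ` ordered_pairs {0..T} \<subseteq> upper_half_plane"
  proof (rule image_subsetI)
    fix p assume "p \<in> ordered_pairs {0..T}"
    hence "p \<in> ordered_pairs I" using sub by blast
    thus "f (fst p) (snd p) z \<in> upper_half_plane"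
      unfolding uhp_iff by (intro P_REF_props(2)[OF assms(1) _ _ _ assms(3)]) (auto simp: ordered_pairs_def)
  qed
  ultimately obtain C where C: "C \<ge> 1" "\<And>w. w \<in> (\<lambda>p. f (fst p) (snd p) z) ` ordered_pairs {0..T} \<Longrightarrow> hsize w \<le> C"
    by (rule hsize_bounded_on_compact) blast
  show thesis
  proof (rule that[OF C(1)])
    fix r t :: real assume "0 \<le> r" "r \<le> t" "t \<le> T"
    hence "(r, t) \<in> ordered_pairs {0..T}" by (auto simp: ordered_pairs_def)
    from imageI[OF this, of "\<lambda>p. f (fst p) (snd p) z"] show "hsize (f r t z) \<le> C" by (intro C(2)) simp
  qed
qed

lemma P_REF_step_rep:
  assumes "P_REF I f" "s \<in> I" "t \<in> I" "s \<le> t"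
  shows "\<exists>\<nu>. sets \<nu> = sets borel \<and> finite_measure \<nu> \<and> emeasure \<nu> (- {0..1}) = 0 \<and>
    (\<forall>z. Im z > 0 \<longrightarrow> f s t z - z = of_real (Re (f s t \<i>)) + (LINT u|\<nu>. circle_kernel z u))"
proof -
  have h1: "(\<lambda>z. f s t z - z) holomorphic_on upper_half_plane" by (intro holomorphic_intros P_REF_props(1)[OF assms])
  have h2: "Im (f s t z - z) \<ge> 0" if "Im z > 0" for z using P_REF_Im_ge[OF assms that] by simp
  show ?thesis
  proof (rule Nevanlinna_circle[OF h1 h2])
    fix \<nu> :: "real measure"
    assume "sets \<nu> = sets borel" "finite_measure \<nu>" "emeasure \<nu> (- {0..1}) = 0"
      "\<And>z. Im z > 0 \<Longrightarrow> f s t z - z = of_real (Re (f s t \<i> - \<i>)) + (LINT u|\<nu>. circle_kernel z u)"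
    thus ?thesis by (intro exI[of _ \<nu>] conjI allI impI) simp_all
  qed
qed

text \<open>Clamping extends a continuous function on a time interval to a continuous function on the whole
  line, so that its measurability needs no restriction of spaces.\<close>
definition clamp_to :: "real \<Rightarrow> real \<Rightarrow> real \<Rightarrow> real" where
  "clamp_to a b r = max a (min b r)"

lemma clamp_to_in: "a \<le> b \<Longrightarrow> a \<le> clamp_to a b r \<and> clamp_to a b r \<le> b"
  by (auto simp: clamp_to_def)

lemma clamp_to_id: "a \<le> r \<Longrightarrow> r \<le> b \<Longrightarrow> clamp_to a b r = r"
  by (auto simp: clamp_to_def)

lemma integrand_eq_pick_kernel: "(\<lambda>(x, r). (1 + complex_of_real x * f r t z) / (complex_of_real x - f r t z))
   = (\<lambda>p. pick_kernel (f (snd p) t z) (fst p))"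
  by (auto simp: pick_kernel_def)

section \<open>The generating pair on a compact time interval\<close>

locale compact_REF =
  fixes T :: real and f :: "real \<Rightarrow> real \<Rightarrow> complex \<Rightarrow> complex"
  assumes T: "T > 0" and ref: "P_REF {0..T} f"
begin

definition step_measure :: "real \<Rightarrow> real \<Rightarrow> real measure" where
  "step_measure s t = (SOME \<nu>. sets \<nu> = sets borel \<and> finite_measure \<nu> \<and> emeasure \<nu> (- {0..1}) = 0 \<and>
    (\<forall>z. Im z > 0 \<longrightarrow> f s t z - z = of_real (Re (f s t \<i>)) + (LINT u|\<nu>. circle_kernel z u)))"

lemma step_measure:
  assumes "0 \<le> s" "s \<le> t" "t \<le> T"
  shows "sets (step_measure s t) = sets borel" "finite_measure (step_measure s t)" 
    "emeasure (step_measure s t) (- {0..1}) = 0"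
    "Im z > 0 \<Longrightarrow> f s t z - z = of_real (Re (f s t \<i>)) + (LINT u|step_measure s t. circle_kernel z u)"
  using someI_ex[OF P_REF_step_rep[OF ref, of s t]] assms unfolding step_measure_def[symmetric] by auto

definition height :: "real \<Rightarrow> real" where "height r = Im (f r T \<i>)"

lemma height_cont: "continuous_on {0..T} height"
proof -
  have "continuous_on {0..T} (\<lambda>r. f (fst (r, T)) (snd (r, T)) \<i>)"
    by (rule continuous_on_compose2[OF P_REF_continuous[OF ref]]) (use T in \<open>auto intro!: continuous_intros simp: ordered_pairs_def\<close>)
  thus ?thesis unfolding height_def by (auto intro: continuous_intros)
qed

lemma height_antimono: "0 \<le> r \<Longrightarrow> r \<le> s \<Longrightarrow> s \<le> T \<Longrightarrow> height s \<le> height r"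
  unfolding height_def using P_REF_comp[OF ref, of r s T \<i>] P_REF_Im_ge[OF ref, of r s "f s T \<i>"] P_REF_props(2)[OF ref, of s T \<i>]
  by auto

text \<open>By the composition rule, height s - height t is Im (f s t w - w) for w = f t T \<i>. This is the
  integral of Im (circle_kernel w u), which is at least 1 / hsize w, and hsize w is bounded on [0,T].\<close>
lemma step_measure_mass:
  obtains C where "C \<ge> 1" 
    "\<And>s t. 0 \<le> s \<Longrightarrow> s \<le> t \<Longrightarrow> t \<le> T \<Longrightarrow> measure (step_measure s t) UNIV \<le> C * (height s - height t)"
proof -
  obtain C where C: "C \<ge> 1" "\<And>r t. 0 \<le> r \<Longrightarrow> r \<le> t \<Longrightarrow> t \<le> T \<Longrightarrow> hsize (f r t \<i>) \<le> C"
    using P_REF_hsize_bound[OF ref, of T \<i>] by auto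
  show thesis
  proof (rule that[OF C(1)])
    fix s t assume st: "0 \<le> s" "s \<le> t" "t \<le> T"
    define w where "w = f t T \<i>"
    have w: "Im w > 0" unfolding w_def by (rule P_REF_props(2)[OF ref]) (use st in auto)
    note sm = step_measure[OF st]
    interpret finite_measure "step_measure s t" by (rule sm)
    have sp: "space (step_measure s t) = UNIV" using sets_eq_imp_space_eq[OF sm(1)] by simp
    have "f s t w = f s T \<i>" unfolding w_def by (rule P_REF_comp[OF ref]) (use st in auto)
    hence "height s - height t = Im (f s t w - w)" by (simp add: height_def w_def)
    also have "\<dots> = Im (LINT u|step_measure s t. circle_kernel w u)" unfolding sm(4)[OF w] by simp
    also have "\<dots> = (LINT u|step_measure s t. Im (circle_kernel w u))"
      by (rule integral_Im[symmetric, OF circle_kernel_integrable[OF sm(2,1) w]])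
    also have "\<dots> \<ge> (LINT u|step_measure s t. 1 / C)"
    proof (rule integral_mono)
      show "1 / C \<le> Im (circle_kernel w u)" for u
      proof -
        have "1 / C \<le> 1 / hsize w" 
          using C(2)[of t T] st hsize_pos[OF w] by (intro divide_left_mono) (auto simp: w_def)
        also note Im_circle_kernel_ge[OF w, of u]
        finally show ?thesis .
      qed
    qed (auto intro!: integrable_Im circle_kernel_integrable sm w)
    finally show "measure (step_measure s t) UNIV \<le> C * (height s - height t)"
      using C(1) by (simp add: sp field_simps)
  qed
qed

definition grid :: "nat \<Rightarrow> nat \<Rightarrow> real" where "grid n j = T * real j / 2 ^ n"

lemma grid_props: "grid n 0 = 0" "grid n (2 ^ n) = T" "j \<le> k \<Longrightarrow> grid n j \<le> grid n k" "0 \<le> grid n j"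
  "grid n j \<le> grid n k \<longleftrightarrow> j \<le> k" "grid n j < grid n k \<longleftrightarrow> j < k" "grid n j \<le> T \<longleftrightarrow> j \<le> 2 ^ n"
  "grid n (Suc j) = grid n j + T / 2 ^ n"
proof -
  show "grid n j \<le> T \<longleftrightarrow> j \<le> 2 ^ n"
  proof -
    have "grid n j \<le> T \<longleftrightarrow> T * real j \<le> T * real (2 ^ n)" by (simp add: grid_def divide_simps)
    thus ?thesis using T by simp
  qed
qed (use T in \<open>auto simp: grid_def divide_simps distrib_left\<close>)

text \<open>The mass of a time step is placed at its right end point, because the map of that step is evaluated
  at the value that the trajectory has there.\<close>
definition grid_measure :: "nat \<Rightarrow> (real \<times> real) measure" where
  "grid_measure n = sum_measure {..<2 ^ n} (\<lambda>j. distr (step_measure (grid n j) (grid n (Suc j))) borel (\<lambda>u. (u, grid n (Suc j))))"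

lemma grid_step: assumes "j < 2 ^ n" shows "0 \<le> grid n j" "grid n j \<le> grid n (Suc j)" "grid n (Suc j) \<le> T"
  using assms grid_props(7)[of n "Suc j"] grid_props(3)[of j "Suc j" n] grid_props(4) by auto

lemma pair_const_measurable: "(\<lambda>u. (u, c)) \<in> measurable borel (borel :: (real \<times> real) measure)"
  by (intro borel_measurable_continuous_onI continuous_intros)

lemma pair_const_measurable_step:
  assumes "j < 2 ^ n" 
  shows "(\<lambda>u. (u, c)) \<in> measurable (step_measure (grid n j) (grid n (Suc j))) (borel :: (real \<times> real) measure)"
  unfolding measurable_cong_sets[OF step_measure(1)[OF grid_step[OF assms]] refl] by (rule pair_const_measurable)

lemma grid_measure_props:
  "sets (grid_measure n) = sets borel" "finite_measure (grid_measure n)"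
  "emeasure (grid_measure n) (- ({0..1} \<times> {0..T})) = 0"
proof -
  show "sets (grid_measure n) = sets borel" by (simp add: grid_measure_def)
  show "finite_measure (grid_measure n)" unfolding grid_measure_def
    by (intro finite_measure_sum_measure finite_measure.finite_measure_distr step_measure(2) grid_step pair_const_measurable_step) auto
  have box: "- ({0..1::real} \<times> {0..T}) \<in> sets borel"
    by (intro borel_open open_Compl closed_Times closed_atLeastAtMost)
  have "emeasure (distr (step_measure (grid n j) (grid n (Suc j))) borel (\<lambda>u. (u, grid n (Suc j)))) (- ({0..1} \<times> {0..T})) = 0" 
    if "j < 2 ^ n" for j
  proof -
    have "(\<lambda>u. (u, grid n (Suc j))) -` (- ({0..1} \<times> {0..T})) \<inter> space (step_measure (grid n j) (grid n (Suc j))) \<subseteq> - {0..1}"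
      using grid_step[OF that] by auto
    hence "emeasure (step_measure (grid n j) (grid n (Suc j))) ((\<lambda>u. (u, grid n (Suc j))) -` (- ({0..1} \<times> {0..T})) \<inter> space (step_measure (grid n j) (grid n (Suc j)))) = 0"
      by (intro emeasure_eq_0[OF _ step_measure(3)[OF grid_step[OF that]]]) (auto simp: step_measure(1)[OF grid_step[OF that]])
    thus ?thesis by (subst emeasure_distr[OF pair_const_measurable_step[OF that] box])
  qed
  thus "emeasure (grid_measure n) (- ({0..1} \<times> {0..T})) = 0"
    unfolding grid_measure_def by (subst emeasure_sum_measure[OF _ _ box]) auto
qed

lemma grid_measure_integral:
  fixes g :: "real \<times> real \<Rightarrow> complex"
  assumes g: "g \<in> borel_measurable borel" and b: "\<And>x. cmod (g x) \<le> B"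
  shows "integral\<^sup>L (grid_measure n) g = (\<Sum>j<2 ^ n. LINT u|step_measure (grid n j) (grid n (Suc j)). g (u, grid n (Suc j)))"
proof -
  have "integral\<^sup>L (grid_measure n) g = (\<Sum>j<2 ^ n. integral\<^sup>L (distr (step_measure (grid n j) (grid n (Suc j))) borel (\<lambda>u. (u, grid n (Suc j)))) g)"
    unfolding grid_measure_def
    by (rule integral_sum_measure[OF _ _ _ g b]) (auto intro!: finite_measure.finite_measure_distr step_measure(2) grid_step pair_const_measurable_step)
  also have "\<dots> = (\<Sum>j<2 ^ n. LINT u|step_measure (grid n j) (grid n (Suc j)). g (u, grid n (Suc j)))"
    by (intro sum.cong refl integral_distr g pair_const_measurable_step) auto
  finally show ?thesis .
qed

lemma grid_measure_mass:
  obtains B where "\<And>n. measure (grid_measure n) UNIV \<le> B" 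
proof -
  obtain C where C: "C \<ge> 1" 
    "\<And>s t. 0 \<le> s \<Longrightarrow> s \<le> t \<Longrightarrow> t \<le> T \<Longrightarrow> measure (step_measure s t) UNIV \<le> C * (height s - height t)"
    using step_measure_mass by blast
  show thesis
  proof (rule that[of "C * (height 0 - height T)"])
    fix n
    interpret finite_measure "grid_measure n" by (rule grid_measure_props)
    have sp: "space (grid_measure n) = UNIV" using sets_eq_imp_space_eq[OF grid_measure_props(1)] by simp
    have sps: "space (step_measure (grid n j) (grid n (Suc j))) = UNIV" if "j < 2 ^ n" for j
      using sets_eq_imp_space_eq[OF step_measure(1)[OF grid_step[OF that]]] by simp
    have "complex_of_real (measure (grid_measure n) UNIV) = integral\<^sup>L (grid_measure n) (\<lambda>_. 1 :: complex)"
      by (simp add: sp scaleR_conv_of_real)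
    also have "\<dots> = (\<Sum>j<2 ^ n. LINT u|step_measure (grid n j) (grid n (Suc j)). (1 :: complex))"
      by (rule grid_measure_integral[where B = 1]) auto
    also have "\<dots> = of_real (\<Sum>j<2 ^ n. measure (step_measure (grid n j) (grid n (Suc j))) UNIV)"
      unfolding of_real_sum
      by (intro sum.cong refl) (simp add: sps scaleR_conv_of_real finite_measure.integrable_const[OF step_measure(2)[OF grid_step]])
    finally have "measure (grid_measure n) UNIV = (\<Sum>j<2 ^ n. measure (step_measure (grid n j) (grid n (Suc j))) UNIV)"
      by (simp only: of_real_eq_iff)
    also have "\<dots> \<le> (\<Sum>j<2 ^ n. C * (height (grid n j) - height (grid n (Suc j))))"
      by (intro sum_mono C(2) grid_step) auto
    also have "\<dots> = C * (height 0 - height T)"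
      unfolding sum_distrib_left[symmetric] using sum_lessThan_telescope'[of "\<lambda>j. height (grid n j)" "2 ^ n"]
      by (simp add: grid_props)
    finally show "measure (grid_measure n) UNIV \<le> C * (height 0 - height T)" .
  qed
qed

text \<open>Only steps within 2 \<delta> of the time s meet the support of the bump, and their masses are
  bounded by a telescoping sum of decreases of height. Since height is continuous, weak limits cannot
  charge a single time.\<close>
lemma grid_measure_bump:
  obtains C where "C \<ge> 1"
   "\<And>s \<delta> n. 0 \<le> s \<Longrightarrow> s \<le> T \<Longrightarrow> \<delta> > 0 \<Longrightarrow> T / 2 ^ n < \<delta> \<Longrightarrow>
     cmod (LINT p|grid_measure n. complex_of_real (max 0 (1 - \<bar>snd p - s\<bar> / \<delta>))) 
       \<le> C * (height (max 0 (s - 2 * \<delta>)) - height (min T (s + 2 * \<delta>)))"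
proof -
  obtain C where C: "C \<ge> 1" 
    "\<And>s t. 0 \<le> s \<Longrightarrow> s \<le> t \<Longrightarrow> t \<le> T \<Longrightarrow> measure (step_measure s t) UNIV \<le> C * (height s - height t)"
    using step_measure_mass by blast
  show thesis
  proof (rule that[OF C(1)])
    fix s \<delta> :: real and n
    assume s: "0 \<le> s" "s \<le> T" and \<delta>: "\<delta> > 0" and n: "T / 2 ^ n < \<delta>"
    define bmp where "bmp r = max 0 (1 - \<bar>r - s\<bar> / \<delta>)" for r
    have bmp: "0 \<le> bmp r" "bmp r \<le> 1" for r using \<delta> by (auto simp: bmp_def)
    have bmp0: "\<bar>r - s\<bar> < \<delta>" if "bmp r > 0" for r using that \<delta> by (auto simp: bmp_def max_def field_simps split: if_splits)
    define lo hi where "lo = max 0 (s - 2 * \<delta>)" "hi = min T (s + 2 * \<delta>)"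
    have lohi: "0 \<le> lo" "lo \<le> hi" "hi \<le> T" using s \<delta> by (auto simp: lo_hi_def)
    define hh where "hh r = height (clamp_to lo hi r)" for r
    have hh_mono: "hh r' \<le> hh r" if "r \<le> r'" for r r'
      unfolding hh_def by (intro height_antimono) (use that lohi in \<open>auto simp: clamp_to_def\<close>)
    let ?m = "\<lambda>j. measure (step_measure (grid n j) (grid n (Suc j))) UNIV"
    have sps: "space (step_measure (grid n j) (grid n (Suc j))) = UNIV" if "j < 2 ^ n" for j
      using sets_eq_imp_space_eq[OF step_measure(1)[OF grid_step[OF that]]] by simp
    have meas: "(\<lambda>p. complex_of_real (bmp (snd p))) \<in> borel_measurable borel" 
      unfolding bmp_def by (intro borel_measurable_continuous_onI continuous_intros) (use \<delta> in auto)
    have "(LINT p|grid_measure n. complex_of_real (bmp (snd p))) 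
       = (\<Sum>j<2 ^ n. LINT u|step_measure (grid n j) (grid n (Suc j)). complex_of_real (bmp (snd (u, grid n (Suc j)))))"
      by (rule grid_measure_integral[where B = 1, OF meas]) (simp add: bmp)
    also have "\<dots> = (\<Sum>j<2 ^ n. of_real (?m j * bmp (grid n (Suc j))))"
      by (intro sum.cong refl) (simp add: sps scaleR_conv_of_real finite_measure.integrable_const[OF step_measure(2)[OF grid_step]])
    finally have "cmod (LINT p|grid_measure n. complex_of_real (bmp (snd p))) = \<bar>\<Sum>j<2 ^ n. ?m j * bmp (grid n (Suc j))\<bar>"
      by (simp only: of_real_sum[symmetric] norm_of_real)
    also have "\<dots> = (\<Sum>j<2 ^ n. ?m j * bmp (grid n (Suc j)))" 
      by (intro abs_of_nonneg sum_nonneg mult_nonneg_nonneg bmp measure_nonneg)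
    also have "\<dots> \<le> (\<Sum>j<2 ^ n. C * (hh (grid n j) - hh (grid n (Suc j))))"
    proof (rule sum_mono)
      fix j assume "j \<in> {..<(2::nat) ^ n}"
      hence j: "j < 2 ^ n" by simp
      show "?m j * bmp (grid n (Suc j)) \<le> C * (hh (grid n j) - hh (grid n (Suc j)))"
      proof (cases "bmp (grid n (Suc j)) > 0")
        case False
        hence "bmp (grid n (Suc j)) = 0" using bmp(1)[of "grid n (Suc j)"] by simp
        thus ?thesis using C(1) hh_mono[OF grid_step(2)[OF j]] by simp
      next
        case True
        from bmp0[OF this] have 1: "\<bar>grid n (Suc j) - s\<bar> < \<delta>" .
        have 2: "grid n (Suc j) < grid n j + \<delta>" using n by (simp add: grid_props)
        have "hh (grid n (Suc j)) = height (grid n (Suc j))" "hh (grid n j) = height (grid n j)"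
          unfolding hh_def using 1 2 grid_step[OF j] \<delta> by (auto intro!: arg_cong[of _ _ height] clamp_to_id simp: lo_hi_def)
        moreover have "?m j * bmp (grid n (Suc j)) \<le> ?m j * 1" by (intro mult_left_mono bmp measure_nonneg)
        ultimately show ?thesis using C(2)[OF grid_step[OF j]] by simp
      qed
    qed
    also have "\<dots> = C * (hh 0 - hh T)"
      unfolding sum_distrib_left[symmetric] using sum_lessThan_telescope'[of "\<lambda>j. hh (grid n j)" "2 ^ n"]
      by (simp add: grid_props)
    also have "C * (hh 0 - hh T) = C * (height lo - height hi)" using lohi by (simp add: hh_def clamp_to_def)
    finally show "cmod (LINT p|grid_measure n. complex_of_real (max 0 (1 - \<bar>snd p - s\<bar> / \<delta>))) 
       \<le> C * (height (max 0 (s - 2 * \<delta>)) - height (min T (s + 2 * \<delta>)))"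
      by (simp add: bmp_def lo_hi_def)
  qed
qed

definition traj :: "real \<Rightarrow> real \<Rightarrow> complex \<Rightarrow> real \<Rightarrow> complex" where
  "traj s t z r = f (clamp_to s t r) t z"

lemma traj_cont: assumes "0 \<le> s" "s \<le> t" "t \<le> T" "Im z > 0" shows "continuous_on UNIV (traj s t z)"
proof -
  have "continuous_on UNIV (\<lambda>r. f (fst (clamp_to s t r, t)) (snd (clamp_to s t r, t)) z)"
    by (rule continuous_on_compose2[OF P_REF_continuous[OF ref assms(4)]]) 
       (use assms clamp_to_in[of s t] in \<open>auto intro!: continuous_intros simp: ordered_pairs_def clamp_to_def\<close>)
  thus ?thesis by (simp add: traj_def[abs_def])
qed

lemma traj_Im: assumes "0 \<le> s" "s \<le> t" "t \<le> T" "Im z > 0" shows "Im (traj s t z r) \<ge> Im z"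
  unfolding traj_def by (rule P_REF_Im_ge[OF ref]) (use assms clamp_to_in[of s t r] in auto)

text \<open>The half-open interval corresponds to the placement of the grid measure at right end points. For a
  measure that charges no single time it is as good as the closed interval.\<close>
definition integrand :: "real \<Rightarrow> real \<Rightarrow> complex \<Rightarrow> real \<times> real \<Rightarrow> complex" where
  "integrand s t z p = indicator {s<..t} (snd p) *\<^sub>R circle_kernel (traj s t z (snd p)) (fst p)"

lemma kernel_traj_cont:
  assumes "0 \<le> s" "s \<le> t" "t \<le> T" "Im z > 0"
  shows "continuous_on UNIV (\<lambda>p. circle_kernel (traj s t z (snd p)) (fst p))"
proof (rule continuous_on_circle_kernel)
  show "continuous_on UNIV (\<lambda>p :: real \<times> real. traj s t z (snd p))"
    by (rule continuous_on_compose2[OF traj_cont[OF assms]]) (auto intro!: continuous_intros)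
qed (use traj_Im[OF assms] assms in \<open>auto intro!: continuous_intros intro: order_less_le_trans\<close>)

lemma integrand_borel:
  assumes "0 \<le> s" "s \<le> t" "t \<le> T" "Im z > 0"
  shows "integrand s t z \<in> borel_measurable borel"
proof -
  note borel_measurable_continuous_onI[OF kernel_traj_cont[OF assms], measurable]
  show ?thesis unfolding integrand_def[abs_def] by measurable
qed

lemma integrand_bound:
  assumes "Im z > 0"
  obtains C where "C \<ge> 1" "\<And>s t p. 0 \<le> s \<Longrightarrow> s \<le> t \<Longrightarrow> t \<le> T \<Longrightarrow> cmod (integrand s t z p) \<le> C"
proof -
  obtain C where C: "C \<ge> 1" "\<And>r t. 0 \<le> r \<Longrightarrow> r \<le> t \<Longrightarrow> t \<le> T \<Longrightarrow> hsize (f r t z) \<le> C"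
    using P_REF_hsize_bound[OF ref _ assms, of T] by auto
  show thesis
  proof (rule that[OF C(1)])
    fix s t and p :: "real \<times> real" assume st: "0 \<le> s" "s \<le> t" "t \<le> T"
    have "cmod (circle_kernel (traj s t z (snd p)) (fst p)) \<le> hsize (traj s t z (snd p))"
      by (rule norm_circle_kernel_le) (use traj_Im[OF st assms, of "snd p"] assms in simp)
    also have "\<dots> \<le> C" unfolding traj_def by (intro C(2)) (use st clamp_to_in[of s t "snd p"] in auto)
    finally show "cmod (integrand s t z p) \<le> C" using C(1) by (auto simp: integrand_def indicator_def)
  qed
qed

lemma integrand_isCont:
  assumes "0 \<le> s" "s \<le> t" "t \<le> T" "Im z > 0" "snd p \<noteq> s" "snd p \<noteq> t"
  shows "isCont (integrand s t z) p"
proof -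
  define k where "k p = circle_kernel (traj s t z (snd p)) (fst p)" for p
  have kc: "isCont k p" for p 
    using kernel_traj_cont[OF assms(1-4)] unfolding k_def[abs_def] by (metis UNIV_I continuous_on_eq_continuous_at open_UNIV)
  have o: "open {p :: real \<times> real. snd p < s}" "open {p :: real \<times> real. snd p > s \<and> snd p < t}" "open {p :: real \<times> real. snd p > t}"
    by (intro open_Collect_conj open_Collect_less continuous_intros)+
  consider "snd p < s" | "snd p > s \<and> snd p < t" | "snd p > t" using assms by linarith
  thus ?thesis
  proof cases
    case 1
    hence "\<forall>\<^sub>F x in nhds p. x \<in> {p. snd p < s}" using o(1) by (intro eventually_nhds_in_open) auto
    hence "\<forall>\<^sub>F x in nhds p. integrand s t z x = 0" by eventually_elim (auto simp: integrand_def)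
    thus ?thesis using isCont_cong[of "integrand s t z" "\<lambda>_. 0" p] by simp
  next
    case 2
    hence "\<forall>\<^sub>F x in nhds p. x \<in> {p. snd p > s \<and> snd p < t}" using o(2) by (intro eventually_nhds_in_open) auto
    hence "\<forall>\<^sub>F x in nhds p. integrand s t z x = k x" by eventually_elim (auto simp: integrand_def k_def)
    thus ?thesis using isCont_cong[of "integrand s t z" k p] kc by simp
  next
    case 3
    hence "\<forall>\<^sub>F x in nhds p. x \<in> {p. snd p > t}" using o(3) by (intro eventually_nhds_in_open) auto
    hence "\<forall>\<^sub>F x in nhds p. integrand s t z x = 0" by eventually_elim (auto simp: integrand_def)
    thus ?thesis using isCont_cong[of "integrand s t z" "\<lambda>_. 0" p] by simp
  qed
qed

definition drift :: "nat \<Rightarrow> real \<Rightarrow> real \<Rightarrow> real" where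
  "drift n s t = (\<Sum>j | j < 2 ^ n \<and> s \<le> grid n j \<and> grid n j < t. Re (f (grid n j) (grid n (Suc j)) \<i>))"

lemma drift_add: 
  assumes "s \<le> t" "t \<le> u" shows "drift n s u = drift n s t + drift n t u"
proof -
  have *: "{j. j < 2 ^ n \<and> s \<le> grid n j \<and> grid n j < u} = {j. j < 2 ^ n \<and> s \<le> grid n j \<and> grid n j < t} \<union> {j. j < 2 ^ n \<and> t \<le> grid n j \<and> grid n j < u}"
    using assms by auto
  show ?thesis unfolding drift_def * by (rule sum.union_disjoint) auto
qed

text \<open>With w_j the value at z from time grid n j to time t, the composition rule reads w_j = f_j(w_(j+1))
  for the map f_j of step j, so that the representations of the maps f_j - id telescope.\<close>
lemma grid_equation:
  assumes ab: "a \<le> b" "b \<le> 2 ^ n" and z: "Im z > 0"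
  shows "f (grid n a) (grid n b) z - z = of_real (drift n (grid n a) (grid n b)) + integral\<^sup>L (grid_measure n) (integrand (grid n a) (grid n b) z)"
proof -
  define s t where "s = grid n a" "t = grid n b"
  have st: "0 \<le> s" "s \<le> t" "t \<le> T" using ab by (auto simp: s_t_def grid_props)
  define w where "w j = f (grid n j) t z" for j
  have w: "Im (w j) > 0" if "j \<le> b" for j unfolding w_def
    by (rule P_REF_props(2)[OF ref _ _ _ z]) (use that ab st in \<open>auto simp: s_t_def grid_props\<close>)
  have step: "w j - w (Suc j) = of_real (Re (f (grid n j) (grid n (Suc j)) \<i>)) + (LINT u|step_measure (grid n j) (grid n (Suc j)). circle_kernel (w (Suc j)) u)"
    if "j < b" for j
  proof -
    have j: "j < 2 ^ n" using that ab by simp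
    have j': "grid n (Suc j) \<le> t" using that by (simp add: s_t_def grid_props(5))
    have "w j = f (grid n j) (grid n (Suc j)) (w (Suc j))" unfolding w_def
      by (rule P_REF_comp[OF ref, symmetric]) (use j' st z grid_step[OF j] in simp_all)
    thus ?thesis using step_measure(4)[OF grid_step[OF j] w[of "Suc j"]] that by simp
  qed
  have J: "{j. j < 2 ^ n \<and> s \<le> grid n j \<and> grid n j < t} = {a..<b}" using ab by (auto simp: s_t_def grid_props)
  obtain C where C: "\<And>p. cmod (integrand s t z p) \<le> C" using integrand_bound[OF z] st by metis
  have "integral\<^sup>L (grid_measure n) (integrand s t z) = (\<Sum>j<2 ^ n. LINT u|step_measure (grid n j) (grid n (Suc j)). integrand s t z (u, grid n (Suc j)))"
    by (rule grid_measure_integral[OF integrand_borel[OF st z] C])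
  also have "\<dots> = (\<Sum>j<2 ^ n. if j \<in> {a..<b} then (LINT u|step_measure (grid n j) (grid n (Suc j)). circle_kernel (w (Suc j)) u) else 0)"
  proof (intro sum.cong refl)
    fix j assume "j \<in> {..<(2::nat) ^ n}"
    show "(LINT u|step_measure (grid n j) (grid n (Suc j)). integrand s t z (u, grid n (Suc j))) = 
      (if j \<in> {a..<b} then (LINT u|step_measure (grid n j) (grid n (Suc j)). circle_kernel (w (Suc j)) u) else 0)"
    proof (cases "j \<in> {a..<b}")
      case True
      hence "grid n (Suc j) \<in> {s<..t}" by (auto simp: s_t_def grid_props(5,6))
      thus ?thesis using True by (simp add: integrand_def traj_def clamp_to_id w_def)
    next
      case False
      hence "grid n (Suc j) \<notin> {s<..t}" by (auto simp: s_t_def grid_props(5,6))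
      thus ?thesis by (subst if_not_P[OF False]) (simp add: integrand_def)
    qed
  qed
  also have "\<dots> = (\<Sum>j\<in>{a..<b}. LINT u|step_measure (grid n j) (grid n (Suc j)). circle_kernel (w (Suc j)) u)"
    by (subst sum.inter_restrict[symmetric]) (use ab in \<open>auto intro!: sum.cong\<close>)
  finally have "of_real (drift n s t) + integral\<^sup>L (grid_measure n) (integrand s t z) = (\<Sum>j\<in>{a..<b}. w j - w (Suc j))"
    unfolding drift_def J using step by (simp add: sum.distrib)
  also have "\<dots> = w a - w b" using sum_Suc_diff'[OF ab(1), of "\<lambda>j. - w j"] by simp
  also have "w b = z" unfolding w_def s_t_def by (rule P_REF_props(4)[OF ref _ _ _ z, of _ T]) (use ab T in \<open>auto simp: grid_props\<close>)
  finally show ?thesis by (simp add: s_t_def w_def)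
qed

text \<open>Between fixed dyadic times the equation holds on all finer grids. There the kernel integrals
  converge along a subsequence, hence so do the drifts. These are real, independent of z, and additive
  in the time interval, and their limit \<Psi> inherits these properties.\<close>
lemma limit_measure:
  obtains M \<Psi> where "sets M = sets borel" "finite_measure M"
    "emeasure M (- ({0..1} \<times> {0..T})) = 0" "\<And>s. 0 \<le> s \<Longrightarrow> s \<le> T \<Longrightarrow> emeasure M (UNIV \<times> {s}) = 0"
    "\<And>m a b z. a \<le> b \<Longrightarrow> b \<le> 2 ^ m \<Longrightarrow> Im z > 0 \<Longrightarrow> f (grid m a) (grid m b) z - z 
        - integral\<^sup>L M (integrand (grid m a) (grid m b) z) = complex_of_real (\<Psi> (grid m a) (grid m b))"
    "\<And>m a b c. a \<le> b \<Longrightarrow> b \<le> c \<Longrightarrow> c \<le> 2 ^ m \<Longrightarrow> \<Psi> (grid m a) (grid m c) = \<Psi> (grid m a) (grid m b) + \<Psi> (grid m b) (grid m c)"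
proof -
  obtain B where B: "\<And>n. measure (grid_measure n) UNIV \<le> B" using grid_measure_mass by blast
  obtain r M where r: "strict_mono (r :: nat \<Rightarrow> nat)" and M: "sets M = sets borel" "finite_measure M"
    "emeasure M (- ({0..1} \<times> {0..T})) = 0" 
    and conv: "\<And>g :: real \<times> real \<Rightarrow> complex. \<And>C D. g \<in> borel_measurable borel \<Longrightarrow> (\<And>x. cmod (g x) \<le> C) \<Longrightarrow>
       D \<in> sets borel \<Longrightarrow> emeasure M D = 0 \<Longrightarrow> (\<And>x. x \<notin> D \<Longrightarrow> isCont g x) \<Longrightarrow> 
       (\<lambda>n. integral\<^sup>L (grid_measure (r n)) g) \<longlonglongrightarrow> integral\<^sup>L M g"
    by (rule finite_measures_rectangle_subsequence[of T grid_measure B, OF T grid_measure_props B]) blast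
  interpret M: finite_measure M by (rule M)
  have line: "UNIV \<times> {s} \<in> sets (borel :: (real \<times> real) measure)" for s
    by (intro borel_closed closed_Times closed_UNIV closed_singleton)
  have Msp: "space M = UNIV" using sets_eq_imp_space_eq[OF M(1)] by simp
  have rge: "n \<le> r n" for n by (rule strict_mono_imp_increasing[OF r])
  have null: "emeasure M (UNIV \<times> {s}) = 0" if s: "0 \<le> s" "s \<le> T" for s
  proof -
    obtain C where C: "C \<ge> 1"
     "\<And>s \<delta> n. 0 \<le> s \<Longrightarrow> s \<le> T \<Longrightarrow> \<delta> > 0 \<Longrightarrow> T / 2 ^ n < \<delta> \<Longrightarrow>
       cmod (LINT p|grid_measure n. complex_of_real (max 0 (1 - \<bar>snd p - s\<bar> / \<delta>))) 
         \<le> C * (height (max 0 (s - 2 * \<delta>)) - height (min T (s + 2 * \<delta>)))"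
      using grid_measure_bump by blast
    have bound: "measure M (UNIV \<times> {s}) \<le> C * (height (max 0 (s - 2 * \<delta>)) - height (min T (s + 2 * \<delta>)))" if \<delta>: "\<delta> > 0" for \<delta>
    proof -
      define bmp where "bmp p = complex_of_real (max 0 (1 - \<bar>snd p - s\<bar> / \<delta>))" for p :: "real \<times> real"
      have bc: "continuous_on UNIV bmp" unfolding bmp_def[abs_def] by (intro continuous_intros) (use \<delta> in auto)
      have bm: "bmp \<in> borel_measurable borel" using bc by (rule borel_measurable_continuous_onI)
      have bb: "cmod (bmp p) \<le> 1" for p unfolding bmp_def norm_of_real using \<delta> by auto
      have 1: "(\<lambda>n. cmod (integral\<^sup>L (grid_measure (r n)) bmp)) \<longlonglongrightarrow> cmod (integral\<^sup>L M bmp)"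
        by (intro tendsto_norm conv[OF bm bb, of "{}"]) (use bc in \<open>auto simp: continuous_on_eq_continuous_at simp del: split_paired_All split_paired_all\<close>)
      have "(\<lambda>n. T * (1 / 2) ^ n) \<longlonglongrightarrow> T * 0" by (intro tendsto_intros) auto
      hence "\<forall>\<^sub>F n in sequentially. T * (1 / 2) ^ n < \<delta>" using \<delta> by (intro order_tendstoD) auto
      hence 2: "\<forall>\<^sub>F n in sequentially. cmod (integral\<^sup>L (grid_measure (r n)) bmp) \<le> C * (height (max 0 (s - 2 * \<delta>)) - height (min T (s + 2 * \<delta>)))"
      proof eventually_elim
        case (elim n)
        have "T / 2 ^ r n \<le> T / 2 ^ n" using T rge[of n] by (intro divide_left_mono power_increasing) auto
        hence "T / 2 ^ r n < \<delta>" using elim by (simp add: power_one_over)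
        thus ?case unfolding bmp_def using C(2)[OF s \<delta>] by blast
      qed
      have "measure M (UNIV \<times> {s}) = (LINT p|M. indicator (UNIV \<times> {s}) p)" by (simp add: Msp)
      also have "\<dots> \<le> (LINT p|M. Re (bmp p))"
      proof (rule integral_mono)
        show "integrable M (indicator (UNIV \<times> {s}) :: _ \<Rightarrow> real)" using line M by (simp add: M.emeasure_eq_measure)
        show "integrable M (\<lambda>p. Re (bmp p))" 
          by (intro integrable_Re M.integrable_const_bound[OF AE_I2[OF bb]]) (simp add: bm measurable_cong_sets[OF M(1) refl])
        show "indicator (UNIV \<times> {s}) p \<le> Re (bmp p)" for p unfolding bmp_def by (auto simp: indicator_def)
      qed
      also have "\<dots> = Re (integral\<^sup>L M bmp)"
        by (rule integral_Re, rule M.integrable_const_bound[OF AE_I2[OF bb]]) (simp add: bm measurable_cong_sets[OF M(1) refl])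
      also have "\<dots> \<le> cmod (integral\<^sup>L M bmp)" by (rule complex_Re_le_cmod)
      also have "\<dots> \<le> C * (height (max 0 (s - 2 * \<delta>)) - height (min T (s + 2 * \<delta>)))"
        by (rule tendsto_upperbound[OF 1 2]) simp
      finally show ?thesis .
    qed
    define \<delta> where "\<delta> n = inverse (real (Suc n))" for n
    have \<delta>0: "\<delta> \<longlonglongrightarrow> 0" unfolding \<delta>_def by (rule LIMSEQ_inverse_real_of_nat)
    have lim: "(\<lambda>n. height (g (\<delta> n))) \<longlonglongrightarrow> height s" 
      if g: "continuous_on UNIV g" "g 0 = s" "\<And>x. x > 0 \<Longrightarrow> g x \<in> {0..T}" for g
    proof -
      have "(\<lambda>n. g (\<delta> n)) \<longlonglongrightarrow> g 0" using g(1) \<delta>0 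
        by (intro isCont_tendsto_compose[of _ g]) (auto simp: continuous_on_eq_continuous_at)
      thus ?thesis using continuous_on_tendsto_compose[OF height_cont, of "\<lambda>n. g (\<delta> n)" s sequentially] g s
        by (auto simp: \<delta>_def)
    qed
    have "(\<lambda>n. height (max 0 (s - 2 * \<delta> n))) \<longlonglongrightarrow> height s"
      by (rule lim[of "\<lambda>x. max 0 (s - 2 * x)"]) (use s in \<open>auto intro!: continuous_intros\<close>)
    moreover have "(\<lambda>n. height (min T (s + 2 * \<delta> n))) \<longlonglongrightarrow> height s"
      by (rule lim[of "\<lambda>x. min T (s + 2 * x)"]) (use s in \<open>auto intro!: continuous_intros\<close>)
    ultimately have "(\<lambda>n. C * (height (max 0 (s - 2 * \<delta> n)) - height (min T (s + 2 * \<delta> n)))) \<longlonglongrightarrow> C * (height s - height s)"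
      by (intro tendsto_intros)
    hence "measure M (UNIV \<times> {s}) \<le> C * (height s - height s)"
      by (rule tendsto_lowerbound) (auto intro!: always_eventually bound simp: \<delta>_def)
    thus ?thesis by (simp add: M.emeasure_eq_measure measure_le_0_iff)
  qed
  have conv_int: "(\<lambda>n. integral\<^sup>L (grid_measure (r n)) (integrand s t z)) \<longlonglongrightarrow> integral\<^sup>L M (integrand s t z)"
    if st: "0 \<le> s" "s \<le> t" "t \<le> T" and z: "Im z > 0" for s t z
  proof -
    obtain C where C: "\<And>p. cmod (integrand s t z p) \<le> C" using integrand_bound[OF z] st by metis
    show ?thesis
    proof (rule conv[OF integrand_borel[OF st z] C, of "UNIV \<times> {s} \<union> UNIV \<times> {t}"])
      show "emeasure M (UNIV \<times> {s} \<union> UNIV \<times> {t}) = 0"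
        using emeasure_Un_null_set[of "UNIV \<times> {s}" M "UNIV \<times> {t}"] null[of s] null[of t] st line M(1) by (auto simp: null_sets_def)
      show "isCont (integrand s t z) p" if "p \<notin> UNIV \<times> {s} \<union> UNIV \<times> {t}" for p
        by (rule integrand_isCont[OF st z]) (use that in \<open>auto simp: mem_Times_iff\<close>)
    qed (use line in auto)
  qed
  have drift_conv: "(\<lambda>n. complex_of_real (drift (r n) (grid m a) (grid m b))) \<longlonglongrightarrow> f (grid m a) (grid m b) z - z - integral\<^sup>L M (integrand (grid m a) (grid m b) z)"
    if ab: "a \<le> b" "b \<le> 2 ^ m" and z: "Im z > 0" for m a b z
  proof -
    have st: "0 \<le> grid m a" "grid m a \<le> grid m b" "grid m b \<le> T" using ab by (auto simp: grid_props(3,4,7))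
    have 1: "(\<lambda>n. f (grid m a) (grid m b) z - z - integral\<^sup>L (grid_measure (r n)) (integrand (grid m a) (grid m b) z))
       \<longlonglongrightarrow> f (grid m a) (grid m b) z - z - integral\<^sup>L M (integrand (grid m a) (grid m b) z)"
      by (intro tendsto_diff tendsto_const conv_int st z)
    have "\<forall>\<^sub>F n in sequentially. f (grid m a) (grid m b) z - z - integral\<^sup>L (grid_measure (r n)) (integrand (grid m a) (grid m b) z)
        = complex_of_real (drift (r n) (grid m a) (grid m b))"
      using eventually_ge_at_top[of m]
    proof eventually_elim
      case (elim n)
      hence mr: "m \<le> r n" using rge[of n] by simp
      have pw: "(2::nat) ^ r n = 2 ^ (r n - m) * 2 ^ m" using mr by (simp flip: power_add)
      have g: "grid m j = grid (r n) (j * 2 ^ (r n - m))" for j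
      proof -
        have "(2::real) ^ r n = 2 ^ (r n - m) * 2 ^ m" using mr by (simp flip: power_add)
        thus ?thesis by (simp add: grid_def)
      qed
      have b': "b * 2 ^ (r n - m) \<le> 2 ^ r n" using ab(2) unfolding pw by simp
      show ?case unfolding g using grid_equation[OF _ b' z, of "a * 2 ^ (r n - m)"] ab(1) by simp
    qed
    thus ?thesis by (rule Lim_transform_eventually[OF 1])
  qed
  define \<Psi> where "\<Psi> s t = Re (f s t \<i> - \<i> - integral\<^sup>L M (integrand s t \<i>))" for s t
  have drift_conv': "(\<lambda>n. drift (r n) (grid m a) (grid m b)) \<longlonglongrightarrow> \<Psi> (grid m a) (grid m b)" if "a \<le> b" "b \<le> 2 ^ m" for m a b
    using tendsto_Re[OF drift_conv[OF that, of \<i>]] by (simp add: \<Psi>_def)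
  show thesis
  proof (rule that[OF M null])
    fix m a b z assume ab: "a \<le> b" "b \<le> (2::nat) ^ m" and z: "Im z > 0"
    show "f (grid m a) (grid m b) z - z - integral\<^sup>L M (integrand (grid m a) (grid m b) z) = complex_of_real (\<Psi> (grid m a) (grid m b))"
      by (rule LIMSEQ_unique[OF drift_conv[OF ab z] tendsto_of_real[OF drift_conv'[OF ab]]])
  next
    fix m a b c assume abc: "a \<le> b" "b \<le> c" "c \<le> (2::nat) ^ m"
    have "(\<lambda>n. drift (r n) (grid m a) (grid m b) + drift (r n) (grid m b) (grid m c)) \<longlonglongrightarrow> \<Psi> (grid m a) (grid m b) + \<Psi> (grid m b) (grid m c)"
      by (intro tendsto_intros drift_conv') (use abc in auto)
    moreover have "drift (r n) (grid m a) (grid m b) + drift (r n) (grid m b) (grid m c) = drift (r n) (grid m a) (grid m c)" for n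
      by (rule drift_add[symmetric]) (use abc in \<open>auto simp: grid_props(3)\<close>)
    moreover have "(\<lambda>n. drift (r n) (grid m a) (grid m c)) \<longlonglongrightarrow> \<Psi> (grid m a) (grid m c)" by (rule drift_conv') (use abc in auto)
    ultimately show "\<Psi> (grid m a) (grid m c) = \<Psi> (grid m a) (grid m b) + \<Psi> (grid m b) (grid m c)"
      by (simp add: LIMSEQ_unique)
  qed
qed

text \<open>The defect E of the equation without drift is continuous in the pair of times: the kernel integral
  depends continuously on its end points by dominated convergence, as the limit measure does not
  charge them. Its properties at dyadic times, being real, independent of z and additive, therefore
  extend to all times, and an additive function of intervals is a difference of values of a function
  \<gamma>.\<close>
lemma limit_equation:
  obtains M \<gamma> where "sets M = sets borel" "finite_measure M"
    "emeasure M (- ({0..1} \<times> {0..T})) = 0" "\<And>s. 0 \<le> s \<Longrightarrow> s \<le> T \<Longrightarrow> emeasure M (UNIV \<times> {s}) = 0"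
    "continuous_on {0..T} \<gamma>" "\<gamma> 0 = 0"
    "\<And>s t z. 0 \<le> s \<Longrightarrow> s \<le> t \<Longrightarrow> t \<le> T \<Longrightarrow> Im z > 0 \<Longrightarrow> 
       f s t z = z + complex_of_real (\<gamma> s) - complex_of_real (\<gamma> t) + integral\<^sup>L M (integrand s t z)"
proof -
  obtain M \<Psi> where M: "sets M = sets borel" "finite_measure M"
    "emeasure M (- ({0..1} \<times> {0..T})) = 0" and null: "\<And>s. 0 \<le> s \<Longrightarrow> s \<le> T \<Longrightarrow> emeasure M (UNIV \<times> {s}) = 0"
    and eq: "\<And>m a b z. a \<le> b \<Longrightarrow> b \<le> 2 ^ m \<Longrightarrow> Im z > 0 \<Longrightarrow> f (grid m a) (grid m b) z - z 
        - integral\<^sup>L M (integrand (grid m a) (grid m b) z) = complex_of_real (\<Psi> (grid m a) (grid m b))"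
    and add: "\<And>m a b c. a \<le> b \<Longrightarrow> b \<le> c \<Longrightarrow> c \<le> 2 ^ m \<Longrightarrow> \<Psi> (grid m a) (grid m c) = \<Psi> (grid m a) (grid m b) + \<Psi> (grid m b) (grid m c)"
    by (rule limit_measure) blast
  interpret M: finite_measure M by (rule M)
  have Msp: "space M = UNIV" using sets_eq_imp_space_eq[OF M(1)] by simp
  have line: "UNIV \<times> {s} \<in> sets M" for s
    unfolding M(1) by (intro borel_closed closed_Times closed_UNIV closed_singleton)
  define E where "E z p = f (fst p) (snd p) z - z - integral\<^sup>L M (integrand (fst p) (snd p) z)" for z p
  have iM: "integrand s t z \<in> borel_measurable M" if "0 \<le> s" "s \<le> t" "t \<le> T" "Im z > 0" for s t z
    using integrand_borel[OF that] by (simp add: measurable_cong_sets[OF M(1) refl])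
  have Econt: "continuous_on (ordered_pairs {0..T}) (E z)" if z: "Im z > 0" for z
  proof -
    note fc = P_REF_continuous[OF ref z]
    have "continuous_on (ordered_pairs {0..T}) (\<lambda>p. integral\<^sup>L M (integrand (fst p) (snd p) z))"
      unfolding continuous_on_sequentially comp_def
    proof (intro allI ballI impI, elim conjE)
      fix x :: "nat \<Rightarrow> real \<times> real" and p
      assume p: "p \<in> ordered_pairs {0..T}" and xS: "\<forall>n. x n \<in> ordered_pairs {0..T}" and x: "x \<longlonglongrightarrow> p"
      define s t where "s = fst p" "t = snd p"
      have st: "0 \<le> s" "s \<le> t" "t \<le> T" using p by (auto simp: ordered_pairs_def s_t_def)
      have xst: "0 \<le> fst (x n)" "fst (x n) \<le> snd (x n)" "snd (x n) \<le> T" for n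
        using xS[rule_format, of n] by (auto simp: ordered_pairs_def)
      have xs: "(\<lambda>n. fst (x n)) \<longlonglongrightarrow> s" "(\<lambda>n. snd (x n)) \<longlonglongrightarrow> t" unfolding s_t_def by (intro tendsto_intros x)+
      obtain C where C: "\<And>s t p. 0 \<le> s \<Longrightarrow> s \<le> t \<Longrightarrow> t \<le> T \<Longrightarrow> cmod (integrand s t z p) \<le> C" using integrand_bound[OF z] by metis
      show "(\<lambda>n. integral\<^sup>L M (integrand (fst (x n)) (snd (x n)) z)) \<longlonglongrightarrow> integral\<^sup>L M (integrand (fst p) (snd p) z)"
        unfolding s_t_def[symmetric]
      proof (rule integral_dominated_convergence[where w = "\<lambda>_. C"])
        show "AE q in M. (\<lambda>n. integrand (fst (x n)) (snd (x n)) z q) \<longlonglongrightarrow> integrand s t z q"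
        proof -
          have "AE q in M. q \<notin> UNIV \<times> {s}" "AE q in M. q \<notin> UNIV \<times> {t}"
            using null[of s] null[of t] st line by (auto intro!: AE_not_in simp: null_sets_def)
          thus ?thesis
          proof eventually_elim
            case (elim q)
            hence q: "snd q \<noteq> s" "snd q \<noteq> t" by (auto simp: mem_Times_iff)
            have cl: "(\<lambda>n. clamp_to (fst (x n)) (snd (x n)) (snd q)) \<longlonglongrightarrow> clamp_to s t (snd q)"
              unfolding clamp_to_def by (intro tendsto_intros xs)
            have "(\<lambda>n. f (fst (clamp_to (fst (x n)) (snd (x n)) (snd q), snd (x n))) (snd (clamp_to (fst (x n)) (snd (x n)) (snd q), snd (x n))) z)
               \<longlonglongrightarrow> f (fst (clamp_to s t (snd q), t)) (snd (clamp_to s t (snd q), t)) z"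
            proof (rule continuous_on_tendsto_compose[OF fc tendsto_Pair[OF cl xs(2)]])
              show "(clamp_to s t (snd q), t) \<in> ordered_pairs {0..T}"
                using clamp_to_in[OF st(2), of "snd q"] st by (simp add: ordered_pairs_def)
              show "\<forall>\<^sub>F n in sequentially. (clamp_to (fst (x n)) (snd (x n)) (snd q), snd (x n)) \<in> ordered_pairs {0..T}"
              proof (intro always_eventually allI)
                fix n show "(clamp_to (fst (x n)) (snd (x n)) (snd q), snd (x n)) \<in> ordered_pairs {0..T}"
                  using clamp_to_in[OF xst(2)[of n], of "snd q"] xst[of n] by (simp add: ordered_pairs_def)
              qed
            qed
            hence tr: "(\<lambda>n. traj (fst (x n)) (snd (x n)) z (snd q)) \<longlonglongrightarrow> traj s t z (snd q)" by (simp add: traj_def)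
            have kc: "continuous_on upper_half_plane (\<lambda>w. circle_kernel w (fst q))"
              by (rule continuous_on_circle_kernel) (auto intro!: continuous_intros)
            have k: "(\<lambda>n. circle_kernel (traj (fst (x n)) (snd (x n)) z (snd q)) (fst q)) \<longlonglongrightarrow> circle_kernel (traj s t z (snd q)) (fst q)"
            proof (rule continuous_on_tendsto_compose[OF kc tr])
              show "traj s t z (snd q) \<in> upper_half_plane" using traj_Im[OF st z, of "snd q"] z by simp
              show "\<forall>\<^sub>F n in sequentially. traj (fst (x n)) (snd (x n)) z (snd q) \<in> upper_half_plane"
              proof (intro always_eventually allI)
                fix n show "traj (fst (x n)) (snd (x n)) z (snd q) \<in> upper_half_plane"
                  using traj_Im[OF xst[of n] z, of "snd q"] z by simp
              qed
            qed
            have "\<forall>\<^sub>F n in sequentially. (indicator {s<..t} (snd q) :: real) = indicator {fst (x n)<..snd (x n)} (snd q)"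
            proof -
              consider "snd q < s" | "s < snd q \<and> snd q < t" | "t < snd q" using q by linarith
              thus ?thesis
              proof cases
                case 1
                from order_tendstoD(1)[OF xs(1) 1] show ?thesis by eventually_elim (use 1 in \<open>auto simp: indicator_def\<close>)
              next
                case 2
                hence "\<forall>\<^sub>F n in sequentially. fst (x n) < snd q" "\<forall>\<^sub>F n in sequentially. snd q < snd (x n)"
                  using order_tendstoD xs by blast+
                thus ?thesis by eventually_elim (use 2 in \<open>auto simp: indicator_def\<close>)
              next
                case 3
                from order_tendstoD(2)[OF xs(2) 3] show ?thesis by eventually_elim (use 3 in \<open>auto simp: indicator_def\<close>)
              qed
            qed
            hence "(\<lambda>n. indicator {fst (x n)<..snd (x n)} (snd q) :: real) \<longlonglongrightarrow> indicator {s<..t} (snd q)"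
              by (intro Lim_transform_eventually[OF tendsto_const])
            thus ?case unfolding integrand_def by (intro tendsto_scaleR k)
          qed
        qed
      qed (use C st xst iM z in auto)
    qed
    thus ?thesis unfolding E_def by (intro continuous_intros fc)
  qed
  \<comment> \<open>dyadic approximation of s from below\<close>
  define dy where "dy s k = grid k (nat \<lfloor>2 ^ k * (s / T)\<rfloor>)" for s k
  have dyle: "nat \<lfloor>2 ^ k * (s / T)\<rfloor> \<le> 2 ^ k" if "s \<le> T" for s and k :: nat
  proof -
    have "s / T \<le> 1" using that T by simp
    hence "2 ^ k * (s / T) \<le> 2 ^ k * 1" by (intro mult_left_mono) auto
    hence "\<lfloor>2 ^ k * (s / T)\<rfloor> \<le> 2 ^ k" by (simp add: floor_le_iff)
    thus ?thesis by (simp add: nat_le_iff)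
  qed
  have dymono: "nat \<lfloor>2 ^ k * (s / T)\<rfloor> \<le> nat \<lfloor>2 ^ k * (t / T)\<rfloor>" if "s \<le> t" for s t and k :: nat
    using that T by (intro nat_mono floor_mono mult_left_mono divide_right_mono) auto
  have dylim: "dy s \<longlonglongrightarrow> s" if s: "0 \<le> s" for s
  proof (rule tendsto_sandwich[of "\<lambda>k. s - T * (1 / 2) ^ k" _ _ "\<lambda>_. s"])
    have "s - T * (1 / 2) ^ k \<le> dy s k \<and> dy s k \<le> s" for k
    proof -
      define y where "y = 2 ^ k * (s / T)"
      have y0: "y \<ge> 0" using s T by (simp add: y_def)
      have sy: "s = T / 2 ^ k * y" using T by (simp add: y_def)
      have "y - 1 \<le> real (nat \<lfloor>y\<rfloor>)" "real (nat \<lfloor>y\<rfloor>) \<le> y" using y0 by linarith+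
      from this[THEN mult_left_mono, of "T / 2 ^ k"] show ?thesis
        using T unfolding dy_def y_def[symmetric] grid_def by (subst (1 2) sy) (simp add: power_one_over right_diff_distrib)
    qed
    thus "\<forall>\<^sub>F k in sequentially. s - T * (1 / 2) ^ k \<le> dy s k" "\<forall>\<^sub>F k in sequentially. dy s k \<le> s" by auto
    have "(\<lambda>k. s - T * (1 / 2) ^ k) \<longlonglongrightarrow> s - T * 0" by (intro tendsto_intros) auto
    thus "(\<lambda>k. s - T * (1 / 2) ^ k) \<longlonglongrightarrow> s" by simp
  qed auto
  have Elim: "(\<lambda>k. E z (dy s k, dy t k)) \<longlonglongrightarrow> E z (s, t)" if st: "0 \<le> s" "s \<le> t" "t \<le> T" and z: "Im z > 0" for s t z
  proof (rule continuous_on_tendsto_compose[OF Econt[OF z]])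
    show "(\<lambda>k. (dy s k, dy t k)) \<longlonglongrightarrow> (s, t)" by (intro tendsto_Pair dylim) (use st in auto)
    show "(s, t) \<in> ordered_pairs {0..T}" using st by (simp add: ordered_pairs_def)
    show "\<forall>\<^sub>F k in sequentially. (dy s k, dy t k) \<in> ordered_pairs {0..T}"
    proof (intro always_eventually allI)
      fix k
      have "dy s k \<le> dy t k" "0 \<le> dy s k" "dy t k \<le> T" 
        unfolding dy_def using dymono[OF st(2), of k] dyle[OF st(3), of k] by (simp_all add: grid_props(4,5,7))
      thus "(dy s k, dy t k) \<in> ordered_pairs {0..T}" by (simp add: ordered_pairs_def)
    qed
  qed
  have Edy: "E z (dy s k, dy t k) = of_real (\<Psi> (dy s k) (dy t k))" if "s \<le> t" "t \<le> T" "Im z > 0" for s t z k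
    unfolding E_def dy_def fst_conv snd_conv by (rule eq) (use that dymono dyle in auto)
  have \<Psi>lim: "(\<lambda>k. \<Psi> (dy s k) (dy t k)) \<longlonglongrightarrow> Re (E \<i> (s, t))" if "0 \<le> s" "s \<le> t" "t \<le> T" for s t
    using tendsto_Re[OF Elim[OF that, of \<i>]] Edy[OF that(2,3), of \<i>] by simp
  have Ez: "E z (s, t) = of_real (Re (E \<i> (s, t)))" if st: "0 \<le> s" "s \<le> t" "t \<le> T" and z: "Im z > 0" for s t z
  proof (rule LIMSEQ_unique[OF Elim[OF st z]])
    show "(\<lambda>k. E z (dy s k, dy t k)) \<longlonglongrightarrow> of_real (Re (E \<i> (s, t)))"
      unfolding Edy[OF st(2,3) z] by (intro tendsto_of_real \<Psi>lim st)
  qed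
  have Eadd: "Re (E \<i> (s, u)) = Re (E \<i> (s, t)) + Re (E \<i> (t, u))" if stu: "0 \<le> s" "s \<le> t" "t \<le> u" "u \<le> T" for s t u
  proof (rule LIMSEQ_unique)
    show "(\<lambda>k. \<Psi> (dy s k) (dy u k)) \<longlonglongrightarrow> Re (E \<i> (s, u))" by (rule \<Psi>lim) (use stu in auto)
    have "\<Psi> (dy s k) (dy u k) = \<Psi> (dy s k) (dy t k) + \<Psi> (dy t k) (dy u k)" for k
      unfolding dy_def by (rule add) (use stu dymono dyle in auto)
    moreover have "(\<lambda>k. \<Psi> (dy s k) (dy t k) + \<Psi> (dy t k) (dy u k)) \<longlonglongrightarrow> Re (E \<i> (s, t)) + Re (E \<i> (t, u))"
      by (intro tendsto_add \<Psi>lim) (use stu in auto)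
    ultimately show "(\<lambda>k. \<Psi> (dy s k) (dy u k)) \<longlonglongrightarrow> Re (E \<i> (s, t)) + Re (E \<i> (t, u))" by simp
  qed
  define \<gamma> where "\<gamma> t = - Re (E \<i> (0, t))" for t
  show thesis
  proof (rule that[OF M null, of \<gamma>])
    have "continuous_on {0..T} (\<lambda>t. E \<i> (0, t))"
      by (rule continuous_on_compose2[OF Econt]) (auto intro!: continuous_intros simp: ordered_pairs_def)
    thus "continuous_on {0..T} \<gamma>" unfolding \<gamma>_def by (intro continuous_intros)
    show "\<gamma> 0 = 0" using Eadd[of 0 0 0] T by (simp add: \<gamma>_def)
    fix s t :: real and z assume st: "0 \<le> s" "s \<le> t" "t \<le> T" and z: "Im z > 0"
    have "E z (s, t) = of_real (\<gamma> s) - of_real (\<gamma> t)"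
      using Eadd[of 0 s t] st by (simp add: Ez[OF st z] \<gamma>_def)
    thus "f s t z = z + complex_of_real (\<gamma> s) - complex_of_real (\<gamma> t) + integral\<^sup>L M (integrand s t z)"
      by (simp add: E_def algebra_simps)
  qed
qed

text \<open>It remains to move the limit measure from the circle to the line by x = - cot (\<pi> u). The points
  u = 0 and u = 1 at infinity are null: there the kernel is w itself, whose imaginary part is at least
  y on trajectories that start at iy, so that mass m at infinity would force Im f(iy) \<ge> (1 + m) y
  and contradict f(iy)/(iy) \<longlongrightarrow> 1.\<close>
theorem exists_generating_pair:
  "\<exists>\<gamma> H. generating_pair {0..T} \<gamma> H \<and> satisfies_integral_equation {0..T} f \<gamma> H"
proof -
  obtain M \<gamma> where M: "sets M = sets borel" "finite_measure M" "emeasure M (- ({0..1} \<times> {0..T})) = 0" 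
    and null: "\<And>s. 0 \<le> s \<Longrightarrow> s \<le> T \<Longrightarrow> emeasure M (UNIV \<times> {s}) = 0"
    and \<gamma>: "continuous_on {0..T} \<gamma>" "\<gamma> 0 = 0"
    and eq: "\<And>s t z. 0 \<le> s \<Longrightarrow> s \<le> t \<Longrightarrow> t \<le> T \<Longrightarrow> Im z > 0 \<Longrightarrow> 
       f s t z = z + complex_of_real (\<gamma> s) - complex_of_real (\<gamma> t) + integral\<^sup>L M (integrand s t z)"
    by (rule limit_equation) blast
  interpret M: finite_measure M by (rule M)
  have Msp: "space M = UNIV" using sets_eq_imp_space_eq[OF M(1)] by simp
  have Mm: "g \<in> measurable M N \<longleftrightarrow> g \<in> measurable borel N" for g :: "real \<times> real \<Rightarrow> 'c" and N 
    by (simp only: measurable_cong_sets[OF M(1) refl])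
  have line: "UNIV \<times> {s} \<in> sets M" for s
    unfolding M(1) by (intro borel_closed closed_Times closed_UNIV closed_singleton)
  have iM: "integrable M (integrand s t z)" if h: "0 \<le> s" "s \<le> t" "t \<le> T" "Im z > 0" for s t z
  proof -
    obtain C where C: "\<And>p. cmod (integrand s t z p) \<le> C" using integrand_bound[OF h(4)] h by metis
    show ?thesis by (rule M.integrable_const_bound[OF AE_I2[OF C]]) (simp add: Mm integrand_borel[OF h])
  qed
  \<comment> \<open>the points at infinity; time 0 is left out because the integrand is zero there\<close>
  define Bd where "Bd = {0, 1 :: real} \<times> {0<..T}"
  have Bdm: "Bd \<in> sets M" unfolding M(1) Bd_def borel_prod[symmetric] by (intro pair_measureI) auto
  have Bd0: "measure M Bd \<le> 0"
  proof -
    define y where "y n = \<i> * of_nat (Suc n)" for n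
    have yi: "Im (y n) > 0" "Im (y n) = real (Suc n)" for n by (simp_all add: y_def)
    have "measure M Bd \<le> Re (f 0 T (y n) / y n) - 1" for n
    proof -
      have st: "0 \<le> (0::real)" "0 \<le> T" "T \<le> T" using T by auto
      have "real (Suc n) * measure M Bd = (LINT p|M. real (Suc n) * indicator Bd p)" 
        using Bdm by (simp add: M.emeasure_eq_measure Msp)
      also have "\<dots> \<le> (LINT p|M. Im (integrand 0 T (y n) p))"
      proof (rule integral_mono)
        show "integrable M (\<lambda>p. real (Suc n) * indicator Bd p)" using Bdm by (intro integrable_mult_right) (simp add: M.emeasure_eq_measure)
        show "integrable M (\<lambda>p. Im (integrand 0 T (y n) p))" by (intro integrable_Im iM st yi)
        fix p :: "real \<times> real"
        show "real (Suc n) * indicator Bd p \<le> Im (integrand 0 T (y n) p)"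
        proof (cases "p \<in> Bd")
          case True
          hence "fst p = 0 \<or> fst p = 1" "snd p \<in> {0<..T}" by (auto simp: Bd_def)
          thus ?thesis using True traj_Im[OF st yi(1)[of n], of "snd p"] yi(2)[of n]
            by (auto simp: integrand_def circle_kernel_01)
        next
          case False
          have "0 \<le> Im (circle_kernel (traj 0 T (y n) (snd p)) (fst p))"
            by (intro less_imp_le Im_circle_kernel_pos) (use traj_Im[OF st yi(1)[of n], of "snd p"] yi(1)[of n] in simp)
          thus ?thesis using False by (simp add: integrand_def indicator_def)
        qed
      qed
      also have "\<dots> = Im (integral\<^sup>L M (integrand 0 T (y n)))" by (intro integral_Im iM st yi)
      also have "\<dots> = Im (f 0 T (y n)) - real (Suc n)" unfolding eq[OF st yi(1)] by (simp add: yi(2))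
      also have "\<dots> = real (Suc n) * (Re (f 0 T (y n) / y n) - 1)"
      proof -
        have "f 0 T (y n) / y n = - \<i> * f 0 T (y n) / of_real (real (Suc n))" by (simp add: y_def field_simps del: of_nat_Suc)
        hence "Re (f 0 T (y n) / y n) = Im (f 0 T (y n)) / real (Suc n)" by (simp only: Re_divide_of_real) simp
        thus ?thesis by (simp add: right_diff_distrib del: of_nat_Suc)
      qed
      finally show ?thesis by (simp del: of_nat_Suc)
    qed
    moreover have "(\<lambda>n. Re (f 0 T (y n) / y n) - 1) \<longlonglongrightarrow> Re 1 - 1"
      unfolding y_def by (intro tendsto_intros class_P_asymp P_REF_props(3)[OF ref]) (use T in auto)
    ultimately show ?thesis by (intro tendsto_lowerbound[of "\<lambda>n. Re (f 0 T (y n) / y n) - 1" _ sequentially]) auto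
  qed
  have AE1: "AE p in M. 0 < fst p \<and> fst p < 1 \<and> 0 < snd p \<and> snd p \<le> T"
  proof -
    have "AE p in M. p \<notin> Bd" using Bd0 Bdm by (intro AE_not_in) (simp add: null_sets_def M.emeasure_eq_measure measure_le_0_iff)
    moreover have "AE p in M. p \<notin> UNIV \<times> {0}" using null[of 0] T line by (intro AE_not_in) (simp add: null_sets_def)
    moreover have "- ({0..1} \<times> {0..T}) \<in> sets M" unfolding M(1) 
      by (intro borel_open open_Compl closed_Times closed_atLeastAtMost)
    hence "AE p in M. p \<notin> - ({0..1} \<times> {0..T})" using M(3) by (intro AE_not_in) (simp add: null_sets_def)
    ultimately show ?thesis
    proof eventually_elim
      case (elim p)
      have 1: "0 \<le> fst p" "fst p \<le> 1" "0 \<le> snd p" "snd p \<le> T" using elim(3) by (auto simp: mem_Times_iff)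
      have 2: "snd p \<noteq> 0" using elim(2) by (auto simp: mem_Times_iff)
      have "fst p \<noteq> 0" "fst p \<noteq> 1" using elim(1) 1 2 by (auto simp: Bd_def mem_Times_iff)
      with 1 2 show ?case by auto
    qed
  qed
  define N where "N = restrict_space borel (UNIV \<times> {0..T} :: (real \<times> real) set)"
  \<comment> \<open>the time is clamped so that all values lie in the strip\<close>
  define \<phi> where "\<phi> p = (- cot (pi * fst p), clamp_to 0 T (snd p))" for p :: "real \<times> real"
  have \<phi>M: "\<phi> \<in> measurable M N" unfolding Mm N_def
  proof (rule measurable_restrict_space2)
    show "\<phi> \<in> space borel \<rightarrow> UNIV \<times> {0..T}" using clamp_to_in[of 0 T] T by (auto simp: \<phi>_def)
    show "\<phi> \<in> borel_measurable borel" unfolding \<phi>_def[abs_def] cot_def clamp_to_def by (intro borel_measurable_Pair) measurable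
  qed
  define H where "H = distr M N \<phi>"
  have Hsets: "sets H = sets N" by (simp add: H_def)
  have Nspace: "space N = UNIV \<times> {0..T}" by (simp add: N_def space_restrict_space)
  have Nsets: "UNIV \<times> A \<in> sets N" if "A \<in> sets borel" "A \<subseteq> {0..T}" for A
  proof -
    have "UNIV \<times> A \<in> sets (borel :: (real \<times> real) measure)" unfolding borel_prod[symmetric] using that by (intro pair_measureI) auto
    moreover have "UNIV \<times> {0..T} \<in> sets (borel :: (real \<times> real) measure)" unfolding borel_prod[symmetric] by (intro pair_measureI) auto
    ultimately show ?thesis unfolding N_def using that by (subst sets_restrict_space_iff) auto
  qed
  have gp: "generating_pair {0..T} \<gamma> H"
    unfolding generating_pair_def
  proof (intro conjI ballI \<gamma>)
    show "sets H = sets (restrict_space borel (UNIV \<times> {0..T}))" unfolding Hsets N_def ..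
    fix t assume t: "t \<in> {0..T}"
    have fin: "finite_measure H" unfolding H_def by (rule M.finite_measure_distr[OF \<phi>M])
    show "emeasure H (UNIV \<times> {0..t}) < \<infinity>" using finite_measure.emeasure_finite[OF fin] by (simp add: less_top)
    have "emeasure H (UNIV \<times> {t}) = emeasure M (\<phi> -` (UNIV \<times> {t}) \<inter> space M)"
      unfolding H_def by (rule emeasure_distr[OF \<phi>M Nsets]) (use t in auto)
    also have "\<dots> = 0"
    proof -
      have "AE p in M. p \<notin> UNIV \<times> {t}" using null[of t] t line by (intro AE_not_in) (simp add: null_sets_def)
      with AE1 have "AE p in M. p \<notin> \<phi> -` (UNIV \<times> {t}) \<inter> space M"
      proof eventually_elim
        case (elim p)
        thus ?case by (auto simp: \<phi>_def clamp_to_id mem_Times_iff)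
      qed
      moreover have "\<phi> -` (UNIV \<times> {t}) \<inter> space M \<in> sets M" by (rule measurable_sets[OF \<phi>M Nsets]) (use t in auto)
      ultimately show ?thesis by (subst (asm) AE_iff_measurable[where N="\<phi> -` (UNIV \<times> {t}) \<inter> space M"]) auto
    qed
    finally show "emeasure H (UNIV \<times> {t}) = 0" .
  qed
  moreover have "satisfies_integral_equation {0..T} f \<gamma> H"
    unfolding satisfies_integral_equation_def integrand_eq_pick_kernel
  proof (intro ballI impI)
    fix s t z assume "s \<in> {0..T}" "t \<in> {0..T}" and st0: "s \<le> t" and "z \<in> upper_half_plane"
    hence st: "0 \<le> s" "s \<le> t" "t \<le> T" and z: "Im z > 0" by auto
    define k where "k p = indicator {s..t} (snd p) *\<^sub>R pick_kernel (traj s t z (snd p)) (fst p)" for p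
    have keq: "indicator (UNIV \<times> {s..t}) p *\<^sub>R pick_kernel (f (snd p) t z) (fst p) = k p" for p
      by (cases "snd p \<in> {s..t}") (auto simp: k_def traj_def clamp_to_id indicator_def mem_Times_iff)
    have "continuous_on UNIV (\<lambda>p. pick_kernel (traj s t z (snd p)) (fst p))"
    proof (rule continuous_on_pick_kernel)
      show "continuous_on UNIV (\<lambda>p :: real \<times> real. traj s t z (snd p))"
        by (rule continuous_on_compose2[OF traj_cont[OF st z]]) (auto intro!: continuous_intros)
    qed (use traj_Im[OF st z] z in \<open>auto intro!: continuous_intros intro: order_less_le_trans\<close>)
    note borel_measurable_continuous_onI[OF this, measurable]
    have kb: "k \<in> borel_measurable borel" unfolding k_def[abs_def] by measurable
    have kN: "k \<in> borel_measurable N" unfolding N_def by (rule measurable_restrict_space1[OF kb])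
    have AEk: "AE p in M. integrand s t z p = k (\<phi> p)"
    proof -
      have "AE p in M. p \<notin> UNIV \<times> {s}" using null[of s] st line by (intro AE_not_in) (simp add: null_sets_def)
      with AE1 show ?thesis
      proof eventually_elim
        case (elim p)
        have "snd p \<noteq> s" using elim by (auto simp: mem_Times_iff)
        hence "(indicator {s..t} (snd p) :: real) = indicator {s<..t} (snd p)" by (auto simp: indicator_def)
        thus ?case using elim by (simp add: k_def integrand_def \<phi>_def clamp_to_id circle_kernel_eq_pick)
      qed
    qed
    have k\<phi>: "(\<lambda>p. k (\<phi> p)) \<in> borel_measurable M" using measurable_compose[OF \<phi>M kN] .
    have int: "integrable M (\<lambda>p. k (\<phi> p))"
      by (rule integrable_cong_AE_imp[OF iM[OF st z] k\<phi>]) (use AEk in eventually_elim, simp)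
    have "integrable H k" unfolding H_def by (subst integrable_distr_eq[OF \<phi>M kN]) (rule int)
    moreover have "integral\<^sup>L H k = integral\<^sup>L M (integrand s t z)"
      unfolding H_def integral_distr[OF \<phi>M kN]
      by (rule integral_cong_AE[OF k\<phi>]) (use AEk iM[OF st z] in \<open>auto elim: eventually_mono\<close>)
    ultimately show "set_integrable H (UNIV \<times> {s..t}) (\<lambda>p. pick_kernel (f (snd p) t z) (fst p)) \<and>
       f s t z = z + complex_of_real (\<gamma> s) - complex_of_real (\<gamma> t) +
          set_lebesgue_integral H (UNIV \<times> {s..t}) (\<lambda>p. pick_kernel (f (snd p) t z) (fst p))"
      unfolding set_integrable_def set_lebesgue_integral_def keq using eq[OF st z] by simp
  qed
  ultimately show ?thesis by blast
qed

end

section \<open>Time intervals and integration over strips\<close>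

lemma time_interval_facts:
  assumes "time_interval I"
  shows "0 \<in> I" "t \<in> I \<Longrightarrow> 0 \<le> t" "t \<in> I \<Longrightarrow> 0 \<le> s \<Longrightarrow> s \<le> t \<Longrightarrow> s \<in> I"
proof -
  have tr: "ereal s < T0" if "s \<le> t" "ereal t < T0" for s t T0
    using that by (meson ereal_less_eq(3) order_le_less_trans)
  show "0 \<in> I" "t \<in> I \<Longrightarrow> 0 \<le> t" "t \<in> I \<Longrightarrow> 0 \<le> s \<Longrightarrow> s \<le> t \<Longrightarrow> s \<in> I"
    using assms unfolding time_interval_def by (auto intro: tr simp: zero_ereal_def[symmetric])
qed

text \<open>For local questions at t, the interval I may be replaced by a compact one.\<close>
lemma time_interval_bound:
  assumes "time_interval I" "t \<in> I"
  obtains T \<delta> where "T \<in> I" "0 < T" "t \<le> T" "\<delta> > 0" "\<And>t'. t' \<in> I \<Longrightarrow> \<bar>t' - t\<bar> < \<delta> \<Longrightarrow> t' \<le> T"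
  using assms(1) unfolding time_interval_def
proof
  assume "\<exists>T0::ereal. 0 < T0 \<and> I = {t. 0 \<le> t \<and> ereal t < T0}"
  then obtain T0 :: ereal where T0: "0 < T0" and I: "I = {t. 0 \<le> t \<and> ereal t < T0}" by blast
  have t: "0 \<le> t" "ereal t < T0" using assms I by auto
  then obtain T where T: "ereal t < ereal T" "ereal T < T0" using ereal_dense2 by blast
  show thesis by (rule that[of T "T - t"]) (use T t I in auto)
next
  assume "\<exists>T0::real. 0 < T0 \<and> I = {0..T0}"
  then obtain T0 where "0 < T0" "I = {0..T0}" by blast
  thus thesis using assms by (intro that[of T0 1]) auto
qed

lemma time_interval_exhaust:
  assumes "time_interval I"
  obtains T :: "nat \<Rightarrow> real" where "incseq T" "\<And>k. T k \<in> I" "\<And>k. 0 < T k" "\<And>t. t \<in> I \<Longrightarrow> \<exists>k. t \<le> T k"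
  using assms unfolding time_interval_def
proof
  assume "\<exists>T0::ereal. 0 < T0 \<and> I = {t. 0 \<le> t \<and> ereal t < T0}"
  then obtain T0 :: ereal where T0: "0 < T0" and I: "I = {t. 0 \<le> t \<and> ereal t < T0}" by blast
  show thesis
  proof (cases T0)
    case (real c)
    hence c: "c > 0" using T0 by simp
    have q: "(\<lambda>k. c - c * inverse (real (Suc (Suc k)))) \<longlonglongrightarrow> c - c * 0"
      by (intro tendsto_intros LIMSEQ_Suc[OF LIMSEQ_inverse_real_of_nat])
    show thesis
    proof (rule that[of "\<lambda>k. c - c * inverse (real (Suc (Suc k)))"])
      show "incseq (\<lambda>k. c - c * inverse (real (Suc (Suc k))))" 
        by (intro incseq_SucI diff_left_mono mult_left_mono le_imp_inverse_le) (use c in auto)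
      fix k
      have "inverse (real (Suc (Suc k))) < 1" by (simp add: field_simps)
      hence "c * inverse (real (Suc (Suc k))) < c * 1" using c by (intro mult_strict_left_mono) auto
      thus p: "0 < c - c * inverse (real (Suc (Suc k)))" by simp
      thus "c - c * inverse (real (Suc (Suc k))) \<in> I" using c by (simp add: I real)
    next
      fix t assume "t \<in> I"
      hence "t < c - c * 0" by (simp add: I real)
      from order_tendstoD(1)[OF q this] show "\<exists>k. t \<le> c - c * inverse (real (Suc (Suc k)))"
        by (auto simp: eventually_sequentially intro: less_imp_le)
    qed
  next
    case PInf
    show thesis
    proof (rule that[of "\<lambda>k. real (Suc k)"])
      show "\<exists>k. t \<le> real (Suc k)" for t using real_arch_simple[of t] by (metis le_SucI of_nat_le_iff order_trans order_refl)
    qed (auto simp: I PInf incseq_def)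
  qed (use T0 in auto)
next
  assume "\<exists>T0::real. 0 < T0 \<and> I = {0..T0}"
  then obtain T0 where "0 < T0" "I = {0..T0}" by blast
  thus thesis by (intro that[of "\<lambda>_. T0"]) (auto simp: incseq_def)
qed

lemma time_interval_Icc: "0 < T \<Longrightarrow> time_interval {0..T}"
  unfolding time_interval_def by blast

locale strip =
  fixes I :: "real set" and \<gamma> :: "real \<Rightarrow> real" and H :: "(real \<times> real) measure"
  assumes I: "time_interval I" and gp: "generating_pair I \<gamma> H"
begin

lemma sets_H: "sets H = sets (restrict_space borel (UNIV \<times> I))"
  using gp by (simp add: generating_pair_def)

lemma space_H: "space H = UNIV \<times> I"
  using sets_eq_imp_space_eq[OF sets_H] by (simp add: space_restrict_space)

lemma strip_sets: assumes "B \<in> sets borel" "A \<in> sets borel" "A \<subseteq> I" shows "B \<times> A \<in> sets H"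
proof -
  have "B \<times> A \<in> sets (borel :: (real \<times> real) measure)" unfolding borel_prod[symmetric] using assms by (intro pair_measureI) auto
  moreover have "B \<times> A = (UNIV \<times> I) \<inter> B \<times> A" using assms by auto
  ultimately show ?thesis unfolding sets_H sets_restrict_space by blast
qed

lemma borel_measurable_H: "g \<in> measurable borel N \<Longrightarrow> g \<in> measurable H N"
  unfolding measurable_cong_sets[OF sets_H refl] by (rule measurable_restrict_space1)

lemma Icc_sub: "t \<in> I \<Longrightarrow> 0 \<le> s \<Longrightarrow> {s..t} \<subseteq> I"
  by (intro subsetI, rule time_interval_facts(3)[OF I, of t]) auto

lemma Icc_sets: "t \<in> I \<Longrightarrow> 0 \<le> s \<Longrightarrow> UNIV \<times> {s..t} \<in> sets H"
  by (intro strip_sets Icc_sub) auto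

lemma Icc_fin: assumes "t \<in> I" "0 \<le> s" shows "emeasure H (UNIV \<times> {s..t}) < \<infinity>"
proof -
  have "emeasure H (UNIV \<times> {s..t}) \<le> emeasure H (UNIV \<times> {0..t})"
    by (intro emeasure_mono Icc_sets) (use assms in auto)
  also have "\<dots> < \<infinity>" using gp assms by (simp add: generating_pair_def)
  finally show ?thesis .
qed

lemma line_null: "t \<in> I \<Longrightarrow> UNIV \<times> {t} \<in> null_sets H"
  using gp strip_sets[of UNIV "{t}"] by (auto simp: generating_pair_def null_sets_def)

lemma strip_integrable:
  fixes g :: "real \<times> real \<Rightarrow> 'b :: {banach, second_countable_topology}"
  assumes "t \<in> I" "0 \<le> s" "g \<in> borel_measurable borel" "\<And>p. snd p \<in> {s..t} \<Longrightarrow> norm (g p) \<le> C"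
  shows "set_integrable H (UNIV \<times> {s..t}) g"
  unfolding set_integrable_def
proof (rule integrableI_bounded_set[where A = "UNIV \<times> {s..t}" and B = C])
  show "UNIV \<times> {s..t} \<in> sets H" by (rule Icc_sets[OF assms(1,2)])
  show "(\<lambda>x. indicator (UNIV \<times> {s..t}) x *\<^sub>R g x) \<in> borel_measurable H"
    using Icc_sets[OF assms(1,2)] borel_measurable_H[OF assms(3)] by (intro borel_measurable_scaleR borel_measurable_indicator)
  show "emeasure H (UNIV \<times> {s..t}) < \<infinity>" by (rule Icc_fin[OF assms(1,2)])
qed (use assms(4) in \<open>auto intro!: AE_I2 simp: indicator_def mem_Times_iff\<close>)

definition mass :: "real \<Rightarrow> real \<Rightarrow> real" where "mass s t = measure H (UNIV \<times> {s..t})"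

lemma mass_nonneg [simp]: "0 \<le> mass s t" by (simp add: mass_def)

lemma strip_split:
  fixes g :: "real \<times> real \<Rightarrow> 'b :: {banach, second_countable_topology}"
  assumes "0 \<le> s" "s \<le> t" "t \<le> u" "u \<in> I" "set_integrable H (UNIV \<times> {s..u}) g"
  shows "set_lebesgue_integral H (UNIV \<times> {s..u}) g = set_lebesgue_integral H (UNIV \<times> {s..t}) g + set_lebesgue_integral H (UNIV \<times> {t..u}) g"
proof -
  have t: "t \<in> I" by (rule time_interval_facts(3)[OF I, of u]) (use assms in auto)
  have e: "UNIV \<times> {s..u} = UNIV \<times> {s..t} \<union> UNIV \<times> {t..u}" using assms by auto
  have sub: "UNIV \<times> {s..t} \<in> sets H" "UNIV \<times> {t..u} \<in> sets H" using assms t by (auto intro!: Icc_sets)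
  show ?thesis unfolding e
  proof (rule set_integral_Un_AE[OF _ sub])
    have "AE p in H. p \<notin> UNIV \<times> {t}" by (rule AE_not_in[OF line_null[OF t]])
    thus "AE p in H. \<not> (p \<in> UNIV \<times> {s..t} \<and> p \<in> UNIV \<times> {t..u})" by eventually_elim auto
    show "set_integrable H (UNIV \<times> {s..t}) g" by (rule set_integrable_subset[OF assms(5) sub(1)]) (use assms in auto)
    show "set_integrable H (UNIV \<times> {t..u}) g" by (rule set_integrable_subset[OF assms(5) sub(2)]) (use assms in auto)
  qed
qed

lemma mass_eq: assumes "t \<in> I" "0 \<le> s" shows "mass s t = set_lebesgue_integral H (UNIV \<times> {s..t}) (\<lambda>_. 1)"
proof -
  have "UNIV \<times> {s..t} \<inter> space H = UNIV \<times> {s..t}" unfolding space_H using Icc_sub[OF assms] by auto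
  thus ?thesis by (simp add: set_lebesgue_integral_def mass_def)
qed

lemma mass_add: assumes "0 \<le> s" "s \<le> t" "t \<le> u" "u \<in> I" shows "mass s u = mass s t + mass t u"
proof -
  have t: "t \<in> I" by (rule time_interval_facts(3)[OF I, of u]) (use assms in auto)
  have "set_integrable H (UNIV \<times> {s..u}) (\<lambda>_. 1 :: real)" using assms by (intro strip_integrable[where C = 1]) auto
  from strip_split[OF assms this] show ?thesis using assms t by (simp add: mass_eq)
qed

lemma strip_norm_le:
  fixes g :: "real \<times> real \<Rightarrow> 'b :: {banach, second_countable_topology}"
  assumes "t \<in> I" "0 \<le> s" "set_integrable H (UNIV \<times> {s..t}) g" "\<And>p. snd p \<in> {s..t} \<Longrightarrow> norm (g p) \<le> C"
  shows "norm (set_lebesgue_integral H (UNIV \<times> {s..t}) g) \<le> C * mass s t"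
proof -
  have "norm (set_lebesgue_integral H (UNIV \<times> {s..t}) g) \<le> (LINT p|H. C * indicator (UNIV \<times> {s..t}) p)"
    unfolding set_lebesgue_integral_def
  proof (rule Bochner_Integration.integral_norm_bound_integral)
    show "integrable H (\<lambda>p. C * indicator (UNIV \<times> {s..t}) p)"
      using Icc_sets[OF assms(1,2)] Icc_fin[OF assms(1,2)] by (intro integrable_mult_right) (simp add: less_top)
  qed (use assms(3,4) in \<open>auto simp: set_integrable_def indicator_def mem_Times_iff\<close>)
  also have "\<dots> = C * mass s t"
  proof -
    have "UNIV \<times> {s..t} \<inter> space H = UNIV \<times> {s..t}" unfolding space_H using Icc_sub[OF assms(1,2)] by auto
    thus ?thesis by (simp add: mass_def)
  qed
  finally show ?thesis .
qed

lemma pick_strip_integrable: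
  assumes "t \<in> I" "0 \<le> s" "Im z > 0"
  shows "set_integrable H (UNIV \<times> {s..t}) (\<lambda>p. pick_kernel z (fst p))"
  by (rule strip_integrable[where C = "hsize z", OF assms(1,2)])
     (auto intro!: borel_measurable_continuous_onI continuous_on_pick_kernel continuous_intros pick_kernel_le assms)

end

section \<open>Uniqueness in the Nevanlinna representation\<close>

lemma arctan_lipschitz: "\<bar>arctan a - arctan b\<bar> \<le> \<bar>a - b\<bar>"
proof -
  have "norm (arctan a - arctan b) \<le> 1 * norm (a - b)"
  proof (rule field_differentiable_bound[of UNIV arctan "\<lambda>x. inverse (1 + x\<^sup>2)"])
    show "(arctan has_field_derivative inverse (1 + x\<^sup>2)) (at x within UNIV)" for x :: real by (rule DERIV_arctan)
    show "norm (inverse (1 + x\<^sup>2)) \<le> 1" for x :: real by (simp add: inverse_le_1_iff)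
  qed auto
  thus ?thesis by simp
qed

text \<open>The derivative is the Poisson integral of the measure at height y. An explicit primitive of the
  Poisson kernel replaces the exchange of two integrals in Stieltjes inversion.\<close>
lemma arctan_integral_deriv:
  assumes fin: "finite_measure \<rho>" and sets: "sets \<rho> = sets borel" and y: "y > 0"
  shows "((\<lambda>b. LINT x|\<rho>. arctan ((b - x) / y)) has_real_derivative (LINT x|\<rho>. (1 / y) * inverse (1 + ((b - x) / y)\<^sup>2))) (at b)"
proof -
  interpret finite_measure \<rho> by (rule fin)
  note sets[measurable_cong]
  define A where "A b = (LINT x|\<rho>. arctan ((b - x) / y))" for b
  have int: "integrable \<rho> (\<lambda>x. arctan ((b - x) / y))" for b
    by (rule integrable_const_bound[where B = "pi/2"]) 
       (use arctan_bounded in \<open>auto intro!: AE_I2 abs_leI less_imp_le simp: minus_less_iff, (smt (verit))?\<close>)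
  have "((\<lambda>h. (A (b + h) - A b) / h) \<longlongrightarrow> (LINT x|\<rho>. (1 / y) * inverse (1 + ((b - x) / y)\<^sup>2))) (at 0)"
    unfolding tendsto_at_iff_sequentially comp_def
  proof (intro allI impI)
    fix X :: "nat \<Rightarrow> real"
    assume X0: "\<forall>i. X i \<in> UNIV - {0}" and X: "X \<longlonglongrightarrow> 0"
    have "(\<lambda>n. LINT x|\<rho>. (arctan ((b + X n - x) / y) - arctan ((b - x) / y)) / X n) \<longlonglongrightarrow> (LINT x|\<rho>. (1 / y) * inverse (1 + ((b - x) / y)\<^sup>2))"
    proof (rule integral_dominated_convergence[where w = "\<lambda>_. 1 / y"])
      show "AE x in \<rho>. (\<lambda>n. (arctan ((b + X n - x) / y) - arctan ((b - x) / y)) / X n) \<longlonglongrightarrow> (1 / y) * inverse (1 + ((b - x) / y)\<^sup>2)"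
      proof (rule AE_I2)
        fix x
        have "((\<lambda>b. arctan ((b - x) / y)) has_real_derivative (1 / y) * inverse (1 + ((b - x) / y)\<^sup>2)) (at b)"
          using y by (auto intro!: derivative_eq_intros simp: divide_inverse)
        hence "((\<lambda>h. (arctan ((b + h - x) / y) - arctan ((b - x) / y)) / h) \<longlongrightarrow> (1 / y) * inverse (1 + ((b - x) / y)\<^sup>2)) (at 0)"
          by (simp add: DERIV_def)
        thus "(\<lambda>n. (arctan ((b + X n - x) / y) - arctan ((b - x) / y)) / X n) \<longlonglongrightarrow> (1 / y) * inverse (1 + ((b - x) / y)\<^sup>2)"
          using X0 X unfolding tendsto_at_iff_sequentially comp_def by blast
      qed
      show "AE x in \<rho>. norm ((arctan ((b + X n - x) / y) - arctan ((b - x) / y)) / X n) \<le> 1 / y" for n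
      proof (rule AE_I2)
        fix x
        have xn: "X n \<noteq> 0" using X0 by auto
        have "\<bar>arctan ((b + X n - x) / y) - arctan ((b - x) / y)\<bar> \<le> \<bar>(b + X n - x) / y - (b - x) / y\<bar>" by (rule arctan_lipschitz)
        also have "(b + X n - x) / y - (b - x) / y = X n / y" by (simp add: diff_divide_distrib[symmetric])
        finally have "\<bar>arctan ((b + X n - x) / y) - arctan ((b - x) / y)\<bar> / \<bar>X n\<bar> \<le> (\<bar>X n\<bar> / y) / \<bar>X n\<bar>"
          using y by (intro divide_right_mono) auto
        thus "norm ((arctan ((b + X n - x) / y) - arctan ((b - x) / y)) / X n) \<le> 1 / y" using xn by (simp add: abs_divide)
      qed
    qed measurable
    moreover have "(LINT x|\<rho>. (arctan ((b + X n - x) / y) - arctan ((b - x) / y)) / X n) = (A (b + X n) - A b) / X n" for n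
      unfolding A_def using int[of "b + X n"] int[of b] by simp
    ultimately show "(\<lambda>n. (A (b + X n) - A b) / X n) \<longlonglongrightarrow> (LINT x|\<rho>. (1 / y) * inverse (1 + ((b - x) / y)\<^sup>2))" by (simp only:)
  qed
  thus ?thesis by (simp add: DERIV_def A_def)
qed

lemma arctan_integral_at_top:
  assumes fin: "finite_measure \<rho>" and sets: "sets \<rho> = sets borel" and y: "y > 0"
  shows "(\<lambda>n. LINT x|\<rho>. arctan ((real n - x) / y)) \<longlonglongrightarrow> pi / 2 * measure \<rho> UNIV"
proof -
  interpret finite_measure \<rho> by (rule fin)
  note sets[measurable_cong]
  have sp: "space \<rho> = UNIV" using sets_eq_imp_space_eq[OF sets] by simp
  have "(\<lambda>n. LINT x|\<rho>. arctan ((real n - x) / y)) \<longlonglongrightarrow> (LINT x|\<rho>. pi / 2)"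
  proof (rule integral_dominated_convergence[where w = "\<lambda>_. pi / 2"])
    show "AE x in \<rho>. (\<lambda>n. arctan ((real n - x) / y)) \<longlonglongrightarrow> pi / 2"
    proof (rule AE_I2)
      fix x
      have "filterlim (\<lambda>n. (real n - x) / y) at_top sequentially"
        using y by real_asymp
      thus "(\<lambda>n. arctan ((real n - x) / y)) \<longlonglongrightarrow> pi / 2"
        by (rule filterlim_compose[OF tendsto_arctan_at_top])
    qed
    show "AE x in \<rho>. norm (arctan ((real n - x) / y)) \<le> pi / 2" for n
      using arctan_bounded by (intro AE_I2) (auto intro!: abs_leI less_imp_le simp: minus_less_iff, (smt (verit))?)
  qed auto
  thus ?thesis by (simp add: sp mult.commute)
qed

lemma arctan_integral_sgn:
  assumes fin: "finite_measure \<rho>" and sets: "sets \<rho> = sets borel"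
  shows "(\<lambda>n. LINT x|\<rho>. arctan ((b - x) / inverse (real (Suc n)))) \<longlonglongrightarrow> (LINT x|\<rho>. pi / 2 * sgn (b - x))"
proof -
  interpret finite_measure \<rho> by (rule fin)
  note sets[measurable_cong]
  show ?thesis
  proof (rule integral_dominated_convergence[where w = "\<lambda>_. pi / 2"])
    show "AE x in \<rho>. (\<lambda>n. arctan ((b - x) / inverse (real (Suc n)))) \<longlonglongrightarrow> pi / 2 * sgn (b - x)"
    proof (rule AE_I2)
      fix x
      consider "b - x = 0" | "b - x > 0" | "b - x < 0" by linarith
      thus "(\<lambda>n. arctan ((b - x) / inverse (real (Suc n)))) \<longlonglongrightarrow> pi / 2 * sgn (b - x)"
      proof cases
        case 2
        define c where "c = b - x"
        have "c > 0" using 2 by (simp add: c_def)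
        hence "filterlim (\<lambda>n. c / inverse (real (Suc n))) at_top sequentially" by real_asymp
        from filterlim_compose[OF tendsto_arctan_at_top this] show ?thesis using 2 by (simp add: c_def)
      next
        case 3
        define c where "c = b - x"
        have "c < 0" using 3 by (simp add: c_def)
        hence "filterlim (\<lambda>n. c / inverse (real (Suc n))) at_bot sequentially" by real_asymp
        from filterlim_compose[OF tendsto_arctan_at_bot this] show ?thesis using 3 by (simp add: c_def)
      qed simp
    qed
    show "AE x in \<rho>. norm (arctan ((b - x) / inverse (real (Suc n)))) \<le> pi / 2" for n
      using arctan_bounded by (intro AE_I2) (auto intro!: abs_leI less_imp_le simp: minus_less_iff, (smt (verit))?)
  qed auto
qed

text \<open>The integral of sgn (b - x) counts an atom at b with weight zero instead of one; approaching b from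
  the right corrects this.\<close>
lemma sgn_integral_right_limit:
  assumes fin: "finite_measure \<rho>" and sets: "sets \<rho> = sets borel"
  shows "(\<lambda>n. LINT x|\<rho>. sgn (b + inverse (real (Suc n)) - x)) \<longlonglongrightarrow> 2 * cdf \<rho> b - measure \<rho> UNIV"
proof -
  interpret finite_measure \<rho> by (rule fin)
  note sets[measurable_cong]
  have sp: "space \<rho> = UNIV" using sets_eq_imp_space_eq[OF sets] by simp
  have "(\<lambda>n. LINT x|\<rho>. sgn (b + inverse (real (Suc n)) - x)) \<longlonglongrightarrow> (LINT x|\<rho>. 2 * indicator {..b} x - 1)"
  proof (rule integral_dominated_convergence[where w = "\<lambda>_. 1"])
    show "AE x in \<rho>. (\<lambda>n. sgn (b + inverse (real (Suc n)) - x)) \<longlonglongrightarrow> 2 * indicator {..b} x - 1"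
    proof (rule AE_I2)
      fix x
      show "(\<lambda>n. sgn (b + inverse (real (Suc n)) - x)) \<longlonglongrightarrow> 2 * indicator {..b} x - 1"
      proof (cases "x \<le> b")
        case True
        have "sgn (b + inverse (real (Suc n)) - x) = 1" for n
        proof -
          have "inverse (real (Suc n)) > 0" by simp
          hence "b + inverse (real (Suc n)) - x > 0" using True by linarith
          thus ?thesis by (rule sgn_pos)
        qed
        thus ?thesis using True by simp
      next
        case False
        have "(\<lambda>n. b + inverse (real (Suc n)) - x) \<longlonglongrightarrow> b + 0 - x" by (intro tendsto_intros LIMSEQ_inverse_real_of_nat)
        hence "\<forall>\<^sub>F n in sequentially. b + inverse (real (Suc n)) - x < 0" by (rule order_tendstoD) (use False in simp)
        hence "\<forall>\<^sub>F n in sequentially. -1 = sgn (b + inverse (real (Suc n)) - x)" by eventually_elim (simp add: sgn_1_neg)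
        thus ?thesis using False by (intro Lim_transform_eventually[OF tendsto_const]) auto
      qed
    qed
    show "AE x in \<rho>. norm (sgn (b + inverse (real (Suc n)) - x)) \<le> 1" for n by (intro AE_I2) (auto simp: sgn_real_def)
  qed auto
  also have "(LINT x|\<rho>. 2 * indicator {..b} x - 1) = 2 * cdf \<rho> b - measure \<rho> UNIV"
    by (simp add: cdf_def sp emeasure_eq_measure)
  finally show ?thesis .
qed

lemma pick_integrable:
  assumes "finite_measure \<rho>" "sets \<rho> = sets borel" "Im z > 0"
  shows "integrable \<rho> (pick_kernel z)"
proof -
  have "continuous_on UNIV (pick_kernel z)" using assms(3) by (intro continuous_on_pick_kernel continuous_intros) auto
  thus ?thesis
    by (intro finite_measure.integrable_const_bound[OF assms(1) AE_I2[OF pick_kernel_le[OF assms(3)]]])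
       (simp add: borel_measurable_continuous_onI measurable_cong_sets[OF assms(2) refl])
qed

text \<open>The Pick kernel k satisfies (k(z,x) - z)/(1 + z^2) = 1/(x - z), whose imaginary part is the Poisson
  kernel. The bound y < 1 excludes z = \<i>, where 1 + z^2 vanishes.\<close>
lemma pick_poisson:
  assumes "finite_measure \<rho>" "sets \<rho> = sets borel" "0 < y" "y < 1"
  shows "(LINT x|\<rho>. (1 / y) * inverse (1 + ((b - x) / y)\<^sup>2)) 
     = Im ((integral\<^sup>L \<rho> (pick_kernel (Complex b y)) - of_real (measure \<rho> UNIV) * Complex b y) / (1 + (Complex b y)\<^sup>2))"
proof -
  interpret finite_measure \<rho> by fact
  define z where "z = Complex b y"
  have z: "Im z > 0" "Im z = y" "Re z = b" using assms by (auto simp: z_def)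
  have sp: "space \<rho> = UNIV" using sets_eq_imp_space_eq[OF assms(2)] by simp
  have z1: "1 + z\<^sup>2 \<noteq> 0"
  proof
    assume "1 + z\<^sup>2 = 0"
    hence "(z - \<i>) * (z + \<i>) = 0" by (simp add: algebra_simps power2_eq_square)
    hence "z = \<i> \<or> z = - \<i>" by (simp only: mult_eq_0_iff eq_iff_diff_eq_0[of z]) simp
    thus False using z(2) assms by auto
  qed
  have k: "(pick_kernel z x - z) / (1 + z\<^sup>2) = 1 / (complex_of_real x - z)" for x
  proof -
    have nz: "complex_of_real x - z \<noteq> 0" using uhp_minus_real_nz[OF z(1), of x] by auto
    have "pick_kernel z x - z = (1 + z\<^sup>2) / (complex_of_real x - z)"
      using nz by (simp add: pick_kernel_def field_simps power2_eq_square)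
    thus ?thesis using z1 by simp
  qed
  have pi: "integrable \<rho> (pick_kernel z)" by (rule pick_integrable[OF assms(1,2) z(1)])
  have "(integral\<^sup>L \<rho> (pick_kernel z) - of_real (measure \<rho> UNIV) * z) / (1 + z\<^sup>2) = (LINT x|\<rho>. (pick_kernel z x - z) / (1 + z\<^sup>2))"
    using pi by (simp add: sp scaleR_conv_of_real)
  hence "Im ((integral\<^sup>L \<rho> (pick_kernel z) - of_real (measure \<rho> UNIV) * z) / (1 + z\<^sup>2)) = Im (LINT x|\<rho>. (pick_kernel z x - z) / (1 + z\<^sup>2))" by (simp only:)
  also have "\<dots> = (LINT x|\<rho>. Im ((pick_kernel z x - z) / (1 + z\<^sup>2)))"
    by (rule integral_Im[symmetric]) (use pi in simp)
  also have "\<dots> = (LINT x|\<rho>. (1 / y) * inverse (1 + ((b - x) / y)\<^sup>2))"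
  proof (rule Bochner_Integration.integral_cong[OF refl])
    fix x
    have "Im (1 / (complex_of_real x - z)) = y / ((x - b)\<^sup>2 + y\<^sup>2)" by (simp add: Im_divide z)
    also have "\<dots> = (1 / y) * inverse (1 + ((b - x) / y)\<^sup>2)"
    proof -
      have p: "(x - b)\<^sup>2 + y\<^sup>2 > 0" using assms by (simp add: add_nonneg_pos)
      have "1 + ((b - x) / y)\<^sup>2 = ((x - b)\<^sup>2 + y\<^sup>2) / y\<^sup>2" using assms by (simp add: power_divide field_simps power2_commute)
      thus ?thesis using p assms by (simp add: power2_eq_square)
    qed
    finally show "Im ((pick_kernel z x - z) / (1 + z\<^sup>2)) = (1 / y) * inverse (1 + ((b - x) / y)\<^sup>2)" unfolding k .
  qed
  finally show ?thesis by (simp add: z_def)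
qed

text \<open>The value at \<i> determines the constant and the total mass. The Poisson integrals of both measures
  agree by the preceding lemma, so the arctan integrals differ by a constant, which is zero in view of
  their limits at infinity. As y decreases to zero they turn into the distribution functions.\<close>
theorem Nevanlinna_unique:
  fixes a1 a2 :: real
  assumes f1: "finite_measure \<rho>1" "sets \<rho>1 = sets borel" and f2: "finite_measure \<rho>2" "sets \<rho>2 = sets borel"
    and eq: "\<And>z. Im z > 0 \<Longrightarrow> of_real a1 + integral\<^sup>L \<rho>1 (pick_kernel z) = of_real a2 + integral\<^sup>L \<rho>2 (pick_kernel z)"
  shows "a1 = a2" "\<rho>1 = \<rho>2"
proof -
  have sp: "space \<rho>1 = UNIV" "space \<rho>2 = UNIV" using sets_eq_imp_space_eq[OF f1(2)] sets_eq_imp_space_eq[OF f2(2)] by auto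
  have pk: "integral\<^sup>L \<rho> (pick_kernel \<i>) = of_real (measure \<rho> UNIV) * \<i>" if "space \<rho> = UNIV" "finite_measure \<rho>" for \<rho> :: "real measure"
  proof -
    have "pick_kernel \<i> = (\<lambda>_. \<i>)" by auto
    thus ?thesis using finite_measure.integrable_const[OF that(2), of \<i>] that(1) by (simp add: scaleR_conv_of_real)
  qed
  have "of_real a1 + of_real (measure \<rho>1 UNIV) * \<i> = of_real a2 + of_real (measure \<rho>2 UNIV) * \<i>"
    using eq[of \<i>] pk[OF sp(1) f1(1)] pk[OF sp(2) f2(1)] by simp
  hence a: "a1 = a2" and m: "measure \<rho>1 UNIV = measure \<rho>2 UNIV" by (auto simp: complex_eq_iff)
  show "a1 = a2" by (rule a)
  define A where "A \<rho> y b = (LINT x|\<rho>. arctan ((b - x) / y))" for \<rho> :: "real measure" and y b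
  have Aeq: "A \<rho>1 y b = A \<rho>2 y b" if y: "0 < y" "y < 1" for y b
  proof -
    have eq': "integral\<^sup>L \<rho>1 (pick_kernel z) = integral\<^sup>L \<rho>2 (pick_kernel z)" if "Im z > 0" for z
      using eq[OF that] a by simp
    have "((\<lambda>b. A \<rho>1 y b - A \<rho>2 y b) has_real_derivative 0) (at b)" for b
    proof -
      have "((\<lambda>b. A \<rho>1 y b - A \<rho>2 y b) has_real_derivative 
         (LINT x|\<rho>1. (1 / y) * inverse (1 + ((b - x) / y)\<^sup>2)) - (LINT x|\<rho>2. (1 / y) * inverse (1 + ((b - x) / y)\<^sup>2))) (at b)"
        unfolding A_def by (intro DERIV_diff arctan_integral_deriv f1 f2 y)
      thus ?thesis unfolding pick_poisson[OF f1 y] pick_poisson[OF f2 y] using eq'[of "Complex b y"] m y by simp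
    qed
    hence const: "A \<rho>1 y b - A \<rho>2 y b = A \<rho>1 y c - A \<rho>2 y c" for b c
      using DERIV_isconst_all[of "\<lambda>b. A \<rho>1 y b - A \<rho>2 y b"] by blast
    have "(\<lambda>n. A \<rho>1 y (real n) - A \<rho>2 y (real n)) \<longlonglongrightarrow> pi / 2 * measure \<rho>1 UNIV - pi / 2 * measure \<rho>2 UNIV"
      unfolding A_def by (intro tendsto_diff arctan_integral_at_top f1 f2 y)
    moreover have "(\<lambda>n. A \<rho>1 y (real n) - A \<rho>2 y (real n)) = (\<lambda>n. A \<rho>1 y b - A \<rho>2 y b)" by (rule ext) (rule const)
    ultimately have "(\<lambda>n::nat. A \<rho>1 y b - A \<rho>2 y b) \<longlonglongrightarrow> 0" using m by simp
    thus ?thesis by (simp add: LIMSEQ_const_iff)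
  qed
  have sgn: "(LINT x|\<rho>1. sgn (b - x)) = (LINT x|\<rho>2. sgn (b - x))" for b
  proof -
    have c: "(\<lambda>n. A \<rho>1 (inverse (real (Suc (Suc n)))) b) \<longlonglongrightarrow> (LINT x|\<rho>1. pi / 2 * sgn (b - x))"
      "(\<lambda>n. A \<rho>2 (inverse (real (Suc (Suc n)))) b) \<longlonglongrightarrow> (LINT x|\<rho>2. pi / 2 * sgn (b - x))"
      unfolding A_def using LIMSEQ_Suc[OF arctan_integral_sgn[OF f1, of b]] LIMSEQ_Suc[OF arctan_integral_sgn[OF f2, of b]] by simp_all
    have e: "A \<rho>1 (inverse (real (Suc (Suc n)))) b = A \<rho>2 (inverse (real (Suc (Suc n)))) b" for n
      by (rule Aeq) (auto simp: field_simps)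
    have "(LINT x|\<rho>1. pi / 2 * sgn (b - x)) = (LINT x|\<rho>2. pi / 2 * sgn (b - x))"
      by (rule LIMSEQ_unique[OF c(1)[unfolded e] c(2)])
    thus ?thesis by simp
  qed
  have "cdf \<rho>1 b = cdf \<rho>2 b" for b
  proof -
    have "2 * cdf \<rho>1 b - measure \<rho>1 UNIV = 2 * cdf \<rho>2 b - measure \<rho>2 UNIV"
      using sgn_integral_right_limit[OF f1, of b] sgn_integral_right_limit[OF f2, of b] unfolding sgn by (rule LIMSEQ_unique)
    thus ?thesis using m by simp
  qed
  hence "cdf \<rho>1 = cdf \<rho>2" by auto
  thus "\<rho>1 = \<rho>2" by (intro cdf_unique') (auto intro!: finite_borel_measure.intro finite_borel_measure_axioms.intro f1 f2)
qed

section \<open>Uniqueness of the generating pair\<close>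

lemma integral_equation_pick:
  assumes "satisfies_integral_equation I f \<gamma> H" "s \<in> I" "t \<in> I" "s \<le> t" "Im z > 0"
  shows "set_integrable H (UNIV \<times> {s..t}) (\<lambda>p. pick_kernel (f (snd p) t z) (fst p))"
    "f s t z = z + complex_of_real (\<gamma> s) - complex_of_real (\<gamma> t) +
          set_lebesgue_integral H (UNIV \<times> {s..t}) (\<lambda>p. pick_kernel (f (snd p) t z) (fst p))"
  using assms unfolding satisfies_integral_equation_def integrand_eq_pick_kernel by auto

context strip
begin

text \<open>Over a short interval [a,b] the integral equation gives f a b z - z with the kernel taken at f r b
  z, which is uniformly close to z. Replacing it by z costs a small multiple of the mass of the
  interval, and the remaining terms add up exactly. The limit involves the pair in a form from which
  it can be read off, whereas the sums involve the family only.\<close>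
lemma generator_from_REF:
  assumes ref: "P_REF I f" and sie: "satisfies_integral_equation I f \<gamma> H" and t: "t \<in> I" and z: "Im z > 0"
  shows "(\<lambda>n. \<Sum>j<Suc n. f (t * real j / real (Suc n)) (t * real (Suc j) / real (Suc n)) z - z)
     \<longlonglongrightarrow> - complex_of_real (\<gamma> t) + set_lebesgue_integral H (UNIV \<times> {0..t}) (\<lambda>p. pick_kernel z (fst p))"
proof -
  have t0: "0 \<le> t" by (rule time_interval_facts(2)[OF I t])
  have sub: "{0..t} \<subseteq> I" by (rule Icc_sub[OF t]) simp
  have \<gamma>0: "\<gamma> 0 = 0" using gp by (simp add: generating_pair_def)
  obtain C where C: "C \<ge> 1" "\<And>r s. 0 \<le> r \<Longrightarrow> r \<le> s \<Longrightarrow> s \<le> t \<Longrightarrow> hsize (f r s z) \<le> C"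
    using P_REF_hsize_bound[OF ref sub z] by blast
  have sub2: "ordered_pairs {0..t} \<subseteq> ordered_pairs I" using sub by (auto simp: ordered_pairs_def)
  have uc: "uniformly_continuous_on (ordered_pairs {0..t}) (\<lambda>p. f (fst p) (snd p) z)"
    by (intro compact_uniformly_continuous continuous_on_subset[OF P_REF_continuous[OF ref z] sub2] compact_ordered_pairs)
  define P where "P s u = set_lebesgue_integral H (UNIV \<times> {s..u}) (\<lambda>p. pick_kernel z (fst p))" for s u
  define \<tau> where "\<tau> n j = t * real j / real (Suc n)" for n j
  have \<tau>n: "\<tau> n (Suc n) = t" for n by (simp add: \<tau>_def del: of_nat_Suc)
  have \<tau>: "0 \<le> \<tau> n j" "\<tau> n j \<le> \<tau> n (Suc j)" "\<tau> n 0 = 0" "\<tau> n (Suc n) = t" "\<tau> n (Suc j) = \<tau> n j + t / real (Suc n)" for n j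
    using \<tau>n[of n] t0 by (auto simp: \<tau>_def divide_right_mono mult_left_mono add_divide_distrib distrib_left)
  have \<tau>t: "\<tau> n j \<le> t" if "j \<le> Suc n" for n j
  proof -
    have "t * real j \<le> t * real (Suc n)" using that t0 by (intro mult_left_mono) auto
    thus ?thesis unfolding \<tau>_def by (simp add: divide_le_eq del: of_nat_Suc)
  qed
  have \<tau>I: "\<tau> n j \<in> I" if "j \<le> Suc n" for n j using \<tau>(1) \<tau>t[OF that] sub by auto
  have sumP: "(\<Sum>j<m. P (\<tau> n j) (\<tau> n (Suc j))) = P 0 (\<tau> n m)" and summ: "(\<Sum>j<m. mass (\<tau> n j) (\<tau> n (Suc j))) = mass 0 (\<tau> n m)" if "m \<le> Suc n" for m n
    using that
  proof (induction m)
    case 0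
    have l: "UNIV \<times> {0..0} = (UNIV \<times> {0} :: (real \<times> real) set)" by auto
    have z0: "UNIV \<times> {0} \<in> null_sets H" by (rule line_null[OF time_interval_facts(1)[OF I]])
    { case 1
      have "AE p in H. indicator (UNIV \<times> {0}) p *\<^sub>R pick_kernel z (fst p) = 0"
        using AE_not_in[OF z0] by eventually_elim simp
      hence "P 0 0 = 0" unfolding P_def set_lebesgue_integral_def l by (rule integral_eq_zero_AE)
      thus ?case by (simp add: \<tau>(3)) }
    { case 2
      show ?case using z0 by (simp add: \<tau>(3) mass_def l null_sets_def measure_def) }
  next
    case (Suc m)
    { case 1
      have "P 0 (\<tau> n (Suc m)) = P 0 (\<tau> n m) + P (\<tau> n m) (\<tau> n (Suc m))"
        unfolding P_def by (rule strip_split) (use 1 \<tau>I[of "Suc m" n] \<tau>(1)[of n m] \<tau>(2)[of n m] in \<open>auto intro!: pick_strip_integrable z\<close>)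
      thus ?case using Suc 1 by simp }
    { case 2
      have "mass 0 (\<tau> n (Suc m)) = mass 0 (\<tau> n m) + mass (\<tau> n m) (\<tau> n (Suc m))"
        by (rule mass_add) (use 2 \<tau>I[of "Suc m" n] \<tau>(1)[of n m] \<tau>(2)[of n m] in auto)
      thus ?case using Suc 2 by simp }
  qed
  have est: "cmod ((\<Sum>j<Suc n. f (\<tau> n j) (\<tau> n (Suc j)) z - z) - (- complex_of_real (\<gamma> t) + P 0 t)) \<le> C * C * \<epsilon> * mass 0 t"
    if \<epsilon>: "\<epsilon> > 0" and close: "\<And>p. p \<in> ordered_pairs {0..t} \<Longrightarrow> snd p - fst p \<le> t / real (Suc n) \<Longrightarrow> cmod (f (fst p) (snd p) z - z) \<le> \<epsilon>" for n \<epsilon>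
  proof -
    have step: "cmod ((f (\<tau> n j) (\<tau> n (Suc j)) z - z) - (of_real (\<gamma> (\<tau> n j) - \<gamma> (\<tau> n (Suc j))) + P (\<tau> n j) (\<tau> n (Suc j)))) \<le> C * C * \<epsilon> * mass (\<tau> n j) (\<tau> n (Suc j))"
      if j: "j < Suc n" for j
    proof -
      define a b where "a = \<tau> n j" "b = \<tau> n (Suc j)"
      have ab: "0 \<le> a" "a \<le> b" "b \<le> t" "a \<in> I" "b \<in> I" "b - a = t / real (Suc n)"
        using \<tau>(1)[of n j] \<tau>(2)[of n j] \<tau>(5)[of n j] \<tau>t[of "Suc j" n] \<tau>I[of j n] \<tau>I[of "Suc j" n] j by (auto simp: a_b_def simp del: of_nat_Suc)
      note i1 = integral_equation_pick(1)[OF sie ab(4,5,2) z]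
      note i2 = pick_strip_integrable[OF ab(5,1) z]
      have "(f a b z - z) - (of_real (\<gamma> a - \<gamma> b) + P a b) = set_lebesgue_integral H (UNIV \<times> {a..b}) (\<lambda>p. pick_kernel (f (snd p) b z) (fst p) - pick_kernel z (fst p))"
        unfolding set_integral_diff(2)[OF i1 i2] P_def using integral_equation_pick(2)[OF sie ab(4,5,2) z] by simp
      also have "cmod \<dots> \<le> C * C * \<epsilon> * mass a b"
      proof (rule strip_norm_le[OF ab(5,1) set_integral_diff(1)[OF i1 i2]])
        fix p :: "real \<times> real" assume p: "snd p \<in> {a..b}"
        have op: "(snd p, b) \<in> ordered_pairs {0..t}" using p ab by (simp add: ordered_pairs_def)
        have w: "Im (f (snd p) b z) > 0" by (rule P_REF_props(2)[OF ref _ ab(5) _ z]) (use p ab sub in auto)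
        have zC: "hsize z \<le> C" using C(2)[of 0 0] P_REF_props(4)[OF ref _ _ _ z, of 0 0] time_interval_facts(1)[OF I] t0 by simp
        have wC: "hsize (f (snd p) b z) \<le> C" by (rule C(2)) (use p ab in auto)
        have "cmod (pick_kernel (f (snd p) b z) (fst p) - pick_kernel z (fst p)) \<le> hsize (f (snd p) b z) * hsize z * cmod (f (snd p) b z - z)"
          by (rule pick_kernel_lipschitz[OF w z])
        also have "\<dots> \<le> C * C * \<epsilon>"
          using close[OF op] p ab hsize_pos[OF w] hsize_pos[OF z] C(1) by (intro mult_mono zC wC) auto
        finally show "cmod (pick_kernel (f (snd p) b z) (fst p) - pick_kernel z (fst p)) \<le> C * C * \<epsilon>" .
      qed
      finally show ?thesis by (simp add: a_b_def)
    qed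
    have "(\<Sum>j<Suc n. \<gamma> (\<tau> n j) - \<gamma> (\<tau> n (Suc j))) = - \<gamma> t"
      using sum_lessThan_telescope'[of "\<lambda>j. \<gamma> (\<tau> n j)" "Suc n"] \<tau>(3,4) \<gamma>0 by simp
    hence "(\<Sum>j<Suc n. of_real (\<gamma> (\<tau> n j) - \<gamma> (\<tau> n (Suc j)))) = - complex_of_real (\<gamma> t)" by (simp only: of_real_sum[symmetric] of_real_minus[symmetric])
    hence "- complex_of_real (\<gamma> t) + P 0 t = (\<Sum>j<Suc n. of_real (\<gamma> (\<tau> n j) - \<gamma> (\<tau> n (Suc j))) + P (\<tau> n j) (\<tau> n (Suc j)))"
      using sumP[of "Suc n" n] \<tau>(4) by (simp only: sum.distrib)
    hence "(\<Sum>j<Suc n. f (\<tau> n j) (\<tau> n (Suc j)) z - z) - (- complex_of_real (\<gamma> t) + P 0 t)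
      = (\<Sum>j<Suc n. (f (\<tau> n j) (\<tau> n (Suc j)) z - z) - (of_real (\<gamma> (\<tau> n j) - \<gamma> (\<tau> n (Suc j))) + P (\<tau> n j) (\<tau> n (Suc j))))"
      by (simp only: sum_subtractf)
    also have "cmod \<dots> \<le> (\<Sum>j<Suc n. C * C * \<epsilon> * mass (\<tau> n j) (\<tau> n (Suc j)))"
      by (intro order_trans[OF norm_sum] sum_mono step) simp
    also have "\<dots> = C * C * \<epsilon> * mass 0 t" using summ[of "Suc n" n] \<tau>(4) by (simp only: sum_distrib_left[symmetric])
    finally show ?thesis .
  qed
  show ?thesis unfolding \<tau>_def[symmetric] P_def[symmetric]
  proof (rule LIMSEQ_I)
    fix e :: real assume e: "e > 0"
    define \<epsilon> where "\<epsilon> = e / (2 * (C * C * mass 0 t + 1))"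
    have K: "C * C * mass 0 t + 1 > 0" using C(1) by (simp add: add_nonneg_pos)
    have \<epsilon>: "\<epsilon> > 0" using e K by (simp add: \<epsilon>_def)
    have small: "C * C * \<epsilon> * mass 0 t < e"
    proof -
      have "C * C * \<epsilon> * mass 0 t = (C * C * mass 0 t) * e / (2 * (C * C * mass 0 t + 1))" by (simp add: \<epsilon>_def)
      also have "\<dots> < e"
      proof -
        define k where "k = C * C * mass 0 t"
        have "k \<ge> 0" using C(1) by (simp add: k_def)
        hence "k * e < e * (2 * (k + 1))" using e by (simp add: algebra_simps) (smt (verit) mult_nonneg_nonneg)
        thus ?thesis using \<open>k \<ge> 0\<close> unfolding k_def[symmetric] by (simp add: divide_less_eq mult.commute)
      qed
      finally show ?thesis .
    qed
    obtain d where d: "d > 0" "\<And>p q. p \<in> ordered_pairs {0..t} \<Longrightarrow> q \<in> ordered_pairs {0..t} \<Longrightarrow> dist p q < d \<Longrightarrow> dist (f (fst p) (snd p) z) (f (fst q) (snd q) z) < \<epsilon>"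
      using uc \<epsilon> unfolding uniformly_continuous_on_def by (metis dist_commute)
    have "(\<lambda>n. t * inverse (real (Suc n))) \<longlonglongrightarrow> t * 0" by (intro tendsto_intros LIMSEQ_inverse_real_of_nat)
    hence "\<forall>\<^sub>F n in sequentially. t * inverse (real (Suc n)) < d" using d(1) by (intro order_tendstoD) auto
    then obtain N where N: "\<And>n. n \<ge> N \<Longrightarrow> t * inverse (real (Suc n)) < d" by (auto simp: eventually_sequentially)
    show "\<exists>no. \<forall>n\<ge>no. norm ((\<Sum>j<Suc n. f (\<tau> n j) (\<tau> n (Suc j)) z - z) - (- complex_of_real (\<gamma> t) + P 0 t)) < e"
    proof (intro exI[of _ N] allI impI order_le_less_trans[OF est[OF \<epsilon>] small])
      fix n p assume n: "N \<le> n" and p: "p \<in> ordered_pairs {0..t}" and pd: "snd p - fst p \<le> t / real (Suc n)"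
      obtain r s where rs: "p = (r, s)" by (cases p)
      have rs': "0 \<le> r" "r \<le> s" "s \<le> t" using p by (auto simp: rs ordered_pairs_def)
      have "dist p (s, s) = \<bar>r - s\<bar>" by (simp add: rs dist_prod_def dist_real_def)
      also have "\<dots> < d" using N[OF n] pd rs' by (simp add: rs divide_inverse del: of_nat_Suc)
      finally have "dist (f r s z) (f s s z) < \<epsilon>" using d(2)[OF p, of "(s, s)"] rs' by (simp add: rs ordered_pairs_def)
      moreover have "f s s z = z" by (rule P_REF_props(4)[OF ref _ _ _ z, of s s]) (use rs' sub in auto)
      ultimately show "cmod (f (fst p) (snd p) z - z) \<le> \<epsilon>" by (simp add: rs dist_norm)
    qed
  qed
qed

definition slice :: "real \<Rightarrow> real measure" where
  "slice t = distr (restrict_space H (UNIV \<times> {0..t})) borel fst"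

lemma slice_props:
  assumes t: "t \<in> I"
  shows "finite_measure (slice t)" "sets (slice t) = sets borel" 
    "A \<in> sets borel \<Longrightarrow> emeasure (slice t) A = emeasure H (A \<times> {0..t})"
    "Im z > 0 \<Longrightarrow> integral\<^sup>L (slice t) (pick_kernel z) = set_lebesgue_integral H (UNIV \<times> {0..t}) (\<lambda>p. pick_kernel z (fst p))"
proof -
  have S: "UNIV \<times> {0..t} \<in> sets H" by (rule Icc_sets[OF t]) simp
  hence S': "UNIV \<times> {0..t} \<inter> space H \<in> sets H" by (simp add: sets.Int_space_eq2)
  have fm: "fst \<in> measurable (restrict_space H (UNIV \<times> {0..t})) borel"
    by (intro measurable_restrict_space1 borel_measurable_H) simp
  show "sets (slice t) = sets borel" by (simp add: slice_def)
  show em: "emeasure (slice t) A = emeasure H (A \<times> {0..t})" if A: "A \<in> sets borel" for A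
  proof -
    have "fst -` A \<inter> space (restrict_space H (UNIV \<times> {0..t})) = A \<times> {0..t}"
      using Icc_sub[OF t, of 0] by (auto simp: space_restrict_space space_H)
    thus ?thesis unfolding slice_def emeasure_distr[OF fm A] by (simp add: emeasure_restrict_space[OF S'] Sigma_mono)
  qed
  show "finite_measure (slice t)"
  proof
    show "emeasure (slice t) (space (slice t)) \<noteq> \<infinity>"
      using em[of UNIV] Icc_fin[OF t, of 0] by (simp add: slice_def)
  qed
  show "integral\<^sup>L (slice t) (pick_kernel z) = set_lebesgue_integral H (UNIV \<times> {0..t}) (\<lambda>p. pick_kernel z (fst p))" if z: "Im z > 0"
  proof -
    have "continuous_on UNIV (pick_kernel z)" using z by (intro continuous_on_pick_kernel continuous_intros) auto
    hence "pick_kernel z \<in> borel_measurable borel" by (rule borel_measurable_continuous_onI)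
    from integral_distr[OF fm this] show ?thesis
      unfolding slice_def set_lebesgue_integral_def by (simp add: integral_restrict_space[OF S'])
  qed
qed

end

text \<open>Intersected with the strip up to time T k, a quadrant is empty or a rectangle starting at time zero.
  Quadrants generate the Borel sets and are stable under intersection, and the strips up to T k
  exhaust the whole strip.\<close>
lemma strip_measure_eqI:
  assumes s1: "strip I \<gamma>1 H1" and s2: "strip I \<gamma>2 H2"
    and eq: "\<And>A t. A \<in> sets borel \<Longrightarrow> t \<in> I \<Longrightarrow> emeasure H1 (A \<times> {0..t}) = emeasure H2 (A \<times> {0..t})"
  shows "H1 = H2"
proof (rule measure_eqI)
  interpret S1: strip I \<gamma>1 H1 by (rule s1)
  interpret S2: strip I \<gamma>2 H2 by (rule s2)
  show "sets H1 = sets H2" by (simp add: S1.sets_H S2.sets_H)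
  fix A assume A: "A \<in> sets H1"
  obtain T :: "nat \<Rightarrow> real" where T: "incseq T" "\<And>k. T k \<in> I" "\<And>k. 0 < T k" "\<And>t. t \<in> I \<Longrightarrow> \<exists>k. t \<le> T k"
    using time_interval_exhaust[OF S1.I] by blast
  obtain B where B: "B \<in> sets borel" "A = (UNIV \<times> I) \<inter> B" using A unfolding S1.sets_H sets_restrict_space by auto
  define L where "L H k = distr (restrict_space H (UNIV \<times> {0..T k})) borel (\<lambda>p. p)" for H :: "(real \<times> real) measure" and k
  have L: "emeasure (L H k) X = emeasure H (X \<inter> UNIV \<times> {0..T k})" if "strip I \<gamma> H" "X \<in> sets borel" for H \<gamma> X k
  proof -
    interpret strip I \<gamma> H by fact
    have S: "UNIV \<times> {0..T k} \<in> sets H" by (rule Icc_sets[OF T(2)]) simp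
    hence S': "UNIV \<times> {0..T k} \<inter> space H \<in> sets H" by (simp add: sets.Int_space_eq2)
    have m: "(\<lambda>p. p) \<in> measurable (restrict_space H (UNIV \<times> {0..T k})) borel"
      by (intro measurable_restrict_space1 borel_measurable_H) simp
    have "(\<lambda>p. p) -` X \<inter> space (restrict_space H (UNIV \<times> {0..T k})) = X \<inter> UNIV \<times> {0..T k}"
      using Icc_sub[OF T(2), of 0 k] by (auto simp: space_restrict_space space_H)
    thus ?thesis unfolding L_def emeasure_distr[OF m that(2)] by (simp add: emeasure_restrict_space[OF S'])
  qed
  have Leq: "L H1 k = L H2 k" for k
  proof (rule measure_eqI_generator_eq[where \<Omega> = UNIV and E = "range (\<lambda>a :: real \<times> real. {..a})" and A = "\<lambda>n. {..(real n, real n)}"])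
    show "Int_stable (range (\<lambda>a :: real \<times> real. {..a}))"
    proof -
      have "{..a} \<inter> {..b} = {..inf a b}" for a b :: "real \<times> real" by (auto simp del: atMost_def)
      thus ?thesis by (auto simp: Int_stable_def simp del: split_paired_All split_paired_all)
    qed
    fix X assume "X \<in> range (\<lambda>a :: real \<times> real. {..a})"
    then obtain a b where X: "X = {..(a, b)}" by auto
    have Xb: "X \<in> sets borel" unfolding X by simp
    have "X \<inter> UNIV \<times> {0..T k} = (if b < 0 then {} else {..a} \<times> {0..min b (T k)})"
      by (auto simp: X less_eq_prod_def)
    moreover have "min b (T k) \<in> I" if "\<not> b < 0" by (rule time_interval_facts(3)[OF S1.I T(2)[of k]]) (use that T(3)[of k] in auto)
    ultimately show "emeasure (L H1 k) X = emeasure (L H2 k) X"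
      unfolding L[OF s1 Xb] L[OF s2 Xb] by (auto intro!: eq)
  next
    show "sets (L H1 k) = sigma_sets UNIV (range (\<lambda>a :: real \<times> real. {..a}))" "sets (L H2 k) = sigma_sets UNIV (range (\<lambda>a :: real \<times> real. {..a}))"
      unfolding L_def sets_distr by (subst borel_eq_atMost, simp)+
    show "(\<Union>i. {..(real i, real i)}) = UNIV"
    proof (intro set_eqI iffI UNIV_I)
      fix p :: "real \<times> real"
      obtain i where "max (fst p) (snd p) \<le> real i" using real_arch_simple by blast
      thus "p \<in> (\<Union>i. {..(real i, real i)})" by (intro UN_I[of i]) (auto simp: less_eq_prod_def)
    qed
    fix i
    have "emeasure (L H1 k) {..(real i, real i)} \<le> emeasure H1 (UNIV \<times> {0..T k})"
      by (subst L[OF s1]) (auto intro!: emeasure_mono S1.Icc_sets[OF T(2)])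
    also have "\<dots> < \<infinity>" by (rule S1.Icc_fin[OF T(2)]) simp
    finally show "emeasure (L H1 k) {..(real i, real i)} \<noteq> \<infinity>" by simp
  qed auto
  have sup: "emeasure H A = (SUP k. emeasure (L H k) B)" if st: "strip I \<gamma> H" for H \<gamma>
  proof -
    interpret strip I \<gamma> H by fact
    have "A \<in> sets H" using A by (simp add: sets_H S1.sets_H)
    have "(\<Union>k. B \<inter> UNIV \<times> {0..T k}) = A"
    proof (intro set_eqI iffI)
      fix p assume "p \<in> (\<Union>k. B \<inter> UNIV \<times> {0..T k})"
      thus "p \<in> A" using Icc_sub[OF T(2)] unfolding B(2) by (auto simp: mem_Times_iff subset_iff)
    next
      fix p assume p: "p \<in> A"
      hence "snd p \<in> I" "p \<in> B" unfolding B(2) by (auto simp: mem_Times_iff)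
      moreover from T(4)[OF this(1)] obtain k where "snd p \<le> T k" by blast
      ultimately show "p \<in> (\<Union>k. B \<inter> UNIV \<times> {0..T k})" using time_interval_facts(2)[OF I] by (auto simp: mem_Times_iff)
    qed
    moreover have "(SUP k. emeasure H (B \<inter> UNIV \<times> {0..T k})) = emeasure H (\<Union>k. B \<inter> UNIV \<times> {0..T k})"
    proof (rule SUP_emeasure_incseq)
      show "range (\<lambda>k. B \<inter> UNIV \<times> {0..T k}) \<subseteq> sets H"
      proof (intro image_subsetI)
        fix k
        have "B \<inter> UNIV \<times> {0..T k} = A \<inter> UNIV \<times> {0..T k}" using Icc_sub[OF T(2), of 0 k] unfolding B(2) by auto
        thus "B \<inter> UNIV \<times> {0..T k} \<in> sets H" using \<open>A \<in> sets H\<close> Icc_sets[OF T(2), of 0 k] by auto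
      qed
      show "incseq (\<lambda>k. B \<inter> UNIV \<times> {0..T k})" 
      proof (intro monoI)
        fix i j :: nat assume "i \<le> j"
        hence "T i \<le> T j" using T(1) by (rule incseqD[rotated])
        thus "B \<inter> UNIV \<times> {0..T i} \<le> B \<inter> UNIV \<times> {0..T j}" by auto
      qed
    qed
    ultimately show ?thesis by (simp add: L[OF st B(1)])
  qed
  show "emeasure H1 A = emeasure H2 A" unfolding sup[OF s1] sup[OF s2] Leq ..
qed

text \<open>The limit in generator_from_REF is a Nevanlinna representation with constant - \<gamma> t and
  measure slice t.\<close>
theorem generating_pair_unique:
  assumes I: "time_interval I" and ref: "P_REF I f"
    and g1: "generating_pair I \<gamma>1 H1" "satisfies_integral_equation I f \<gamma>1 H1"
    and g2: "generating_pair I \<gamma>2 H2" "satisfies_integral_equation I f \<gamma>2 H2"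
  shows "\<forall>t\<in>I. \<gamma>1 t = \<gamma>2 t" "H1 = H2"
proof -
  interpret S1: strip I \<gamma>1 H1 by (rule strip.intro[OF I g1(1)])
  interpret S2: strip I \<gamma>2 H2 by (rule strip.intro[OF I g2(1)])
  have eq: "complex_of_real (- \<gamma>1 t) + integral\<^sup>L (S1.slice t) (pick_kernel z) = complex_of_real (- \<gamma>2 t) + integral\<^sup>L (S2.slice t) (pick_kernel z)"
    if "t \<in> I" "Im z > 0" for t z
    using LIMSEQ_unique[OF S1.generator_from_REF[OF ref g1(2) that] S2.generator_from_REF[OF ref g2(2) that]]
    by (simp add: S1.slice_props(4)[OF that] S2.slice_props(4)[OF that])
  have u: "- \<gamma>1 t = - \<gamma>2 t" "S1.slice t = S2.slice t" if t: "t \<in> I" for t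
    using Nevanlinna_unique[OF S1.slice_props(1,2)[OF t] S2.slice_props(1,2)[OF t] eq[OF t]] by blast+
  show "\<forall>t\<in>I. \<gamma>1 t = \<gamma>2 t" using u(1) by simp
  show "H1 = H2"
  proof (rule strip_measure_eqI[OF S1.strip_axioms S2.strip_axioms])
    fix A t assume "A \<in> sets (borel :: real measure)" "t \<in> I"
    thus "emeasure H1 (A \<times> {0..t}) = emeasure H2 (A \<times> {0..t})"
      using u(2)[of t] S1.slice_props(3)[of t A] S2.slice_props(3)[of t A] by simp
  qed
qed

section \<open>Gluing of generating pairs\<close>

context strip
begin

lemma restrict_props:
  fixes g :: "real \<times> real \<Rightarrow> complex"
  assumes T: "T \<in> I" "0 < T"
  shows "generating_pair {0..T} \<gamma> (restrict_space H (UNIV \<times> {0..T}))"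
    "0 \<le> s \<Longrightarrow> t \<le> T \<Longrightarrow> set_integrable (restrict_space H (UNIV \<times> {0..T})) (UNIV \<times> {s..t}) g \<longleftrightarrow> set_integrable H (UNIV \<times> {s..t}) g"
    "0 \<le> s \<Longrightarrow> t \<le> T \<Longrightarrow> set_lebesgue_integral (restrict_space H (UNIV \<times> {0..T})) (UNIV \<times> {s..t}) g = set_lebesgue_integral H (UNIV \<times> {s..t}) g"
proof -
  have sub: "{0..T} \<subseteq> I" by (rule Icc_sub[OF T(1)]) simp
  have "UNIV \<times> {0..T} \<in> sets H" by (rule Icc_sets[OF T(1)]) simp
  hence S': "UNIV \<times> {0..T} \<inter> space H \<in> sets H" by (simp add: sets.Int_space_eq2)
  have "sets (restrict_space H (UNIV \<times> {0..T})) = sets (restrict_space (restrict_space borel (UNIV \<times> I)) (UNIV \<times> {0..T}))"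
    by (simp only: sets_restrict_space sets_H)
  also have "\<dots> = sets (restrict_space borel (UNIV \<times> I \<inter> UNIV \<times> {0..T}))" by (rule sets_restrict_restrict_space)
  also have "UNIV \<times> I \<inter> UNIV \<times> {0..T} = (UNIV \<times> {0..T} :: (real \<times> real) set)" using sub by auto
  finally have sets: "sets (restrict_space H (UNIV \<times> {0..T})) = sets (restrict_space borel (UNIV \<times> {0..T}))" .
  show "generating_pair {0..T} \<gamma> (restrict_space H (UNIV \<times> {0..T}))"
    unfolding generating_pair_def
  proof (intro conjI ballI sets)
    show "continuous_on {0..T} \<gamma>" "\<gamma> 0 = 0" using gp sub by (auto simp: generating_pair_def intro: continuous_on_subset)
    fix t assume t: "t \<in> {0..T}"
    hence tI: "t \<in> I" using sub by auto
    show "emeasure (restrict_space H (UNIV \<times> {0..T})) (UNIV \<times> {0..t}) < \<infinity>"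
      by (subst emeasure_restrict_space[OF S']) (use t Icc_fin[OF tI, of 0] in auto)
    show "emeasure (restrict_space H (UNIV \<times> {0..T})) (UNIV \<times> {t}) = 0"
      by (subst emeasure_restrict_space[OF S']) (use t line_null[OF tI] in \<open>auto simp: null_sets_def\<close>)
  qed
  show "set_integrable (restrict_space H (UNIV \<times> {0..T})) (UNIV \<times> {s..t}) g \<longleftrightarrow> set_integrable H (UNIV \<times> {s..t}) g"
    "set_lebesgue_integral (restrict_space H (UNIV \<times> {0..T})) (UNIV \<times> {s..t}) g = set_lebesgue_integral H (UNIV \<times> {s..t}) g"
    if st: "0 \<le> s" "t \<le> T"
  proof -
    have "indicator (UNIV \<times> {0..T}) p *\<^sub>R indicator (UNIV \<times> {s..t}) p *\<^sub>R g p = indicator (UNIV \<times> {s..t}) p *\<^sub>R g p" for p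
      using st by (auto simp: indicator_def mem_Times_iff)
    thus "set_integrable (restrict_space H (UNIV \<times> {0..T})) (UNIV \<times> {s..t}) g \<longleftrightarrow> set_integrable H (UNIV \<times> {s..t}) g"
      "set_lebesgue_integral (restrict_space H (UNIV \<times> {0..T})) (UNIV \<times> {s..t}) g = set_lebesgue_integral H (UNIV \<times> {s..t}) g"
      unfolding set_integrable_def set_lebesgue_integral_def integrable_restrict_space[OF S'] integral_restrict_space[OF S'] by (simp_all only:)
  qed
qed

lemma restrict_integral_equation:
  assumes T: "T \<in> I" "0 < T"
  shows "satisfies_integral_equation {0..T} f \<gamma> (restrict_space H (UNIV \<times> {0..T})) \<longleftrightarrow>
    (\<forall>s\<in>{0..T}. \<forall>t\<in>{0..T}. s \<le> t \<longrightarrow> (\<forall>z\<in>upper_half_plane.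
        set_integrable H (UNIV \<times> {s..t}) (\<lambda>(x, r). (1 + complex_of_real x * f r t z) / (complex_of_real x - f r t z)) \<and>
        f s t z = z + complex_of_real (\<gamma> s) - complex_of_real (\<gamma> t) +
          set_lebesgue_integral H (UNIV \<times> {s..t}) (\<lambda>(x, r). (1 + complex_of_real x * f r t z) / (complex_of_real x - f r t z))))"
  unfolding satisfies_integral_equation_def
  by (intro ball_cong refl imp_cong) (simp add: restrict_props(2,3)[OF T])

end

text \<open>By uniqueness, the pairs on the intervals [0, T k] are restrictions of each other. The function
  \<gamma> is their common extension, and the measure is the supremum of the measures extended by
  zero.\<close>
theorem generating_pair_exists:
  assumes I: "time_interval I" and ref: "P_REF I f"
  shows "\<exists>\<gamma> H. generating_pair I \<gamma> H \<and> satisfies_integral_equation I f \<gamma> H"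
proof -
  obtain T :: "nat \<Rightarrow> real" where T: "incseq T" "\<And>k. T k \<in> I" "\<And>k. 0 < T k" "\<And>t. t \<in> I \<Longrightarrow> \<exists>k. t \<le> T k"
    using time_interval_exhaust[OF I] by blast
  note tf = time_interval_facts[OF I]
  have sub: "{0..T k} \<subseteq> I" for k by (intro subsetI, rule tf(3)[OF T(2)[of k]]) auto
  have refk: "P_REF {0..T k} f" for k by (rule P_REF_restrict[OF ref sub])
  have "\<exists>\<gamma> H. generating_pair {0..T k} \<gamma> H \<and> satisfies_integral_equation {0..T k} f \<gamma> H" for k
    by (rule compact_REF.exists_generating_pair) (intro compact_REF.intro T refk)
  then obtain \<gamma> H where gpk: "\<And>k. generating_pair {0..T k} (\<gamma> k) (H k)" and sie: "\<And>k. satisfies_integral_equation {0..T k} f (\<gamma> k) (H k)"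
    by metis
  have st: "strip {0..T k} (\<gamma> k) (H k)" for k by (intro strip.intro time_interval_Icc T gpk)
  have Tmono: "T k \<le> T l" if "k \<le> l" for k l using T(1) that by (rule incseqD)
  have cons: "\<forall>t\<in>{0..T k}. \<gamma> k t = \<gamma> l t" "H k = restrict_space (H l) (UNIV \<times> {0..T k})" if kl: "k \<le> l" for k l
  proof -
    interpret strip "{0..T l}" "\<gamma> l" "H l" by (rule st)
    have Tk: "T k \<in> {0..T l}" "0 < T k" using Tmono[OF kl] T(3)[of k] by auto
    have "satisfies_integral_equation {0..T k} f (\<gamma> l) (restrict_space (H l) (UNIV \<times> {0..T k}))"
      unfolding restrict_integral_equation[OF Tk]
      using sie[of l] Tmono[OF kl] unfolding satisfies_integral_equation_def by auto
    from generating_pair_unique[OF time_interval_Icc[OF T(3)[of k]] refk gpk[of k] sie[of k] restrict_props(1)[OF Tk] this]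
    show "\<forall>t\<in>{0..T k}. \<gamma> k t = \<gamma> l t" "H k = restrict_space (H l) (UNIV \<times> {0..T k})" by auto
  qed
  define \<gamma>' where "\<gamma>' t = \<gamma> (LEAST k. t \<le> T k) t" for t
  have \<gamma>': "\<gamma>' t = \<gamma> k t" if t: "0 \<le> t" "t \<le> T k" for k t
  proof -
    define m where "m = (LEAST k. t \<le> T k)"
    have "t \<le> T m" "m \<le> k" unfolding m_def using t by (auto intro: LeastI Least_le)
    thus ?thesis using cons(1)[of m k] t by (simp add: \<gamma>'_def m_def)
  qed
  define \<Omega> where "\<Omega> = (UNIV \<times> I :: (real \<times> real) set)"
  define N where "N = restrict_space borel \<Omega>"
  have Ok: "UNIV \<times> {0..T k} \<in> sets (H k)" for k using strip.Icc_sets[OF st, of "T k" k 0] T(3)[of k] by simp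
  have idm: "(\<lambda>p. p) \<in> measurable (H k) N" for k
    unfolding N_def
  proof (rule measurable_restrict_space2)
    show "(\<lambda>p. p) \<in> space (H k) \<rightarrow> \<Omega>" using sub[of k] by (auto simp: strip.space_H[OF st] \<Omega>_def)
    show "(\<lambda>p. p) \<in> measurable (H k) borel" by (rule strip.borel_measurable_H[OF st]) simp
  qed
  \<comment> \<open>H k as a measure on the full strip\<close>
  define M where "M k = distr (H k) N (\<lambda>p. p)" for k
  have Mem: "emeasure (M k) A = emeasure (H k) (A \<inter> UNIV \<times> {0..T k})" if "A \<in> sets N" for k A
    unfolding M_def using emeasure_distr[OF idm that] by (simp add: strip.space_H[OF st])
  have Nk: "A \<inter> UNIV \<times> {0..T k} \<in> sets (H k)" if "A \<in> sets N" for A k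
    using measurable_sets[OF idm that, of k] by (simp add: strip.space_H[OF st])
  have HkHl: "emeasure (H k) A = emeasure (H l) A" if "k \<le> l" "A \<subseteq> UNIV \<times> {0..T k}" for k l A
  proof -
    have "UNIV \<times> {0..T k} \<in> sets (H l)" using strip.Icc_sets[OF st, of "T k" l 0] T(3)[of k] Tmono[OF that(1)] by simp
    hence "UNIV \<times> {0..T k} \<inter> space (H l) \<in> sets (H l)" by (simp add: sets.Int_space_eq2)
    thus ?thesis unfolding cons(2)[OF that(1)] using that(2) by (rule emeasure_restrict_space)
  qed
  have Mmono: "emeasure (M k) A \<le> emeasure (M l) A" if "k \<le> l" "A \<in> sets N" for k l A
  proof -
    have "emeasure (M k) A = emeasure (H l) (A \<inter> UNIV \<times> {0..T k})" unfolding Mem[OF that(2)] by (rule HkHl[OF that(1)]) auto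
    also have "\<dots> \<le> emeasure (M l) A" unfolding Mem[OF that(2)] by (intro emeasure_mono Nk that) (use Tmono[OF that(1)] in auto)
    finally show ?thesis .
  qed
  have Mle: "M k \<le> M l" if "k \<le> l" for k l
  proof -
    have s: "sets (M k) = sets (M l)" by (simp add: M_def)
    show ?thesis unfolding le_measure[OF s] le_fun_def
    proof
      fix A show "emeasure (M k) A \<le> emeasure (M l) A"
      proof (cases "A \<in> sets N")
        case False
        hence "emeasure (M k) A = 0" by (intro emeasure_notin_sets) (simp add: M_def)
        thus ?thesis by simp
      qed (rule Mmono[OF that])
    qed
  qed
  define HH where "HH = (SUP k. M k)"
  have HHsets: "sets HH = sets N" unfolding HH_def by (rule sets_SUP) (auto simp: M_def)
  have HHem: "emeasure HH A = (SUP k. emeasure (M k) A)" if "A \<in> sets N" for A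
    unfolding HH_def
  proof (rule emeasure_SUP_chain)
    show "Complete_Partial_Order.chain (\<le>) (M ` UNIV)"
      unfolding Complete_Partial_Order.chain_def
    proof (intro ballI, elim imageE, simp only:)
      fix k l show "M k \<le> M l \<or> M l \<le> M k" by (cases "k \<le> l") (auto intro: Mle)
    qed
  qed (use that in \<open>auto simp: M_def\<close>)
  have HHk: "emeasure HH A = emeasure (H k) A" if "A \<in> sets N" "A \<subseteq> UNIV \<times> {0..T k}" for A k
  proof -
    have Ak: "A \<inter> UNIV \<times> {0..T k} = A" using that by auto
    have up: "emeasure (M l) A \<le> emeasure (H k) A" for l
    proof (cases "k \<le> l")
      case True
      have "A \<inter> UNIV \<times> {0..T l} = A" using that Tmono[OF True] by auto
      thus ?thesis unfolding Mem[OF that(1)] using HkHl[OF True that(2)] by simp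
    next
      case False
      hence "emeasure (M l) A \<le> emeasure (M k) A" by (intro Mmono that) simp
      thus ?thesis unfolding Mem[OF that(1)] Ak .
    qed
    show ?thesis unfolding HHem[OF that(1)]
    proof (rule antisym)
      show "(SUP l. emeasure (M l) A) \<le> emeasure (H k) A" by (intro SUP_least up)
      show "emeasure (H k) A \<le> (SUP l. emeasure (M l) A)" using Mem[OF that(1), of k] unfolding Ak by (intro SUP_upper2[of k]) auto
    qed
  qed
  have NI: "UNIV \<times> A \<in> sets N" if "A \<in> sets borel" "A \<subseteq> I" for A
  proof -
    have "UNIV \<times> A \<in> sets (borel :: (real \<times> real) measure)" unfolding borel_prod[symmetric] using that by (intro pair_measureI) auto
    moreover have "UNIV \<times> A = \<Omega> \<inter> UNIV \<times> A" using that by (auto simp: \<Omega>_def)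
    ultimately show ?thesis unfolding N_def sets_restrict_space by blast
  qed
  have gpI: "generating_pair I \<gamma>' HH"
    unfolding generating_pair_def
  proof (intro conjI ballI)
    show "sets HH = sets (restrict_space borel (UNIV \<times> I))" unfolding HHsets N_def \<Omega>_def ..
    show "\<gamma>' 0 = 0" using \<gamma>'[of 0 0] T(3)[of 0] gpk[of 0] by (simp add: generating_pair_def)
    show "continuous_on I \<gamma>'"
      unfolding continuous_on_eq_continuous_within
    proof
      fix t assume t: "t \<in> I"
      obtain S \<delta> where S: "S \<in> I" "0 < S" "t \<le> S" "\<delta> > 0" "\<And>t'. t' \<in> I \<Longrightarrow> \<bar>t' - t\<bar> < \<delta> \<Longrightarrow> t' \<le> S"
        by (rule time_interval_bound[OF I t]) blast
      obtain k where k: "S \<le> T k" using T(4)[OF S(1)] by blast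
      have "continuous_on {0..T k} (\<gamma> k)" using gpk[of k] by (simp add: generating_pair_def)
      hence "continuous_on {0..T k} \<gamma>'" by (rule continuous_on_eq) (simp add: \<gamma>'[where k = k])
      hence c: "continuous (at t within {0..T k}) \<gamma>'" using t S(3) k tf(2)[OF t] by (simp add: continuous_on_eq_continuous_within)
      have "at t within I = at t within {0..T k}"
      proof (rule at_within_nhd[of t "{t - \<delta><..<t + \<delta>}"])
        have "x \<in> {0..T k}" if x: "x \<in> I" "x \<in> {t - \<delta><..<t + \<delta>}" for x
        proof -
          have "\<bar>x - t\<bar> < \<delta>" using x(2) by auto
          thus ?thesis using S(5)[OF x(1)] k tf(2)[OF x(1)] by auto
        qed
        thus "I \<inter> {t - \<delta><..<t + \<delta>} - {t} = {0..T k} \<inter> {t - \<delta><..<t + \<delta>} - {t}" using sub[of k] by blast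
      qed (use S in auto)
      with c show "continuous (at t within I) \<gamma>'" by (simp add: continuous_within)
    qed
    fix t assume t: "t \<in> I"
    obtain k where k: "t \<le> T k" using T(4)[OF t] by blast
    have t0: "0 \<le> t" by (rule tf(2)[OF t])
    have s: "{0..t} \<subseteq> I" by (intro subsetI, rule tf(3)[OF t]) auto
    have "emeasure HH (UNIV \<times> {0..t}) = emeasure (H k) (UNIV \<times> {0..t})" by (rule HHk[OF NI]) (use s k in auto)
    thus "emeasure HH (UNIV \<times> {0..t}) < \<infinity>" using gpk[of k] t0 k by (simp add: generating_pair_def)
    have "emeasure HH (UNIV \<times> {t}) = emeasure (H k) (UNIV \<times> {t})" by (rule HHk[OF NI]) (use t t0 k in auto)
    thus "emeasure HH (UNIV \<times> {t}) = 0" using gpk[of k] t0 k by (simp add: generating_pair_def)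
  qed
  interpret HH: strip I \<gamma>' HH by (rule strip.intro[OF I gpI])
  have HHrestrict: "restrict_space HH (UNIV \<times> {0..T k}) = H k" for k
  proof (rule measure_eqI)
    have "generating_pair {0..T k} \<gamma>' (restrict_space HH (UNIV \<times> {0..T k}))" by (rule HH.restrict_props(1)[OF T(2,3)])
    thus s: "sets (restrict_space HH (UNIV \<times> {0..T k})) = sets (H k)" using gpk[of k] by (simp add: generating_pair_def)
    fix A assume A: "A \<in> sets (restrict_space HH (UNIV \<times> {0..T k}))"
    have S: "UNIV \<times> {0..T k} \<in> sets HH" by (rule HH.Icc_sets[OF T(2)]) simp
    hence S': "UNIV \<times> {0..T k} \<inter> space HH \<in> sets HH" by (simp add: sets.Int_space_eq2)
    have A': "A \<subseteq> UNIV \<times> {0..T k}" "A \<in> sets HH" using A sets_restrict_space_iff[OF S'] by auto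
    show "emeasure (restrict_space HH (UNIV \<times> {0..T k})) A = emeasure (H k) A"
      unfolding emeasure_restrict_space[OF S' A'(1)] using A' by (intro HHk) (simp_all add: HHsets)
  qed
  have "satisfies_integral_equation I f \<gamma>' HH"
    unfolding satisfies_integral_equation_def
  proof (intro ballI impI)
    fix s t z assume h: "s \<in> I" "t \<in> I" "s \<le> t" "z \<in> upper_half_plane"
    obtain k where k: "t \<le> T k" using T(4)[OF h(2)] by blast
    have s: "s \<in> {0..T k}" and t: "t \<in> {0..T k}" using h k tf(2)[of s] by auto
    have "satisfies_integral_equation {0..T k} f \<gamma>' (restrict_space HH (UNIV \<times> {0..T k}))"
      using sie[of k] \<gamma>'[of _ k] unfolding HHrestrict satisfies_integral_equation_def by simp
    from this[unfolded HH.restrict_integral_equation[OF T(2,3)], rule_format, OF s t h(3,4)]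
    show "set_integrable HH (UNIV \<times> {s..t}) (\<lambda>(x, r). (1 + complex_of_real x * f r t z) / (complex_of_real x - f r t z)) \<and>
        f s t z = z + complex_of_real (\<gamma>' s) - complex_of_real (\<gamma>' t) +
          set_lebesgue_integral HH (UNIV \<times> {s..t}) (\<lambda>(x, r). (1 + complex_of_real x * f r t z) / (complex_of_real x - f r t z))" .
  qed
  with gpI show ?thesis by blast
qed

section \<open>Gronwall's inequality on the strip\<close>

text \<open>A real translation changes hsize by a bounded factor. Trajectories can thus be compared after
  subtracting \<gamma>, which is merely continuous and may have infinite variation.\<close>
lemma hsize_shift:
  assumes "Im w > 0" 
  shows "hsize (w + of_real a) \<le> (1 + \<bar>a\<bar>)\<^sup>2 * hsize w"
proof -
  define r where "r = cmod w"
  have r0: "r \<ge> 0" by (simp add: r_def)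
  have "cmod (w + of_real a) \<le> r + \<bar>a\<bar>" unfolding r_def by (rule order_trans[OF norm_triangle_ineq]) simp
  hence "(cmod (w + of_real a))\<^sup>2 \<le> (r + \<bar>a\<bar>)\<^sup>2" by (intro power_mono) auto
  also have "\<dots> = r\<^sup>2 + 2 * r * \<bar>a\<bar> + \<bar>a\<bar>\<^sup>2" by (simp add: power2_eq_square algebra_simps)
  finally have 1: "1 + (cmod (w + of_real a))\<^sup>2 \<le> 1 + r\<^sup>2 + 2 * r * \<bar>a\<bar> + \<bar>a\<bar>\<^sup>2" by simp
  have "2 * r \<le> 1 + r\<^sup>2" using zero_le_power2[of "r - 1"] by (simp add: power2_eq_square algebra_simps)
  hence 2: "2 * r * \<bar>a\<bar> \<le> (1 + r\<^sup>2) * \<bar>a\<bar>" by (rule mult_right_mono) simp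
  have 3: "0 \<le> (1 + r\<^sup>2) * \<bar>a\<bar>" "0 \<le> \<bar>a\<bar>\<^sup>2 * r\<^sup>2" by simp_all
  have 4: "(1 + \<bar>a\<bar>)\<^sup>2 * (1 + r\<^sup>2) = 1 + r\<^sup>2 + 2 * ((1 + r\<^sup>2) * \<bar>a\<bar>) + \<bar>a\<bar>\<^sup>2 + \<bar>a\<bar>\<^sup>2 * r\<^sup>2" 
    by (simp add: power2_eq_square algebra_simps)
  have "1 + (cmod (w + of_real a))\<^sup>2 \<le> (1 + \<bar>a\<bar>)\<^sup>2 * (1 + r\<^sup>2)" using 1 2 3 4 by linarith
  hence "(1 + (cmod (w + of_real a))\<^sup>2) / Im w \<le> ((1 + \<bar>a\<bar>)\<^sup>2 * (1 + r\<^sup>2)) / Im w" using assms by (intro divide_right_mono) auto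
  thus ?thesis by (simp add: hsize_def r_def)
qed

lemma hsize_unshift: 
  assumes "Im w > 0" shows "hsize w \<le> (1 + \<bar>a\<bar>)\<^sup>2 * hsize (w - of_real a)"
  using hsize_shift[of "w - of_real a" a] assms by simp

lemma pick_kernel_diff:
  assumes "Im w > 0" "Im z > 0"
  shows "pick_kernel w x - pick_kernel z x = (w - z) * (of_real (1 + x\<^sup>2) / ((of_real x - w) * (of_real x - z)))"
proof -
  have "complex_of_real x - w \<noteq> 0" "complex_of_real x - z \<noteq> 0" 
    using uhp_minus_real_nz[OF assms(1), of x] uhp_minus_real_nz[OF assms(2), of x] by auto
  thus ?thesis by (simp add: pick_kernel_def field_simps power2_eq_square)
qed

context strip
begin

lemma in_I: "0 \<le> s \<Longrightarrow> s \<le> t \<Longrightarrow> t \<in> I \<Longrightarrow> s \<in> I" by (rule time_interval_facts(3)[OF I])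

lemma I_nonneg: "t \<in> I \<Longrightarrow> 0 \<le> t" by (rule time_interval_facts(2)[OF I])

lemma \<gamma>_cont: "T \<in> I \<Longrightarrow> continuous_on {0..T} \<gamma>"
  using gp Icc_sub[of T 0] by (auto simp: generating_pair_def intro: continuous_on_subset)

lemma mass_refl: "t \<in> I \<Longrightarrow> mass t t = 0"
  using line_null[of t] by (simp add: mass_def null_sets_def measure_def)

lemma mass_mono: "0 \<le> s \<Longrightarrow> s \<le> s' \<Longrightarrow> s' \<le> t' \<Longrightarrow> t' \<le> t \<Longrightarrow> t \<in> I \<Longrightarrow> mass s' t' \<le> mass s t"
  using mass_add[of s s' t] mass_add[of s' t' t] by simp

lemma mass_continuous: 
  assumes T: "T \<in> I" shows "continuous_on {0..T} (mass 0)"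
  unfolding continuous_on_sequentially comp_def
proof (intro allI ballI impI, elim conjE)
  fix x :: "nat \<Rightarrow> real" and s
  assume s: "s \<in> {0..T}" and xS: "\<forall>n. x n \<in> {0..T}" and x: "x \<longlonglongrightarrow> s"
  have xI: "x n \<in> I" for n using xS in_I[OF _ _ T] by auto
  have xb: "x n \<le> T" for n using xS by auto
  have sI: "s \<in> I" using s in_I[OF _ _ T] by auto
  have ind: "mass 0 u = (LINT p|H. indicator (UNIV \<times> {0..u}) p)" if "u \<in> I" for u
    using mass_eq[OF that, of 0] by (simp add: set_lebesgue_integral_def)
  show "(\<lambda>n. mass 0 (x n)) \<longlonglongrightarrow> mass 0 s"
    unfolding ind[OF sI] ind[OF xI]
  proof (rule integral_dominated_convergence[where w = "indicator (UNIV \<times> {0..T})"])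
    show "integrable H (indicator (UNIV \<times> {0..T}) :: _ \<Rightarrow> real)" 
      using Icc_sets[OF T, of 0] Icc_fin[OF T, of 0] by (simp add: less_top)
    show "indicator (UNIV \<times> {0..s}) \<in> borel_measurable H" using Icc_sets[OF sI, of 0] by simp
    show "indicator (UNIV \<times> {0..x n}) \<in> borel_measurable H" for n using Icc_sets[OF xI, of 0 n] by simp
    show "AE p in H. norm (indicator (UNIV \<times> {0..x n}) p :: real) \<le> indicator (UNIV \<times> {0..T}) p" for n
      by (intro AE_I2) (auto simp: indicator_def intro: order_trans[OF _ xb])
    have "AE p in H. p \<notin> UNIV \<times> {s}" by (rule AE_not_in[OF line_null[OF sI]])
    thus "AE p in H. (\<lambda>n. indicator (UNIV \<times> {0..x n}) p :: real) \<longlonglongrightarrow> indicator (UNIV \<times> {0..s}) p"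
    proof eventually_elim
      case (elim p)
      hence "snd p < s \<or> snd p > s" by (auto simp: mem_Times_iff)
      thus ?case
      proof
        assume "snd p < s"
        hence "\<forall>\<^sub>F n in sequentially. snd p < x n" by (rule order_tendstoD[OF x])
        hence "\<forall>\<^sub>F n in sequentially. (indicator (UNIV \<times> {0..s}) p :: real) = indicator (UNIV \<times> {0..x n}) p"
          by eventually_elim (use \<open>snd p < s\<close> in \<open>auto simp: indicator_def mem_Times_iff\<close>)
        thus ?thesis by (intro Lim_transform_eventually[OF tendsto_const])
      next
        assume "snd p > s"
        hence "\<forall>\<^sub>F n in sequentially. x n < snd p" by (rule order_tendstoD[OF x])
        hence "\<forall>\<^sub>F n in sequentially. (indicator (UNIV \<times> {0..s}) p :: real) = indicator (UNIV \<times> {0..x n}) p"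
          by eventually_elim (use \<open>snd p > s\<close> in \<open>auto simp: indicator_def mem_Times_iff\<close>)
        thus ?thesis by (intro Lim_transform_eventually[OF tendsto_const])
      qed
    qed
  qed
qed

lemma driving_modulus:
  assumes T: "T \<in> I" and C: "C \<ge> 0" and \<epsilon>: "\<epsilon> > 0"
  obtains \<delta> where "\<delta> > 0" "\<And>s s'. 0 \<le> s \<Longrightarrow> s \<le> s' \<Longrightarrow> s' \<le> T \<Longrightarrow> s' - s \<le> \<delta> \<Longrightarrow> \<bar>\<gamma> s - \<gamma> s'\<bar> + C * mass s s' \<le> \<epsilon>"
proof -
  have "uniformly_continuous_on {0..T} \<gamma>" by (intro compact_uniformly_continuous \<gamma>_cont[OF T] compact_Icc)
  then obtain d1 where d1: "d1 > 0" "\<And>s s'. s \<in> {0..T} \<Longrightarrow> s' \<in> {0..T} \<Longrightarrow> dist s' s < d1 \<Longrightarrow> dist (\<gamma> s') (\<gamma> s) < \<epsilon> / 2"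
    unfolding uniformly_continuous_on_def using \<epsilon> half_gt_zero by metis
  have "uniformly_continuous_on {0..T} (\<lambda>s. C * mass 0 s)" by (intro compact_uniformly_continuous continuous_intros mass_continuous[OF T] compact_Icc)
  then obtain d2 where d2: "d2 > 0" "\<And>s s'. s \<in> {0..T} \<Longrightarrow> s' \<in> {0..T} \<Longrightarrow> dist s' s < d2 \<Longrightarrow> dist (C * mass 0 s') (C * mass 0 s) < \<epsilon> / 2"
    unfolding uniformly_continuous_on_def using \<epsilon> half_gt_zero by metis
  show thesis
  proof (rule that[of "min d1 d2 / 2"])
    show "min d1 d2 / 2 > 0" using d1 d2 by simp
    fix s s' assume h: "0 \<le> s" "s \<le> s'" "s' \<le> T" "s' - s \<le> min d1 d2 / 2"
    have "dist s' s < d1" "dist s' s < d2" using h d1(1) d2(1) by (auto simp: dist_real_def)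
    hence "\<bar>\<gamma> s' - \<gamma> s\<bar> < \<epsilon> / 2" "\<bar>C * mass 0 s' - C * mass 0 s\<bar> < \<epsilon> / 2"
      using d1(2)[of s s'] d2(2)[of s s'] h by (auto simp: dist_real_def)
    moreover have "C * mass 0 s' - C * mass 0 s = C * mass s s'" 
      using mass_add[of 0 s s'] h in_I[OF _ h(3) T] by (simp add: algebra_simps)
    ultimately show "\<bar>\<gamma> s - \<gamma> s'\<bar> + C * mass s s' \<le> \<epsilon>" by linarith
  qed
qed

lemma null_strip_integral: 
  fixes g :: "real \<times> real \<Rightarrow> 'b :: {banach, second_countable_topology}"
  assumes "t \<in> I" shows "set_lebesgue_integral H (UNIV \<times> {t..t}) g = 0"
proof -
  have "AE p in H. p \<notin> UNIV \<times> {t}" by (rule AE_not_in[OF line_null[OF assms]])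
  hence "AE p in H. indicator (UNIV \<times> {t..t}) p *\<^sub>R g p = 0" by eventually_elim (auto simp: indicator_def mem_Times_iff)
  thus ?thesis unfolding set_lebesgue_integral_def by (rule integral_eq_zero_AE)
qed

lemma continuous_time_integrable:
  fixes u :: "real \<Rightarrow> real"
  assumes t: "t \<in> I" and uc: "continuous_on {0..t} u" and ab: "0 \<le> a" "a \<le> b" "b \<le> t"
  shows "set_integrable H (UNIV \<times> {a..b}) (\<lambda>p. u (snd p))"
proof -
  have "bounded (u ` {0..t})" by (rule compact_imp_bounded[OF compact_continuous_image[OF uc compact_Icc]])
  then obtain B where "\<forall>y\<in>u ` {0..t}. norm y \<le> B" unfolding bounded_iff by blast
  hence B: "\<bar>u r\<bar> \<le> B" if "r \<in> {0..t}" for r using that by auto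
  define u' where "u' p = u (clamp_to 0 t (snd p))" for p :: "real \<times> real"
  have u'c: "continuous_on UNIV u'" unfolding u'_def clamp_to_def
    by (rule continuous_on_compose2[OF uc]) (use ab in \<open>auto intro!: continuous_intros\<close>)
  have "set_integrable H (UNIV \<times> {a..b}) u'"
    by (rule strip_integrable[where C = B, OF in_I[OF _ ab(3) t]])
       (use ab B u'c in \<open>auto intro!: borel_measurable_continuous_onI simp: u'_def clamp_to_id\<close>)
  moreover have "(\<lambda>p. indicator (UNIV \<times> {a..b}) p *\<^sub>R u' p) = (\<lambda>p. indicator (UNIV \<times> {a..b}) p *\<^sub>R u (snd p))"
    using ab by (intro ext) (auto simp: indicator_def u'_def clamp_to_id mem_Times_iff)
  ultimately show ?thesis by (simp add: set_integrable_def)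
qed

text \<open>As H charges no single time, [0,t] can be cut backwards from t into at most N pieces on each of
  which L * mass is at most 1/2. On such a piece the integral can be absorbed on the left, and the
  bound at most doubles.\<close>
lemma gronwall:
  fixes L :: real
  assumes T: "T \<in> I" and L: "L \<ge> 0"
  obtains K where "K \<ge> 1"
    "\<And>t u A s. t \<le> T \<Longrightarrow> A \<ge> 0 \<Longrightarrow> continuous_on {0..t} u \<Longrightarrow> (\<And>r. 0 \<le> r \<Longrightarrow> r \<le> t \<Longrightarrow> 0 \<le> u r) \<Longrightarrow>
       (\<And>s. 0 \<le> s \<Longrightarrow> s \<le> t \<Longrightarrow> u s \<le> A + L * set_lebesgue_integral H (UNIV \<times> {s..t}) (\<lambda>p. u (snd p))) \<Longrightarrow>
       0 \<le> s \<Longrightarrow> s \<le> t \<Longrightarrow> u s \<le> K * A"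
proof -
  define N where "N = nat \<lceil>2 * L * mass 0 T\<rceil>"
  show thesis
  proof (rule that[of "2 ^ N"])
    fix t A s :: real and u :: "real \<Rightarrow> real"
    assume tT: "t \<le> T" and A: "A \<ge> 0" and uc: "continuous_on {0..t} u" and u0: "\<And>r. 0 \<le> r \<Longrightarrow> r \<le> t \<Longrightarrow> 0 \<le> u r"
      and ineq: "\<And>s. 0 \<le> s \<Longrightarrow> s \<le> t \<Longrightarrow> u s \<le> A + L * set_lebesgue_integral H (UNIV \<times> {s..t}) (\<lambda>p. u (snd p))"
      and s: "0 \<le> s" "s \<le> t"
    have t: "t \<in> I" "0 \<le> t" using in_I[of t T] s tT T by auto
    define G where "G s = A + L * set_lebesgue_integral H (UNIV \<times> {s..t}) (\<lambda>p. u (snd p))" for s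
    note int = continuous_time_integrable[OF t(1) uc]
    have Gsplit: "G a = G b + L * set_lebesgue_integral H (UNIV \<times> {a..b}) (\<lambda>p. u (snd p))" if "0 \<le> a" "a \<le> b" "b \<le> t" for a b
      using strip_split[OF that t(1) int[of a t]] that by (simp add: G_def algebra_simps)
    have Gmono: "G b \<le> G a" if "0 \<le> a" "a \<le> b" "b \<le> t" for a b
    proof -
      have "0 \<le> set_lebesgue_integral H (UNIV \<times> {a..b}) (\<lambda>p. u (snd p))"
        unfolding set_lebesgue_integral_def by (intro integral_nonneg_AE AE_I2) (use that u0 in \<open>auto simp: indicator_def mem_Times_iff\<close>)
      thus ?thesis using Gsplit[OF that] L by simp
    qed
    have Gt: "G t = A" unfolding G_def null_strip_integral[OF t(1)] by simp
    have step: "G a \<le> G b + L * mass a b * G a" if "0 \<le> a" "a \<le> b" "b \<le> t" for a b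
    proof -
      have "norm (set_lebesgue_integral H (UNIV \<times> {a..b}) (\<lambda>p. u (snd p))) \<le> G a * mass a b"
      proof (rule strip_norm_le[OF _ that(1) int[OF that]])
        show "b \<in> I" using in_I[OF _ that(3) t(1)] that by auto
        fix p :: "real \<times> real" assume p: "snd p \<in> {a..b}"
        have "u (snd p) \<le> G (snd p)" unfolding G_def by (rule ineq) (use p that in auto)
        also have "\<dots> \<le> G a" by (rule Gmono) (use p that in auto)
        finally show "norm (u (snd p)) \<le> G a" using u0[of "snd p"] p that by simp
      qed
      hence "L * set_lebesgue_integral H (UNIV \<times> {a..b}) (\<lambda>p. u (snd p)) \<le> L * (G a * mass a b)"
        by (intro mult_left_mono L) simp
      thus ?thesis using Gsplit[OF that] by (simp add: mult_ac)
    qed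
    have main: "G a \<le> 2 ^ n * A" if "0 \<le> a" "a \<le> t" "2 * L * mass a t \<le> real n" for n a
      using that
    proof (induction n arbitrary: a)
      case 0
      have "0 \<le> L * mass a t" by (rule mult_nonneg_nonneg[OF L mass_nonneg])
      moreover have "2 * (L * mass a t) \<le> 0" using 0(3) by (simp only: of_nat_0 mult.assoc)
      ultimately have e0: "L * mass a t = 0" by linarith
      show ?case using step[OF 0(1,2) order_refl] unfolding e0 Gt by simp
    next
      case (Suc n)
      show ?case
      proof (cases "2 * L * mass a t \<le> real n")
        case True
        from Suc.IH[OF Suc.prems(1,2) True] have "G a \<le> 2 ^ n * A" .
        also have "\<dots> \<le> 2 ^ Suc n * A" using A by (intro mult_right_mono) auto
        finally show ?thesis .
      next
        case False
        have sub: "{a..t} \<subseteq> {0..T}" using Suc.prems tT by auto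
        have mt: "mass r t = mass 0 t - mass 0 r" if "r \<in> {a..t}" for r
          using mass_add[of 0 r t] that Suc.prems t by auto
        have "continuous_on {a..t} (\<lambda>r. 2 * L * (mass 0 t - mass 0 r))"
          by (intro continuous_intros continuous_on_subset[OF mass_continuous[OF T] sub])
        moreover have "2 * L * (mass 0 t - mass 0 t) \<le> real n" "real n \<le> 2 * L * (mass 0 t - mass 0 a)" 
          using False mt[of a] Suc.prems by auto
        ultimately obtain b where b: "a \<le> b" "b \<le> t" "2 * L * (mass 0 t - mass 0 b) = real n"
          using IVT2'[of "\<lambda>r. 2 * L * (mass 0 t - mass 0 r)" t "real n" a] Suc.prems by auto
        hence bn: "2 * L * mass b t = real n" using mt[of b] by simp
        have "mass a t = mass a b + mass b t" by (rule mass_add) (use b Suc.prems t in auto)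
        hence "2 * L * mass a b \<le> 1" using bn Suc.prems by (simp add: distrib_left)
        hence h: "L * mass a b \<le> 1 / 2" by simp
        have G0: "0 \<le> G a" using Gmono[of a t] Gt A Suc.prems by simp
        have "G a \<le> G b + L * mass a b * G a" by (rule step) (use b Suc.prems in auto)
        also have "\<dots> \<le> G b + 1 / 2 * G a" using h G0 by (intro add_left_mono mult_right_mono) auto
        finally have "G a \<le> 2 * G b" by simp
        also have "G b \<le> 2 ^ n * A" by (rule Suc.IH) (use b bn Suc.prems in auto)
        finally show ?thesis by simp
      qed
    qed
    have "2 * L * mass s t \<le> 2 * L * mass 0 T" using mass_mono[of 0 s t T] s tT T L by (intro mult_left_mono) auto
    also have "\<dots> \<le> real N" unfolding N_def by (rule real_nat_ceiling_ge)
    finally have "G s \<le> 2 ^ N * A" using main[OF s] by blast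
    thus "u s \<le> 2 ^ N * A" using ineq[OF s] unfolding G_def by simp
  qed simp
qed

section \<open>Euler polygons\<close>

text \<open>One step of the Euler method, backwards from time t to time s: the trajectory inside the kernel is
  frozen at its value z at time t.\<close>
definition step :: "real \<Rightarrow> real \<Rightarrow> complex \<Rightarrow> complex" where
  "step s t z = z + of_real (\<gamma> s) - of_real (\<gamma> t) + set_lebesgue_integral H (UNIV \<times> {s..t}) (\<lambda>p. pick_kernel z (fst p))"

lemma step_Im:
  assumes "0 \<le> s" "t \<in> I" "Im z > 0" shows "Im z \<le> Im (step s t z)"
proof -
  have "Im (set_lebesgue_integral H (UNIV \<times> {s..t}) (\<lambda>p. pick_kernel z (fst p))) = (LINT p|H. Im (indicator (UNIV \<times> {s..t}) p *\<^sub>R pick_kernel z (fst p)))"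
    unfolding set_lebesgue_integral_def
    by (rule integral_Im[symmetric]) (use pick_strip_integrable[OF assms(2,1,3)] in \<open>simp add: set_integrable_def\<close>)
  also have "\<dots> \<ge> 0" using Im_pick_kernel_pos[OF assms(3)] by (intro integral_nonneg_AE AE_I2) (auto simp: less_imp_le)
  finally show ?thesis by (simp add: step_def)
qed

lemma step_refl: "t \<in> I \<Longrightarrow> step t t z = z"
  unfolding step_def by (simp only: null_strip_integral) simp

text \<open>Differentiation under the integral sign: the Lipschitz bound of the kernel dominates its difference
  quotients.\<close>
lemma step_holomorphic:
  assumes s: "0 \<le> s" and t: "t \<in> I" shows "step s t holomorphic_on upper_half_plane"
proof -
  define \<Phi> where "\<Phi> z = set_lebesgue_integral H (UNIV \<times> {s..t}) (\<lambda>p. pick_kernel z (fst p))" for z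
  have "\<Phi> field_differentiable (at z within upper_half_plane)" if z0: "z \<in> upper_half_plane" for z
  proof -
    have z: "Im z > 0" using z0 by simp
    define K where "K w x = of_real (1 + x\<^sup>2) / ((of_real x - w) * (of_real x - z))" for w and x :: real
    have den: "complex_of_real x - w \<noteq> 0" if "Im w > 0" for w x using uhp_minus_real_nz[OF that, of x] by auto
    have Kb: "cmod (K w x) \<le> hsize w * hsize z" if w: "Im w > 0" "w \<noteq> z" for w x
    proof -
      have "cmod (w - z) * cmod (K w x) \<le> hsize w * hsize z * cmod (w - z)"
        using pick_kernel_lipschitz[OF w(1) z, of x] unfolding pick_kernel_diff[OF w(1) z] K_def norm_mult .
      thus ?thesis using w by (simp add: mult.commute)
    qed
    have Kc: "continuous_on UNIV (\<lambda>p :: real \<times> real. K w (fst p))" if "Im w > 0" for w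
      unfolding K_def by (intro continuous_intros) (use den[OF that] den[OF z] in auto)
    have Km: "(\<lambda>p. K w (fst p)) \<in> borel_measurable H" if "Im w > 0" for w
      by (intro borel_measurable_H borel_measurable_continuous_onI Kc that)
    have Sm: "(\<lambda>p. indicator (UNIV \<times> {s..t}) p *\<^sub>R K w (fst p)) \<in> borel_measurable H" if "Im w > 0" for w
      using Km[OF that] Icc_sets[OF t s] by (intro borel_measurable_scaleR borel_measurable_indicator)
    have "((\<lambda>w. (\<Phi> w - \<Phi> z) / (w - z)) \<longlongrightarrow> set_lebesgue_integral H (UNIV \<times> {s..t}) (\<lambda>p. K z (fst p))) (at z within upper_half_plane)"
      unfolding tendsto_at_iff_sequentially comp_def
    proof (intro allI impI)
      fix X :: "nat \<Rightarrow> complex" assume X: "\<forall>i. X i \<in> upper_half_plane - {z}" and Xz: "X \<longlonglongrightarrow> z"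
      have Xp: "Im (X n) > 0" "X n \<noteq> z" for n using X by auto
      have "compact (insert z (range X))" by (rule compact_sequence_with_limit[OF Xz])
      moreover have "insert z (range X) \<subseteq> upper_half_plane" using Xp z by auto
      ultimately obtain C where C: "C \<ge> 1" "\<And>w. w \<in> insert z (range X) \<Longrightarrow> hsize w \<le> C" 
        by (rule hsize_bounded_on_compact) blast
      have Kn: "cmod (K (X n) x) \<le> C * C" for n x
        by (rule order_trans[OF Kb[OF Xp]], intro mult_mono C(2)) (use C(1) hsize_pos[OF z] in auto)
      have "(\<lambda>n. set_lebesgue_integral H (UNIV \<times> {s..t}) (\<lambda>p. K (X n) (fst p))) \<longlonglongrightarrow> set_lebesgue_integral H (UNIV \<times> {s..t}) (\<lambda>p. K z (fst p))"
        unfolding set_lebesgue_integral_def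
      proof (rule integral_dominated_convergence[where w = "\<lambda>p. C * C * indicator (UNIV \<times> {s..t}) p"])
        show "integrable H (\<lambda>p. C * C * indicator (UNIV \<times> {s..t}) p)"
          using Icc_sets[OF t s] Icc_fin[OF t s] by (intro integrable_mult_right) (simp add: less_top)
        show "AE p in H. (\<lambda>n. indicator (UNIV \<times> {s..t}) p *\<^sub>R K (X n) (fst p)) \<longlonglongrightarrow> indicator (UNIV \<times> {s..t}) p *\<^sub>R K z (fst p)"
          unfolding K_def by (intro AE_I2 tendsto_intros Xz) (use den[OF z] in auto)
        show "AE p in H. cmod (indicator (UNIV \<times> {s..t}) p *\<^sub>R K (X n) (fst p)) \<le> C * C * indicator (UNIV \<times> {s..t}) p" for n
          using Kn by (intro AE_I2) (auto simp: indicator_def)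
      qed (auto intro!: Sm Xp z)
      moreover have "set_lebesgue_integral H (UNIV \<times> {s..t}) (\<lambda>p. K (X n) (fst p)) = (\<Phi> (X n) - \<Phi> z) / (X n - z)" for n
      proof -
        have "\<Phi> (X n) - \<Phi> z = set_lebesgue_integral H (UNIV \<times> {s..t}) (\<lambda>p. pick_kernel (X n) (fst p) - pick_kernel z (fst p))"
          unfolding \<Phi>_def by (rule set_integral_diff(2)[symmetric]) (intro pick_strip_integrable t s Xp z)+
        also have "\<dots> = (X n - z) * set_lebesgue_integral H (UNIV \<times> {s..t}) (\<lambda>p. K (X n) (fst p))"
          unfolding pick_kernel_diff[OF Xp(1) z] K_def by (rule set_integral_mult_right)
        finally show ?thesis using Xp(2)[of n] by simp
      qed
      ultimately show "(\<lambda>n. (\<Phi> (X n) - \<Phi> z) / (X n - z)) \<longlonglongrightarrow> set_lebesgue_integral H (UNIV \<times> {s..t}) (\<lambda>p. K z (fst p))" by simp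
    qed
    thus ?thesis unfolding field_differentiable_def has_field_derivative_iff by blast
  qed
  hence "\<Phi> holomorphic_on upper_half_plane" by (simp add: holomorphic_on_def)
  hence "(\<lambda>z. z + of_real (\<gamma> s) - of_real (\<gamma> t) + \<Phi> z) holomorphic_on upper_half_plane" by (intro holomorphic_intros)
  thus ?thesis by (simp add: step_def[abs_def] \<Phi>_def)
qed

text \<open>In coordinates shifted by \<gamma>, the step is a map F with F \<i> - \<i> of size at most B * mass
  s t, since B bounds hsize (\<i> + \<gamma> t). The factor of the Schwarz-Pick estimate is then at
  most (1 + B * mass s t)^3. Without the shift it would involve the oscillation of \<gamma>, and the
  product over many steps could be unbounded.\<close>
lemma step_hsize:
  assumes s: "0 \<le> s" "s \<le> t" and t: "t \<in> I" and w: "Im w > 0" and B: "(\<gamma> t)\<^sup>2 + 2 \<le> B"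
  shows "hsize (step s t w - of_real (\<gamma> s)) \<le> exp (3 * B * mass s t) * hsize (w - of_real (\<gamma> t))"
proof -
  define F where "F z = step s t (z + of_real (\<gamma> t)) - of_real (\<gamma> s)" for z
  have hol: "F holomorphic_on upper_half_plane"
  proof -
    have "(step s t \<circ> (\<lambda>z. z + of_real (\<gamma> t))) holomorphic_on upper_half_plane"
      by (rule holomorphic_on_compose_gen[OF _ step_holomorphic[OF s(1) t]]) (auto intro!: holomorphic_intros)
    thus ?thesis unfolding F_def by (intro holomorphic_intros) (simp add: comp_def)
  qed
  have ge: "Im z \<le> Im (F z)" if "Im z > 0" for z
    using step_Im[OF s(1) t, of "z + of_real (\<gamma> t)"] that by (simp add: F_def)
  define \<mu> where "\<mu> = B * mass s t"
  have Bpos: "B \<ge> 0" using B zero_le_power2[of "\<gamma> t"] by linarith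
  have \<mu>0: "\<mu> \<ge> 0" using Bpos by (simp add: \<mu>_def)
  define q where "q = set_lebesgue_integral H (UNIV \<times> {s..t}) (\<lambda>p. pick_kernel (\<i> + of_real (\<gamma> t)) (fst p))"
  have ig: "Im (\<i> + complex_of_real (\<gamma> t)) > 0" by simp
  have "hsize (\<i> + complex_of_real (\<gamma> t)) = (\<gamma> t)\<^sup>2 + 2" by (simp add: hsize_def cmod_power2)
  hence hB: "hsize (\<i> + complex_of_real (\<gamma> t)) \<le> B" using B by simp
  have "cmod q \<le> B * mass s t" unfolding q_def
    by (rule strip_norm_le[OF t s(1) pick_strip_integrable[OF t s(1) ig]]) (rule order_trans[OF pick_kernel_le[OF ig] hB])
  hence q: "\<bar>Re q\<bar> \<le> \<mu>" "Im q \<le> \<mu>" using abs_Re_le_cmod[of q] abs_Im_le_cmod[of q] by (auto simp: \<mu>_def)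
  have Fi: "F \<i> = \<i> + q" by (simp add: F_def step_def q_def)
  have wg: "Im (w - of_real (\<gamma> t)) > 0" using w by simp
  have "hsize (F (w - of_real (\<gamma> t))) \<le> (1 + \<bar>Re (F \<i>)\<bar>)\<^sup>2 * Im (F \<i>) * hsize (w - of_real (\<gamma> t))"
    by (rule hsize_image_le[OF hol ge wg])
  also have "\<dots> \<le> exp (3 * B * mass s t) * hsize (w - of_real (\<gamma> t))"
  proof (rule mult_right_mono)
    have "(1 + \<bar>Re (F \<i>)\<bar>)\<^sup>2 * Im (F \<i>) \<le> (1 + \<mu>)\<^sup>2 * (1 + \<mu>)"
      using q \<mu>0 ge[of \<i>] by (intro mult_mono power_mono) (auto simp: Fi)
    also have "\<dots> \<le> (exp \<mu>)\<^sup>2 * exp \<mu>" using \<mu>0 exp_ge_add_one_self[of \<mu>] by (intro mult_mono power_mono) auto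
    also have "\<dots> = exp (3 * B * mass s t)" by (simp add: \<mu>_def power2_eq_square flip: exp_add) 
    finally show "(1 + \<bar>Re (F \<i>)\<bar>)\<^sup>2 * Im (F \<i>) \<le> exp (3 * B * mass s t)" .
  qed (use hsize_pos[OF wg] in simp)
  finally show ?thesis by (simp add: F_def)
qed

text \<open>The grid t, t - d, t - 2 d, ... is anchored at the final time, where the initial value is given, and
  stays at 0 once it gets there.\<close>
definition node_time :: "real \<Rightarrow> real \<Rightarrow> nat \<Rightarrow> real" where
  "node_time d t k = max 0 (t - real k * d)"

primrec node :: "real \<Rightarrow> real \<Rightarrow> complex \<Rightarrow> nat \<Rightarrow> complex" where
  "node d t z 0 = z"
| "node d t z (Suc k) = step (node_time d t (Suc k)) (node_time d t k) (node d t z k)"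

definition node_index :: "real \<Rightarrow> real \<Rightarrow> real \<Rightarrow> nat" where
  "node_index d t s = nat \<lfloor>(t - s) / d\<rfloor>"

text \<open>The nodes are interpolated by partial steps, so that the polygon solves an exact integral equation,
  with the trajectory in the kernel replaced by the nodes (lemma euler_equation).\<close>
definition euler :: "real \<Rightarrow> real \<Rightarrow> complex \<Rightarrow> real \<Rightarrow> complex" where
  "euler d t z s = step s (node_time d t (node_index d t s)) (node d t z (node_index d t s))"

lemma node_time_props:
  assumes "d > 0" "0 \<le> t" 
  shows "0 \<le> node_time d t k" "node_time d t k \<le> t" "node_time d t (Suc k) \<le> node_time d t k" "node_time d t 0 = t"
  using assms by (auto simp: node_time_def algebra_simps)

lemma node_index_props:
  assumes "d > 0" "0 \<le> s" "s \<le> t"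
  shows "s \<le> node_time d t (node_index d t s)" "node_time d t (node_index d t s) - s \<le> d" 
    "node_time d t (Suc (node_index d t s)) \<le> s"
proof -
  define k where "k = node_index d t s"
  have "0 \<le> (t - s) / d" using assms by simp
  hence "real k = of_int \<lfloor>(t - s) / d\<rfloor>" by (simp add: k_def node_index_def)
  hence k: "real k \<le> (t - s) / d" "(t - s) / d < real k + 1" by linarith+
  hence "real k * d \<le> t - s" "t - s < (real k + 1) * d" using assms(1) by (auto simp: field_simps)
  thus "s \<le> node_time d t (node_index d t s)" "node_time d t (node_index d t s) - s \<le> d" 
    "node_time d t (Suc (node_index d t s)) \<le> s"
    unfolding k_def[symmetric] using assms by (auto simp: node_time_def algebra_simps)
qed

lemma node_index_eq:
  assumes "d > 0" "0 \<le> r" "node_time d t (Suc k) < r" "r \<le> node_time d t k" "r \<le> t"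
  shows "node_index d t r = k"
proof -
  have r0: "r > 0" using assms(2,3) by (auto simp: node_time_def max_def split: if_splits)
  hence 1: "r \<le> t - real k * d" using assms(4) by (auto simp: node_time_def max_def split: if_splits)
  have 2: "t - real (Suc k) * d < r" using assms(3) by (simp add: node_time_def)
  have "real k \<le> (t - r) / d" "(t - r) / d < real k + 1" using 1 2 assms(1) by (auto simp: field_simps)
  hence "\<lfloor>(t - r) / d\<rfloor> = int k" by linarith
  thus ?thesis by (simp add: node_index_def)
qed

lemma node_Im: 
  assumes "t \<in> I" "d > 0" "Im z > 0" 
  shows "Im z \<le> Im (node d t z k)"
proof (induction k)
  case (Suc k)
  note nt = node_time_props[OF assms(2) I_nonneg[OF assms(1)]]
  have "Im (node d t z k) \<le> Im (node d t z (Suc k))"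
    unfolding node.simps by (rule step_Im[OF nt(1) in_I[OF nt(1,2) assms(1)]]) (use assms(3) Suc in simp)
  with Suc show ?case by simp
qed simp

lemma node_hsize_shifted:
  assumes t: "t \<in> I" and d: "d > 0" and z: "Im z > 0" and B: "\<And>r. 0 \<le> r \<Longrightarrow> r \<le> t \<Longrightarrow> (\<gamma> r)\<^sup>2 + 2 \<le> B"
  shows "hsize (node d t z k - of_real (\<gamma> (node_time d t k))) \<le> exp (3 * B * mass (node_time d t k) t) * hsize (z - of_real (\<gamma> t))"
proof (induction k)
  case 0
  show ?case using mass_refl[OF t] node_time_props[OF d I_nonneg[OF t]] by simp
next
  case (Suc k)
  define a b where "a = node_time d t (Suc k)" "b = node_time d t k"
  have ab: "0 \<le> a" "a \<le> b" "b \<le> t" using node_time_props[OF d I_nonneg[OF t]] by (auto simp: a_b_def)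
  have bI: "b \<in> I" by (rule in_I[OF _ ab(3) t]) (use ab in simp)
  have w: "Im (node d t z k) > 0" using node_Im[OF t d z, of k] z by simp
  have "hsize (node d t z (Suc k) - of_real (\<gamma> a)) \<le> exp (3 * B * mass a b) * hsize (node d t z k - of_real (\<gamma> b))"
    unfolding node.simps a_b_def[symmetric] by (rule step_hsize[OF ab(1,2) bI w B]) (use ab in auto)
  also have "\<dots> \<le> exp (3 * B * mass a b) * (exp (3 * B * mass b t) * hsize (z - of_real (\<gamma> t)))"
    using Suc by (intro mult_left_mono) (simp_all add: a_b_def)
  also have "\<dots> = exp (3 * B * mass a t) * hsize (z - of_real (\<gamma> t))"
    using mass_add[OF ab t] by (simp add: distrib_left exp_add)
  finally show ?case by (simp add: a_b_def)
qed

text \<open>The growth factors of the single steps multiply to the exponential of the total mass, so that Q does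
  not depend on the mesh width d.\<close>
lemma euler_hsize:
  assumes T: "T \<in> I"
  obtains Q where "Q \<ge> 1"
    "\<And>t d z k. 0 \<le> t \<Longrightarrow> t \<le> T \<Longrightarrow> d > 0 \<Longrightarrow> Im z > 0 \<Longrightarrow> hsize (node d t z k) \<le> Q * hsize z"
    "\<And>t d z s. 0 \<le> s \<Longrightarrow> s \<le> t \<Longrightarrow> t \<le> T \<Longrightarrow> d > 0 \<Longrightarrow> Im z > 0 \<Longrightarrow> hsize (euler d t z s) \<le> Q * hsize z"
proof -
  have "bounded (\<gamma> ` {0..T})" by (rule compact_imp_bounded[OF compact_continuous_image[OF \<gamma>_cont[OF T] compact_Icc]])
  then obtain G where "\<forall>y\<in>\<gamma> ` {0..T}. norm y \<le> G" unfolding bounded_iff by blast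
  hence G: "\<bar>\<gamma> r\<bar> \<le> G" if "0 \<le> r" "r \<le> T" for r using that by auto
  have G0: "G \<ge> 0" using G[of 0] I_nonneg[OF T] by auto
  define B where "B = G\<^sup>2 + 2"
  have B: "(\<gamma> r)\<^sup>2 + 2 \<le> B" if "0 \<le> r" "r \<le> T" for r
    using power_mono[OF G[OF that], of 2] by (simp add: B_def)
  have B0: "B \<ge> 0" by (simp add: B_def)
  define Q where "Q = (1 + G)\<^sup>2 * exp (3 * B * mass 0 T) * (1 + G)\<^sup>2"
  have main: "hsize w \<le> Q * hsize z" 
    if h: "0 \<le> s" "s \<le> t" "t \<le> T" "Im z > 0" "Im w > 0" and hw: "hsize (w - of_real (\<gamma> s)) \<le> exp (3 * B * mass s t) * hsize (z - of_real (\<gamma> t))" for s t z w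
  proof -
    have "hsize w \<le> (1 + \<bar>\<gamma> s\<bar>)\<^sup>2 * hsize (w - of_real (\<gamma> s))" by (rule hsize_unshift[OF h(5)])
    also have "\<dots> \<le> (1 + G)\<^sup>2 * (exp (3 * B * mass 0 T) * ((1 + G)\<^sup>2 * hsize z))"
    proof (intro mult_mono order_trans[OF hw] power_mono)
      show "1 + \<bar>\<gamma> s\<bar> \<le> 1 + G" using G[of s] h by simp
      show "exp (3 * B * mass s t) \<le> exp (3 * B * mass 0 T)" using B0 mass_mono[of 0 s t T] h T by (simp add: mult_left_mono)
      have "hsize (z - of_real (\<gamma> t)) \<le> (1 + \<bar>- \<gamma> t\<bar>)\<^sup>2 * hsize z" using hsize_shift[OF h(4), of "- \<gamma> t"] by simp
      also have "\<dots> \<le> (1 + G)\<^sup>2 * hsize z" using G[of t] h hsize_pos[OF h(4)] by (intro mult_right_mono power_mono) auto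
      finally show "hsize (z - of_real (\<gamma> t)) \<le> (1 + G)\<^sup>2 * hsize z" .
    qed (use h hsize_pos[of "w - of_real (\<gamma> s)"] hsize_pos[of "z - of_real (\<gamma> t)"] in auto)
    finally show ?thesis by (simp add: Q_def mult_ac)
  qed
  have "1 \<le> (1 + G)\<^sup>2" using G0 by simp
  moreover have "1 \<le> exp (3 * B * mass 0 T)" using B0 by simp
  ultimately have "1 * 1 * 1 \<le> Q" unfolding Q_def by (intro mult_mono) auto
  hence Q1: "Q \<ge> 1" by simp
  show thesis
  proof (rule that[OF Q1])
    fix t d z k assume h: "0 \<le> t" "t \<le> T" "d > (0::real)" "Im z > 0"
    have t: "t \<in> I" by (rule in_I[OF h(1,2) T])
    show "hsize (node d t z k) \<le> Q * hsize z"
      by (rule main[OF _ _ h(2,4) _ node_hsize_shifted[OF t h(3,4)]])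
         (use node_time_props[OF h(3,1)] node_Im[OF t h(3,4), of k] h B in auto)
  next
    fix t d z s assume h: "0 \<le> s" "s \<le> t" "t \<le> T" "d > (0::real)" "Im z > 0"
    have t: "t \<in> I" by (rule in_I[OF _ h(3) T]) (use h in simp)
    define k b where "k = node_index d t s" "b = node_time d t k"
    have b: "s \<le> b" "b \<le> t" using node_index_props[OF h(4,1,2)] node_time_props[OF h(4) I_nonneg[OF t]] by (auto simp: k_b_def)
    have bI: "b \<in> I" by (rule in_I[OF _ b(2) t]) (use h b in simp)
    have w: "Im (node d t z k) > 0" using node_Im[OF t h(4,5), of k] h by simp
    have "hsize (euler d t z s - of_real (\<gamma> s)) \<le> exp (3 * B * mass s b) * hsize (node d t z k - of_real (\<gamma> b))"
      unfolding euler_def k_b_def(1)[symmetric] unfolding k_b_def(2)[symmetric] by (rule step_hsize[OF h(1) b(1) bI w B]) (use h b in auto)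
    also have "\<dots> \<le> exp (3 * B * mass s b) * (exp (3 * B * mass b t) * hsize (z - of_real (\<gamma> t)))"
      unfolding k_b_def by (intro mult_left_mono node_hsize_shifted[OF t h(4,5)] B) (use h in auto)
    also have "\<dots> = exp (3 * B * mass s t) * hsize (z - of_real (\<gamma> t))"
      using mass_add[OF h(1) b t] by (simp add: distrib_left exp_add)
    finally have e: "hsize (euler d t z s - of_real (\<gamma> s)) \<le> exp (3 * B * mass s t) * hsize (z - of_real (\<gamma> t))" .
    have "Im (euler d t z s) > 0"
      using step_Im[OF h(1) bI w] w unfolding euler_def k_b_def by simp
    from main[OF h(1-3,5) this e] show "hsize (euler d t z s) \<le> Q * hsize z" .
  qed
qed

text \<open>The kernel at the last node that is passed on the way from time t down to time snd p.\<close>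
definition node_field :: "real \<Rightarrow> real \<Rightarrow> complex \<Rightarrow> real \<times> real \<Rightarrow> complex" where
  "node_field d t z p = pick_kernel (node d t z (node_index d t (snd p))) (fst p)"

lemma node_field_borel:
  assumes "t \<in> I" "d > 0" "Im z > 0"
  shows "node_field d t z \<in> borel_measurable borel"
proof -
  have 1: "(\<lambda>p. pick_kernel (node d t z k) (fst p)) \<in> borel_measurable borel" for k
    by (intro borel_measurable_continuous_onI continuous_on_pick_kernel continuous_intros) (use node_Im[OF assms, of k] assms in auto)
  have "(\<lambda>p :: real \<times> real. nat \<lfloor>(t - snd p) / d\<rfloor>) \<in> measurable borel (count_space UNIV)" by measurable
  from measurable_compose_countable[OF 1 this] show ?thesis unfolding node_field_def[abs_def] node_index_def .
qed

lemma node_field_bound: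
  assumes T: "T \<in> I"
  obtains Q where "Q \<ge> 1" "\<And>t d z p. 0 \<le> t \<Longrightarrow> t \<le> T \<Longrightarrow> d > 0 \<Longrightarrow> Im z > 0 \<Longrightarrow> cmod (node_field d t z p) \<le> Q * hsize z"
proof -
  obtain Q where Q: "Q \<ge> 1"
    "\<And>t d z k. 0 \<le> t \<Longrightarrow> t \<le> T \<Longrightarrow> d > 0 \<Longrightarrow> Im z > 0 \<Longrightarrow> hsize (node d t z k) \<le> Q * hsize z"
    using euler_hsize[OF T] by metis
  show thesis
  proof (rule that[OF Q(1)])
    fix t d :: real and z and p :: "real \<times> real" assume h: "0 \<le> t" "t \<le> T" "d > 0" "Im z > 0"
    have "Im (node d t z (node_index d t (snd p))) > 0" using node_Im[OF in_I[OF h(1,2) T] h(3,4), of "node_index d t (snd p)"] h by simp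
    thus "cmod (node_field d t z p) \<le> Q * hsize z"
      unfolding node_field_def by (rule order_trans[OF pick_kernel_le Q(2)[OF h]])
  qed
qed

lemma node_field_integrable:
  assumes "t \<in> I" "d > 0" "Im z > 0" "0 \<le> s" "s' \<le> t" "s' \<in> I"
  shows "set_integrable H (UNIV \<times> {s..s'}) (node_field d t z)"
proof -
  obtain Q where "\<And>t' d z p. 0 \<le> t' \<Longrightarrow> t' \<le> t \<Longrightarrow> d > 0 \<Longrightarrow> Im z > 0 \<Longrightarrow> cmod (node_field d t' z p) \<le> Q * hsize z"
    using node_field_bound[OF assms(1)] by metis
  hence "cmod (node_field d t z p) \<le> Q * hsize z" for p using I_nonneg[OF assms(1)] assms by auto
  thus ?thesis by (intro strip_integrable[where C = "Q * hsize z"] node_field_borel assms)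
qed

text \<open>During a single step the frozen node does not change, except at the lower end, where the index may
  jump, and this end is a null set.\<close>
lemma step_as_node_field:
  assumes t: "t \<in> I" and d: "d > 0" and z: "Im z > 0" and s: "0 \<le> s" "node_time d t (Suc k) \<le> s" "s \<le> node_time d t k"
  shows "set_lebesgue_integral H (UNIV \<times> {s..node_time d t k}) (\<lambda>p. pick_kernel (node d t z k) (fst p))
    = set_lebesgue_integral H (UNIV \<times> {s..node_time d t k}) (node_field d t z)"
proof -
  note nt = node_time_props[OF d I_nonneg[OF t]]
  have bI: "node_time d t k \<in> I" by (rule in_I[OF nt(1,2) t])
  have sI: "s \<in> I" by (rule in_I[OF s(1,3) bI])
  have w: "Im (node d t z k) > 0" using node_Im[OF t d z, of k] z by simp
  show ?thesis unfolding set_lebesgue_integral_def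
  proof (rule integral_cong_AE)
    show "(\<lambda>p. indicator (UNIV \<times> {s..node_time d t k}) p *\<^sub>R pick_kernel (node d t z k) (fst p)) \<in> borel_measurable H"
      using pick_strip_integrable[OF bI s(1) w] by (simp add: set_integrable_def)
    show "(\<lambda>p. indicator (UNIV \<times> {s..node_time d t k}) p *\<^sub>R node_field d t z p) \<in> borel_measurable H"
      using node_field_integrable[OF t d z s(1) nt(2) bI] by (simp add: set_integrable_def)
    have "AE p in H. p \<notin> UNIV \<times> {s}" by (rule AE_not_in[OF line_null[OF sI]])
    thus "AE p in H. indicator (UNIV \<times> {s..node_time d t k}) p *\<^sub>R pick_kernel (node d t z k) (fst p) 
        = indicator (UNIV \<times> {s..node_time d t k}) p *\<^sub>R node_field d t z p"
    proof eventually_elim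
      case (elim p)
      show ?case
      proof (cases "snd p \<in> {s..node_time d t k}")
        case True
        hence "s < snd p" "snd p \<le> node_time d t k" using elim by (auto simp: mem_Times_iff order_less_le)
        hence "node_index d t (snd p) = k" using s nt(2)[of k] by (intro node_index_eq[OF d]) auto
        thus ?thesis by (simp add: node_field_def)
      qed (auto simp: indicator_def mem_Times_iff)
    qed
  qed
qed

lemma node_equation:
  assumes t: "t \<in> I" and d: "d > 0" and z: "Im z > 0"
  shows "node d t z k = z + of_real (\<gamma> (node_time d t k)) - of_real (\<gamma> t) + set_lebesgue_integral H (UNIV \<times> {node_time d t k..t}) (node_field d t z)"
proof (induction k)
  case 0
  show ?case using null_strip_integral[OF t, of "node_field d t z"] node_time_props(4)[OF d I_nonneg[OF t]] by simp
next
  case (Suc k)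
  note nt = node_time_props[OF d I_nonneg[OF t]]
  have "set_lebesgue_integral H (UNIV \<times> {node_time d t (Suc k)..t}) (node_field d t z)
     = set_lebesgue_integral H (UNIV \<times> {node_time d t (Suc k)..node_time d t k}) (node_field d t z) + set_lebesgue_integral H (UNIV \<times> {node_time d t k..t}) (node_field d t z)"
    by (rule strip_split[OF nt(1,3,2) t node_field_integrable[OF t d z nt(1) order_refl t]])
  thus ?case unfolding node.simps step_def step_as_node_field[OF t d z nt(1) order_refl nt(3)] using Suc by simp
qed

lemma euler_equation:
  assumes t: "t \<in> I" and d: "d > 0" and z: "Im z > 0" and s: "0 \<le> s" "s \<le> t"
  shows "euler d t z s = z + of_real (\<gamma> s) - of_real (\<gamma> t) + set_lebesgue_integral H (UNIV \<times> {s..t}) (node_field d t z)"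
proof -
  define k where "k = node_index d t s"
  note nt = node_time_props[OF d I_nonneg[OF t]]
  note ni = node_index_props[OF d s, folded k_def]
  have "set_lebesgue_integral H (UNIV \<times> {s..t}) (node_field d t z)
     = set_lebesgue_integral H (UNIV \<times> {s..node_time d t k}) (node_field d t z) + set_lebesgue_integral H (UNIV \<times> {node_time d t k..t}) (node_field d t z)"
    by (rule strip_split[OF s(1) ni(1) nt(2) t node_field_integrable[OF t d z s(1) order_refl t]])
  thus ?thesis
    unfolding euler_def k_def[symmetric] step_def step_as_node_field[OF t d z s(1) ni(3,1)] using node_equation[OF t d z, of k] by simp
qed

text \<open>The modulus of continuity of a solution depends on the integrand only through a bound.\<close>
lemma drift_modulus:
  assumes t: "t \<in> I" and W: "\<And>s. 0 \<le> s \<Longrightarrow> s \<le> t \<Longrightarrow> W s = z + of_real (\<gamma> s) - of_real (\<gamma> t) + set_lebesgue_integral H (UNIV \<times> {s..t}) g"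
    and int: "set_integrable H (UNIV \<times> {0..t}) g" and b: "\<And>p. snd p \<in> {0..t} \<Longrightarrow> cmod (g p) \<le> C"
    and s: "0 \<le> s" "s \<le> s'" "s' \<le> t"
  shows "cmod (W s - W s') \<le> \<bar>\<gamma> s - \<gamma> s'\<bar> + C * mass s s'"
proof -
  have s'I: "s' \<in> I" by (rule in_I[OF _ s(3) t]) (use s in simp)
  have sub: "set_integrable H (UNIV \<times> {a..b}) g" if "0 \<le> a" "b \<le> t" "b \<in> I" for a b
    by (rule set_integrable_subset[OF int Icc_sets[OF that(3,1)]]) (use that in auto)
  have "W s - W s' = of_real (\<gamma> s - \<gamma> s') + set_lebesgue_integral H (UNIV \<times> {s..s'}) g"
    using strip_split[OF s t sub[OF s(1) order_refl t]] W[of s] W[of s'] s by simp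
  also have "cmod \<dots> \<le> \<bar>\<gamma> s - \<gamma> s'\<bar> + C * mass s s'"
  proof (rule order_trans[OF norm_triangle_ineq] add_mono)+
    show "cmod (set_lebesgue_integral H (UNIV \<times> {s..s'}) g) \<le> C * mass s s'"
      by (rule strip_norm_le[OF s'I s(1) sub[OF s(1,3) s'I]]) (use b s in auto)
  qed simp
  finally show ?thesis .
qed

lemma modulus_continuous:
  assumes T: "T \<in> I" and t: "t \<le> T" and C: "C \<ge> 0"
    and m: "\<And>s s'. 0 \<le> s \<Longrightarrow> s \<le> s' \<Longrightarrow> s' \<le> t \<Longrightarrow> cmod (W s - W s') \<le> \<bar>\<gamma> s - \<gamma> s'\<bar> + C * mass s s'"
  shows "continuous_on {0..t} W"
  unfolding continuous_on_iff
proof (intro ballI allI impI)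
  fix s and e :: real assume s: "s \<in> {0..t}" and e: "e > 0"
  obtain \<delta> where \<delta>: "\<delta> > 0" "\<And>s s'. 0 \<le> s \<Longrightarrow> s \<le> s' \<Longrightarrow> s' \<le> T \<Longrightarrow> s' - s \<le> \<delta> \<Longrightarrow> \<bar>\<gamma> s - \<gamma> s'\<bar> + C * mass s s' \<le> e / 2"
    using driving_modulus[OF T C, of "e / 2"] e by auto
  show "\<exists>d>0. \<forall>x'\<in>{0..t}. dist x' s < d \<longrightarrow> dist (W x') (W s) < e"
  proof (intro exI[of _ \<delta>] conjI \<delta>(1) ballI impI)
    fix r assume r: "r \<in> {0..t}" "dist r s < \<delta>"
    have "cmod (W (min r s) - W (max r s)) \<le> e / 2"
      by (rule order_trans[OF m \<delta>(2)]) (use r s t in \<open>auto simp: dist_real_def\<close>)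
    hence "cmod (W r - W s) \<le> e / 2" by (auto simp: min_def max_def norm_minus_commute split: if_splits)
    thus "dist (W r) (W s) < e" using e by (simp add: dist_norm)
  qed
qed

lemma set_integral_norm_le:
  fixes g :: "real \<times> real \<Rightarrow> complex"
  assumes "set_integrable H S g" "set_integrable H S h" "\<And>p. p \<in> S \<Longrightarrow> cmod (g p) \<le> h p"
  shows "cmod (set_lebesgue_integral H S g) \<le> set_lebesgue_integral H S h"
  unfolding set_lebesgue_integral_def
  by (rule Bochner_Integration.integral_norm_bound_integral)
     (use assms in \<open>auto simp: set_integrable_def indicator_def\<close>)

section \<open>Stability of the integral equation\<close>

text \<open>W solves the integral equation with V in place of W inside the kernel, where V stays in a sublevel
  set of hsize and within \<epsilon> of W. Exact solutions have V = W and \<epsilon> = 0; for Euler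
  polygons, V is the frozen node.\<close>
definition perturbed_solution :: "real \<Rightarrow> real \<Rightarrow> real \<Rightarrow> complex \<Rightarrow> (real \<Rightarrow> complex) \<Rightarrow> (real \<Rightarrow> complex) \<Rightarrow> bool" where
  "perturbed_solution C \<epsilon> t z V W \<longleftrightarrow> continuous_on {0..t} W \<and>
     (\<forall>r\<in>{0..t}. Im (V r) > 0 \<and> hsize (V r) \<le> C \<and> cmod (V r - W r) \<le> \<epsilon>) \<and>
     set_integrable H (UNIV \<times> {0..t}) (\<lambda>p. pick_kernel (V (snd p)) (fst p)) \<and>
     (\<forall>s\<in>{0..t}. W s = z + of_real (\<gamma> s) - of_real (\<gamma> t) + set_lebesgue_integral H (UNIV \<times> {s..t}) (\<lambda>p. pick_kernel (V (snd p)) (fst p)))"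

text \<open>The two kernels differ by at most C^2 |V1 - V2|, hence by at most C^2 (|W1 - W2| + 2 \<epsilon>),
  and Gronwall's inequality applies to |W1 - W2|.\<close>
lemma kernel_stability:
  assumes T: "T \<in> I" and C: "C \<ge> 1"
  obtains K where "K \<ge> 1"
    "\<And>t W1 W2 V1 V2 z1 z2 \<epsilon> s. t \<le> T \<Longrightarrow> \<epsilon> \<ge> 0 \<Longrightarrow> perturbed_solution C \<epsilon> t z1 V1 W1 \<Longrightarrow> perturbed_solution C \<epsilon> t z2 V2 W2 \<Longrightarrow>
      0 \<le> s \<Longrightarrow> s \<le> t \<Longrightarrow> cmod (W1 s - W2 s) \<le> K * (cmod (z1 - z2) + \<epsilon>)"
proof -
  define L where "L = C * C"
  have L: "L \<ge> 0" using C by (simp add: L_def)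
  obtain K where K: "K \<ge> 1"
    "\<And>t u A s. t \<le> T \<Longrightarrow> A \<ge> 0 \<Longrightarrow> continuous_on {0..t} u \<Longrightarrow> (\<And>r. 0 \<le> r \<Longrightarrow> r \<le> t \<Longrightarrow> 0 \<le> u r) \<Longrightarrow>
       (\<And>s. 0 \<le> s \<Longrightarrow> s \<le> t \<Longrightarrow> u s \<le> A + L * set_lebesgue_integral H (UNIV \<times> {s..t}) (\<lambda>p. u (snd p))) \<Longrightarrow>
       0 \<le> s \<Longrightarrow> s \<le> t \<Longrightarrow> u s \<le> K * A"
    by (rule gronwall[OF T L]) blast
  define K' where "K' = K * (1 + 2 * L * mass 0 T)"
  have K'1: "K' \<ge> 1" 
  proof -
    have "1 * 1 \<le> K * (1 + 2 * L * mass 0 T)" using K(1) L by (intro mult_mono) auto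
    thus ?thesis by (simp add: K'_def)
  qed
  show thesis
  proof (rule that[OF K'1])
    fix t \<epsilon> s :: real and W1 W2 V1 V2 :: "real \<Rightarrow> complex" and z1 z2 :: complex
    assume tT: "t \<le> T" and \<epsilon>: "\<epsilon> \<ge> 0" and s: "0 \<le> s" "s \<le> t"
      and ps: "perturbed_solution C \<epsilon> t z1 V1 W1" "perturbed_solution C \<epsilon> t z2 V2 W2"
    note ps' = ps[unfolded perturbed_solution_def]
    have Wc: "continuous_on {0..t} W1" "continuous_on {0..t} W2"
      and i1: "set_integrable H (UNIV \<times> {0..t}) (\<lambda>p. pick_kernel (V1 (snd p)) (fst p))"
      and i2: "set_integrable H (UNIV \<times> {0..t}) (\<lambda>p. pick_kernel (V2 (snd p)) (fst p))"
      using ps' by simp_all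
    have V1: "Im (V1 r) > 0 \<and> hsize (V1 r) \<le> C \<and> cmod (V1 r - W1 r) \<le> \<epsilon>"
      and V2: "Im (V2 r) > 0 \<and> hsize (V2 r) \<le> C \<and> cmod (V2 r - W2 r) \<le> \<epsilon>" if "0 \<le> r" "r \<le> t" for r
      using ps'(1)[THEN conjunct2, THEN conjunct1, THEN bspec, of r] ps'(2)[THEN conjunct2, THEN conjunct1, THEN bspec, of r] that by simp_all
    have e1: "W1 a = z1 + of_real (\<gamma> a) - of_real (\<gamma> t) + set_lebesgue_integral H (UNIV \<times> {a..t}) (\<lambda>p. pick_kernel (V1 (snd p)) (fst p))"
      and e2: "W2 a = z2 + of_real (\<gamma> a) - of_real (\<gamma> t) + set_lebesgue_integral H (UNIV \<times> {a..t}) (\<lambda>p. pick_kernel (V2 (snd p)) (fst p))"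
      if "0 \<le> a" "a \<le> t" for a
      using ps'(1)[THEN conjunct2, THEN conjunct2, THEN conjunct2, THEN bspec, of a]
        ps'(2)[THEN conjunct2, THEN conjunct2, THEN conjunct2, THEN bspec, of a] that by simp_all
    have t: "t \<in> I" "0 \<le> t" using in_I[OF _ tT T] s by auto
    define u where "u r = cmod (W1 r - W2 r)" for r
    have uc: "continuous_on {0..t} u" unfolding u_def by (intro continuous_intros Wc)
    define A where "A = cmod (z1 - z2) + 2 * L * mass 0 T * \<epsilon>"
    have A0: "A \<ge> 0" unfolding A_def using L \<epsilon> by simp
    have ineq: "u a \<le> A + L * set_lebesgue_integral H (UNIV \<times> {a..t}) (\<lambda>p. u (snd p))" if a: "0 \<le> a" "a \<le> t" for a
    proof -
      let ?S = "UNIV \<times> {a..t} :: (real \<times> real) set"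
      have sub: "?S \<in> sets H" "?S \<subseteq> UNIV \<times> {0..t}" using Icc_sets[OF t(1) a(1)] a by auto
      note j1 = set_integrable_subset[OF i1 sub] and j2 = set_integrable_subset[OF i2 sub]
      have c1: "set_integrable H ?S (\<lambda>_. 2 * L * \<epsilon>)" by (rule strip_integrable[where C = "2 * L * \<epsilon>", OF t(1) a(1)]) (use L \<epsilon> in auto)
      have c2: "set_integrable H ?S (\<lambda>p. L * u (snd p))" using continuous_time_integrable[OF t(1) uc a order_refl] by simp
      have "W1 a - W2 a = (z1 - z2) + set_lebesgue_integral H ?S (\<lambda>p. pick_kernel (V1 (snd p)) (fst p) - pick_kernel (V2 (snd p)) (fst p))"
        unfolding set_integral_diff(2)[OF j1 j2] using e1[OF a] e2[OF a] by simp
      hence "u a \<le> cmod (z1 - z2) + cmod (set_lebesgue_integral H ?S (\<lambda>p. pick_kernel (V1 (snd p)) (fst p) - pick_kernel (V2 (snd p)) (fst p)))"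
        unfolding u_def by (simp add: norm_triangle_ineq)
      also have "cmod (set_lebesgue_integral H ?S (\<lambda>p. pick_kernel (V1 (snd p)) (fst p) - pick_kernel (V2 (snd p)) (fst p)))
          \<le> set_lebesgue_integral H ?S (\<lambda>p. 2 * L * \<epsilon> + L * u (snd p))"
      proof (rule set_integral_norm_le[OF set_integral_diff(1)[OF j1 j2] set_integral_add(1)[OF c1 c2]])
        fix p :: "real \<times> real" assume "p \<in> ?S"
        hence p: "0 \<le> snd p" "snd p \<le> t" using a by auto
        note v1 = V1[OF p] and v2 = V2[OF p]
        have "cmod (V1 (snd p) - V2 (snd p)) = cmod ((V1 (snd p) - W1 (snd p)) + (W1 (snd p) - W2 (snd p)) - (V2 (snd p) - W2 (snd p)))" by simp
        also have "\<dots> \<le> \<epsilon> + u (snd p) + \<epsilon>"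
          unfolding u_def by (rule order_trans[OF norm_triangle_ineq4], rule add_mono, rule order_trans[OF norm_triangle_ineq]) (use v1 v2 in auto)
        finally have v: "cmod (V1 (snd p) - V2 (snd p)) \<le> u (snd p) + 2 * \<epsilon>" by simp
        have "cmod (pick_kernel (V1 (snd p)) (fst p) - pick_kernel (V2 (snd p)) (fst p)) \<le> hsize (V1 (snd p)) * hsize (V2 (snd p)) * cmod (V1 (snd p) - V2 (snd p))"
          by (rule pick_kernel_lipschitz) (use v1 v2 in auto)
        also have "\<dots> \<le> C * C * (u (snd p) + 2 * \<epsilon>)"
          using v1 v2 v C hsize_pos[of "V2 (snd p)"] by (intro mult_mono) auto
        finally show "cmod (pick_kernel (V1 (snd p)) (fst p) - pick_kernel (V2 (snd p)) (fst p)) \<le> 2 * L * \<epsilon> + L * u (snd p)"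
          by (simp add: L_def algebra_simps)
      qed
      also have "\<dots> = 2 * L * \<epsilon> * mass a t + L * set_lebesgue_integral H ?S (\<lambda>p. u (snd p))"
      proof -
        have "set_lebesgue_integral H ?S (\<lambda>_. 2 * L * \<epsilon> * 1) = 2 * L * \<epsilon> * mass a t" unfolding mass_eq[OF t(1) a(1)] by (rule set_integral_mult_right)
        thus ?thesis unfolding set_integral_add(2)[OF c1 c2] by simp
      qed
      also have "2 * L * \<epsilon> * mass a t \<le> 2 * L * \<epsilon> * mass 0 T" using mass_mono[of 0 a t T] a tT T L \<epsilon> by (intro mult_left_mono) auto
      finally show ?thesis by (simp add: A_def mult_ac)
    qed
    have "u s \<le> K * A" by (rule K(2)[OF tT A0 uc _ ineq s]) (auto simp: u_def)
    also have "\<dots> \<le> K' * (cmod (z1 - z2) + \<epsilon>)"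
    proof -
      have "A \<le> (1 + 2 * L * mass 0 T) * (cmod (z1 - z2) + \<epsilon>)" unfolding A_def using L \<epsilon> by (simp add: algebra_simps)
      from mult_left_mono[OF this, of K] show ?thesis using K(1) by (simp add: K'_def mult.assoc)
    qed
    finally show "cmod (W1 s - W2 s) \<le> K' * (cmod (z1 - z2) + \<epsilon>)" by (simp add: u_def)
  qed
qed

lemma euler_modulus:
  assumes T: "T \<in> I"
  obtains Q where "Q \<ge> 1"
    "\<And>t d z s s'. t \<le> T \<Longrightarrow> d > 0 \<Longrightarrow> Im z > 0 \<Longrightarrow> 0 \<le> s \<Longrightarrow> s \<le> s' \<Longrightarrow> s' \<le> t \<Longrightarrow> 
       cmod (euler d t z s - euler d t z s') \<le> \<bar>\<gamma> s - \<gamma> s'\<bar> + Q * hsize z * mass s s'"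
    "\<And>t d z k. 0 \<le> t \<Longrightarrow> t \<le> T \<Longrightarrow> d > 0 \<Longrightarrow> Im z > 0 \<Longrightarrow> hsize (node d t z k) \<le> Q * hsize z"
    "\<And>t d z s. 0 \<le> s \<Longrightarrow> s \<le> t \<Longrightarrow> t \<le> T \<Longrightarrow> d > 0 \<Longrightarrow> Im z > 0 \<Longrightarrow> hsize (euler d t z s) \<le> Q * hsize z"
proof -
  obtain Q where Q: "Q \<ge> 1"
    "\<And>t d z k. 0 \<le> t \<Longrightarrow> t \<le> T \<Longrightarrow> d > 0 \<Longrightarrow> Im z > 0 \<Longrightarrow> hsize (node d t z k) \<le> Q * hsize z"
    "\<And>t d z s. 0 \<le> s \<Longrightarrow> s \<le> t \<Longrightarrow> t \<le> T \<Longrightarrow> d > 0 \<Longrightarrow> Im z > 0 \<Longrightarrow> hsize (euler d t z s) \<le> Q * hsize z"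
    using euler_hsize[OF T] by blast
  show thesis
  proof (rule that[OF Q(1) _ Q(2,3)])
    fix t d z s s' assume h: "t \<le> T" "(d::real) > 0" "Im z > 0" "0 \<le> s" "s \<le> s'" "s' \<le> t"
    have t: "t \<in> I" by (rule in_I[OF _ h(1) T]) (use h in simp)
    show "cmod (euler d t z s - euler d t z s') \<le> \<bar>\<gamma> s - \<gamma> s'\<bar> + Q * hsize z * mass s s'"
    proof (rule drift_modulus[OF t euler_equation[OF t h(2,3)] node_field_integrable[OF t h(2,3) order_refl order_refl t] _ h(4-6)])
      fix p :: "real \<times> real"
      have "Im (node d t z (node_index d t (snd p))) > 0" using node_Im[OF t h(2,3), of "node_index d t (snd p)"] h(3) by simp
      thus "cmod (node_field d t z p) \<le> Q * hsize z"
        unfolding node_field_def by (rule order_trans[OF pick_kernel_le Q(2)[OF I_nonneg[OF t] h(1-3)]])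
    qed
  qed
qed

lemma node_eq_euler:
  assumes t: "t \<in> I" and d: "d > 0" and z: "Im z > 0" and r: "0 \<le> r" "r \<le> t"
  shows "node d t z (node_index d t r) = euler d t z (node_time d t (node_index d t r))"
proof -
  define k where "k = node_index d t r"
  have "0 \<le> (t - r) / d" using r d by simp
  hence "real k = of_int \<lfloor>(t - r) / d\<rfloor>" by (simp add: k_def node_index_def)
  hence "real k \<le> (t - r) / d" by linarith
  hence "real k * d \<le> t - r" using d by (simp add: field_simps)
  hence nt: "node_time d t k = t - real k * d" using r by (simp add: node_time_def)
  have "node_index d t (node_time d t k) = k" using d by (simp add: nt node_index_def)
  moreover have "node_time d t k \<in> I" using node_time_props(1,2)[OF d I_nonneg[OF t], of k] by (intro in_I[OF _ _ t])
  ultimately show ?thesis unfolding k_def[symmetric] by (simp add: euler_def step_refl)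
qed

text \<open>Within one step the polygon moves little, by the uniform continuity of \<gamma> and of the mass.
  Euler polygons on fine grids are therefore perturbed solutions with small \<epsilon>, all with the
  same initial value.\<close>
lemma euler_Cauchy:
  assumes T: "T \<in> I" and C: "C \<ge> 1" and e: "e > 0"
  obtains \<delta> where "\<delta> > 0"
    "\<And>t d d' z s. t \<le> T \<Longrightarrow> 0 < d \<Longrightarrow> d \<le> \<delta> \<Longrightarrow> 0 < d' \<Longrightarrow> d' \<le> \<delta> \<Longrightarrow> Im z > 0 \<Longrightarrow> hsize z \<le> C \<Longrightarrow> 0 \<le> s \<Longrightarrow> s \<le> t \<Longrightarrow>
       cmod (euler d t z s - euler d' t z s) \<le> e"
    "\<And>t d z r. t \<le> T \<Longrightarrow> 0 < d \<Longrightarrow> d \<le> \<delta> \<Longrightarrow> Im z > 0 \<Longrightarrow> hsize z \<le> C \<Longrightarrow> 0 \<le> r \<Longrightarrow> r \<le> t \<Longrightarrow>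
       cmod (node d t z (node_index d t r) - euler d t z r) \<le> e"
proof -
  obtain Q where Q: "Q \<ge> 1"
    "\<And>t d z s s'. t \<le> T \<Longrightarrow> d > 0 \<Longrightarrow> Im z > 0 \<Longrightarrow> 0 \<le> s \<Longrightarrow> s \<le> s' \<Longrightarrow> s' \<le> t \<Longrightarrow> 
       cmod (euler d t z s - euler d t z s') \<le> \<bar>\<gamma> s - \<gamma> s'\<bar> + Q * hsize z * mass s s'"
    "\<And>t d z k. 0 \<le> t \<Longrightarrow> t \<le> T \<Longrightarrow> d > 0 \<Longrightarrow> Im z > 0 \<Longrightarrow> hsize (node d t z k) \<le> Q * hsize z"
    "\<And>t d z s. 0 \<le> s \<Longrightarrow> s \<le> t \<Longrightarrow> t \<le> T \<Longrightarrow> d > 0 \<Longrightarrow> Im z > 0 \<Longrightarrow> hsize (euler d t z s) \<le> Q * hsize z"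
    using euler_modulus[OF T] by blast
  define C' where "C' = Q * C"
  have C'1: "C' \<ge> 1" 
  proof -
    have "1 * 1 \<le> Q * C" using Q(1) C by (intro mult_mono) auto
    thus ?thesis by (simp add: C'_def)
  qed
  have QC: "Q * hsize z \<le> C'" if "hsize z \<le> C" for z using that Q(1) by (simp add: C'_def mult_left_mono)
  have mod: "cmod (euler d t z s - euler d t z s') \<le> \<bar>\<gamma> s - \<gamma> s'\<bar> + C' * mass s s'"
    if "t \<le> T" "d > 0" "Im z > 0" "hsize z \<le> C" "0 \<le> s" "s \<le> s'" "s' \<le> t" for t d z s s'
    using Q(2)[OF that(1-3,5-7)] mult_right_mono[OF QC[OF that(4)] mass_nonneg[of s s']] by linarith
  have C'0: "C' \<ge> 0" using C'1 by simp
  obtain K where K: "K \<ge> 1"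
    "\<And>t W1 W2 V1 V2 z1 z2 \<epsilon> s. t \<le> T \<Longrightarrow> \<epsilon> \<ge> 0 \<Longrightarrow> perturbed_solution C' \<epsilon> t z1 V1 W1 \<Longrightarrow> perturbed_solution C' \<epsilon> t z2 V2 W2 \<Longrightarrow>
      0 \<le> s \<Longrightarrow> s \<le> t \<Longrightarrow> cmod (W1 s - W2 s) \<le> K * (cmod (z1 - z2) + \<epsilon>)"
    by (rule kernel_stability[OF T C'1]) blast
  define \<epsilon> where "\<epsilon> = e / K"
  have \<epsilon>: "\<epsilon> > 0" using e K(1) by (simp add: \<epsilon>_def)
  have \<epsilon>e: "\<epsilon> \<le> e" using e K(1) by (simp add: \<epsilon>_def divide_le_eq mult_left_le) 
  obtain \<delta> where \<delta>: "\<delta> > 0" "\<And>s s'. 0 \<le> s \<Longrightarrow> s \<le> s' \<Longrightarrow> s' \<le> T \<Longrightarrow> s' - s \<le> \<delta> \<Longrightarrow> \<bar>\<gamma> s - \<gamma> s'\<bar> + C' * mass s s' \<le> \<epsilon>"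
    by (rule driving_modulus[OF T C'0 \<epsilon>]) blast
  have nd: "cmod (node d t z (node_index d t r) - euler d t z r) \<le> \<epsilon>"
    if h: "t \<le> T" "0 < d" "d \<le> \<delta>" "Im z > 0" "hsize z \<le> C" "0 \<le> r" "r \<le> t" for t d z r
  proof -
    have t: "t \<in> I" by (rule in_I[OF _ h(1) T]) (use h in simp)
    define b where "b = node_time d t (node_index d t r)"
    have b: "r \<le> b" "b - r \<le> d" "b \<le> t" using node_index_props[OF h(2,6,7)] node_time_props(2)[OF h(2) I_nonneg[OF t]] by (auto simp: b_def)
    have "cmod (euler d t z r - euler d t z b) \<le> \<epsilon>"
      by (rule order_trans[OF mod[OF h(1,2,4,5,6) b(1,3)] \<delta>(2)]) (use b h in auto)
    thus ?thesis unfolding node_eq_euler[OF t h(2,4,6,7)] b_def by (simp add: norm_minus_commute)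
  qed
  show thesis
  proof (rule that[OF \<delta>(1)])
    fix t d d' z s
    assume h: "t \<le> T" "0 < d" "d \<le> \<delta>" "0 < d'" "d' \<le> \<delta>" "Im z > 0" "hsize z \<le> C" "0 \<le> s" "s \<le> t"
    have t: "t \<in> I" "0 \<le> t" by (rule in_I[OF _ h(1) T]) (use h in auto)
    have V: "Im (node d t z k) > 0 \<and> hsize (node d t z k) \<le> C'" if "d > 0" for d k
      using node_Im[OF t(1) that h(6), of k] h(6) order_trans[OF Q(3)[OF t(2) h(1) that h(6)] QC[OF h(7)]] by simp
    have cont: "continuous_on {0..t} (euler d t z)" if "d > 0" for d
      by (rule modulus_continuous[OF T h(1) C'0 mod[OF h(1) that h(6,7)]])
    have ps: "perturbed_solution C' \<epsilon> t z (\<lambda>r. node d t z (node_index d t r)) (euler d t z)" if d: "0 < d" "d \<le> \<delta>" for d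
      unfolding perturbed_solution_def
    proof (intro conjI ballI cont d)
      show "set_integrable H (UNIV \<times> {0..t}) (\<lambda>p. pick_kernel (node d t z (node_index d t (snd p))) (fst p))"
        using node_field_integrable[OF t(1) d(1) h(6) order_refl order_refl t(1)] by (simp add: node_field_def[abs_def])
      fix a assume "a \<in> {0..t}"
      hence a: "0 \<le> a" "a \<le> t" by auto
      show "euler d t z a = z + of_real (\<gamma> a) - of_real (\<gamma> t) + set_lebesgue_integral H (UNIV \<times> {a..t}) (\<lambda>p. pick_kernel (node d t z (node_index d t (snd p))) (fst p))"
        using euler_equation[OF t(1) d(1) h(6) a] by (simp add: node_field_def[abs_def])
      show "Im (node d t z (node_index d t a)) > 0" "hsize (node d t z (node_index d t a)) \<le> C'"
        "cmod (node d t z (node_index d t a) - euler d t z a) \<le> \<epsilon>"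
        using V[OF d(1)] nd[OF h(1) d h(6,7) a] by simp_all
    qed
    have "cmod (euler d t z s - euler d' t z s) \<le> K * (cmod (z - z) + \<epsilon>)"
      by (rule K(2)[OF h(1) less_imp_le[OF \<epsilon>] ps[OF h(2,3)] ps[OF h(4,5)] h(8,9)])
    also have "\<dots> = e" using K(1) by (simp add: \<epsilon>_def)
    finally show "cmod (euler d t z s - euler d' t z s) \<le> e" .
  next
    fix t d z r assume "t \<le> T" "0 < d" "d \<le> \<delta>" "Im z > 0" "hsize z \<le> C" "0 \<le> r" "r \<le> t"
    from order_trans[OF nd[OF this] \<epsilon>e] show "cmod (node d t z (node_index d t r) - euler d t z r) \<le> e" .
  qed
qed

section \<open>The flow of a generating pair\<close>

definition mesh :: "nat \<Rightarrow> real" where "mesh n = inverse (real (Suc n))"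

definition flow :: "real \<Rightarrow> real \<Rightarrow> complex \<Rightarrow> complex" where
  "flow s t z = lim (\<lambda>n. euler (mesh n) t z s)"

lemma mesh_pos: "mesh n > 0" by (simp add: mesh_def)

lemma mesh_small: "\<delta> > 0 \<Longrightarrow> \<exists>N. \<forall>n\<ge>N. mesh n \<le> \<delta>"
  using order_tendstoD(2)[OF LIMSEQ_inverse_real_of_nat, of \<delta>] unfolding mesh_def eventually_sequentially by (meson less_imp_le)

text \<open>The rate of convergence depends on z only through hsize z. This uniformity is what transfers
  holomorphy to the limit.\<close>
lemma flow_approx:
  assumes T: "T \<in> I" and C: "C \<ge> 1" and e: "e > 0"
  obtains N where "\<And>n t z s. n \<ge> N \<Longrightarrow> t \<le> T \<Longrightarrow> Im z > 0 \<Longrightarrow> hsize z \<le> C \<Longrightarrow> 0 \<le> s \<Longrightarrow> s \<le> t \<Longrightarrow> cmod (euler (mesh n) t z s - flow s t z) \<le> e"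
    "\<And>n t z s. n \<ge> N \<Longrightarrow> t \<le> T \<Longrightarrow> Im z > 0 \<Longrightarrow> hsize z \<le> C \<Longrightarrow> 0 \<le> s \<Longrightarrow> s \<le> t \<Longrightarrow> cmod (node (mesh n) t z (node_index (mesh n) t s) - euler (mesh n) t z s) \<le> e"
proof -
  have conv: "convergent (\<lambda>n. euler (mesh n) t z s)" if h: "t \<le> T" "Im z > 0" "hsize z \<le> C" "0 \<le> s" "s \<le> t" for t z s
    unfolding Cauchy_convergent_iff[symmetric]
  proof (rule metric_CauchyI)
    fix e :: real assume e: "e > 0"
    obtain \<delta> where \<delta>: "\<delta> > 0" "\<And>t d d' z s. t \<le> T \<Longrightarrow> 0 < d \<Longrightarrow> d \<le> \<delta> \<Longrightarrow> 0 < d' \<Longrightarrow> d' \<le> \<delta> \<Longrightarrow> Im z > 0 \<Longrightarrow> hsize z \<le> C \<Longrightarrow> 0 \<le> s \<Longrightarrow> s \<le> t \<Longrightarrow>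
       cmod (euler d t z s - euler d' t z s) \<le> e / 2"
      by (rule euler_Cauchy[OF T C, of "e / 2"]) (use e in simp, blast)
    obtain N where N: "\<forall>n\<ge>N. mesh n \<le> \<delta>" using mesh_small[OF \<delta>(1)] by blast
    show "\<exists>M. \<forall>m\<ge>M. \<forall>n\<ge>M. dist (euler (mesh m) t z s) (euler (mesh n) t z s) < e"
    proof (intro exI[of _ N] allI impI)
      fix m n assume "N \<le> m" "N \<le> n"
      hence "cmod (euler (mesh m) t z s - euler (mesh n) t z s) \<le> e / 2"
        using N by (intro \<delta>(2)[OF h(1) mesh_pos _ mesh_pos _ h(2-5)]) auto
      thus "dist (euler (mesh m) t z s) (euler (mesh n) t z s) < e" using e by (simp add: dist_norm)
    qed
  qed
  obtain \<delta> where \<delta>: "\<delta> > 0" 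
    "\<And>t d d' z s. t \<le> T \<Longrightarrow> 0 < d \<Longrightarrow> d \<le> \<delta> \<Longrightarrow> 0 < d' \<Longrightarrow> d' \<le> \<delta> \<Longrightarrow> Im z > 0 \<Longrightarrow> hsize z \<le> C \<Longrightarrow> 0 \<le> s \<Longrightarrow> s \<le> t \<Longrightarrow>
       cmod (euler d t z s - euler d' t z s) \<le> e"
    "\<And>t d z r. t \<le> T \<Longrightarrow> 0 < d \<Longrightarrow> d \<le> \<delta> \<Longrightarrow> Im z > 0 \<Longrightarrow> hsize z \<le> C \<Longrightarrow> 0 \<le> r \<Longrightarrow> r \<le> t \<Longrightarrow>
       cmod (node d t z (node_index d t r) - euler d t z r) \<le> e"
    by (rule euler_Cauchy[OF T C e]) blast
  obtain N where N: "\<forall>n\<ge>N. mesh n \<le> \<delta>" using mesh_small[OF \<delta>(1)] by blast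
  show thesis
  proof (rule that[of N])
    fix n t z s assume n: "N \<le> n" and h: "t \<le> T" "Im z > 0" "hsize z \<le> C" "0 \<le> s" "s \<le> t"
    have "(\<lambda>m. euler (mesh m) t z s) \<longlonglongrightarrow> flow s t z" using conv[OF h] unfolding flow_def convergent_LIMSEQ_iff .
    hence "(\<lambda>m. cmod (euler (mesh n) t z s - euler (mesh m) t z s)) \<longlonglongrightarrow> cmod (euler (mesh n) t z s - flow s t z)"
      by (intro tendsto_intros)
    moreover have "\<forall>\<^sub>F m in sequentially. cmod (euler (mesh n) t z s - euler (mesh m) t z s) \<le> e"
      unfolding eventually_sequentially using N n by (intro exI[of _ N] allI impI \<delta>(2)[OF h(1) mesh_pos _ mesh_pos _ h(2-5)]) auto
    ultimately show "cmod (euler (mesh n) t z s - flow s t z) \<le> e" by (rule tendsto_upperbound) simp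
    show "cmod (node (mesh n) t z (node_index (mesh n) t s) - euler (mesh n) t z s) \<le> e"
      by (rule \<delta>(3)[OF h(1) mesh_pos _ h(2-5)]) (use N n in auto)
  qed
qed

lemma flow_limit:
  assumes t: "t \<in> I" and z: "Im z > 0" and s: "0 \<le> s" "s \<le> t"
  shows "(\<lambda>n. euler (mesh n) t z s) \<longlonglongrightarrow> flow s t z" 
    "(\<lambda>n. node (mesh n) t z (node_index (mesh n) t s)) \<longlonglongrightarrow> flow s t z"
proof -
  define C where "C = max 1 (hsize z)"
  have C: "C \<ge> 1" "hsize z \<le> C" by (auto simp: C_def)
  show 1: "(\<lambda>n. euler (mesh n) t z s) \<longlonglongrightarrow> flow s t z"
  proof (rule LIMSEQ_I)
    fix r :: real assume r: "r > 0"
    obtain N where "\<And>n t' z s. n \<ge> N \<Longrightarrow> t' \<le> t \<Longrightarrow> Im z > 0 \<Longrightarrow> hsize z \<le> C \<Longrightarrow> 0 \<le> s \<Longrightarrow> s \<le> t' \<Longrightarrow> cmod (euler (mesh n) t' z s - flow s t' z) \<le> r / 2"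
      by (rule flow_approx[OF t C(1), of "r / 2"]) (use r in simp, blast)
    note b = this[OF _ order_refl z C(2) s]
    show "\<exists>no. \<forall>n\<ge>no. norm (euler (mesh n) t z s - flow s t z) < r"
      by (intro exI[of _ N] allI impI order_le_less_trans[OF b]) (use r in auto)
  qed
  have "(\<lambda>n. node (mesh n) t z (node_index (mesh n) t s) - euler (mesh n) t z s) \<longlonglongrightarrow> 0"
  proof (rule LIMSEQ_I)
    fix r :: real assume r: "r > 0"
    obtain N where "\<And>n t' z s. n \<ge> N \<Longrightarrow> t' \<le> t \<Longrightarrow> Im z > 0 \<Longrightarrow> hsize z \<le> C \<Longrightarrow> 0 \<le> s \<Longrightarrow> s \<le> t' \<Longrightarrow> cmod (node (mesh n) t' z (node_index (mesh n) t' s) - euler (mesh n) t' z s) \<le> r / 2"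
      by (rule flow_approx[OF t C(1), of "r / 2"]) (use r in simp, blast)
    note b = this[OF _ order_refl z C(2) s]
    show "\<exists>no. \<forall>n\<ge>no. norm (node (mesh n) t z (node_index (mesh n) t s) - euler (mesh n) t z s - 0) < r"
      unfolding diff_zero by (intro exI[of _ N] allI impI order_le_less_trans[OF b]) (use r in auto)
  qed
  from tendsto_add[OF this 1] show "(\<lambda>n. node (mesh n) t z (node_index (mesh n) t s)) \<longlonglongrightarrow> flow s t z" by simp
qed

lemma flow_Im:
  assumes t: "t \<in> I" and z: "Im z > 0" and s: "0 \<le> s" "s \<le> t"
  shows "Im z \<le> Im (flow s t z)"
proof (rule tendsto_lowerbound[OF tendsto_Im[OF flow_limit(2)[OF assms]]])
  show "\<forall>\<^sub>F n in sequentially. Im z \<le> Im (node (mesh n) t z (node_index (mesh n) t s))"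
    by (intro always_eventually allI node_Im t mesh_pos z)
qed simp

lemma flow_props:
  assumes T: "T \<in> I"
  obtains Q where "Q \<ge> 1"
    "\<And>t z s. 0 \<le> s \<Longrightarrow> s \<le> t \<Longrightarrow> t \<le> T \<Longrightarrow> Im z > 0 \<Longrightarrow> hsize (flow s t z) \<le> Q * hsize z"
    "\<And>t z s s'. t \<le> T \<Longrightarrow> Im z > 0 \<Longrightarrow> 0 \<le> s \<Longrightarrow> s \<le> s' \<Longrightarrow> s' \<le> t \<Longrightarrow> 
       cmod (flow s t z - flow s' t z) \<le> \<bar>\<gamma> s - \<gamma> s'\<bar> + Q * hsize z * mass s s'"
proof -
  obtain Q where Q: "Q \<ge> 1"
    "\<And>t d z s s'. t \<le> T \<Longrightarrow> d > 0 \<Longrightarrow> Im z > 0 \<Longrightarrow> 0 \<le> s \<Longrightarrow> s \<le> s' \<Longrightarrow> s' \<le> t \<Longrightarrow> 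
       cmod (euler d t z s - euler d t z s') \<le> \<bar>\<gamma> s - \<gamma> s'\<bar> + Q * hsize z * mass s s'"
    "\<And>t d z k. 0 \<le> t \<Longrightarrow> t \<le> T \<Longrightarrow> d > 0 \<Longrightarrow> Im z > 0 \<Longrightarrow> hsize (node d t z k) \<le> Q * hsize z"
    "\<And>t d z s. 0 \<le> s \<Longrightarrow> s \<le> t \<Longrightarrow> t \<le> T \<Longrightarrow> d > 0 \<Longrightarrow> Im z > 0 \<Longrightarrow> hsize (euler d t z s) \<le> Q * hsize z"
    using euler_modulus[OF T] by blast
  show thesis
  proof (rule that[OF Q(1)])
    fix t z s assume h: "0 \<le> s" "s \<le> t" "t \<le> T" "Im z > 0"
    have t: "t \<in> I" by (rule in_I[OF _ h(3) T]) (use h in simp)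
    have "Im (flow s t z) > 0" using flow_Im[OF t h(4,1,2)] h(4) by simp
    hence "(\<lambda>n. hsize (node (mesh n) t z (node_index (mesh n) t s))) \<longlonglongrightarrow> hsize (flow s t z)"
      unfolding hsize_def by (intro tendsto_intros flow_limit(2)[OF t h(4,1,2)]) simp
    thus "hsize (flow s t z) \<le> Q * hsize z"
      by (rule tendsto_upperbound) (use h I_nonneg[OF t] in \<open>auto intro!: always_eventually Q(3) mesh_pos\<close>)
  next
    fix t z s s' assume h: "t \<le> T" "Im z > 0" "0 \<le> s" "s \<le> s'" "s' \<le> t"
    have t: "t \<in> I" by (rule in_I[OF _ h(1) T]) (use h in simp)
    have "(\<lambda>n. cmod (euler (mesh n) t z s - euler (mesh n) t z s')) \<longlonglongrightarrow> cmod (flow s t z - flow s' t z)"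
      by (intro tendsto_intros flow_limit(1)[OF t h(2)]) (use h in auto)
    thus "cmod (flow s t z - flow s' t z) \<le> \<bar>\<gamma> s - \<gamma> s'\<bar> + Q * hsize z * mass s s'"
      by (rule tendsto_upperbound) (intro always_eventually allI Q(2)[OF h(1) mesh_pos h(2-5)], simp)
  qed
qed

lemma flow_continuous:
  assumes t: "t \<in> I" and z: "Im z > 0" shows "continuous_on {0..t} (\<lambda>s. flow s t z)"
proof -
  obtain Q where Q: "Q \<ge> 1" "\<And>t' z s s'. t' \<le> t \<Longrightarrow> Im z > 0 \<Longrightarrow> 0 \<le> s \<Longrightarrow> s \<le> s' \<Longrightarrow> s' \<le> t' \<Longrightarrow> 
       cmod (flow s t' z - flow s' t' z) \<le> \<bar>\<gamma> s - \<gamma> s'\<bar> + Q * hsize z * mass s s'"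
    by (rule flow_props[OF t]) blast
  show ?thesis
    by (rule modulus_continuous[OF t order_refl _ Q(2)[OF order_refl z]]) (use Q(1) hsize_pos[OF z] in auto)
qed

lemma field_integrable:
  assumes t: "t \<in> I" and c: "continuous_on {0..t} w" and w: "\<And>r. 0 \<le> r \<Longrightarrow> r \<le> t \<Longrightarrow> Im (w r) > 0" and s: "0 \<le> s" "s \<le> t"
  shows "set_integrable H (UNIV \<times> {s..t}) (\<lambda>p. pick_kernel (w (snd p)) (fst p))"
proof -
  have "compact (w ` {0..t})" by (intro compact_continuous_image c compact_Icc)
  moreover have "w ` {0..t} \<subseteq> upper_half_plane" using w by auto
  ultimately obtain C where C: "C \<ge> 1" "\<And>v. v \<in> w ` {0..t} \<Longrightarrow> hsize v \<le> C" by (rule hsize_bounded_on_compact) blast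
  define g where "g p = pick_kernel (w (clamp_to 0 t (snd p))) (fst p)" for p
  have cl: "0 \<le> clamp_to 0 t r" "clamp_to 0 t r \<le> t" for r using clamp_to_in[OF I_nonneg[OF t], of r] by auto
  have "continuous_on UNIV (\<lambda>p :: real \<times> real. w (clamp_to 0 t (snd p)))"
    by (rule continuous_on_compose2[OF c]) (use cl in \<open>auto simp: clamp_to_def intro!: continuous_intros\<close>)
  hence gc: "continuous_on UNIV g" unfolding g_def by (intro continuous_on_pick_kernel continuous_intros) (use w cl in auto)
  have "set_integrable H (UNIV \<times> {s..t}) g"
  proof (rule strip_integrable[OF t s(1) borel_measurable_continuous_onI[OF gc]])
    fix p :: "real \<times> real"
    show "cmod (g p) \<le> C" unfolding g_def
      by (rule order_trans[OF pick_kernel_le C(2)]) (use w cl in auto)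
  qed
  moreover have "(\<lambda>p. indicator (UNIV \<times> {s..t}) p *\<^sub>R g p) = (\<lambda>p. indicator (UNIV \<times> {s..t}) p *\<^sub>R pick_kernel (w (snd p)) (fst p))"
    using s by (intro ext) (auto simp: indicator_def g_def clamp_to_id mem_Times_iff)
  ultimately show ?thesis by (simp add: set_integrable_def)
qed

text \<open>The equation of the Euler polygons passes to the limit: the nodes converge to the flow, and
  node_field_bound provides a dominating constant.\<close>
lemma flow_equation:
  assumes t: "t \<in> I" and z: "Im z > 0" and s: "0 \<le> s" "s \<le> t"
  shows "set_integrable H (UNIV \<times> {s..t}) (\<lambda>p. pick_kernel (flow (snd p) t z) (fst p))"
    "flow s t z = z + of_real (\<gamma> s) - of_real (\<gamma> t) + set_lebesgue_integral H (UNIV \<times> {s..t}) (\<lambda>p. pick_kernel (flow (snd p) t z) (fst p))"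
proof -
  have w: "Im (flow r t z) > 0" if "0 \<le> r" "r \<le> t" for r using flow_Im[OF t z that] z by simp
  show int: "set_integrable H (UNIV \<times> {s..t}) (\<lambda>p. pick_kernel (flow (snd p) t z) (fst p))"
    by (rule field_integrable[OF t flow_continuous[OF t z] w s])
  obtain Q where Q: "Q \<ge> 1" "\<And>t' d z p. 0 \<le> t' \<Longrightarrow> t' \<le> t \<Longrightarrow> d > 0 \<Longrightarrow> Im z > 0 \<Longrightarrow> cmod (node_field d t' z p) \<le> Q * hsize z"
    by (rule node_field_bound[OF t]) blast
  have "(\<lambda>n. set_lebesgue_integral H (UNIV \<times> {s..t}) (node_field (mesh n) t z)) \<longlonglongrightarrow> set_lebesgue_integral H (UNIV \<times> {s..t}) (\<lambda>p. pick_kernel (flow (snd p) t z) (fst p))"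
    unfolding set_lebesgue_integral_def
  proof (rule integral_dominated_convergence[where w = "\<lambda>p. Q * hsize z * indicator (UNIV \<times> {s..t}) p"])
    show "integrable H (\<lambda>p. Q * hsize z * indicator (UNIV \<times> {s..t}) p)"
      using Icc_sets[OF t s(1)] Icc_fin[OF t s(1)] by (intro integrable_mult_right) (simp add: less_top)
    show "(\<lambda>p. indicator (UNIV \<times> {s..t}) p *\<^sub>R pick_kernel (flow (snd p) t z) (fst p)) \<in> borel_measurable H"
      using int by (simp add: set_integrable_def)
    show "(\<lambda>p. indicator (UNIV \<times> {s..t}) p *\<^sub>R node_field (mesh n) t z p) \<in> borel_measurable H" for n
      using node_field_integrable[OF t mesh_pos z s(1) order_refl t, of n] by (simp add: set_integrable_def)
    show "AE p in H. cmod (indicator (UNIV \<times> {s..t}) p *\<^sub>R node_field (mesh n) t z p) \<le> Q * hsize z * indicator (UNIV \<times> {s..t}) p" for n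
      using Q(2)[OF I_nonneg[OF t] order_refl mesh_pos z, of n] by (intro AE_I2) (auto simp: indicator_def)
    show "AE p in H. (\<lambda>n. indicator (UNIV \<times> {s..t}) p *\<^sub>R node_field (mesh n) t z p) \<longlonglongrightarrow> indicator (UNIV \<times> {s..t}) p *\<^sub>R pick_kernel (flow (snd p) t z) (fst p)"
    proof (rule AE_I2)
      fix p :: "real \<times> real"
      show "(\<lambda>n. indicator (UNIV \<times> {s..t}) p *\<^sub>R node_field (mesh n) t z p) \<longlonglongrightarrow> indicator (UNIV \<times> {s..t}) p *\<^sub>R pick_kernel (flow (snd p) t z) (fst p)"
      proof (cases "snd p \<in> {s..t}")
        case True
        hence r: "0 \<le> snd p" "snd p \<le> t" using s by auto
        have kc: "continuous_on upper_half_plane (\<lambda>w. pick_kernel w (fst p))"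
          by (rule continuous_on_pick_kernel) (auto intro!: continuous_intros)
        have "(\<lambda>n. pick_kernel (node (mesh n) t z (node_index (mesh n) t (snd p))) (fst p)) \<longlonglongrightarrow> pick_kernel (flow (snd p) t z) (fst p)"
        proof (rule continuous_on_tendsto_compose[OF kc flow_limit(2)[OF t z r]])
          show "\<forall>\<^sub>F n in sequentially. node (mesh n) t z (node_index (mesh n) t (snd p)) \<in> upper_half_plane"
          proof (intro always_eventually allI)
            fix n show "node (mesh n) t z (node_index (mesh n) t (snd p)) \<in> upper_half_plane"
              using node_Im[OF t mesh_pos z, of n "node_index (mesh n) t (snd p)"] z by simp
          qed
        qed (use w[OF r] in simp)
        thus ?thesis unfolding node_field_def by (intro tendsto_intros)
      qed (auto simp: indicator_def mem_Times_iff)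
    qed
  qed
  hence "(\<lambda>n. z + of_real (\<gamma> s) - of_real (\<gamma> t) + set_lebesgue_integral H (UNIV \<times> {s..t}) (node_field (mesh n) t z)) 
     \<longlonglongrightarrow> z + of_real (\<gamma> s) - of_real (\<gamma> t) + set_lebesgue_integral H (UNIV \<times> {s..t}) (\<lambda>p. pick_kernel (flow (snd p) t z) (fst p))"
    by (intro tendsto_intros)
  hence "(\<lambda>n. euler (mesh n) t z s) \<longlonglongrightarrow> z + of_real (\<gamma> s) - of_real (\<gamma> t) + set_lebesgue_integral H (UNIV \<times> {s..t}) (\<lambda>p. pick_kernel (flow (snd p) t z) (fst p))"
    unfolding euler_equation[OF t mesh_pos z s] .
  from LIMSEQ_unique[OF flow_limit(1)[OF t z s] this]
  show "flow s t z = z + of_real (\<gamma> s) - of_real (\<gamma> t) + set_lebesgue_integral H (UNIV \<times> {s..t}) (\<lambda>p. pick_kernel (flow (snd p) t z) (fst p))" .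
qed

section \<open>The flow as a reverse evolution family\<close>

lemma flow_stability:
  assumes T: "T \<in> I" and C: "C \<ge> 1"
  obtains K where "K \<ge> 1" "\<And>t z1 z2 s. t \<le> T \<Longrightarrow> Im z1 > 0 \<Longrightarrow> Im z2 > 0 \<Longrightarrow> hsize z1 \<le> C \<Longrightarrow> hsize z2 \<le> C \<Longrightarrow> 0 \<le> s \<Longrightarrow> s \<le> t \<Longrightarrow>
    cmod (flow s t z1 - flow s t z2) \<le> K * cmod (z1 - z2)"
proof -
  obtain Q where Q: "Q \<ge> 1"
    "\<And>t z s. 0 \<le> s \<Longrightarrow> s \<le> t \<Longrightarrow> t \<le> T \<Longrightarrow> Im z > 0 \<Longrightarrow> hsize (flow s t z) \<le> Q * hsize z"
    by (rule flow_props[OF T]) blast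
  define C' where "C' = Q * C"
  have C'1: "C' \<ge> 1" 
  proof -
    have "1 * 1 \<le> Q * C" using Q(1) C by (intro mult_mono) auto
    thus ?thesis by (simp add: C'_def)
  qed
  obtain K where K: "K \<ge> 1"
    "\<And>t W1 W2 V1 V2 z1 z2 \<epsilon> s. t \<le> T \<Longrightarrow> \<epsilon> \<ge> 0 \<Longrightarrow> perturbed_solution C' \<epsilon> t z1 V1 W1 \<Longrightarrow> perturbed_solution C' \<epsilon> t z2 V2 W2 \<Longrightarrow>
      0 \<le> s \<Longrightarrow> s \<le> t \<Longrightarrow> cmod (W1 s - W2 s) \<le> K * (cmod (z1 - z2) + \<epsilon>)"
    by (rule kernel_stability[OF T C'1]) blast
  show thesis
  proof (rule that[OF K(1)])
    fix t z1 z2 s assume h: "t \<le> T" "Im z1 > 0" "Im z2 > 0" "hsize z1 \<le> C" "hsize z2 \<le> C" "0 \<le> s" "s \<le> t"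
    have t: "t \<in> I" "0 \<le> t" by (rule in_I[OF _ h(1) T]) (use h in auto)
    have V: "Im (flow r t z) > 0" "hsize (flow r t z) \<le> C'"
      if "0 \<le> r" "r \<le> t" "Im z > 0" "hsize z \<le> C" for r z
    proof -
      have "hsize (flow r t z) \<le> Q * hsize z" by (rule Q(2)[OF that(1,2) h(1) that(3)])
      also have "\<dots> \<le> C'" unfolding C'_def using that(4) Q(1) by (intro mult_left_mono) auto
      finally show "hsize (flow r t z) \<le> C'" .
      show "Im (flow r t z) > 0" using flow_Im[OF t(1) that(3,1,2)] that(3) by simp
    qed
    have ps: "perturbed_solution C' 0 t z (\<lambda>r. flow r t z) (\<lambda>r. flow r t z)" if z: "Im z > 0" "hsize z \<le> C" for z
      unfolding perturbed_solution_def
      by (intro conjI ballI flow_continuous[OF t(1) z(1)] flow_equation(1)[OF t(1) z(1) order_refl t(2)] flow_equation(2)[OF t(1) z(1)] V z) auto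
    have "cmod (flow s t z1 - flow s t z2) \<le> K * (cmod (z1 - z2) + 0)"
      by (rule K(2)[OF h(1) order_refl ps[OF h(2,4)] ps[OF h(3,5)] h(6,7)])
    thus "cmod (flow s t z1 - flow s t z2) \<le> K * cmod (z1 - z2)" by simp
  qed
qed

text \<open>A sublevel set of hsize contains both trajectories, and stability applies with \<epsilon> = 0.\<close>
lemma flow_unique:
  assumes t: "t \<in> I" and z: "Im z > 0" and c: "continuous_on {0..t} w" and w: "\<And>r. 0 \<le> r \<Longrightarrow> r \<le> t \<Longrightarrow> Im (w r) > 0"
    and eq: "\<And>s. 0 \<le> s \<Longrightarrow> s \<le> t \<Longrightarrow> w s = z + of_real (\<gamma> s) - of_real (\<gamma> t) + set_lebesgue_integral H (UNIV \<times> {s..t}) (\<lambda>p. pick_kernel (w (snd p)) (fst p))"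
    and s: "0 \<le> s" "s \<le> t"
  shows "w s = flow s t z"
proof -
  have t0: "0 \<le> t" using s by simp
  have fI: "Im (flow r t z) > 0" if "0 \<le> r" "r \<le> t" for r using flow_Im[OF t z that] z by simp
  note fc = flow_continuous[OF t z]
  have "compact (w ` {0..t} \<union> (\<lambda>r. flow r t z) ` {0..t})" by (intro compact_Un compact_continuous_image c fc compact_Icc)
  moreover have "w ` {0..t} \<union> (\<lambda>r. flow r t z) ` {0..t} \<subseteq> upper_half_plane" using w fI by auto
  ultimately obtain C where C: "C \<ge> 1" "\<And>v. v \<in> w ` {0..t} \<union> (\<lambda>r. flow r t z) ` {0..t} \<Longrightarrow> hsize v \<le> C" 
    by (rule hsize_bounded_on_compact) blast
  obtain K where K: "K \<ge> 1"
    "\<And>t' W1 W2 V1 V2 z1 z2 \<epsilon> s. t' \<le> t \<Longrightarrow> \<epsilon> \<ge> 0 \<Longrightarrow> perturbed_solution C \<epsilon> t' z1 V1 W1 \<Longrightarrow> perturbed_solution C \<epsilon> t' z2 V2 W2 \<Longrightarrow>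
      0 \<le> s \<Longrightarrow> s \<le> t' \<Longrightarrow> cmod (W1 s - W2 s) \<le> K * (cmod (z1 - z2) + \<epsilon>)"
    by (rule kernel_stability[OF t C(1)]) blast
  have ps: "perturbed_solution C 0 t z w w" "perturbed_solution C 0 t z (\<lambda>r. flow r t z) (\<lambda>r. flow r t z)"
    unfolding perturbed_solution_def
    by (intro conjI ballI c fc field_integrable[OF t c w order_refl t0] flow_equation(1)[OF t z order_refl t0] eq flow_equation(2)[OF t z] w fI C(2);
        auto)+
  have "cmod (w s - flow s t z) \<le> K * (cmod (z - z) + 0)"
    by (rule K(2)[OF order_refl order_refl ps s])
  thus ?thesis by simp
qed

lemma flow_refl: "t \<in> I \<Longrightarrow> Im z > 0 \<Longrightarrow> flow t t z = z"
  using flow_equation(2)[of t z t] I_nonneg[of t] null_strip_integral[of t "\<lambda>p. pick_kernel (flow (snd p) t z) (fst p)"] by simp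

text \<open>As a function of s, the right side solves the equation up to time t with value flow t u z at time t.\<close>
lemma flow_comp:
  assumes s: "0 \<le> s" "s \<le> t" "t \<le> u" and u: "u \<in> I" and z: "Im z > 0"
  shows "flow s t (flow t u z) = flow s u z"
proof -
  have t: "t \<in> I" by (rule in_I[OF _ s(3) u]) (use s in simp)
  have wI: "Im (flow r u z) > 0" if "0 \<le> r" "r \<le> u" for r using flow_Im[OF u z that] z by simp
  have c: "continuous_on {0..t} (\<lambda>r. flow r u z)" by (rule continuous_on_subset[OF flow_continuous[OF u z]]) (use s in auto)
  have "flow s u z = flow s t (flow t u z)"
  proof (rule flow_unique[where w = "\<lambda>r. flow r u z", OF t wI c wI _ s(1,2)])
    fix a assume a: "0 \<le> a" "a \<le> t"
    have "set_lebesgue_integral H (UNIV \<times> {a..u}) (\<lambda>p. pick_kernel (flow (snd p) u z) (fst p)) =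
      set_lebesgue_integral H (UNIV \<times> {a..t}) (\<lambda>p. pick_kernel (flow (snd p) u z) (fst p)) + set_lebesgue_integral H (UNIV \<times> {t..u}) (\<lambda>p. pick_kernel (flow (snd p) u z) (fst p))"
      by (rule strip_split[OF a s(3) u flow_equation(1)[OF u z a(1)]]) (use a s in simp)
    thus "flow a u z = flow t u z + of_real (\<gamma> a) - of_real (\<gamma> t) + set_lebesgue_integral H (UNIV \<times> {a..t}) (\<lambda>p. pick_kernel (flow (snd p) u z) (fst p))"
      using flow_equation(2)[OF u z, of a] flow_equation(2)[OF u z, of t] a s by simp
  qed (use s in auto)
  thus ?thesis by simp
qed

lemma node_holomorphic:
  assumes t: "t \<in> I" and d: "d > 0"
  shows "(\<lambda>z. node d t z k) holomorphic_on upper_half_plane"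
proof (induction k)
  case (Suc k)
  note nt = node_time_props[OF d I_nonneg[OF t]]
  have "(step (node_time d t (Suc k)) (node_time d t k) \<circ> (\<lambda>z. node d t z k)) holomorphic_on upper_half_plane"
  proof (rule holomorphic_on_compose_gen[OF Suc step_holomorphic[OF nt(1) in_I[OF nt(1,2) t]]])
    show "(\<lambda>z. node d t z k) ` upper_half_plane \<subseteq> upper_half_plane"
      using order_less_le_trans[OF _ node_Im[OF t d]] by auto
  qed
  thus ?case by (simp add: comp_def)
qed (simp add: holomorphic_on_ident)

lemma euler_holomorphic:
  assumes t: "t \<in> I" and d: "d > 0" and s: "0 \<le> s"
  shows "(\<lambda>z. euler d t z s) holomorphic_on upper_half_plane"
proof -
  note nt = node_time_props[OF d I_nonneg[OF t]]
  have "(step s (node_time d t (node_index d t s)) \<circ> (\<lambda>z. node d t z (node_index d t s))) holomorphic_on upper_half_plane"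
  proof (rule holomorphic_on_compose_gen[OF node_holomorphic[OF t d] step_holomorphic[OF s in_I[OF nt(1,2) t]]])
    show "(\<lambda>z. node d t z (node_index d t s)) ` upper_half_plane \<subseteq> upper_half_plane"
      using order_less_le_trans[OF _ node_Im[OF t d]] by auto
  qed
  thus ?thesis by (simp add: comp_def euler_def)
qed

lemma flow_holomorphic:
  assumes t: "t \<in> I" and s: "0 \<le> s" "s \<le> t"
  shows "flow s t holomorphic_on upper_half_plane"
proof (rule holomorphic_uniform_sequence[OF open_uhp euler_holomorphic[OF t mesh_pos s(1)]])
  fix x assume "x \<in> upper_half_plane"
  then obtain d where d: "d > 0" "cball x d \<subseteq> upper_half_plane" using open_uhp open_contains_cball by blast
  obtain C where C: "C \<ge> 1" "\<And>w. w \<in> cball x d \<Longrightarrow> hsize w \<le> C" 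
    using hsize_bounded_on_compact[OF compact_cball d(2)] by metis
  have "uniform_limit (cball x d) (\<lambda>n z. euler (mesh n) t z s) (flow s t) sequentially"
  proof (rule uniform_limitI)
    fix e :: real assume e: "e > 0"
    obtain N where N: "\<And>n t' z s. n \<ge> N \<Longrightarrow> t' \<le> t \<Longrightarrow> Im z > 0 \<Longrightarrow> hsize z \<le> C \<Longrightarrow> 0 \<le> s \<Longrightarrow> s \<le> t' \<Longrightarrow> cmod (euler (mesh n) t' z s - flow s t' z) \<le> e / 2"
      by (rule flow_approx[OF t C(1), of "e / 2"]) (use e in simp, blast)
    have "dist (euler (mesh n) t z s) (flow s t z) < e" if "n \<ge> N" "z \<in> cball x d" for n z
    proof -
      have "Im z > 0" using d(2) that(2) by auto
      from N[OF that(1) order_refl this C(2)[OF that(2)] s] show ?thesis using e by (simp add: dist_norm)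
    qed
    thus "\<forall>\<^sub>F n in sequentially. \<forall>z\<in>cball x d. dist (euler (mesh n) t z s) (flow s t z) < e"
      unfolding eventually_sequentially by blast
  qed
  with d show "\<exists>d>0. cball x d \<subseteq> upper_half_plane \<and> uniform_limit (cball x d) (\<lambda>n z. euler (mesh n) t z s) (flow s t) sequentially" by blast
qed

end

text \<open>In the representation of F - id, the circle kernel at iy is bounded by y for y \<ge> 1.\<close>
lemma imaginary_axis_growth:
  assumes hol: "F holomorphic_on upper_half_plane" and ge: "\<And>z. Im z > 0 \<Longrightarrow> Im z \<le> Im (F z)" and y: "y \<ge> 1"
  shows "cmod (F (\<i> * of_real y)) \<le> (1 + 2 * cmod (F \<i>)) * y"
proof -
  have h1: "(\<lambda>z. F z - z) holomorphic_on upper_half_plane" by (intro holomorphic_intros hol)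
  have h2: "Im (F z - z) \<ge> 0" if "Im z > 0" for z using ge[OF that] by simp
  define z where "z = \<i> * complex_of_real y"
  have z: "Im z > 0" "Im z = y" "Re z = 0" "cmod z = y" using y by (auto simp: z_def norm_mult)
  obtain \<nu> where \<nu>: "sets \<nu> = sets borel" "finite_measure \<nu>" "emeasure \<nu> (- {0..1}) = 0"
    "measure \<nu> UNIV = Im (F \<i> - \<i>)"
    "\<And>z. Im z > 0 \<Longrightarrow> F z - z = of_real (Re (F \<i> - \<i>)) + (LINT u|\<nu>. circle_kernel z u)"
    using Nevanlinna_circle[OF h1 h2] by blast
  interpret finite_measure \<nu> by (rule \<nu>(2))
  have sp: "space \<nu> = UNIV" using sets_eq_imp_space_eq[OF \<nu>(1)] by simp
  have "cmod (circle_kernel z u) \<le> y" for u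
  proof -
    have D: "(cmod (kernel_den z u))\<^sup>2 \<ge> 1"
    proof -
      have "1 = (cos (pi * u))\<^sup>2 + (sin (pi * u))\<^sup>2" by simp
      also have "\<dots> \<le> (cos (pi * u))\<^sup>2 + y\<^sup>2 * (sin (pi * u))\<^sup>2"
        using mult_right_mono[of 1 "y\<^sup>2" "(sin (pi * u))\<^sup>2"] y by (intro add_left_mono) (simp add: one_le_power)
      also have "\<dots> = (cmod (kernel_den z u))\<^sup>2" unfolding kernel_den_norm_sq z by (simp add: power_mult_distrib)
      finally show ?thesis .
    qed
    have "(cmod (circle_kernel z u))\<^sup>2 \<le> y\<^sup>2"
    proof -
      have "(1 + y\<^sup>2) / (cmod (kernel_den z u))\<^sup>2 \<le> (1 + y\<^sup>2) / 1" using D by (intro divide_left_mono) (auto simp: add_nonneg_nonneg)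
      thus ?thesis unfolding norm_circle_kernel_sq[OF z(1)] z(4) by simp
    qed
    thus ?thesis by (rule power2_le_imp_le) (use y in simp)
  qed
  hence "cmod (LINT u|\<nu>. circle_kernel z u) \<le> (LINT u|\<nu>. y)"
    by (intro Bochner_Integration.integral_norm_bound_integral circle_kernel_integrable[OF \<nu>(2,1) z(1)]) auto
  also have "\<dots> = Im (F \<i> - \<i>) * y" using \<nu>(4) by (simp add: sp mult.commute)
  also have "\<dots> \<le> cmod (F \<i>) * y" using y abs_Im_le_cmod[of "F \<i>"] by (intro mult_right_mono) auto
  finally have 1: "cmod (LINT u|\<nu>. circle_kernel z u) \<le> cmod (F \<i>) * y" .
  have "F z = z + of_real (Re (F \<i> - \<i>)) + (LINT u|\<nu>. circle_kernel z u)" using \<nu>(5)[OF z(1)] by (simp add: algebra_simps)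
  hence "cmod (F z) \<le> cmod z + cmod (complex_of_real (Re (F \<i> - \<i>))) + cmod (LINT u|\<nu>. circle_kernel z u)"
    by (metis norm_triangle_le add_right_mono norm_triangle_ineq)
  also have "\<dots> \<le> y + cmod (F \<i>) * y + cmod (F \<i>) * y"
  proof (intro add_mono 1)
    have "cmod (complex_of_real (Re (F \<i> - \<i>))) \<le> cmod (F \<i>) * 1" using abs_Re_le_cmod[of "F \<i>"] by simp
    also have "\<dots> \<le> cmod (F \<i>) * y" using y by (intro mult_left_mono) auto
    finally show "cmod (complex_of_real (Re (F \<i> - \<i>))) \<le> cmod (F \<i>) * y" .
  qed (simp add: z(4))
  finally show ?thesis by (simp add: z_def algebra_simps)
qed

context strip
begin

text \<open>At z = iy the flow w satisfies |w| \<le> R y and Im w \<ge> y. After division by iy the kernel at w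
  is therefore bounded uniformly in x and y, and it tends to zero for each fixed x. By dominated
  convergence the integral equation, divided by iy, leaves the limit one.\<close>
lemma flow_class_P:
  assumes t: "t \<in> I" and s: "0 \<le> s" "s \<le> t"
  shows "flow s t \<in> class_P"
proof (rule class_P_criterion[OF flow_holomorphic[OF t s]])
  show "Im (flow s t z) > 0" if "Im z > 0" for z using flow_Im[OF t that s] that by simp
  obtain Q where Q: "Q \<ge> 1" "\<And>t' z s. 0 \<le> s \<Longrightarrow> s \<le> t' \<Longrightarrow> t' \<le> t \<Longrightarrow> Im z > 0 \<Longrightarrow> hsize (flow s t' z) \<le> Q * hsize z"
    by (rule flow_props[OF t]) blast
  define R where "R = 1 + 2 * (Q * 2)"
  have R1: "R \<ge> 1" using Q(1) by (simp add: R_def)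
  have hi: "hsize \<i> = 2" by (simp add: hsize_def)
  define y where "y n = real (Suc n)" for n
  define zn where "zn n = \<i> * complex_of_real (y n)" for n
  have y: "y n \<ge> 1" "y n > 0" for n by (auto simp: y_def)
  have zI: "Im (zn n) > 0" "Im (zn n) = y n" "cmod (zn n) = y n" "zn n \<noteq> 0" for n using y[of n] by (auto simp: zn_def norm_mult)
  have fb: "cmod (flow r t (zn n)) \<le> R * y n" if r: "0 \<le> r" "r \<le> t" for r n
  proof -
    have fi: "Im (flow r t \<i>) > 0" using flow_Im[OF t _ r, of \<i>] by simp
    have "cmod (flow r t (\<i> * of_real (y n))) \<le> (1 + 2 * cmod (flow r t \<i>)) * y n"
      by (rule imaginary_axis_growth[OF flow_holomorphic[OF t r] flow_Im[OF t _ r] y(1)])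
    also have "\<dots> \<le> R * y n"
    proof (rule mult_right_mono)
      have "cmod (flow r t \<i>) \<le> Q * 2" using order_trans[OF hsize_bounds(3)[OF fi] Q(2)[OF r order_refl, of \<i>]] hi by simp
      thus "1 + 2 * cmod (flow r t \<i>) \<le> R" by (simp add: R_def)
    qed (use y(2)[of n] in simp)
    finally show ?thesis by (simp add: zn_def)
  qed
  define S where "S = R\<^sup>2 + R + 1"
  have pb: "cmod (pick_kernel w x) \<le> S * y n" "cmod (pick_kernel w x) \<le> (1 + \<bar>x\<bar> * (R * y n)) / y n"
    if w: "cmod w \<le> R * y n" "y n \<le> Im w" for w x n
  proof -
    have wp: "Im w > 0" using w y(2)[of n] by linarith
    have nz: "complex_of_real x - w \<noteq> 0" using uhp_minus_real_nz[OF wp, of x] by auto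
    have "Im w \<le> cmod (complex_of_real x - w)" using norm_uhp_minus_real_ge[OF wp, of x] by (simp add: norm_minus_commute)
    hence D: "y n \<le> cmod (complex_of_real x - w)" using w by simp
    have "cmod (1 + of_real x * w) \<le> 1 + \<bar>x\<bar> * (R * y n)"
      by (rule order_trans[OF norm_triangle_ineq]) (use w in \<open>auto simp: norm_mult intro!: mult_left_mono\<close>)
    thus "cmod (pick_kernel w x) \<le> (1 + \<bar>x\<bar> * (R * y n)) / y n"
      unfolding pick_kernel_def norm_divide using D y(2)[of n] R1 by (intro frac_le) (auto intro!: add_nonneg_nonneg mult_nonneg_nonneg)
    have "pick_kernel w x = w + (1 + w\<^sup>2) / (of_real x - w)"
      using nz by (simp add: pick_kernel_def field_simps power2_eq_square)
    hence "cmod (pick_kernel w x) \<le> cmod w + cmod (1 + w\<^sup>2) / cmod (of_real x - w)" by (metis norm_triangle_ineq norm_divide)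
    also have "\<dots> \<le> R * y n + (1 + (R * y n)\<^sup>2) / y n"
    proof (intro add_mono w(1) frac_le D y(2))
      have "cmod (1 + w\<^sup>2) \<le> 1 + (cmod w)\<^sup>2" by (rule order_trans[OF norm_triangle_ineq]) (simp add: norm_power)
      also have "\<dots> \<le> 1 + (R * y n)\<^sup>2" using w(1) by (intro add_left_mono power_mono) auto
      finally show "cmod (1 + w\<^sup>2) \<le> 1 + (R * y n)\<^sup>2" .
    qed (simp add: add_nonneg_nonneg)
    also have "\<dots> = R * y n + 1 / y n + R\<^sup>2 * y n" using y(2)[of n] by (simp add: field_simps power2_eq_square)
    also have "\<dots> \<le> R * y n + y n + R\<^sup>2 * y n"
    proof -
      have "1 / y n \<le> 1" using y(1)[of n] by simp
      thus ?thesis using y(1)[of n] by linarith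
    qed
    finally show "cmod (pick_kernel w x) \<le> S * y n" by (simp add: S_def algebra_simps)
  qed
  define g where "g n p = pick_kernel (flow (snd p) t (zn n)) (fst p)" for n p
  have gb: "cmod (g n p) \<le> S * y n" "cmod (g n p) \<le> (1 + \<bar>fst p\<bar> * (R * y n)) / y n" if "snd p \<in> {s..t}" for n p
    unfolding g_def using that s flow_Im[OF t zI(1)[of n], of "snd p"] zI(2)[of n] by (auto intro!: pb fb)
  note gi = flow_equation(1)[OF t zI(1) s, folded g_def]
  have lim: "(\<lambda>n. LINT p|H. (indicator (UNIV \<times> {s..t}) p *\<^sub>R g n p) / zn n) \<longlonglongrightarrow> (LINT p|H. 0)"
  proof (rule integral_dominated_convergence[where w = "\<lambda>p. S * indicator (UNIV \<times> {s..t}) p"])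
    show "integrable H (\<lambda>p. S * indicator (UNIV \<times> {s..t}) p)"
      using Icc_sets[OF t s(1)] Icc_fin[OF t s(1)] by (intro integrable_mult_right) (simp add: less_top)
    show "(\<lambda>p. (indicator (UNIV \<times> {s..t}) p *\<^sub>R g n p) / zn n) \<in> borel_measurable H" for n
      using gi[of n] unfolding set_integrable_def by (intro borel_measurable_divide) auto
    have "cmod ((indicator (UNIV \<times> {s..t}) p *\<^sub>R g n p) / zn n) \<le> S * indicator (UNIV \<times> {s..t}) p" for p n
    proof (cases "p \<in> UNIV \<times> {s..t}")
      case True
      hence "cmod (g n p) \<le> S * y n" using gb(1)[of p n] by auto
      thus ?thesis using True y(2)[of n] by (simp add: norm_divide zI(3) divide_le_eq)
    qed simp
    thus "AE p in H. cmod ((indicator (UNIV \<times> {s..t}) p *\<^sub>R g n p) / zn n) \<le> S * indicator (UNIV \<times> {s..t}) p" for n by simp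
    show "AE p in H. (\<lambda>n. (indicator (UNIV \<times> {s..t}) p *\<^sub>R g n p) / zn n) \<longlonglongrightarrow> 0"
    proof (rule AE_I2)
      fix p
      have b: "cmod ((indicator (UNIV \<times> {s..t}) p *\<^sub>R g n p) / zn n) \<le> (inverse (real (Suc n)))\<^sup>2 + \<bar>fst p\<bar> * R * inverse (real (Suc n))" for n
      proof (cases "p \<in> UNIV \<times> {s..t}")
        case True
        hence "cmod (g n p) \<le> (1 + \<bar>fst p\<bar> * (R * y n)) / y n" using gb(2)[of p n] by auto
        hence "cmod (g n p) / y n \<le> ((1 + \<bar>fst p\<bar> * (R * y n)) / y n) / y n" using y(2)[of n] by (intro divide_right_mono) auto
        also have "\<dots> = (inverse (y n))\<^sup>2 + \<bar>fst p\<bar> * R * inverse (y n)" using y(2)[of n] by (simp add: field_simps power2_eq_square)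
        finally show ?thesis using True by (simp add: norm_divide zI(3) y_def)
      next
        case False
        have "0 \<le> \<bar>fst p\<bar> * R * inverse (real (Suc n))" using R1 by (intro mult_nonneg_nonneg) auto
        thus ?thesis using False by simp
      qed
      have "(\<lambda>n. (inverse (real (Suc n)))\<^sup>2 + \<bar>fst p\<bar> * R * inverse (real (Suc n))) \<longlonglongrightarrow> 0\<^sup>2 + \<bar>fst p\<bar> * R * 0"
        by (intro tendsto_intros LIMSEQ_inverse_real_of_nat)
      hence "(\<lambda>n. (inverse (real (Suc n)))\<^sup>2 + \<bar>fst p\<bar> * R * inverse (real (Suc n))) \<longlonglongrightarrow> 0" by simp
      thus "(\<lambda>n. (indicator (UNIV \<times> {s..t}) p *\<^sub>R g n p) / zn n) \<longlonglongrightarrow> 0"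
        by (rule Lim_null_comparison[rotated]) (intro always_eventually allI b)
    qed
  qed auto
  have "(\<lambda>n. 1 + of_real (\<gamma> s - \<gamma> t) * (1 / \<i>) * complex_of_real (inverse (real (Suc n))) + (LINT p|H. (indicator (UNIV \<times> {s..t}) p *\<^sub>R g n p) / zn n)) \<longlonglongrightarrow> 1 + of_real (\<gamma> s - \<gamma> t) * (1 / \<i>) * complex_of_real 0 + (LINT p|H. 0)"
    by (intro tendsto_add tendsto_mult tendsto_const tendsto_of_real LIMSEQ_inverse_real_of_nat lim)
  moreover have "1 + of_real (\<gamma> s - \<gamma> t) * (1 / \<i>) * complex_of_real (inverse (real (Suc n))) + (LINT p|H. (indicator (UNIV \<times> {s..t}) p *\<^sub>R g n p) / zn n)
     = flow s t (\<i> * of_nat (Suc n)) / (\<i> * of_nat (Suc n))" for n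
  proof -
    have "flow s t (zn n) = zn n + of_real (\<gamma> s - \<gamma> t) + (LINT p|H. indicator (UNIV \<times> {s..t}) p *\<^sub>R g n p)"
      using flow_equation(2)[OF t zI(1)[of n] s] by (simp add: g_def set_lebesgue_integral_def)
    hence "flow s t (zn n) / zn n = 1 + of_real (\<gamma> s - \<gamma> t) / zn n + (LINT p|H. indicator (UNIV \<times> {s..t}) p *\<^sub>R g n p) / zn n"
      using zI(4)[of n] by (simp add: add_divide_distrib)
    also have "of_real (\<gamma> s - \<gamma> t) / zn n = of_real (\<gamma> s - \<gamma> t) * (1 / \<i>) * complex_of_real (inverse (real (Suc n)))"
    proof -
      have "zn n = \<i> * of_real (real (Suc n))" by (simp add: zn_def y_def)
      thus ?thesis by (simp only: divide_inverse inverse_mult_distrib of_real_inverse mult_1_left mult.assoc)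
    qed
    also have "(LINT p|H. indicator (UNIV \<times> {s..t}) p *\<^sub>R g n p) / zn n = (LINT p|H. (indicator (UNIV \<times> {s..t}) p *\<^sub>R g n p) / zn n)"
      by (rule integral_divide_zero[symmetric])
    finally show ?thesis by (simp add: zn_def y_def)
  qed
  ultimately show "(\<lambda>n. flow s t (\<i> * of_nat (Suc n)) / (\<i> * of_nat (Suc n))) \<longlonglongrightarrow> 1" by simp
qed

text \<open>The end points are moved one at a time. Trajectories are uniformly continuous in the lower time.
  Moving the upper time from v to u changes the initial value at time u from flow u v z to z, and the
  flow depends on it in a Lipschitz way.\<close>
lemma flow_uniform_limit:
  assumes st: "s \<in> I" "t \<in> I" "s \<le> t" and K: "compact K" "K \<subseteq> upper_half_plane"
  shows "uniform_limit K (\<lambda>(s', t'). flow s' t') (flow s t) (at (s, t) within ordered_pairs I)"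
proof -
  obtain T \<delta>0 where T: "T \<in> I" "0 < T" "t \<le> T" "\<delta>0 > 0" "\<And>t'. t' \<in> I \<Longrightarrow> \<bar>t' - t\<bar> < \<delta>0 \<Longrightarrow> t' \<le> T"
    by (rule time_interval_bound[OF I st(2)]) blast
  obtain C where C: "C \<ge> 1" "\<And>w. w \<in> K \<Longrightarrow> hsize w \<le> C" using hsize_bounded_on_compact[OF K] by metis
  obtain Q where Q: "Q \<ge> 1"
    "\<And>t z s. 0 \<le> s \<Longrightarrow> s \<le> t \<Longrightarrow> t \<le> T \<Longrightarrow> Im z > 0 \<Longrightarrow> hsize (flow s t z) \<le> Q * hsize z"
    "\<And>t z s s'. t \<le> T \<Longrightarrow> Im z > 0 \<Longrightarrow> 0 \<le> s \<Longrightarrow> s \<le> s' \<Longrightarrow> s' \<le> t \<Longrightarrow> 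
       cmod (flow s t z - flow s' t z) \<le> \<bar>\<gamma> s - \<gamma> s'\<bar> + Q * hsize z * mass s s'"
    by (rule flow_props[OF T(1)]) blast
  have QC1: "Q * C \<ge> 1" "C \<le> Q * C" 
  proof -
    have "1 * C \<le> Q * C" using Q(1) C(1) by (intro mult_right_mono) auto
    thus "C \<le> Q * C" by simp
    with C(1) show "Q * C \<ge> 1" by linarith
  qed
  obtain L where L: "L \<ge> 1" "\<And>t z1 z2 s. t \<le> T \<Longrightarrow> Im z1 > 0 \<Longrightarrow> Im z2 > 0 \<Longrightarrow> hsize z1 \<le> Q * C \<Longrightarrow> hsize z2 \<le> Q * C \<Longrightarrow> 0 \<le> s \<Longrightarrow> s \<le> t \<Longrightarrow>
    cmod (flow s t z1 - flow s t z2) \<le> L * cmod (z1 - z2)"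
    by (rule flow_stability[OF T(1) QC1(1)]) blast
  show ?thesis
  proof (rule uniform_limitI)
    fix e :: real assume e: "e > 0"
    define \<epsilon> where "\<epsilon> = e / (2 * (L + 1))"
    have \<epsilon>: "\<epsilon> > 0" using e L(1) by (simp add: \<epsilon>_def)
    have QC0: "Q * C \<ge> 0" using QC1 by simp
    obtain \<delta> where \<delta>: "\<delta> > 0" "\<And>s s'. 0 \<le> s \<Longrightarrow> s \<le> s' \<Longrightarrow> s' \<le> T \<Longrightarrow> s' - s \<le> \<delta> \<Longrightarrow> \<bar>\<gamma> s - \<gamma> s'\<bar> + (Q * C) * mass s s' \<le> \<epsilon>"
      by (rule driving_modulus[OF T(1) QC0 \<epsilon>]) blast
    have c0: "cmod (flow a u z - flow b u z) \<le> \<epsilon>" 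
      if "u \<le> T" "z \<in> K" "0 \<le> a" "a \<le> b" "b \<le> u" "b - a \<le> \<delta>" for a b u z
    proof -
      have z: "Im z > 0" using K(2) that(2) by auto
      have "Q * hsize z * mass a b \<le> (Q * C) * mass a b" using C(2)[OF that(2)] Q(1) by (intro mult_right_mono mult_left_mono) auto
      moreover have "\<bar>\<gamma> a - \<gamma> b\<bar> + (Q * C) * mass a b \<le> \<epsilon>" by (rule \<delta>(2)) (use that in auto)
      ultimately show ?thesis using Q(3)[OF that(1) z that(3-5)] by linarith
    qed
    have c1: "cmod (flow (min a u) u z - flow (min b u) u z) \<le> \<epsilon>" if "u \<le> T" "z \<in> K" "0 \<le> a" "0 \<le> b" "0 \<le> u" "\<bar>a - b\<bar> \<le> \<delta>" for a b u z
    proof (cases "a \<le> b")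
      case True thus ?thesis by (intro c0) (use that in auto)
    next
      case False
      have "cmod (flow (min b u) u z - flow (min a u) u z) \<le> \<epsilon>" by (intro c0) (use that False in auto)
      thus ?thesis by (simp add: norm_minus_commute)
    qed
    \<comment> \<open>the minimum keeps the lower time below the upper one while the latter moves\<close>
    have c2: "cmod (flow (min a u) u z - flow (min a v) v z) \<le> L * \<epsilon>" if h: "0 \<le> u" "u \<le> v" "v \<le> T" "v - u \<le> \<delta>" "0 \<le> a" "z \<in> K" for a u v z
    proof -
      have z: "Im z > 0" using K(2) h(6) by auto
      have vI: "v \<in> I" by (rule in_I[OF _ h(3) T(1)]) (use h in simp)
      have uI: "u \<in> I" by (rule in_I[OF h(1,2) vI])
      show ?thesis
      proof (cases "a \<le> u")
        case True
        have "flow a v z = flow a u (flow u v z)" by (rule flow_comp[symmetric, OF h(5) True h(2) vI z])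
        hence "cmod (flow (min a u) u z - flow (min a v) v z) = cmod (flow a u z - flow a u (flow u v z))" using True h(2) by simp
        also have "\<dots> \<le> L * cmod (z - flow u v z)"
        proof (rule L(2)[OF _ z _ _ _ h(5) True])
          show "u \<le> T" using h by simp
          show "0 < Im (flow u v z)" using flow_Im[OF vI z h(1,2)] z by simp
          show "hsize z \<le> Q * C" using C(2)[OF h(6)] QC1(2) by simp
          show "hsize (flow u v z) \<le> Q * C" 
            by (rule order_trans[OF Q(2)[OF h(1,2,3) z]]) (use C(2)[OF h(6)] Q(1) in \<open>auto intro!: mult_left_mono\<close>)
        qed
        also have "z - flow u v z = - (flow u v z - flow v v z)" using flow_refl[OF vI z] by simp
        also have "L * cmod (- (flow u v z - flow v v z)) \<le> L * \<epsilon>" unfolding norm_minus_cancel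
          using L(1) by (intro mult_left_mono c0) (use h in auto)
        finally show ?thesis .
      next
        case False
        have "cmod (flow (min a u) u z - flow (min a v) v z) = cmod (flow (min a v) v z - flow (min v v) v z)"
          using False flow_refl[OF vI z] flow_refl[OF uI z] by (simp add: norm_minus_commute)
        also have "\<dots> \<le> \<epsilon>" unfolding min.idem by (rule c0) (use False h in auto)
        also have "\<dots> \<le> L * \<epsilon>" using L(1) \<epsilon> by simp
        finally show ?thesis .
      qed
    qed
    have main: "dist (flow s' t' z) (flow s t z) < e" if p: "(s', t') \<in> ordered_pairs I" "dist (s', t') (s, t) < min \<delta> \<delta>0" "z \<in> K" for s' t' z
    proof -
      have s't': "s' \<in> I" "t' \<in> I" "s' \<le> t'" using p(1) by (auto simp: ordered_pairs_def)
      have "\<bar>s' - s\<bar> < min \<delta> \<delta>0" "\<bar>t' - t\<bar> < min \<delta> \<delta>0" 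
        using dist_fst_le[of "(s', t')" "(s, t)"] dist_snd_le[of "(s', t')" "(s, t)"] p(2) by (auto simp: dist_real_def)
      hence d: "\<bar>s' - s\<bar> \<le> \<delta>" "\<bar>t' - t\<bar> \<le> \<delta>" and t'T: "t' \<le> T" using T(5)[OF s't'(2)] by auto
      have nn: "0 \<le> s" "0 \<le> t" "0 \<le> s'" "0 \<le> t'" using st s't' I_nonneg by auto
      have 1: "cmod (flow (min s' t') t' z - flow (min s' t) t z) \<le> L * \<epsilon>"
      proof (cases "t' \<le> t")
        case True show ?thesis by (rule c2) (use True d nn T(3) p(3) in auto)
      next
        case False
        have "cmod (flow (min s' t) t z - flow (min s' t') t' z) \<le> L * \<epsilon>" by (rule c2) (use False d nn t'T p(3) in auto)
        thus ?thesis by (simp add: norm_minus_commute)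
      qed
      have 2: "cmod (flow (min s' t) t z - flow (min s t) t z) \<le> \<epsilon>" by (rule c1) (use d nn T(3) p(3) in auto)
      have "cmod (flow s' t' z - flow s t z) \<le> L * \<epsilon> + \<epsilon>"
        using norm_triangle_ineq[of "flow (min s' t') t' z - flow (min s' t) t z" "flow (min s' t) t z - flow (min s t) t z"] 1 2 s't'(3) st(3) by (simp add: min_absorb1)
      also have "\<dots> = (L + 1) * \<epsilon>" by (simp add: algebra_simps)
      also have "\<dots> = e / 2" using L(1) by (simp add: \<epsilon>_def divide_simps)
      also have "\<dots> < e" using e by simp
      finally show ?thesis by (simp add: dist_norm)
    qed
    show "\<forall>\<^sub>F p in at (s, t) within ordered_pairs I. \<forall>z\<in>K. dist ((case p of (s', t') \<Rightarrow> flow s' t') z) (flow s t z) < e"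
      unfolding eventually_at using \<delta>(1) T(4) main by (intro exI[of _ "min \<delta> \<delta>0"]) auto
  qed
qed

lemma flow_P_REF: "P_REF I flow"
proof -
  have "flow s t holomorphic_on upper_half_plane \<and> (\<forall>z. Im z > 0 \<longrightarrow> Im (flow s t z) > 0) \<and> flow s t \<in> class_P"
    if "s \<in> I" "t \<in> I" "s \<le> t" for s t
    using flow_holomorphic[OF that(2) I_nonneg[OF that(1)] that(3)] flow_class_P[OF that(2) I_nonneg[OF that(1)] that(3)]
      flow_Im[OF that(2) _ I_nonneg[OF that(1)] that(3)] by (auto intro: order_less_le_trans)
  moreover have "flow s t (flow t u z) = flow s u z" if "s \<in> I" "t \<in> I" "u \<in> I" "s \<le> t" "t \<le> u" "Im z > 0" for s t u z
    by (rule flow_comp[OF I_nonneg[OF that(1)] that(4,5,3,6)])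
  ultimately show ?thesis unfolding P_REF_iff
    by (intro conjI ballI impI allI flow_refl flow_uniform_limit) blast+
qed

lemma flow_integral_equation: "satisfies_integral_equation I flow \<gamma> H"
  unfolding satisfies_integral_equation_def integrand_eq_pick_kernel
  by (intro ballI impI conjI flow_equation I_nonneg) auto

lemma REF_eq_flow:
  assumes ref: "P_REF I f" and sie: "satisfies_integral_equation I f \<gamma> H" 
    and st: "s \<in> I" "t \<in> I" "s \<le> t" and z: "Im z > 0"
  shows "f s t z = flow s t z"
proof (rule flow_unique[where w = "\<lambda>r. f r t z", OF st(2) z])
  have mem: "r \<in> I" if "0 \<le> r" "r \<le> t" for r by (rule in_I[OF that st(2)])
  have "continuous_on {0..t} (\<lambda>r. f (fst (r, t)) (snd (r, t)) z)"
    by (rule continuous_on_compose2[OF P_REF_continuous[OF ref z]]) (use mem st in \<open>auto intro!: continuous_intros simp: ordered_pairs_def\<close>)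
  thus "continuous_on {0..t} (\<lambda>r. f r t z)" by simp
  show "Im (f r t z) > 0" if "0 \<le> r" "r \<le> t" for r by (rule P_REF_props(2)[OF ref mem[OF that] st(2) that(2) z])
  show "f a t z = z + of_real (\<gamma> a) - of_real (\<gamma> t) + set_lebesgue_integral H (UNIV \<times> {a..t}) (\<lambda>p. pick_kernel (f (snd p) t z) (fst p))"
    if "0 \<le> a" "a \<le> t" for a by (rule integral_equation_pick(2)[OF sie mem[OF that] st(2) that(2) z])
qed (use st I_nonneg in auto)

end

section \<open>Reverse evolution families and generating pairs\<close>

theorem theorem1p12:
  fixes I :: "real set"
  assumes "time_interval I"
  shows "(\<forall>f. P_REF I f \<longrightarrow>
           (\<exists>\<gamma> H. generating_pair I \<gamma> H \<and> satisfies_integral_equation I f \<gamma> H \<and>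
             (\<forall>\<gamma>' H'. generating_pair I \<gamma>' H' \<and> satisfies_integral_equation I f \<gamma>' H' \<longrightarrow>
                (\<forall>t\<in>I. \<gamma>' t = \<gamma> t) \<and> H' = H))) \<and>
         (\<forall>\<gamma> H. generating_pair I \<gamma> H \<longrightarrow>
           (\<exists>f. P_REF I f \<and> satisfies_integral_equation I f \<gamma> H \<and>
             (\<forall>f'. P_REF I f' \<and> satisfies_integral_equation I f' \<gamma> H \<longrightarrow>
                (\<forall>s\<in>I. \<forall>t\<in>I. s \<le> t \<longrightarrow> (\<forall>z\<in>upper_half_plane. f' s t z = f s t z)))))"
proof (intro conjI allI impI)
  fix f assume ref: "P_REF I f"
  obtain \<gamma> H where gp: "generating_pair I \<gamma> H" "satisfies_integral_equation I f \<gamma> H"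
    using generating_pair_exists[OF assms ref] by blast
  have uniq: "(\<forall>t\<in>I. \<gamma>' t = \<gamma> t) \<and> H' = H" if "generating_pair I \<gamma>' H'" "satisfies_integral_equation I f \<gamma>' H'" for \<gamma>' H'
    using generating_pair_unique[OF assms ref that gp] by blast
  show "\<exists>\<gamma> H. generating_pair I \<gamma> H \<and> satisfies_integral_equation I f \<gamma> H \<and>
             (\<forall>\<gamma>' H'. generating_pair I \<gamma>' H' \<and> satisfies_integral_equation I f \<gamma>' H' \<longrightarrow>
                (\<forall>t\<in>I. \<gamma>' t = \<gamma> t) \<and> H' = H)"
    by (rule exI[of _ \<gamma>], rule exI[of _ H], intro conjI[OF gp(1) conjI[OF gp(2)]] allI impI, elim conjE, rule uniq)
next
  fix \<gamma> H assume gp: "generating_pair I \<gamma> H"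
  interpret strip I \<gamma> H by (rule strip.intro[OF assms gp])
  show "\<exists>f. P_REF I f \<and> satisfies_integral_equation I f \<gamma> H \<and>
             (\<forall>f'. P_REF I f' \<and> satisfies_integral_equation I f' \<gamma> H \<longrightarrow>
                (\<forall>s\<in>I. \<forall>t\<in>I. s \<le> t \<longrightarrow> (\<forall>z\<in>upper_half_plane. f' s t z = f s t z)))"
    by (intro exI[of _ flow] conjI flow_P_REF flow_integral_equation allI impI ballI; elim conjE) (simp add: REF_eq_flow)
qed

end
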